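(* For each prime $p$ the following statements are equivalent: (1) there exists an infinite finitely presented residually finite $p$-group; (2) there exists a finitely generated $p$-conjugacy separable subgroup $G\leqslant H\times H$, where $H$ is the free group of rank $2$, such that $G$ is not virtually a direct product of two free groups; (3) there exists a finitely generated $p$-conjugacy separable full subdirect product $G\leqslant F_1\times F_2$, where $F_1,F_2$ are free groups, such that $|(F_1\times F_2):G|=\infty$.
   Context: A group $G$ is $p$-conjugacy separable if for any two non-conjugate elements $x,y\in G$ there is a homomorphism $\varphi$ from $G$ to a finite $p$-group $M$ such that $\varphi(x)$ and $\varphi(y)$ are not conjugate in $M$. A $p$-group is a (possibly infinite) periodic group in which every element has order a power of $p$. A "residually finite $p$-group" means a $p$-group which is residually finite. A group is virtually a direct product of two free groups if it has a finite index subgroup isomorphic to a direct product of two free groups, where either or both of the free groups may be trivial. In $F_1\times F_2$ one identifies $F_1$ with $F_1\times\{1\}$ and $F_2$ with $\{1\}\times F_2$. A subgroup $G\leqslant F_1\times F_2$ is a subdirect product if both coordinate projections map $G$ onto $F_1$ and $F_2$ respectively; it is a full subdirect product if in addition $G\cap F_i\neq\{1\}$ for $i=1,2$. *)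

theory Defs
  imports "HOL-Algebra.Algebra"
begin

section \<open>Free groups\<close>

text \<open>A letter \<open>(x, True)\<close> stands for the generator \<open>x\<close>, and \<open>(x, False)\<close> for its formal inverse.
  The elements of the free group are the reduced words, and the product of two reduced words is
  their concatenation after free cancellation.\<close>

type_synonym 'a letter = "'a \<times> bool"
type_synonym 'a word = "'a letter list"

definition inv_letter :: "'a letter \<Rightarrow> 'a letter" where
  "inv_letter a = (fst a, \<not> snd a)"

definition reduced :: "'a word \<Rightarrow> bool" where
  "reduced w \<longleftrightarrow> successively (\<lambda>a b. b \<noteq> inv_letter a) w"

fun push :: "'a letter \<Rightarrow> 'a word \<Rightarrow> 'a word" where
  "push a [] = [a]"
| "push a (b # w) = (if b = inv_letter a then w else a # b # w)"

definition free_group :: "'a set \<Rightarrow> 'a word monoid" where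
  "free_group S =
    \<lparr>carrier = {w. reduced w \<and> fst ` set w \<subseteq> S}, monoid.mult = foldr push, one = []\<rparr>"

lemma inv_letter_inv_letter [simp]: "inv_letter (inv_letter a) = a"
  by (simp add: inv_letter_def)

lemma inv_letter_neq [simp]: "inv_letter a \<noteq> a" "a \<noteq> inv_letter a"
  by (auto simp: inv_letter_def prod_eq_iff)

lemma fst_inv_letter [simp]: "fst (inv_letter a) = fst a"
  by (simp add: inv_letter_def)

lemma reduced_Nil [simp]: "reduced []"
  by (simp add: reduced_def)

lemma reduced_ConsD: "reduced (a # w) \<Longrightarrow> reduced w"
  by (cases w) (auto simp: reduced_def)

lemma reduced_push: "reduced w \<Longrightarrow> reduced (push a w)"
  by (cases w rule: list.exhaust; cases "tl w") (auto simp: reduced_def)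

lemma reduced_foldr_push: "reduced v \<Longrightarrow> reduced (foldr push u v)"
  by (induction u) (auto intro: reduced_push)

lemma push_reduced: "reduced (a # w) \<Longrightarrow> push a w = a # w"
  by (cases w) (auto simp: reduced_def)

lemma set_push: "set (push a w) \<subseteq> insert a (set w)"
  by (cases w) auto

lemma set_foldr_push: "set (foldr push u v) \<subseteq> set u \<union> set v"
  using set_push by (induction u) fastforce+

lemma push_push_inv: "reduced w \<Longrightarrow> push a (push (inv_letter a) w) = w"
  by (cases w) (auto simp: push_reduced)

lemma foldr_push_Nil: "reduced u \<Longrightarrow> foldr push u [] = u"
  by (induction u) (simp_all, metis push_reduced reduced_ConsD)

lemma foldr_push_push:
  assumes "reduced z"
  shows "foldr push (push a w) z = push a (foldr push w z)"
  using assms by (cases w) (auto simp: push_push_inv reduced_foldr_push)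

lemma foldr_push_assoc:
  "reduced z \<Longrightarrow> foldr push (foldr push x y) z = foldr push x (foldr push y z)"
  by (induction x) (auto simp: foldr_push_push)

lemma foldr_push_left_inverse:
  "reduced z \<Longrightarrow> foldr push (rev (map inv_letter u)) (foldr push u z) = z"
proof (induction u arbitrary: z)
  case (Cons a u)
  then show ?case
    using push_push_inv[of "foldr push u z" "inv_letter a"]
    by (simp add: reduced_foldr_push)
qed simp

lemma group_free_group: "group (free_group S)"
proof (rule groupI)
  fix x y z
  assume x: "x \<in> carrier (free_group S)" and y: "y \<in> carrier (free_group S)"
    and z: "z \<in> carrier (free_group S)"
  show "x \<otimes>\<^bsub>free_group S\<^esub> y \<in> carrier (free_group S)"
    using x y set_foldr_push[of x y] by (fastforce simp: free_group_def reduced_foldr_push)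
  show "x \<otimes>\<^bsub>free_group S\<^esub> y \<otimes>\<^bsub>free_group S\<^esub> z = x \<otimes>\<^bsub>free_group S\<^esub> (y \<otimes>\<^bsub>free_group S\<^esub> z)"
    using z by (simp add: free_group_def foldr_push_assoc)
next
  fix x
  assume x: "x \<in> carrier (free_group S)"
  let ?v = "rev (map inv_letter x)"
  let ?y = "foldr push ?v []"
  have "?y \<in> carrier (free_group S)"
    using x set_foldr_push[of ?v "[]"] by (fastforce simp: free_group_def reduced_foldr_push)
  moreover have "foldr push ?y x = []"
    using x foldr_push_assoc[of x ?v "[]"] foldr_push_left_inverse[of "[]" x]
    by (simp add: free_group_def foldr_push_Nil)
  ultimately show "\<exists>y\<in>carrier (free_group S). y \<otimes>\<^bsub>free_group S\<^esub> x = \<one>\<^bsub>free_group S\<^esub>"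
    by (auto simp: free_group_def)
qed (auto simp: free_group_def)

text \<open>A basis of a free group is a subset of it, so index sets over the type of the elements
  suffice.\<close>

definition is_free_group :: "('g, 'm) monoid_scheme \<Rightarrow> bool" where
  "is_free_group F \<longleftrightarrow> group F \<and> (\<exists>S :: 'g set. F \<cong> free_group S)"


section \<open>Finiteness conditions\<close>

definition finitely_generated_group :: "('g, 'm) monoid_scheme \<Rightarrow> bool" where
  "finitely_generated_group G \<longleftrightarrow>
    group G \<and> (\<exists>A. finite A \<and> A \<subseteq> carrier G \<and> generate G A = carrier G)"

definition normal_closure :: "('g, 'm) monoid_scheme \<Rightarrow> 'g set \<Rightarrow> 'g set" where
  "normal_closure G R = \<Inter> {N. N \<lhd> G \<and> R \<subseteq> N}"

definition finitely_presented_group :: "('g, 'm) monoid_scheme \<Rightarrow> bool" where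
  "finitely_presented_group G \<longleftrightarrow> group G \<and>
    (\<exists>(n :: nat) R. finite R \<and> R \<subseteq> carrier (free_group {..<n}) \<and>
       G \<cong> free_group {..<n} Mod normal_closure (free_group {..<n}) R)"

text \<open>Every finite group is isomorphic to one whose carrier is a set of natural numbers. So it is
  no restriction that the finite groups below have elements of type \<open>nat\<close>.\<close>

definition residually_finite :: "('g, 'm) monoid_scheme \<Rightarrow> bool" where
  "residually_finite G \<longleftrightarrow> group G \<and>
    (\<forall>x\<in>carrier G. x \<noteq> \<one>\<^bsub>G\<^esub> \<longrightarrow>
       (\<exists>(M :: nat monoid) \<phi>. group M \<and> finite (carrier M) \<and> \<phi> \<in> hom G M \<and> \<phi> x \<noteq> \<one>\<^bsub>M\<^esub>))"

text \<open>In HOL-Algebra elements of infinite order have \<^const>\<open>group.ord\<close> equal to \<open>0\<close>, which is not a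
  power of a prime.\<close>

definition p_group :: "nat \<Rightarrow> ('g, 'm) monoid_scheme \<Rightarrow> bool" where
  "p_group p G \<longleftrightarrow> group G \<and> (\<forall>x\<in>carrier G. \<exists>k. group.ord G x = p ^ k)"

definition conjugate_in :: "('g, 'm) monoid_scheme \<Rightarrow> 'g \<Rightarrow> 'g \<Rightarrow> bool" where
  "conjugate_in G x y \<longleftrightarrow> (\<exists>g\<in>carrier G. y = inv\<^bsub>G\<^esub> g \<otimes>\<^bsub>G\<^esub> x \<otimes>\<^bsub>G\<^esub> g)"

definition p_conjugacy_separable :: "nat \<Rightarrow> ('g, 'm) monoid_scheme \<Rightarrow> bool" where
  "p_conjugacy_separable p G \<longleftrightarrow> group G \<and>
    (\<forall>x\<in>carrier G. \<forall>y\<in>carrier G. \<not> conjugate_in G x y \<longrightarrow>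
       (\<exists>(M :: nat monoid) \<phi>. p_group p M \<and> finite (carrier M) \<and> \<phi> \<in> hom G M \<and>
          \<not> conjugate_in M (\<phi> x) (\<phi> y)))"


section \<open>Subgroups of direct products\<close>

definition finite_index :: "('g, 'm) monoid_scheme \<Rightarrow> 'g set \<Rightarrow> bool" where
  "finite_index G K \<longleftrightarrow> subgroup K G \<and> finite (rcosets\<^bsub>G\<^esub> K)"

text \<open>If \<open>K\<close> is isomorphic to \<open>A \<times>\<times> B\<close>, then \<open>A\<close> and \<open>B\<close> embed in \<open>G\<close>. So it is no restriction that
  they have the same element type as \<open>G\<close>. Trivial factors are included, as \<open>free_group {}\<close> is
  trivial.\<close>

definition virtually_product_of_two_free_groups :: "('g, 'm) monoid_scheme \<Rightarrow> bool" where
  "virtually_product_of_two_free_groups G \<longleftrightarrow> group G \<and>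
    (\<exists>K (A :: 'g monoid) (B :: 'g monoid). finite_index G K \<and>
       is_free_group A \<and> is_free_group B \<and> G\<lparr>carrier := K\<rparr> \<cong> A \<times>\<times> B)"

definition subdirect_product ::
  "('a, 'm) monoid_scheme \<Rightarrow> ('b, 'n) monoid_scheme \<Rightarrow> ('a \<times> 'b) set \<Rightarrow> bool" where
  "subdirect_product F1 F2 G \<longleftrightarrow>
    subgroup G (F1 \<times>\<times> F2) \<and> fst ` G = carrier F1 \<and> snd ` G = carrier F2"

definition full_subdirect_product ::
  "('a, 'm) monoid_scheme \<Rightarrow> ('b, 'n) monoid_scheme \<Rightarrow> ('a \<times> 'b) set \<Rightarrow> bool" where
  "full_subdirect_product F1 F2 G \<longleftrightarrow> subdirect_product F1 F2 G \<and>
    G \<inter> (carrier F1 \<times> {\<one>\<^bsub>F2\<^esub>}) \<noteq> {\<one>\<^bsub>F1 \<times>\<times> F2\<^esub>} \<and>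
    G \<inter> ({\<one>\<^bsub>F1\<^esub>} \<times> carrier F2) \<noteq> {\<one>\<^bsub>F1 \<times>\<times> F2\<^esub>}"

text \<open>Some existential statements about groups are made for groups with elements of type \<open>nat\<close>. That
  is no loss of generality for finitely generated groups, which are countable. It also covers the
  free factors of a finitely generated subdirect product, because they are its homomorphic images
  and hence finitely generated.\<close>

end

theory Submission
  imports Defs
begin

text \<open>
  Free groups are conjugacy \<open>p\<close>-separable: two non-conjugate words are pulled back to the kernel of a
  homomorphism onto a cyclic group of order \<open>p\<close>, where a conjugate of one of them becomes shorter.
  Applied to \<open>L \<langle>x\<rangle>\<close> for normal subgroups \<open>L\<close> of \<open>p\<close>-power index, this gives a centralizer condition: if
  \<open>g\<close> commutes with \<open>x\<close> in a large enough finite \<open>p\<close>-quotient, then \<open>g\<close> agrees modulo \<open>L\<close> with an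
  element that commutes with \<open>x\<close>.

  If \<open>Q = F / N\<close> is an infinite finitely presented residually finite \<open>p\<close>-group with \<open>F\<close> free, then the
  fibre product of \<open>F\<close> with itself over \<open>Q\<close> is finitely generated. Elements of it that are conjugate in
  \<open>F \<times> F\<close> differ only by the coset of the conjugator modulo centralizers. The centralizer condition
  and the finite quotients of \<open>Q\<close>, which are \<open>p\<close>-groups, separate these cosets.

  If a subgroup of \<open>H \<times> H\<close> is not virtually a product of free groups, then it is a full subdirect
  product of infinite index in the product of its projections.

  Conversely, let \<open>G\<close> be a full subdirect product of infinite index in \<open>F1 \<times> F2\<close>, and let \<open>N1\<close>, \<open>N2\<close> be
  its intersections with the factors, so that \<open>F1 / N1\<close> and \<open>F2 / N2\<close> are isomorphic. This quotient is
  finitely presented, because \<open>F2\<close> is free and \<open>G\<close> is finitely generated. Let \<open>(e, f)\<close> be in \<open>G\<close>. The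
  cosets of \<open>e\<^sup>m\<close> modulo \<open>N1\<close> and of \<open>f\<^sup>m\<close> modulo \<open>N2\<close> contain elements \<open>x1\<close> and \<open>x2\<close> whose
  centralizers are generated by themselves. Hence \<open>(x1, x2)\<close> and \<open>(x1, f\<^sup>-\<^sup>1 x2 f)\<close> are conjugate
  in \<open>G\<close> only if \<open>f\<close> is a power of \<open>f\<^sup>m\<close> modulo \<open>N2\<close>. If \<open>m\<close> is coprime to \<open>p\<close> then they are conjugate
  in every finite \<open>p\<close>-quotient of \<open>G\<close>, so \<open>f\<close> is such a power, which makes \<open>F1 / N1\<close> a \<open>p\<close>-group. The
  case \<open>m = 0\<close> makes it residually finite.
\<close>

section \<open>Normal subgroups of finite \<open>p\<close>-power index\<close>

text \<open>Finite \<open>p\<close>-quotients are represented by their kernels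
  (\<open>p_normal\<close>), so that most arguments stay inside one group. Element types still
  matter: bases of subgroups have new types and are recoded in \<open>nat\<close> before an
  induction hypothesis or a definition can be applied.

  In the fibre product the obstacle is that a conjugator is determined only up to infinite
  centralizers. Torsion of \<open>Q\<close> makes their images in \<open>Q\<close> finite, so only
  finitely many products have to be kept out of one subgroup of finite index.

  In the converse, let \<open>K\<close> be the kernel of a \<open>p\<close>-quotient of
  \<open>G\<close>. Coprimality writes \<open>f\<close> as a power of \<open>f^m\<close> times a
  second coordinate \<open>k2\<close> of an element of \<open>K\<close>. The power acts on
  \<open>x2\<close> like an element \<open>n\<close> of \<open>N2\<close>, since \<open>x2\<close>
  and \<open>f^m\<close> agree modulo \<open>N2\<close>; and \<open>k2\<close> acts trivially on
  \<open>N2\<close> modulo \<open>K\<close>, because commutators with \<open>(1, n)\<close> have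
  first coordinate 1. So the conjugation by \<open>f\<close> in the second coordinate alone is
  achieved inside \<open>G\<close> modulo \<open>K\<close>. The torsion then comes from two choices
  of \<open>m\<close>: \<open>p + 1\<close> gives finite order, and the part of that order prime to
  \<open>p\<close> removes itself.\<close>

lemma (in group) inv_cancel:
  assumes "x \<in> carrier G" "y \<in> carrier G"
  shows "inv x \<otimes> (x \<otimes> y) = y" "x \<otimes> (inv x \<otimes> y) = y"
  using assms by (simp_all flip: m_assoc)

lemmas (in group) group_simps = m_assoc inv_mult_group inv_cancel

lemma (in group) normal_mult_commute:
  assumes "N \<lhd> G" "x \<in> carrier G" "y \<in> carrier G" "x \<otimes> y \<in> N"
  shows "y \<otimes> x \<in> N"
  using normal.inv_op_closed1[OF assms(1,2,4)] assms(2,3) by (simp add: group_simps)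

section \<open>Cosets and subgroups of finite index\<close>

lemma (in group) rcoset_eq_iff:
  assumes "subgroup K G" "x \<in> carrier G" "y \<in> carrier G"
  shows "K #> x = K #> y \<longleftrightarrow> x \<otimes> inv y \<in> K"
proof
  assume "K #> x = K #> y"
  then have "x \<in> K #> y"
    using rcos_self[OF assms(2,1)] by simp
  then show "x \<otimes> inv y \<in> K"
    using assms subgroup.rcos_module_imp[OF assms(1) is_group] by blast
next
  assume "x \<otimes> inv y \<in> K"
  then have "x \<in> K #> y"
    using subgroup.rcos_module_rev[OF assms(1) is_group assms(3,2)] by blast
  then show "K #> x = K #> y"
    using repr_independence[OF _ assms(3,1)] by metis
qed

text \<open>The working criterion for finite index: a map with finite range whose fibres stay within
  single cosets. It allows \<open>f\<close> to be a residue, a pair of cosets or a coset in another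
  group, as convenient.\<close>

lemma (in group) finite_rcosetsI:
  assumes "subgroup K G" "finite (f ` carrier G)"
    and "\<And>x y. x \<in> carrier G \<Longrightarrow> y \<in> carrier G \<Longrightarrow> f x = f y \<Longrightarrow> x \<otimes> inv y \<in> K"
  shows "finite (rcosets K)"
proof -
  have "rcosets K = (\<lambda>x. K #> x) ` carrier G"
    by (auto simp: RCOSETS_def)
  moreover have "K #> x = K #> inv_into (carrier G) f (f x)" if "x \<in> carrier G" for x
    using assms(1) that
    by (subst rcoset_eq_iff)
      (auto intro!: assms(3) simp: f_inv_into_f inv_into_into)
  ultimately have "rcosets K = (\<lambda>z. K #> inv_into (carrier G) f z) ` f ` carrier G"
    by (force simp: image_iff)
  then show ?thesis
    using assms(2) by simp
qed

lemma (in group) finite_image_rcosets: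
  "finite (rcosets K) \<longleftrightarrow> finite ((\<lambda>x. K #> x) ` carrier G)"
  by (simp add: RCOSETS_def UNION_singleton_eq_range)

lemma (in group) finite_index_vimage:
  assumes "group H" "h \<in> hom G H" "subgroup K H" "finite (rcosets\<^bsub>H\<^esub> K)"
  shows "subgroup {g \<in> carrier G. h g \<in> K} G" "finite (rcosets {g \<in> carrier G. h g \<in> K})"
proof -
  interpret h: group_hom G H h
    using assms by (simp add: group_hom_def group_hom_axioms_def)
  interpret K: subgroup K H by fact
  show sub: "subgroup {g \<in> carrier G. h g \<in> K} G"
    by (rule subgroupI) (auto intro!: exI[of _ \<one>])
  have "(\<lambda>x. K #>\<^bsub>H\<^esub> h x) ` carrier G \<subseteq> (\<lambda>x. K #>\<^bsub>H\<^esub> x) ` carrier H"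
    by auto
  then have "finite ((\<lambda>x. K #>\<^bsub>H\<^esub> h x) ` carrier G)"
    using assms(4) h.H.finite_image_rcosets finite_subset by metis
  then show "finite (rcosets {g \<in> carrier G. h g \<in> K})"
    by (rule finite_rcosetsI[OF sub]) (auto simp: h.H.rcoset_eq_iff assms(3))
qed

lemma (in group) normal_vimage:
  assumes "group H" "h \<in> hom G H" "K \<lhd> H"
  shows "{g \<in> carrier G. h g \<in> K} \<lhd> G"
proof -
  interpret h: group_hom G H h
    using assms by (simp add: group_hom_def group_hom_axioms_def)
  interpret K: normal K H by fact
  show ?thesis
    by (rule normal_invI, rule subgroupI) (auto intro!: exI[of _ \<one>] K.inv_op_closed2)
qed

lemma (in group) finite_index_Int:
  assumes "subgroup K G" "finite (rcosets K)" "subgroup L G" "finite (rcosets L)"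
  shows "finite (rcosets (K \<inter> L))"
proof (rule finite_rcosetsI)
  show "subgroup (K \<inter> L) G"
    using assms subgroups_Inter_pair by blast
  have "(\<lambda>x. (K #> x, L #> x)) ` carrier G
      \<subseteq> (\<lambda>x. K #> x) ` carrier G \<times> (\<lambda>x. L #> x) ` carrier G"
    by auto
  then show "finite ((\<lambda>x. (K #> x, L #> x)) ` carrier G)"
    by (rule finite_subset) (use assms in \<open>auto simp: finite_image_rcosets\<close>)
qed (use assms in \<open>auto simp: rcoset_eq_iff\<close>)

lemma (in group) finite_index_trans:
  assumes L: "subgroup L G" "finite (rcosets L)"
    and D: "subgroup D G" "D \<subseteq> L" "finite (rcosets\<^bsub>G\<lparr>carrier := L\<rparr>\<^esub> D)"
  shows "finite (rcosets D)"
proof -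
  interpret L: subgroup L G by fact
  interpret GL: group "G\<lparr>carrier := L\<rparr>"
    by (rule L.subgroup_is_group) (rule is_group)
  \<comment> \<open>The choice depends only on the coset \<open>L #> x\<close>, so elements in the
    same coset of \<open>L\<close> are compared through the same representative.\<close>
  define r where "r x = (SOME t. t \<in> L #> x)" for x
  have r: "r x \<in> L #> x" if "x \<in> carrier G" for x
    unfolding r_def using rcos_self[OF that L(1)] by (rule someI)
  then have rG: "r x \<in> carrier G" if "x \<in> carrier G" for x
    using that by (meson L.elemrcos_carrier is_group)
  have rL: "x \<otimes> inv r x \<in> L" if "x \<in> carrier G" for x
  proof -
    have "r x \<otimes> inv x \<in> L"
      using r[OF that] that L.rcos_module_imp[OF is_group] by blast
    then have "inv (r x \<otimes> inv x) \<in> L"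
      by blast
    then show ?thesis
      using that rG by (simp add: group_simps)
  qed
  show ?thesis
  proof (rule finite_rcosetsI[OF D(1)])
    let ?f = "\<lambda>x. (L #> x, D #> (x \<otimes> inv r x))"
    have "?f ` carrier G \<subseteq> (\<lambda>x. L #> x) ` carrier G \<times> (\<lambda>x. D #> x) ` L"
      using rL by auto
    moreover have "finite ((\<lambda>x. D #> x) ` L)"
      using D(3) GL.finite_image_rcosets by simp
    ultimately show "finite (?f ` carrier G)"
      using L(2) by (simp add: finite_image_rcosets finite_subset[OF _ finite_cartesian_product])
    fix x y
    assume xy: "x \<in> carrier G" "y \<in> carrier G" "?f x = ?f y"
    then have "r x = r y"
      by (simp add: r_def)
    with xy have "x \<otimes> inv r y \<otimes> inv (y \<otimes> inv r y) \<in> D"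
      using rG by (simp add: rcoset_eq_iff D(1))
    then show "x \<otimes> inv y \<in> D"
      using xy rG by (simp add: group_simps)
  qed
qed

lemma (in subgroup) nat_pow_mem:
  "group G \<Longrightarrow> x \<in> H \<Longrightarrow> x [^] (n :: nat) \<in> H"
  by (induction n) (auto simp: nat_pow_Suc)

text \<open>These are the kernels of homomorphisms onto finite \<open>p\<close>-groups. The last
  clause says that the quotient has exponents that are powers of \<open>p\<close>, without
  mentioning the quotient or orders in it.\<close>

definition p_normal :: "nat \<Rightarrow> ('g, 'm) monoid_scheme \<Rightarrow> 'g set \<Rightarrow> bool" where
  "p_normal p G K \<longleftrightarrow> K \<lhd> G \<and> finite (rcosets\<^bsub>G\<^esub> K) \<and>
    (\<forall>x\<in>carrier G. \<exists>k. x [^]\<^bsub>G\<^esub> (p ^ k :: nat) \<in> K)"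

lemma p_normal_imp_normal: "p_normal p G K \<Longrightarrow> K \<lhd> G"
  by (simp add: p_normal_def)

lemma p_normal_pow_mem:
  fixes G (structure)
  shows "p_normal p G K \<Longrightarrow> x \<in> carrier G \<Longrightarrow> \<exists>k. x [^] (p ^ k :: nat) \<in> K"
  by (simp add: p_normal_def)

lemma p_normal_imp_subgroup: "p_normal p G K \<Longrightarrow> subgroup K G"
  by (simp add: p_normal_def normal_imp_subgroup)

lemma (in group) p_normal_vimage:
  assumes "group H" "h \<in> hom G H" "p_normal p H K"
  shows "p_normal p G {g \<in> carrier G. h g \<in> K}"
proof -
  interpret h: group_hom G H h
    using assms by (simp add: group_hom_def group_hom_axioms_def)
  show ?thesis
    using assms finite_index_vimage[OF assms(1,2)] normal_vimage[OF assms(1,2)]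
    by (auto simp: p_normal_def h.hom_nat_pow normal_imp_subgroup)
qed

lemma (in group) p_normal_Int:
  assumes "p_normal p G K" "p_normal p G L"
  shows "p_normal p G (K \<inter> L)"
proof -
  have "\<exists>k. x [^] (p ^ k :: nat) \<in> K \<inter> L" if "x \<in> carrier G" for x
  proof -
    obtain k where k: "x [^] (p ^ k :: nat) \<in> K"
      using p_normal_pow_mem[OF assms(1) \<open>x \<in> carrier G\<close>] ..
    obtain l where l: "x [^] (p ^ l :: nat) \<in> L"
      using p_normal_pow_mem[OF assms(2) \<open>x \<in> carrier G\<close>] ..
    from k l have "(x [^] (p ^ k :: nat)) [^] (p ^ l :: nat) \<in> K"
        "(x [^] (p ^ l :: nat)) [^] (p ^ k :: nat) \<in> L"
      using subgroup.nat_pow_mem[OF _ is_group] assms p_normal_imp_subgroup by blast+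
    then have "x [^] (p ^ (k + l) :: nat) \<in> K \<inter> L"
      using that by (simp add: nat_pow_pow power_add mult.commute)
    then show ?thesis by blast
  qed
  then show ?thesis
    using assms finite_index_Int
    by (auto simp: p_normal_def normal_subgroup_intersect normal_imp_subgroup)
qed

lemma (in group) p_normal_carrier: "p_normal p G (carrier G)"
proof -
  have "finite (rcosets (carrier G))"
    by (rule finite_rcosetsI[where f = "\<lambda>_. ()"]) (auto simp: subgroup_self)
  then show ?thesis
    by (auto simp: p_normal_def subgroup_self intro!: normal_invI)
qed

text \<open>The factor \<open>carrier G\<close> takes care of the empty family, whose intersection
  would otherwise be the whole type.\<close>

lemma (in group) p_normal_INT:
  assumes "finite I" "\<And>i. i \<in> I \<Longrightarrow> p_normal p G (K i)"
  shows "p_normal p G (carrier G \<inter> (\<Inter>i\<in>I. K i))"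
  using assms
proof (induction I)
  case (insert i I)
  then show ?case
    using p_normal_Int[of p "K i" "carrier G \<inter> (\<Inter>i\<in>I. K i)"]
    by (simp add: Int_assoc Int_left_commute)
qed (simp add: p_normal_carrier)

text \<open>\<open>D\<close> is the normal core of \<open>K\<close> in \<open>G\<close>. It is a
  finite intersection of conjugates of \<open>K\<close>, one for each coset of \<open>L\<close>,
  each of which is \<open>p_normal\<close> in \<open>L\<close>. This is the means to lift a
  separation found in a subgroup \<open>L\<close> to the whole group.\<close>

lemma (in group) p_normal_core:
  assumes L: "p_normal p G L" and K: "p_normal p (G\<lparr>carrier := L\<rparr>) K"
  obtains D where "p_normal p G D" "D \<subseteq> K" "D \<subseteq> L"
proof -
  interpret L: normal L G using L by (rule p_normal_imp_normal)
  interpret GL: group "G\<lparr>carrier := L\<rparr>"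
    by (rule L.subgroup_is_group) (rule is_group)
  interpret K: normal K "G\<lparr>carrier := L\<rparr>" using K by (rule p_normal_imp_normal)
  have KL: "K \<subseteq> L" using K.subset by simp
  have KG: "subgroup K G"
    using incl_subgroup L.subgroup_axioms K.subgroup_axioms by blast
  have K_conj: "inv l \<otimes> k \<otimes> l \<in> K" if "k \<in> K" "l \<in> L" for k l
    using K.inv_op_closed1[of l k] that by (simp add: L.subgroup_axioms)
  define C where "C t = {l \<in> L. inv t \<otimes> l \<otimes> t \<in> K}" for t
  have pC: "p_normal p (G\<lparr>carrier := L\<rparr>) (C t)" if "t \<in> carrier G" for t
  proof -
    have "(\<lambda>l. inv t \<otimes> l \<otimes> t) \<in> hom (G\<lparr>carrier := L\<rparr>) (G\<lparr>carrier := L\<rparr>)"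
      using that L.inv_op_closed1 by (auto simp: hom_def group_simps)
    from GL.p_normal_vimage[OF GL.is_group this K] show ?thesis
      by (simp add: C_def)
  qed
  obtain T where T: "finite T" "T \<subseteq> carrier G" "(\<lambda>x. L #> x) ` T = (\<lambda>x. L #> x) ` carrier G"
  proof -
    have "finite ((\<lambda>x. L #> x) ` carrier G)"
      using L by (simp add: p_normal_def finite_image_rcosets)
    from finite_subset_image[OF this order.refl] that show ?thesis
      by metis
  qed
  define D where "D = L \<inter> (\<Inter>t\<in>T. C t)"
  have pD: "p_normal p (G\<lparr>carrier := L\<rparr>) D"
    using GL.p_normal_INT[of T p C] pC T by (auto simp: D_def)
  have DG: "subgroup D G"
    using incl_subgroup L.subgroup_axioms pD p_normal_imp_subgroup by blast
  \<comment> \<open>Conjugation by elements of \<open>L\<close> preserves \<open>K\<close>, so the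
    conjugates by the transversal \<open>T\<close> already account for the conjugates by all of
    \<open>G\<close>.\<close>
  have D_iff: "d \<in> D \<longleftrightarrow> d \<in> L \<and> (\<forall>g\<in>carrier G. inv g \<otimes> d \<otimes> g \<in> K)" for d
  proof
    assume d: "d \<in> D"
    then have dL: "d \<in> L" by (simp add: D_def)
    have "inv g \<otimes> d \<otimes> g \<in> K" if g: "g \<in> carrier G" for g
    proof -
      obtain t where t: "t \<in> T" "L #> g = L #> t"
        using T(3) g by (metis imageE imageI)
      then have tG: "t \<in> carrier G" using T by auto
      have "g \<otimes> inv t \<in> L"
        using t g tG rcoset_eq_iff L.subgroup_axioms by blast
      then have l: "inv t \<otimes> g \<in> L"
        using g tG by (simp add: normal_mult_commute L.normal_axioms)
      have k: "inv t \<otimes> d \<otimes> t \<in> K"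
        using d t by (auto simp: D_def C_def)
      have "inv (inv t \<otimes> g) \<otimes> (inv t \<otimes> d \<otimes> t) \<otimes> (inv t \<otimes> g) = inv g \<otimes> d \<otimes> g"
        using g tG dL by (simp add: group_simps)
      then show ?thesis
        using K_conj[OF k l] by simp
    qed
    with dL show "d \<in> L \<and> (\<forall>g\<in>carrier G. inv g \<otimes> d \<otimes> g \<in> K)" by blast
  qed (use T(2) in \<open>auto simp: D_def C_def\<close>)
  have "D \<lhd> G"
  proof (rule normal_invI[OF DG])
    fix x h assume x: "x \<in> carrier G" and h: "h \<in> D"
    then have hL: "h \<in> L" by (simp add: D_def)
    have "inv g \<otimes> (x \<otimes> h \<otimes> inv x) \<otimes> g \<in> K" if "g \<in> carrier G" for g
    proof -
      have "inv (inv x \<otimes> g) \<otimes> h \<otimes> (inv x \<otimes> g) \<in> K"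
        using h x that by (simp add: D_iff)
      moreover have "inv (inv x \<otimes> g) \<otimes> h \<otimes> (inv x \<otimes> g) = inv g \<otimes> (x \<otimes> h \<otimes> inv x) \<otimes> g"
        using x that hL by (simp add: group_simps)
      ultimately show ?thesis by simp
    qed
    then show "x \<otimes> h \<otimes> inv x \<in> D"
      using x hL by (simp add: D_iff L.inv_op_closed2)
  qed
  moreover have "finite (rcosets D)"
    using finite_index_trans[OF L.subgroup_axioms _ DG] L pD
    by (simp add: p_normal_def D_def)
  moreover have "\<exists>k. x [^] (p ^ k :: nat) \<in> D" if "x \<in> carrier G" for x
  proof -
    obtain k where k: "x [^] (p ^ k :: nat) \<in> L"
      using p_normal_pow_mem[OF L \<open>x \<in> carrier G\<close>] ..
    then obtain j where "(x [^] (p ^ k :: nat)) [^] (p ^ j :: nat) \<in> D"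
      using pD by (auto simp: p_normal_def simp flip: nat_pow_consistent)
    then show ?thesis
      using that by (auto simp: nat_pow_pow simp flip: power_add)
  qed
  ultimately have "p_normal p G D"
    by (simp add: p_normal_def)
  moreover have "D \<subseteq> K"
    using D_iff L.mem_carrier by (metis inv_one l_one one_closed r_one subsetI)
  ultimately show ?thesis
    using that by (auto simp: D_def)
qed

section \<open>Non-conjugacy in a finite \<open>p\<close>-quotient, expressed through the
  kernel\<close>

definition conj_separated ::
  "nat \<Rightarrow> ('g, 'm) monoid_scheme \<Rightarrow> 'g \<Rightarrow> 'g \<Rightarrow> bool" where
  "conj_separated p G x y \<longleftrightarrow>
    (\<exists>K. p_normal p G K \<and> (\<forall>g\<in>carrier G. inv\<^bsub>G\<^esub> g \<otimes>\<^bsub>G\<^esub> x \<otimes>\<^bsub>G\<^esub> g \<otimes>\<^bsub>G\<^esub> inv\<^bsub>G\<^esub> y \<notin> K))"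

text \<open>The preimage of \<open>K\<close> works: conjugators from \<open>G\<close> map to some of
  the conjugators in \<open>H\<close>, all of which fail modulo \<open>K\<close>.\<close>

lemma (in group) conj_separated_hom:
  assumes "group H" "h \<in> hom G H" "x \<in> carrier G" "y \<in> carrier G"
    and "conj_separated p H (h x) (h y)"
  shows "conj_separated p G x y"
proof -
  interpret h: group_hom G H h
    using assms by (simp add: group_hom_def group_hom_axioms_def)
  obtain K where K: "p_normal p H K"
    and "\<forall>g\<in>carrier H. inv\<^bsub>H\<^esub> g \<otimes>\<^bsub>H\<^esub> h x \<otimes>\<^bsub>H\<^esub> g \<otimes>\<^bsub>H\<^esub> inv\<^bsub>H\<^esub> (h y) \<notin> K"
    using assms(5) by (auto simp: conj_separated_def)
  with p_normal_vimage[OF assms(1,2) K] assms(3,4) show ?thesis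
    by (force simp: conj_separated_def)
qed

lemma (in group) conj_separated_sym:
  assumes "conj_separated p G x y" "x \<in> carrier G" "y \<in> carrier G"
  shows "conj_separated p G y x"
proof -
  obtain K where K: "p_normal p G K"
    and sep: "\<And>g. g \<in> carrier G \<Longrightarrow> inv g \<otimes> x \<otimes> g \<otimes> inv y \<notin> K"
    using assms(1) by (auto simp: conj_separated_def)
  interpret K: normal K G using K by (rule p_normal_imp_normal)
  have "inv g \<otimes> y \<otimes> g \<otimes> inv x \<notin> K" if g: "g \<in> carrier G" for g
  proof
    assume "inv g \<otimes> y \<otimes> g \<otimes> inv x \<in> K"
    then have "g \<otimes> inv (inv g \<otimes> y \<otimes> g \<otimes> inv x) \<otimes> inv g \<in> K"
      using g K.inv_op_closed2 by blast
    moreover have "g \<otimes> inv (inv g \<otimes> y \<otimes> g \<otimes> inv x) \<otimes> inv g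
        = inv (inv g) \<otimes> x \<otimes> inv g \<otimes> inv y"
      using g assms(2,3) by (simp add: group_simps)
    ultimately show False
      using sep[of "inv g"] g by simp
  qed
  with K show ?thesis
    by (auto simp: conj_separated_def)
qed

lemma (in group) conj_separated_conj:
  assumes "conj_separated p G (inv a \<otimes> x \<otimes> a) y"
    and "a \<in> carrier G" "x \<in> carrier G" "y \<in> carrier G"
  shows "conj_separated p G x y"
proof -
  obtain K where K: "p_normal p G K"
    and sep: "\<And>g. g \<in> carrier G \<Longrightarrow> inv g \<otimes> (inv a \<otimes> x \<otimes> a) \<otimes> g \<otimes> inv y \<notin> K"
    using assms(1) by (auto simp: conj_separated_def)
  have "inv g \<otimes> x \<otimes> g \<otimes> inv y \<notin> K" if g: "g \<in> carrier G" for g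
    using sep[of "inv a \<otimes> g"] g assms(2-) by (simp add: group_simps)
  with K show ?thesis
    by (auto simp: conj_separated_def)
qed

lemma (in group) conjugate_in_refl: "x \<in> carrier G \<Longrightarrow> conjugate_in G x x"
  by (auto simp: conjugate_in_def intro!: bexI[of _ \<one>])

lemma (in group) conjugate_in_sym:
  assumes "conjugate_in G x y" "x \<in> carrier G" "y \<in> carrier G"
  shows "conjugate_in G y x"
proof -
  obtain g where "g \<in> carrier G" "y = inv g \<otimes> x \<otimes> g"
    using assms by (auto simp: conjugate_in_def)
  then show ?thesis
    using assms(2) by (auto simp: conjugate_in_def group_simps intro!: bexI[of _ "inv g"])
qed

text \<open>Transport of structure along an injection. Quotients and subgroups acquire elements of
  type \<open>nat\<close> in this way.\<close>

lemma group_image_group: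
  fixes G (structure)
  assumes "group G" "inj_on f (carrier G)"
  shows "f \<in> iso G (image_group f G)" "group (image_group f G)"
proof -
  interpret group G by fact
  have wgm: "weak_group_morphism f {\<one>} G"
  proof (rule weak_group_morphismsI[OF one_is_normal])
    fix a b assume ab: "a \<in> carrier G" "b \<in> carrier G"
    then have "a = b \<longleftrightarrow> a \<otimes> inv b = \<one>"
      by (metis inv_closed inv_equality inv_inv r_inv)
    then show "f a = f b \<longleftrightarrow> a \<otimes> inv b \<in> {\<one>}"
      using inj_on_eq_iff[OF assms(2) ab] by simp
  qed
  show "group (image_group f G)"
    by (rule image_group_is_group[OF wgm])
  show "f \<in> iso G (image_group f G)"
    using weak_group_morphism_is_hom[OF wgm] assms(2)
    by (simp add: iso_iff image_group_carrier)
qed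

text \<open>The bridge to the finite \<open>p\<close>-groups over \<open>nat\<close> in the
  definitions. Primality turns an order that divides \<open>p ^ k\<close> into a power of
  \<open>p\<close>. Surjectivity is recorded because a conjugator in the quotient must have a
  preimage.\<close>

lemma (in group) p_normal_iff_hom:
  assumes "Factorial_Ring.prime p"
  shows "p_normal p G K \<longleftrightarrow> (\<exists>(M :: nat monoid) \<phi>. p_group p M \<and> finite (carrier M) \<and>
    \<phi> \<in> hom G M \<and> \<phi> ` carrier G = carrier M \<and> K = kernel G M \<phi>)"
proof
  assume K: "p_normal p G K"
  then interpret K: normal K G by (rule p_normal_imp_normal)
  interpret Q: group "G Mod K" by (rule K.factorgroup_is_group)
  have fin: "finite (carrier (G Mod K))"
    using K by (simp add: p_normal_def FactGroup_def)
  then obtain f :: "'a set \<Rightarrow> nat" where f: "inj_on f (carrier (G Mod K))"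
    using finite_imp_inj_to_nat_seg by blast
  define M where "M = image_group f (G Mod K)"
  note iso = group_image_group[OF Q.is_group f, folded M_def]
  interpret M: group M by (fact iso)
  define \<phi> where "\<phi> = f \<circ> (\<lambda>x. K #> x)"
  have \<phi>: "\<phi> \<in> hom G M"
    unfolding \<phi>_def
    by (rule Group.hom_compose[OF K.r_coset_hom_Mod iso_imp_homomorphism[OF iso(1)]])
  interpret h: group_hom G M \<phi>
    using \<phi> by (simp add: group_hom_def group_hom_axioms_def M.is_group is_group)
  have surj: "\<phi> ` carrier G = carrier M"
    by (auto simp: \<phi>_def M_def image_group_carrier carrier_FactGroup)
  have one: "\<phi> x = \<one>\<^bsub>M\<^esub> \<longleftrightarrow> x \<in> K" if "x \<in> carrier G" for x
  proof -
    have "\<phi> x = \<one>\<^bsub>M\<^esub> \<longleftrightarrow> f (K #> x) = f (K #> \<one>)"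
      using h.hom_one by (simp add: \<phi>_def)
    also have "\<dots> \<longleftrightarrow> K #> x = K #> \<one>"
      using that by (intro inj_on_eq_iff[OF f]) (auto simp: carrier_FactGroup)
    also have "\<dots> \<longleftrightarrow> x \<in> K"
      using that by (simp add: rcoset_eq_iff K.subgroup_axioms)
    finally show ?thesis .
  qed
  have "\<exists>k. group.ord M y = p ^ k" if "y \<in> carrier M" for y
  proof -
    obtain x where x: "x \<in> carrier G" "y = \<phi> x"
      using surj \<open>y \<in> carrier M\<close> by auto
    obtain k where "x [^] (p ^ k :: nat) \<in> K"
      using p_normal_pow_mem[OF K x(1)] ..
    then have "y [^]\<^bsub>M\<^esub> (p ^ k :: nat) = \<one>\<^bsub>M\<^esub>"
      using x one[of "x [^] (p ^ k :: nat)"] by (simp add: h.hom_nat_pow)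
    then have "M.ord y dvd p ^ k"
      using that M.pow_eq_id by blast
    then show ?thesis
      using assms divides_primepow_nat by blast
  qed
  then have "p_group p M"
    by (simp add: p_group_def M.is_group)
  moreover have "finite (carrier M)"
    using fin by (simp add: M_def image_group_carrier)
  moreover have "K = kernel G M \<phi>"
    using one K.subset by (auto simp: kernel_def)
  ultimately show "\<exists>(M :: nat monoid) \<phi>. p_group p M \<and> finite (carrier M) \<and>
    \<phi> \<in> hom G M \<and> \<phi> ` carrier G = carrier M \<and> K = kernel G M \<phi>"
    using \<phi> surj by blast
next
  assume "\<exists>(M :: nat monoid) \<phi>. p_group p M \<and> finite (carrier M) \<and>
    \<phi> \<in> hom G M \<and> \<phi> ` carrier G = carrier M \<and> K = kernel G M \<phi>"
  then obtain M :: "nat monoid" and \<phi> where M: "p_group p M" "finite (carrier M)"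
    and \<phi>: "\<phi> \<in> hom G M" and K: "K = kernel G M \<phi>" by blast
  interpret M: group M using M(1) by (simp add: p_group_def)
  interpret h: group_hom G M \<phi>
    using \<phi> by (simp add: group_hom_def group_hom_axioms_def M.is_group is_group)
  have "p_normal p M {\<one>\<^bsub>M\<^esub>}"
  proof -
    have "finite (rcosets\<^bsub>M\<^esub> {\<one>\<^bsub>M\<^esub>})"
      using M(2) by (simp add: M.finite_image_rcosets)
    moreover have "\<exists>k. x [^]\<^bsub>M\<^esub> (p ^ k :: nat) \<in> {\<one>\<^bsub>M\<^esub>}" if "x \<in> carrier M" for x
      using M(1) that M.pow_eq_id by (metis dvd_refl p_group_def singletonI)
    ultimately show ?thesis
      by (simp add: p_normal_def M.one_is_normal)
  qed
  from p_normal_vimage[OF M.is_group \<phi> this] show "p_normal p G K"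
    by (simp add: K kernel_def)
qed

lemma p_conjugacy_separable_iff:
  fixes G (structure)
  assumes "Factorial_Ring.prime p"
  shows "p_conjugacy_separable p G \<longleftrightarrow> group G \<and>
    (\<forall>x\<in>carrier G. \<forall>y\<in>carrier G. \<not> conjugate_in G x y \<longrightarrow> conj_separated p G x y)"
proof (intro iffI conjI ballI impI)
  assume *: "p_conjugacy_separable p G"
  then show "group G" by (simp add: p_conjugacy_separable_def)
  interpret group G by fact
  fix x y
  assume xy: "x \<in> carrier G" "y \<in> carrier G" "\<not> conjugate_in G x y"
  then obtain M :: "nat monoid" and \<phi> where M: "p_group p M" "finite (carrier M)"
    and \<phi>: "\<phi> \<in> hom G M" and nc: "\<not> conjugate_in M (\<phi> x) (\<phi> y)"
    using * by (meson p_conjugacy_separable_def)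
  interpret M: group M using M(1) by (simp add: p_group_def)
  interpret h: group_hom G M \<phi>
    using \<phi> by (simp add: group_hom_def group_hom_axioms_def M.is_group is_group)
  have "conj_separated p M (\<phi> x) (\<phi> y)"
    unfolding conj_separated_def
  proof (intro exI conjI ballI)
    have "{\<one>\<^bsub>M\<^esub>} = kernel M M (\<lambda>x. x)"
      by (auto simp: kernel_def)
    then show "p_normal p M {\<one>\<^bsub>M\<^esub>}"
      using M by (subst M.p_normal_iff_hom[OF assms])
        (auto intro!: exI[of _ M] exI[of _ "\<lambda>x. x"] simp: hom_def)
    fix g assume g: "g \<in> carrier M"
    show "inv\<^bsub>M\<^esub> g \<otimes>\<^bsub>M\<^esub> \<phi> x \<otimes>\<^bsub>M\<^esub> g \<otimes>\<^bsub>M\<^esub> inv\<^bsub>M\<^esub> \<phi> y \<notin> {\<one>\<^bsub>M\<^esub>}"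
    proof
      assume "inv\<^bsub>M\<^esub> g \<otimes>\<^bsub>M\<^esub> \<phi> x \<otimes>\<^bsub>M\<^esub> g \<otimes>\<^bsub>M\<^esub> inv\<^bsub>M\<^esub> \<phi> y \<in> {\<one>\<^bsub>M\<^esub>}"
      then have "\<phi> y = inv\<^bsub>M\<^esub> g \<otimes>\<^bsub>M\<^esub> \<phi> x \<otimes>\<^bsub>M\<^esub> g"
        using g xy by (simp add: M.inv_solve_right')
      then show False
        using nc g by (auto simp: conjugate_in_def)
    qed
  qed
  then show "conj_separated p G x y"
    using conj_separated_hom[OF M.is_group \<phi>] xy by blast
next
  assume *: "group G \<and>
    (\<forall>x\<in>carrier G. \<forall>y\<in>carrier G. \<not> conjugate_in G x y \<longrightarrow> conj_separated p G x y)"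
  then interpret group G by blast
  have "\<exists>(M :: nat monoid) \<phi>. p_group p M \<and> finite (carrier M) \<and> \<phi> \<in> hom G M \<and>
          \<not> conjugate_in M (\<phi> x) (\<phi> y)"
    if xy: "x \<in> carrier G" "y \<in> carrier G" "\<not> conjugate_in G x y" for x y
  proof -
    obtain K where K: "p_normal p G K"
      and sep: "\<And>g. g \<in> carrier G \<Longrightarrow> inv g \<otimes> x \<otimes> g \<otimes> inv y \<notin> K"
      using * xy by (metis conj_separated_def)
    obtain M :: "nat monoid" and \<phi> where M: "p_group p M" "finite (carrier M)"
      and \<phi>: "\<phi> \<in> hom G M" "\<phi> ` carrier G = carrier M" "K = kernel G M \<phi>"
      using K p_normal_iff_hom[OF assms] by metis
    interpret M: group M using M(1) by (simp add: p_group_def)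
    interpret h: group_hom G M \<phi>
      using \<phi> by (simp add: group_hom_def group_hom_axioms_def M.is_group is_group)
    have "\<not> conjugate_in M (\<phi> x) (\<phi> y)"
    proof
      assume "conjugate_in M (\<phi> x) (\<phi> y)"
      then obtain m where m: "m \<in> carrier M" "\<phi> y = inv\<^bsub>M\<^esub> m \<otimes>\<^bsub>M\<^esub> \<phi> x \<otimes>\<^bsub>M\<^esub> m"
        by (auto simp: conjugate_in_def)
      then obtain g where g: "g \<in> carrier G" "m = \<phi> g"
        using \<phi>(2) by auto
      have "\<phi> (inv g \<otimes> x \<otimes> g \<otimes> inv y) = \<one>\<^bsub>M\<^esub>"
        using g xy m(1) by (simp add: m(2) flip: g(2))
      then show False
        using sep[OF g(1)] g xy by (simp add: \<phi>(3) kernel_def)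
    qed
    then show ?thesis
      using M \<phi> by blast
  qed
  then show "p_conjugacy_separable p G"
    using * by (simp add: p_conjugacy_separable_def)
qed

lemma conjugate_in_iso:
  fixes G (structure)
  assumes "group G" "group H" "h \<in> iso G H" "x \<in> carrier G" "y \<in> carrier G"
    and "conjugate_in H (h x) (h y)"
  shows "conjugate_in G x y"
proof -
  interpret group G by fact
  have h: "h \<in> hom G H" "h ` carrier G = carrier H" "inj_on h (carrier G)"
    using assms(3) by (auto simp: iso_iff)
  interpret h: group_hom G H h
    using assms h by (simp add: group_hom_def group_hom_axioms_def)
  obtain g where g: "g \<in> carrier G" "h y = inv\<^bsub>H\<^esub> h g \<otimes>\<^bsub>H\<^esub> h x \<otimes>\<^bsub>H\<^esub> h g"
    using assms(6) h(2) unfolding conjugate_in_def by (metis imageE)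
  then have "h y = h (inv g \<otimes> x \<otimes> g)"
    using assms by simp
  then have "y = inv g \<otimes> x \<otimes> g"
    using assms g inj_onD[OF h(3), of y "inv g \<otimes> x \<otimes> g"] by blast
  with g show ?thesis by (auto simp: conjugate_in_def)
qed

lemma (in group) finite_index_reps:
  assumes "subgroup L G" "finite (rcosets L)"
  obtains T where "finite T" "T \<subseteq> carrier G"
    "\<And>g. g \<in> carrier G \<Longrightarrow> \<exists>l\<in>L. \<exists>t\<in>T. g = l \<otimes> t"
proof -
  have "finite ((\<lambda>x. L #> x) ` carrier G)"
    using assms(2) by (simp add: finite_image_rcosets)
  from finite_subset_image[OF this order.refl] obtain T where T: "finite T" "T \<subseteq> carrier G"
    "(\<lambda>x. L #> x) ` carrier G = (\<lambda>x. L #> x) ` T"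
    by metis
  have "\<exists>l\<in>L. \<exists>t\<in>T. g = l \<otimes> t" if g: "g \<in> carrier G" for g
  proof -
    obtain t where t: "t \<in> T" "L #> g = L #> t"
      using T(3) g by (metis imageE imageI)
    then have "g \<otimes> inv t \<in> L" "g = (g \<otimes> inv t) \<otimes> t"
      using g T(2) rcoset_eq_iff[OF assms(1) g, of t] by (auto simp: m_assoc)
    with t(1) show ?thesis by blast
  qed
  with T that show ?thesis by blast
qed

text \<open>Every conjugator is \<open>l \<otimes> t\<close>, so being conjugate to \<open>y\<close>
  in \<open>G\<close> means being conjugate in \<open>L\<close> to one of finitely many elements
  \<open>t \<otimes> y \<otimes> inv t\<close>. The subgroups of \<open>L\<close> that separate
  \<open>x\<close> from these are intersected and then replaced by a subgroup normal in
  \<open>G\<close>.\<close>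

lemma (in group) conj_separated_extend:
  assumes L: "p_normal p G L" and x: "x \<in> L" and y: "y \<in> L"
    and T: "finite T" "T \<subseteq> carrier G" "\<And>g. g \<in> carrier G \<Longrightarrow> \<exists>l\<in>L. \<exists>t\<in>T. g = l \<otimes> t"
    and sep: "\<And>t. t \<in> T \<Longrightarrow> conj_separated p (G\<lparr>carrier := L\<rparr>) x (t \<otimes> y \<otimes> inv t)"
  shows "conj_separated p G x y"
proof -
  interpret L: normal L G using L by (rule p_normal_imp_normal)
  interpret GL: group "G\<lparr>carrier := L\<rparr>"
    by (rule L.subgroup_is_group) (rule is_group)
  have "\<exists>K. p_normal p (G\<lparr>carrier := L\<rparr>) K \<and>
      (\<forall>g\<in>L. inv g \<otimes> x \<otimes> g \<otimes> inv (t \<otimes> y \<otimes> inv t) \<notin> K)" if "t \<in> T" for t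
  proof -
    have "t \<otimes> y \<otimes> inv t \<in> L"
      using T(2) that y by (auto intro: L.inv_op_closed2)
    then show ?thesis
      using sep[OF that] by (simp add: conj_separated_def L.subgroup_axioms)
  qed
  then obtain K where K: "\<And>t. t \<in> T \<Longrightarrow> p_normal p (G\<lparr>carrier := L\<rparr>) (K t)"
    "\<And>t g. t \<in> T \<Longrightarrow> g \<in> L \<Longrightarrow> inv g \<otimes> x \<otimes> g \<otimes> inv (t \<otimes> y \<otimes> inv t) \<notin> K t"
    by metis
  have "p_normal p (G\<lparr>carrier := L\<rparr>) (L \<inter> (\<Inter>t\<in>T. K t))"
    using GL.p_normal_INT[OF T(1), of p K] K(1) by simp
  then obtain D where D: "p_normal p G D" "D \<subseteq> L \<inter> (\<Inter>t\<in>T. K t)"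
    using p_normal_core[OF L] by metis
  interpret D: normal D G using D(1) by (rule p_normal_imp_normal)
  have "inv g \<otimes> x \<otimes> g \<otimes> inv y \<notin> D" if g: "g \<in> carrier G" for g
  proof
    assume gD: "inv g \<otimes> x \<otimes> g \<otimes> inv y \<in> D"
    obtain l t where lt: "l \<in> L" "t \<in> T" "g = l \<otimes> t"
      using T(3)[OF g] by blast
    then have t: "t \<in> carrier G" using T(2) by blast
    have "t \<otimes> (inv g \<otimes> x \<otimes> g \<otimes> inv y) \<otimes> inv t \<in> D"
      using gD t by (rule D.inv_op_closed2[rotated])
    moreover have "t \<otimes> (inv g \<otimes> x \<otimes> g \<otimes> inv y) \<otimes> inv t =
        inv l \<otimes> x \<otimes> l \<otimes> inv (t \<otimes> y \<otimes> inv t)"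
      using lt t x y by (simp add: group_simps)
    ultimately show False
      using D(2) K(2)[OF lt(2,1)] lt(2) by auto
  qed
  with D(1) show ?thesis
    by (auto simp: conj_separated_def)
qed

lemma p_conjugacy_separable_iso:
  fixes G (structure)
  assumes p: "Factorial_Ring.prime p" and G: "group G" and "group H" "h \<in> iso G H"
    and H: "p_conjugacy_separable p H"
  shows "p_conjugacy_separable p G"
  unfolding p_conjugacy_separable_iff[OF p]
proof (intro conjI ballI impI)
  interpret group G by fact
  have h: "h \<in> hom G H" "h ` carrier G = carrier H" "inj_on h (carrier G)"
    using assms(4) by (auto simp: iso_iff)
  interpret h: group_hom G H h
    using assms h by (simp add: group_hom_def group_hom_axioms_def)
  fix x y assume xy: "x \<in> carrier G" "y \<in> carrier G" and nc: "\<not> conjugate_in G x y"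
  then have "\<not> conjugate_in H (h x) (h y)"
    using conjugate_in_iso[OF assms(2-4)] by blast
  then have "conj_separated p H (h x) (h y)"
    using H xy by (simp add: p_conjugacy_separable_iff[OF p])
  then show "conj_separated p G x y"
    using conj_separated_hom[OF assms(3) h(1)] xy by blast
qed fact

section \<open>Free groups\<close>

lemma carrier_free_group: "w \<in> carrier (free_group S) \<longleftrightarrow> reduced w \<and> fst ` set w \<subseteq> S"
  and mult_free_group: "u \<otimes>\<^bsub>free_group S\<^esub> v = foldr push u v"
  and one_free_group: "\<one>\<^bsub>free_group S\<^esub> = []"
  by (simp_all add: free_group_def)

lemmas free_group_simps = carrier_free_group mult_free_group one_free_group

interpretation free: group "free_group S" for S :: "'a set"
  by (rule group_free_group)

lemma reduced_append:
  "reduced (u @ v) \<longleftrightarrow>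
    reduced u \<and> reduced v \<and> (u = [] \<or> v = [] \<or> hd v \<noteq> inv_letter (last u))"
  by (auto simp: reduced_def successively_append_iff)

lemma reduced_Cons: "reduced (a # w) \<longleftrightarrow> reduced w \<and> (w = [] \<or> hd w \<noteq> inv_letter a)"
  by (cases w) (auto simp: reduced_def)

lemma inv_letter_eq_iff [simp]: "inv_letter a = inv_letter b \<longleftrightarrow> a = b"
  by (metis inv_letter_inv_letter)

lemma reduced_rev_inv: "reduced w \<Longrightarrow> reduced (rev (map inv_letter w))"
  by (auto simp: reduced_def successively_rev successively_map elim!: successively_mono)

lemma foldr_push_append: "reduced (u @ v) \<Longrightarrow> foldr push u v = u @ v"
  using foldr_push_Nil[of "u @ v"] by (simp add: reduced_append foldr_push_Nil)

lemma Cons_in_carrier_free_group: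
  assumes "a # w \<in> carrier (free_group S)"
  shows "[a] \<in> carrier (free_group S)" "w \<in> carrier (free_group S)"
    "a # w = [a] \<otimes>\<^bsub>free_group S\<^esub> w"
  using assms reduced_ConsD[of a w] push_reduced[of a w]
  by (auto simp: free_group_simps) (simp add: reduced_def)

lemma inv_free_group:
  assumes "w \<in> carrier (free_group S)"
  shows "inv\<^bsub>free_group S\<^esub> w = rev (map inv_letter w)"
proof (rule free.inv_equality)
  show "rev (map inv_letter w) \<in> carrier (free_group S)"
    using assms by (force simp: free_group_simps reduced_rev_inv)
  then show "rev (map inv_letter w) \<otimes>\<^bsub>free_group S\<^esub> w = \<one>\<^bsub>free_group S\<^esub>"
    using assms foldr_push_left_inverse[of "[]" w]
    by (simp add: free_group_simps foldr_push_Nil)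
qed fact

lemma length_push: "length (push a w) \<le> Suc (length w)"
  by (cases w) auto

lemma length_foldr_push: "length (foldr push u v) \<le> length u + length v"
  by (induction u) (auto intro: order.trans[OF length_push])

lemma foldr_push_cancel:
  assumes "reduced u" "reduced v"
  obtains u1 c v1 where "u = u1 @ c" "v = rev (map inv_letter c) @ v1" "foldr push u v = u1 @ v1"
  using assms
proof (induction u arbitrary: thesis)
  case (Cons a u)
  obtain u1 c v1 where IH: "u = u1 @ c" "v = rev (map inv_letter c) @ v1" "foldr push u v = u1 @ v1"
    using Cons.IH Cons.prems reduced_ConsD by blast
  show ?case
  \<comment> \<open>A new letter can cancel only if all of \<open>u\<close> has been absorbed;
    otherwise it meets a letter of \<open>u\<close>, and \<open>a # u\<close> is reduced.\<close>
  proof (cases "u1 = [] \<and> v1 \<noteq> [] \<and> hd v1 = inv_letter a")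
    case True
    then obtain v2 where "v1 = inv_letter a # v2"
      by (cases v1) auto
    with True IH show ?thesis
      by (intro Cons.prems(1)[of "[]" "a # c" v2]) auto
  next
    case False
    have "push a (u1 @ v1) = a # u1 @ v1"
      using False Cons.prems(2) IH(1) by (cases u1; cases v1) (auto simp: reduced_def)
    with IH show ?thesis
      by (intro Cons.prems(1)[of "a # u1" c v1]) auto
  qed
qed auto

section \<open>The universal property and change of basis\<close>

definition free_lift :: "('g, 'm) monoid_scheme \<Rightarrow> ('a \<Rightarrow> 'g) \<Rightarrow> 'a word \<Rightarrow> 'g" where
  "free_lift G f = (\<lambda>w. foldr (\<lambda>a z. (if snd a then f (fst a) else inv\<^bsub>G\<^esub> f (fst a)) \<otimes>\<^bsub>G\<^esub> z) w \<one>\<^bsub>G\<^esub>)"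

lemma free_lift_simps [simp]:
  "free_lift G f [] = \<one>\<^bsub>G\<^esub>"
  "free_lift G f (a # w) =
    (if snd a then f (fst a) else inv\<^bsub>G\<^esub> f (fst a)) \<otimes>\<^bsub>G\<^esub> free_lift G f w"
  by (simp_all add: free_lift_def)

context group begin

lemma free_lift_closed:
  "f \<in> S \<rightarrow> carrier G \<Longrightarrow> fst ` set w \<subseteq> S \<Longrightarrow> free_lift G f w \<in> carrier G"
  by (induction w) auto

text \<open>\<open>free_lift\<close> is evaluated on arbitrary words. That it does not notice
  cancellation is what makes it a homomorphism.\<close>

lemma free_lift_push:
  assumes "f \<in> S \<rightarrow> carrier G" "fst a \<in> S" "fst ` set w \<subseteq> S"
  shows "free_lift G f (push a w) = free_lift G f [a] \<otimes> free_lift G f w"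
proof (cases w)
  case (Cons b v)
  then show ?thesis
    using assms free_lift_closed[OF assms(1), of v]
    by (auto simp: inv_letter_def inv_cancel Pi_iff)
qed (use assms in \<open>auto simp: Pi_iff\<close>)

lemma free_lift_hom:
  assumes f: "f \<in> S \<rightarrow> carrier G"
  shows "free_lift G f \<in> hom (free_group S) G"
proof -
  have "free_lift G f (foldr push u v) = free_lift G f u \<otimes> free_lift G f v"
    if "fst ` set u \<subseteq> S" "fst ` set v \<subseteq> S" for u v
    using that
  proof (induction u)
    case Nil
    then show ?case using free_lift_closed[OF f] by simp
  next
    case (Cons a u)
    have "fst ` set (foldr push u v) \<subseteq> S"
      using Cons.prems set_foldr_push[of u v] by (fastforce simp: image_subset_iff)
    then show ?case
      using Cons free_lift_closed[OF f] f
      by (auto simp: free_lift_push[OF f] m_assoc Pi_iff)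
  qed
  then show ?thesis
    using free_lift_closed[OF f] by (auto simp: hom_def free_group_simps)
qed

end

lemma free_letter: "fst a \<in> S \<Longrightarrow> [a] \<in> carrier (free_group S)"
  by (simp add: free_group_simps reduced_def)

lemma inv_free_letter:
  "x \<in> S \<Longrightarrow> inv\<^bsub>free_group S\<^esub> [(x, e)] = [(x, \<not> e)]"
  by (simp add: inv_free_group free_letter inv_letter_def)

text \<open>Serves as the induction principle for free groups: a property that defines a subgroup
  needs to be checked on the generators only.\<close>

lemma free_group_subgroup_eq:
  assumes "subgroup K (free_group S)" "\<And>x. x \<in> S \<Longrightarrow> [(x, True)] \<in> K"
  shows "K = carrier (free_group S)"
proof
  interpret K: subgroup K "free_group S" by fact
  have letter: "[a] \<in> K" if "fst a \<in> S" for a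
  proof (cases "snd a")
    case True
    then show ?thesis using assms(2)[OF that] by (metis prod.collapse)
  next
    case False
    then have "[a] = inv\<^bsub>free_group S\<^esub> [(fst a, True)]"
      using that by (cases a) (simp add: inv_free_letter)
    then show ?thesis using assms(2)[OF that] by simp
  qed
  show "carrier (free_group S) \<subseteq> K"
  proof
    fix w assume "w \<in> carrier (free_group S)"
    then show "w \<in> K"
    proof (induction w)
      case Nil
      then show ?case using K.one_closed by (simp add: one_free_group)
    next
      case (Cons a w)
      note Cons_in_carrier_free_group[OF Cons.prems]
      then show ?case
        using Cons letter[of a] K.m_closed by (metis carrier_free_group image_subset_iff list.set_intros(1))
    qed
  qed
qed (use assms subgroup.subset in blast)

lemma generate_free_group:
  "generate (free_group S) ((\<lambda>x. [(x, True)]) ` S) = carrier (free_group S)"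
  by (rule free_group_subgroup_eq)
    (auto intro!: free.generate_is_subgroup free_letter generate.incl)

lemma free_hom_eq:
  assumes "group G" "h \<in> hom (free_group S) G" "k \<in> hom (free_group S) G"
    and "\<And>x. x \<in> S \<Longrightarrow> h [(x, True)] = k [(x, True)]" "w \<in> carrier (free_group S)"
  shows "h w = k w"
proof -
  interpret h: group_hom "free_group S" G h
    using assms by (simp add: group_hom_def group_hom_axioms_def)
  interpret k: group_hom "free_group S" G k
    using assms by (simp add: group_hom_def group_hom_axioms_def)
  have "{w \<in> carrier (free_group S). h w = k w} = carrier (free_group S)"
    by (rule free_group_subgroup_eq) (auto intro!: free.subgroupI assms(4) free_letter exI[of _ "\<one>\<^bsub>free_group S\<^esub>"])
  with assms(5) show ?thesis by blast
qed

text \<open>Lets a basis change its type. Bases of subgroups consist of pairs or cosets, while the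
  definitions and inductions expect elements of the group or natural numbers.\<close>

lemma free_group_relabel:
  assumes "inj_on f S"
  shows "map (apfst f) \<in> iso (free_group S) (free_group (f ` S))"
proof -
  have inv: "inv_letter (apfst f a) = apfst f (inv_letter a)" for a
    by (cases a) (simp add: inv_letter_def)
  have eq: "apfst f a = apfst f b \<longleftrightarrow> a = b" if "fst a \<in> S" "fst b \<in> S" for a b
    using that inj_onD[OF assms] by (cases a; cases b) auto
  have red: "reduced (map (apfst f) w) \<longleftrightarrow> reduced w" if "fst ` set w \<subseteq> S" for w
    using that
  proof (induction w rule: induct_list012)
    case (3 a b w)
    then show ?case by (auto simp: reduced_def inv eq)
  qed (auto simp: reduced_def)
  have push: "map (apfst f) (push a w) = push (apfst f a) (map (apfst f) w)"
    if "fst a \<in> S" "fst ` set w \<subseteq> S" for a w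
    using that by (cases w) (auto simp: inv eq)
  have mult: "map (apfst f) (foldr push u v) = foldr push (map (apfst f) u) (map (apfst f) v)"
    if "fst ` set u \<subseteq> S" "fst ` set v \<subseteq> S" for u v
    using that
  proof (induction u)
    case (Cons a u)
    have "fst ` set (foldr push u v) \<subseteq> S"
      using Cons.prems set_foldr_push[of u v] by (fastforce simp: image_subset_iff)
    with Cons show ?case by (simp add: push)
  qed simp
  have surj: "w \<in> map (apfst f) ` carrier (free_group S)" if "w \<in> carrier (free_group (f ` S))" for w
  proof -
    have "w = map (apfst f) (map (apfst (inv_into S f)) w)"
      using that by (auto simp: free_group_simps intro!: map_idI[symmetric] simp: f_inv_into_f image_subset_iff)
    moreover have "fst ` set (map (apfst (inv_into S f)) w) \<subseteq> S"
      using that by (auto simp: free_group_simps image_subset_iff inv_into_into)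
    ultimately show ?thesis
      using that red[of "map (apfst (inv_into S f)) w"] unfolding carrier_free_group
      by (metis carrier_free_group image_eqI)
  qed
  have "inj_on (map (apfst f)) (carrier (free_group S))"
  proof (rule inj_onI)
    fix u v assume "u \<in> carrier (free_group S)" "v \<in> carrier (free_group S)"
      "map (apfst f) u = map (apfst f) v"
    then have "set u \<union> set v \<subseteq> S \<times> UNIV"
      by (force simp: free_group_simps)
    moreover have "inj_on (apfst f) (S \<times> UNIV)"
      using assms by (auto simp: inj_on_def)
    ultimately have "inj_on (apfst f) (set u \<union> set v)"
      using inj_on_subset by blast
    with \<open>map (apfst f) u = _\<close> show "u = v"
      by (rule map_inj_on)
  qed
  moreover have hom: "map (apfst f) \<in> hom (free_group S) (free_group (f ` S))"
    using red mult by (auto simp: hom_def free_group_simps image_subset_iff)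
  moreover have "map (apfst f) ` carrier (free_group S) = carrier (free_group (f ` S))"
    using surj hom_in_carrier[OF hom] by blast
  ultimately show ?thesis
    by (simp add: iso_iff)
qed

lemma free_group_inclusion:
  "S \<subseteq> T \<Longrightarrow> (\<lambda>w. w) \<in> hom (free_group S) (free_group T)"
proof -
  assume "S \<subseteq> T"
  then have "carrier (free_group S) \<subseteq> carrier (free_group T)"
    unfolding free_group_def by simp blast
  then show ?thesis
    by (auto simp: hom_def mult_free_group)
qed

text \<open>The definition asks for a basis indexed by elements of \<open>G\<close> itself; the
  generators, carried into \<open>G\<close>, can serve as their own names.\<close>

lemma is_free_groupI:
  fixes G :: "('g, 'm) monoid_scheme" and S :: "'b set"
  assumes "group G" "G \<cong> free_group S"
  shows "is_free_group G"
proof -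
  interpret group G by fact
  obtain h where h: "h \<in> iso (free_group S) G"
    using free.iso_sym iso_sym[OF assms(2)] by (auto simp: is_iso_def)
  have "inj_on (\<lambda>x. h [(x, True)]) S"
    using h by (auto simp: iso_iff intro!: inj_onI dest!: inj_onD simp: free_letter)
  then have "free_group S \<cong> free_group ((\<lambda>x. h [(x, True)]) ` S)"
    using free_group_relabel is_isoI by blast
  with assms show ?thesis
    using iso_trans by (auto simp: is_free_group_def)
qed

lemma countable_free_group:
  fixes G :: "('g::countable, 'm) monoid_scheme"
  assumes "is_free_group G"
  obtains T :: "nat set" where "G \<cong> free_group T"
proof -
  obtain S :: "'g set" where "G \<cong> free_group S"
    using assms by (auto simp: is_free_group_def)
  moreover have "free_group S \<cong> free_group (to_nat ` S)"
    using free_group_relabel[of to_nat S] is_isoI by (simp add: inj_on_subset[OF inj_to_nat]) 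
  ultimately show ?thesis
    using iso_trans that by blast
qed

section \<open>Homomorphisms to the integers with prescribed values on the basis\<close>

definition weight :: "('a \<Rightarrow> int) \<Rightarrow> 'a word \<Rightarrow> int" where
  "weight f w = (\<Sum>a\<leftarrow>w. if snd a then f (fst a) else - f (fst a))"

lemma weight_simps [simp]:
  "weight f [] = 0"
  "weight f (a # w) = (if snd a then f (fst a) else - f (fst a)) + weight f w"
  "weight f (u @ v) = weight f u + weight f v"
  by (simp_all add: weight_def)

lemma weight_push: "weight f (push a w) = weight f [a] + weight f w"
  by (cases w) (auto simp: inv_letter_def)

lemma weight_mult: "weight f (u \<otimes>\<^bsub>free_group S\<^esub> v) = weight f u + weight f v"
  by (induction u) (simp_all add: free_group_simps weight_push)

lemma weight_inv: "w \<in> carrier (free_group S) \<Longrightarrow> weight f (inv\<^bsub>free_group S\<^esub> w) = - weight f w"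
  using weight_mult[where u = "inv\<^bsub>free_group S\<^esub> w" and v = w and S = S and f = f] by (simp add: one_free_group)

lemma weight_pow:
  "weight f (w [^]\<^bsub>free_group S\<^esub> (n :: nat)) = int n * weight f w"
  by (induction n) (simp_all add: weight_mult one_free_group algebra_simps)

subsection \<open>Cyclically reduced words and centralizers\<close>

definition cyc_reduced :: "'a word \<Rightarrow> bool" where
  "cyc_reduced w \<longleftrightarrow> reduced w \<and> (w = [] \<or> hd w \<noteq> inv_letter (last w))"

lemma not_cyc_reduced_conj:
  assumes w: "w \<in> carrier (free_group S)" and "\<not> cyc_reduced w"
  obtains a v where "fst a \<in> S" "v \<in> carrier (free_group S)" "length v < length w"
    "v = inv\<^bsub>free_group S\<^esub> [a] \<otimes>\<^bsub>free_group S\<^esub> w \<otimes>\<^bsub>free_group S\<^esub> [a]"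
proof -
  have nc: "w \<noteq> []" "hd w = inv_letter (last w)"
    using assms by (auto simp: cyc_reduced_def free_group_simps)
  then obtain a u where u: "w = a # u"
    by (cases w) auto
  have "u \<noteq> []"
    using nc u by auto
  then obtain b v where v: "u = v @ [b]"
    by (metis rev_exhaust)
  have b: "b = inv_letter a"
    using nc u v by simp
  have a: "fst a \<in> S" and vS: "v \<in> carrier (free_group S)"
    using w u v by (auto simp: free_group_simps reduced_append dest: reduced_ConsD)
  have "w = [a] \<otimes>\<^bsub>free_group S\<^esub> (v \<otimes>\<^bsub>free_group S\<^esub> inv\<^bsub>free_group S\<^esub> [a])"
  proof -
    have "reduced (v @ [b])" "push a (v @ [b]) = a # v @ [b]"
      using w u v by (auto simp: free_group_simps push_reduced dest: reduced_ConsD)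
    then show ?thesis
      using u v b free_letter[OF a] by (simp add: mult_free_group inv_free_group foldr_push_append)
  qed
  then have "v = inv\<^bsub>free_group S\<^esub> [a] \<otimes>\<^bsub>free_group S\<^esub> w \<otimes>\<^bsub>free_group S\<^esub> [a]"
    using vS free_letter[OF a] by (simp add: free.group_simps)
  with that a vS u v show ?thesis
    by (metis length_append_singleton length_Cons less_Suc_eq lessI)
qed

lemma conj_cyc_reduced:
  assumes "w \<in> carrier (free_group S)"
  obtains g u where "g \<in> carrier (free_group S)" "u \<in> carrier (free_group S)" "cyc_reduced u"
    "w = g \<otimes>\<^bsub>free_group S\<^esub> u \<otimes>\<^bsub>free_group S\<^esub> inv\<^bsub>free_group S\<^esub> g"
  using assms
proof (induction w arbitrary: thesis rule: length_induct)
  case (1 w)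
  show ?case
  proof (cases "cyc_reduced w")
    case True
    then show ?thesis
      using "1.prems" by (metis free.inv_one free.l_one free.one_closed free.r_one)
  next
    case False
    obtain a v where a: "fst a \<in> S" and v: "v \<in> carrier (free_group S)" "length v < length w"
      "v = inv\<^bsub>free_group S\<^esub> [a] \<otimes>\<^bsub>free_group S\<^esub> w \<otimes>\<^bsub>free_group S\<^esub> [a]"
      using not_cyc_reduced_conj[OF "1.prems"(2) False] .
    obtain g u where gu: "g \<in> carrier (free_group S)" "u \<in> carrier (free_group S)" "cyc_reduced u"
      "v = g \<otimes>\<^bsub>free_group S\<^esub> u \<otimes>\<^bsub>free_group S\<^esub> inv\<^bsub>free_group S\<^esub> g"
      using "1.IH" v(1,2) by blast
    have "w = [a] \<otimes>\<^bsub>free_group S\<^esub> v \<otimes>\<^bsub>free_group S\<^esub> inv\<^bsub>free_group S\<^esub> [a]"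
      using v(3) "1.prems"(2) free_letter[OF a] by (simp add: free.group_simps)
    also have "\<dots> = ([a] \<otimes>\<^bsub>free_group S\<^esub> g) \<otimes>\<^bsub>free_group S\<^esub> u \<otimes>\<^bsub>free_group S\<^esub>
        inv\<^bsub>free_group S\<^esub> ([a] \<otimes>\<^bsub>free_group S\<^esub> g)"
      using gu free_letter[OF a] by (simp add: free.group_simps)
    finally show ?thesis
      using "1.prems"(1) gu free_letter[OF a] by blast
  qed
qed

text \<open>Nothing cancels where two copies of a cyclically reduced word meet. Powers thereby
  become plain concatenations.\<close>

lemma pow_cyc_reduced:
  assumes "u \<in> carrier (free_group S)" "cyc_reduced u"
  shows "u [^]\<^bsub>free_group S\<^esub> (n :: nat) = concat (replicate n u)"
proof -
  have red: "reduced (concat (replicate n u)) \<and>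
      (n > 0 \<longrightarrow> u \<noteq> [] \<longrightarrow> hd (concat (replicate n u)) = hd u \<and> concat (replicate n u) \<noteq> [])" for n
    using assms by (induction n) (auto simp: cyc_reduced_def reduced_append)
  show ?thesis
  proof (induction n)
    case (Suc n)
    have "u [^]\<^bsub>free_group S\<^esub> Suc n = u \<otimes>\<^bsub>free_group S\<^esub> u [^]\<^bsub>free_group S\<^esub> n"
      by (rule free.nat_pow_Suc2[OF assms(1)])
    also have "\<dots> = u @ concat (replicate n u)"
      using Suc foldr_push_append[of u "concat (replicate n u)"] red[of "Suc n"]
      by (simp add: free_group_simps)
    finally show ?case by simp
  qed (simp add: free_group_simps)
qed

lemma free_group_torsion_free:
  assumes "w \<in> carrier (free_group S)" "w [^]\<^bsub>free_group S\<^esub> (n :: nat) = \<one>\<^bsub>free_group S\<^esub>" "n > 0"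
  shows "w = \<one>\<^bsub>free_group S\<^esub>"
proof -
  obtain g u where gu: "g \<in> carrier (free_group S)" "u \<in> carrier (free_group S)" "cyc_reduced u"
    "w = g \<otimes>\<^bsub>free_group S\<^esub> u \<otimes>\<^bsub>free_group S\<^esub> inv\<^bsub>free_group S\<^esub> g"
    using conj_cyc_reduced[OF assms(1)] .
  have "w [^]\<^bsub>free_group S\<^esub> k =
      g \<otimes>\<^bsub>free_group S\<^esub> u [^]\<^bsub>free_group S\<^esub> k \<otimes>\<^bsub>free_group S\<^esub> inv\<^bsub>free_group S\<^esub> g" for k :: nat
    using gu by (induction k) (simp_all add: free.group_simps)
  then have "g \<otimes>\<^bsub>free_group S\<^esub> u [^]\<^bsub>free_group S\<^esub> n \<otimes>\<^bsub>free_group S\<^esub> inv\<^bsub>free_group S\<^esub> g = \<one>\<^bsub>free_group S\<^esub>"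
    using assms(2) by simp
  then have "u [^]\<^bsub>free_group S\<^esub> n = \<one>\<^bsub>free_group S\<^esub>"
    using gu(1,2) by (metis free.inv_solve_right free.inv_solve_left free.l_one free.l_inv
        free.m_closed free.nat_pow_closed free.one_closed free.inv_closed free.r_one)
  then have "u = []"
    using pow_cyc_reduced[OF gu(2,3), of n] assms(3) by (auto simp: free_group_simps)
  then show ?thesis
    using gu by (simp flip: one_free_group[of S])
qed

text \<open>Turns commutation in the group into commutation of lists, where combinatorics on words
  applies. A high power of \<open>u\<close> in front of \<open>v\<close> removes all cancellation
  from both products.\<close>

lemma commuting_words:
  assumes u: "u \<in> carrier (free_group S)" "cyc_reduced u" "u \<noteq> []" and v: "v \<in> carrier (free_group S)"
    and comm: "u \<otimes>\<^bsub>free_group S\<^esub> v = v \<otimes>\<^bsub>free_group S\<^esub> u"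
  obtains n :: nat where "u @ (u [^]\<^bsub>free_group S\<^esub> n \<otimes>\<^bsub>free_group S\<^esub> v) =
    (u [^]\<^bsub>free_group S\<^esub> n \<otimes>\<^bsub>free_group S\<^esub> v) @ u"
proof -
  \<comment> \<open>\<open>v\<close> can absorb at most \<open>length v\<close> letters of the
    power, so one full copy of \<open>u\<close> survives at its front.\<close>
  define n where "n = Suc (length v)"
  define P where "P = u [^]\<^bsub>free_group S\<^esub> n"
  define v' where "v' = P \<otimes>\<^bsub>free_group S\<^esub> v"
  have P: "P \<in> carrier (free_group S)"
    unfolding P_def using u(1) by (rule free.nat_pow_closed)
  have P_eq: "P = u @ concat (replicate (length v) u)"
    using pow_cyc_reduced[OF u(1,2), of n] by (simp add: P_def n_def)
  obtain P1 c v1 where c: "P = P1 @ c" "v = rev (map inv_letter c) @ v1" "v' = P1 @ v1"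
    using foldr_push_cancel[of P v] P v by (auto simp: v'_def free_group_simps)
  have "length v \<le> length u * length v"
    using u(3) by (cases u) auto
  moreover have "length P = length u + length u * length v"
    by (simp add: P_eq length_concat sum_list_replicate)
  moreover have "length c \<le> length v" "length P = length P1 + length c"
    by (simp add: c(2)) (simp add: c(1))
  ultimately have len: "length u \<le> length P1"
    by linarith
  have "take (length u) (P1 @ c) = u"
    by (simp add: P_eq flip: c(1))
  then obtain t where t: "P1 = u @ t"
    using len by (metis append_take_drop_id diff_is_0_eq take0 take_append append_Nil2)
  have v'S: "v' \<in> carrier (free_group S)"
    using P v by (simp add: v'_def)
  have "reduced (u @ v')"
    using v'S u by (auto simp: c(3) t free_group_simps reduced_append cyc_reduced_def)
  then have 1: "u \<otimes>\<^bsub>free_group S\<^esub> v' = u @ v'"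
    by (simp add: free_group_simps foldr_push_append)
  have "u \<otimes>\<^bsub>free_group S\<^esub> P = P \<otimes>\<^bsub>free_group S\<^esub> u"
    using free.nat_pow_Suc2[OF u(1), of n] by (simp add: P_def)
  then have 2: "u \<otimes>\<^bsub>free_group S\<^esub> v' = v' \<otimes>\<^bsub>free_group S\<^esub> u"
    using u(1) P v comm by (metis v'_def free.m_assoc)
  obtain v2 d u2 where d: "v' = v2 @ d" "u = rev (map inv_letter d) @ u2" "foldr push v' u = v2 @ u2"
    using foldr_push_cancel[of v' u] v'S u(1) by (auto simp: free_group_simps)
  \<comment> \<open>The product with \<open>u\<close> on the left has full length. The product on
    the other side is the same word, hence has full length too, and nothing cancels in it.\<close>
  have "v2 @ u2 = u @ v'"
    using 1 2 d(3) by (simp add: free_group_simps)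
  then have "length v2 + length u2 = length u + length v'"
    by (metis length_append)
  then have "d = []"
    using arg_cong[OF d(1), of length] arg_cong[OF d(2), of length] by simp
  with d have "foldr push v' u = v' @ u" by simp
  then have "u @ v' = v' @ u"
    using 1 2 by (simp add: free_group_simps)
  then show ?thesis
    using that by (simp add: v'_def P_def)
qed

text \<open>Both products commute with a long power \<open>W\<close> of \<open>w\<close>, so each of
  them is the prefix of \<open>W\<close> of the same length.\<close>

lemma commuting_lists_trans:
  assumes "x @ w = w @ x" "y @ w = w @ y" "w \<noteq> []"
  shows "x @ y = y @ x"
proof -
  define W where "W = concat (replicate (length x + length y) w)"
  have pow: "z @ concat (replicate n w) = concat (replicate n w) @ z" if "z @ w = w @ z" for z n
    using that by (induction n) (auto, metis append.assoc)
  have "x @ y @ W = W @ x @ y" "y @ x @ W = W @ y @ x"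
    using pow[of "x @ y"] pow[of "y @ x"] assms by (simp_all add: W_def)
  moreover have "length (x @ y) \<le> length W"
    using assms(3) by (cases w) (auto simp: W_def length_concat sum_list_replicate)
  ultimately have "x @ y = take (length (x @ y)) W" "y @ x = take (length (x @ y)) W"
    by (metis append.assoc append_eq_conv_conj take_append diff_is_0_eq take0 append_Nil2,
      metis append.assoc append_eq_conv_conj take_append diff_is_0_eq take0 append_Nil2 length_append add.commute)
  then show ?thesis using \<open>length (x @ y) \<le> length W\<close> by (simp add: min_def)
qed

text \<open>After a conjugation \<open>w\<close> is a cyclically reduced word \<open>u\<close>.
  Shifting the two other elements by powers of \<open>u\<close>, which commute with both, makes them
  commute with \<open>u\<close> as lists, so that the transitivity for lists applies.\<close>

lemma free_group_commute_trans:
  assumes S: "w \<in> carrier (free_group S)" "x \<in> carrier (free_group S)" "y \<in> carrier (free_group S)"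
    and w: "w \<noteq> \<one>\<^bsub>free_group S\<^esub>"
    and comm: "w \<otimes>\<^bsub>free_group S\<^esub> x = x \<otimes>\<^bsub>free_group S\<^esub> w" "w \<otimes>\<^bsub>free_group S\<^esub> y = y \<otimes>\<^bsub>free_group S\<^esub> w"
  shows "x \<otimes>\<^bsub>free_group S\<^esub> y = y \<otimes>\<^bsub>free_group S\<^esub> x"
proof -
  let ?F = "free_group S"
  have cyc: "x \<otimes>\<^bsub>?F\<^esub> y = y \<otimes>\<^bsub>?F\<^esub> x"
    if u: "u \<in> carrier ?F" "cyc_reduced u" "u \<noteq> []" and xy: "x \<in> carrier ?F" "y \<in> carrier ?F"
      and cm: "u \<otimes>\<^bsub>?F\<^esub> x = x \<otimes>\<^bsub>?F\<^esub> u" "u \<otimes>\<^bsub>?F\<^esub> y = y \<otimes>\<^bsub>?F\<^esub> u" for u x y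
  proof -
    obtain n :: nat where n: "u @ (u [^]\<^bsub>?F\<^esub> n \<otimes>\<^bsub>?F\<^esub> x) = (u [^]\<^bsub>?F\<^esub> n \<otimes>\<^bsub>?F\<^esub> x) @ u"
      using commuting_words[OF u xy(1) cm(1)] .
    obtain m :: nat where m: "u @ (u [^]\<^bsub>?F\<^esub> m \<otimes>\<^bsub>?F\<^esub> y) = (u [^]\<^bsub>?F\<^esub> m \<otimes>\<^bsub>?F\<^esub> y) @ u"
      using commuting_words[OF u xy(2) cm(2)] .
    define x' y' where "x' = u [^]\<^bsub>?F\<^esub> n \<otimes>\<^bsub>?F\<^esub> x" and "y' = u [^]\<^bsub>?F\<^esub> m \<otimes>\<^bsub>?F\<^esub> y"
    have carr: "x' \<in> carrier ?F" "y' \<in> carrier ?F"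
      using u xy by (simp_all add: x'_def y'_def)
    have "x' @ y' = y' @ x'"
      using commuting_lists_trans[of x' u y'] n m u(3) by (simp add: x'_def y'_def)
    then have "foldr push (x' @ y') [] = foldr push (y' @ x') []" by simp
    then have "x' \<otimes>\<^bsub>?F\<^esub> y' = y' \<otimes>\<^bsub>?F\<^esub> x'"
      using carr by (simp add: free_group_simps foldr_push_Nil)
    moreover have "u [^]\<^bsub>?F\<^esub> k \<otimes>\<^bsub>?F\<^esub> z = z \<otimes>\<^bsub>?F\<^esub> u [^]\<^bsub>?F\<^esub> k"
      if "u \<otimes>\<^bsub>?F\<^esub> z = z \<otimes>\<^bsub>?F\<^esub> u" "z \<in> carrier ?F" for k :: nat and z
      using that u(1) by (induction k) (simp_all, metis free.m_assoc free.nat_pow_closed)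
    note pc = this
    have "x' \<otimes>\<^bsub>?F\<^esub> y' = u [^]\<^bsub>?F\<^esub> n \<otimes>\<^bsub>?F\<^esub> u [^]\<^bsub>?F\<^esub> m \<otimes>\<^bsub>?F\<^esub> (x \<otimes>\<^bsub>?F\<^esub> y)"
      using pc[OF cm(1) xy(1), of m] u(1) xy
      by (simp add: x'_def y'_def free.m_assoc) (simp flip: free.m_assoc)
    moreover have "y' \<otimes>\<^bsub>?F\<^esub> x' = u [^]\<^bsub>?F\<^esub> n \<otimes>\<^bsub>?F\<^esub> u [^]\<^bsub>?F\<^esub> m \<otimes>\<^bsub>?F\<^esub> (y \<otimes>\<^bsub>?F\<^esub> x)"
    proof -
      have "y' \<otimes>\<^bsub>?F\<^esub> x' = u [^]\<^bsub>?F\<^esub> m \<otimes>\<^bsub>?F\<^esub> (y \<otimes>\<^bsub>?F\<^esub> u [^]\<^bsub>?F\<^esub> n) \<otimes>\<^bsub>?F\<^esub> x"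
        using u(1) xy by (simp add: x'_def y'_def free.m_assoc)
      also have "\<dots> = (u [^]\<^bsub>?F\<^esub> m \<otimes>\<^bsub>?F\<^esub> u [^]\<^bsub>?F\<^esub> n) \<otimes>\<^bsub>?F\<^esub> (y \<otimes>\<^bsub>?F\<^esub> x)"
        using u(1) xy by (simp add: free.m_assoc flip: pc[OF cm(2) xy(2), of n])
      finally show ?thesis
        using u(1) by (simp add: free.nat_pow_mult add.commute)
    qed
    ultimately show ?thesis
      using u(1) xy by simp
  qed
  obtain g u where gu: "g \<in> carrier ?F" "u \<in> carrier ?F" "cyc_reduced u"
    "w = g \<otimes>\<^bsub>?F\<^esub> u \<otimes>\<^bsub>?F\<^esub> inv\<^bsub>?F\<^esub> g"
    using conj_cyc_reduced[OF S(1)] .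
  have u: "u \<noteq> []"
    using w gu by (auto simp flip: one_free_group[of S])
  define c where "c z = inv\<^bsub>?F\<^esub> g \<otimes>\<^bsub>?F\<^esub> z \<otimes>\<^bsub>?F\<^esub> g" for z
  have c_closed: "c z \<in> carrier ?F" if "z \<in> carrier ?F" for z
    using that gu(1) by (simp add: c_def)
  have c_mult: "c a \<otimes>\<^bsub>?F\<^esub> c b = c (a \<otimes>\<^bsub>?F\<^esub> b)" if "a \<in> carrier ?F" "b \<in> carrier ?F" for a b
    using that gu(1) by (simp add: c_def free.group_simps)
  have cw: "c w = u"
    using gu by (simp add: c_def free.group_simps)
  have "c x \<otimes>\<^bsub>?F\<^esub> c y = c y \<otimes>\<^bsub>?F\<^esub> c x"
    using cyc[OF gu(2,3) u c_closed[OF S(2)] c_closed[OF S(3)]] S comm c_mult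
    by (simp flip: cw)
  then have "c (x \<otimes>\<^bsub>?F\<^esub> y) = c (y \<otimes>\<^bsub>?F\<^esub> x)"
    using S by (simp add: c_mult)
  then show ?thesis
    using S gu(1) by (simp add: c_def)
qed

lemma commuting_lists_prefix:
  assumes "u @ v = v @ u" "u \<noteq> []"
  obtains k r where "v = concat (replicate k u) @ take r u" "r < length u"
  using assms
proof (induction v arbitrary: thesis rule: length_induct)
  case (1 v)
  show ?case
  proof (cases "length v < length u")
    case True
    then have "v = take (length v) u"
      using "1.prems"(2) by (metis append_eq_conv_conj append_take_drop_id less_imp_le_nat take_append
          append_Nil2 diff_is_0_eq take0)
    then show ?thesis
      using "1.prems"(1)[of 0 "length v"] True by simp
  next
    case False
    then obtain v' where v': "v = u @ v'"
      using "1.prems"(2) by (metis append_eq_append_conv_if append_take_drop_id not_less)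
    then have "u @ v' = v' @ u" "length v' < length v"
      using "1.prems" by auto
    then obtain k r where "v' = concat (replicate k u) @ take r u" "r < length u"
      using "1.IH" "1.prems"(3) by blast
    then show ?thesis
      using "1.prems"(1)[of "Suc k" r] v' by simp
  qed
qed

text \<open>Besides a power of \<open>u\<close> there are only finitely many possible remainders.
  Both uses rest on this: primitivity excludes nonempty remainders, and a power of \<open>u\<close>
  in a normal subgroup makes the centralizer finite modulo it.\<close>

lemma centralizer_cyc_reduced:
  assumes u: "u \<in> carrier (free_group S)" "cyc_reduced u" "u \<noteq> []" and v: "v \<in> carrier (free_group S)"
    and comm: "u \<otimes>\<^bsub>free_group S\<^esub> v = v \<otimes>\<^bsub>free_group S\<^esub> u"
  obtains i :: int and r where "v = u [^]\<^bsub>free_group S\<^esub> i \<otimes>\<^bsub>free_group S\<^esub> take r u"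
    "r < length u" "u @ take r u = take r u @ u"
proof -
  let ?F = "free_group S"
  obtain n :: nat where n: "u @ (u [^]\<^bsub>?F\<^esub> n \<otimes>\<^bsub>?F\<^esub> v) = (u [^]\<^bsub>?F\<^esub> n \<otimes>\<^bsub>?F\<^esub> v) @ u"
    using commuting_words[OF u v comm] .
  then obtain k r where kr: "u [^]\<^bsub>?F\<^esub> n \<otimes>\<^bsub>?F\<^esub> v = concat (replicate k u) @ take r u" "r < length u"
    using commuting_lists_prefix[OF n u(3)] by blast
  have r: "take r u \<in> carrier ?F"
    using u(1) by (metis append_take_drop_id carrier_free_group image_mono order.trans reduced_append set_take_subset)
  have "reduced (concat (replicate k u) @ take r u)"
    using u(1) v by (simp flip: kr(1) carrier_free_group[THEN iffD1, THEN conjunct1])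
     (metis carrier_free_group free.m_closed free.nat_pow_closed)
  then have "u [^]\<^bsub>?F\<^esub> k \<otimes>\<^bsub>?F\<^esub> take r u = u [^]\<^bsub>?F\<^esub> n \<otimes>\<^bsub>?F\<^esub> v"
    using kr(1) by (simp add: pow_cyc_reduced[OF u(1,2)] mult_free_group foldr_push_append)
  then have "v = inv\<^bsub>?F\<^esub> (u [^]\<^bsub>?F\<^esub> n) \<otimes>\<^bsub>?F\<^esub> (u [^]\<^bsub>?F\<^esub> k \<otimes>\<^bsub>?F\<^esub> take r u)"
    using u(1) v by (simp add: free.inv_cancel)
  also have "\<dots> = u [^]\<^bsub>?F\<^esub> (int k - int n) \<otimes>\<^bsub>?F\<^esub> take r u"
  proof -
    have "u [^]\<^bsub>?F\<^esub> (int k - int n) = inv\<^bsub>?F\<^esub> (u [^]\<^bsub>?F\<^esub> n) \<otimes>\<^bsub>?F\<^esub> u [^]\<^bsub>?F\<^esub> k"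
      using u(1) free.int_pow_mult[of u S "- int n" "int k"]
      by (simp add: free.int_pow_neg int_pow_int)
    then show ?thesis
      using u(1) r by (simp add: free.m_assoc)
  qed
  finally have v_eq: "v = u [^]\<^bsub>?F\<^esub> (int k - int n) \<otimes>\<^bsub>?F\<^esub> take r u" .
  have "concat (replicate k u) @ u = u @ concat (replicate k u)"
    by (induction k) auto
  then have "u @ take r u = take r u @ u"
    using n kr(1) by (metis append.assoc same_append_eq)
  with that v_eq kr(2) show ?thesis by blast
qed

text \<open>A nonempty remainder that commutes with \<open>u\<close> would be a power of the same
  word \<open>z\<close> as \<open>u\<close>. Primitivity forces \<open>z = u\<close>, but the
  remainder is shorter than \<open>u\<close>.\<close>

lemma centralizer_primitive:
  assumes u: "u \<in> carrier (free_group S)" "cyc_reduced u" "u \<noteq> []" and v: "v \<in> carrier (free_group S)"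
    and comm: "u \<otimes>\<^bsub>free_group S\<^esub> v = v \<otimes>\<^bsub>free_group S\<^esub> u"
    and prim: "\<And>z m. u = concat (replicate m z) \<Longrightarrow> m < 2"
  obtains i :: int where "v = u [^]\<^bsub>free_group S\<^esub> i"
proof -
  obtain i :: int and r where ir: "v = u [^]\<^bsub>free_group S\<^esub> i \<otimes>\<^bsub>free_group S\<^esub> take r u"
    "r < length u" "u @ take r u = take r u @ u"
    using centralizer_cyc_reduced[OF u v comm] .
  have "take r u = []"
  proof (rule ccontr)
    assume ne: "take r u \<noteq> []"
    obtain m n z where z: "concat (replicate m z) = u" "concat (replicate n z) = take r u"
      using comm_append_are_replicate[OF ir(3)] by blast
    have "m < 2" using prim z(1) by metis
    moreover have "m \<noteq> 0" using z(1) u(3) by auto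
    ultimately have "m = 1" by simp
    then have "z = u" using z(1) by simp
    then have "length (take r u) = n * length u"
      by (simp flip: z(2) add: length_concat sum_list_replicate)
    with ir(2) ne show False
      by (cases n) auto
  qed
  then show ?thesis
    using that ir(1) u(1) by (metis free.int_pow_closed free.r_one one_free_group)
qed

section \<open>Subgroups of free groups\<close>

text \<open>The letters act on the set \<open>V\<close> from the right through \<open>\<delta>\<close>. The word \<open>rep x\<close>
  leads from the base point to \<open>x\<close>, and \<open>d\<close> makes the edges that these words use a spanning tree.\<close>

locale schreier =
  fixes S :: "'a set" and V :: "'x set" and \<delta> :: "'x \<Rightarrow> 'a letter \<Rightarrow> 'x" and x0 :: 'x
    and rep :: "'x \<Rightarrow> 'a word" and d :: "'x \<Rightarrow> nat"
  assumes x0: "x0 \<in> V" and rep_x0: "rep x0 = []"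
    and \<delta>_closed: "x \<in> V \<Longrightarrow> fst a \<in> S \<Longrightarrow> \<delta> x a \<in> V"
    and \<delta>_inv: "x \<in> V \<Longrightarrow> fst a \<in> S \<Longrightarrow> \<delta> (\<delta> x a) (inv_letter a) = x"
    and rep_step: "x \<in> V \<Longrightarrow> x \<noteq> x0 \<Longrightarrow> \<exists>y a. y \<in> V \<and> fst a \<in> S \<and> x = \<delta> y a \<and> d y < d x \<and>
      rep x = rep y \<otimes>\<^bsub>free_group S\<^esub> [a]"
begin

abbreviation "F \<equiv> free_group S"

section \<open>The action on vertices and the stabilizer of the base point\<close>

definition act :: "'x \<Rightarrow> 'a word \<Rightarrow> 'x" where
  "act = foldl \<delta>"

lemma act_simps [simp]: "act x [] = x" "act x (a # w) = act (\<delta> x a) w" "act x (u @ v) = act (act x u) v"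
  by (simp_all add: act_def)

lemma act_closed: "x \<in> V \<Longrightarrow> fst ` set w \<subseteq> S \<Longrightarrow> act x w \<in> V"
  by (induction w arbitrary: x) (auto simp: \<delta>_closed)

lemma act_push: "x \<in> V \<Longrightarrow> fst a \<in> S \<Longrightarrow> fst ` set w \<subseteq> S \<Longrightarrow> act x (push a w) = act (\<delta> x a) w"
  by (cases w) (auto simp: \<delta>_inv)

lemma act_mult:
  "x \<in> V \<Longrightarrow> u \<in> carrier F \<Longrightarrow> v \<in> carrier F \<Longrightarrow> act x (u \<otimes>\<^bsub>F\<^esub> v) = act (act x u) v"
proof (induction u arbitrary: x)
  case (Cons a u)
  note u = Cons_in_carrier_free_group[OF Cons.prems(2)]
  have a: "fst a \<in> S" using Cons.prems(2) by (auto simp: free_group_simps)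
  have "fst ` set (u \<otimes>\<^bsub>F\<^esub> v) \<subseteq> S"
    using free.m_closed[OF u(2) Cons.prems(3)] by (simp add: carrier_free_group)
  then show ?case
    using Cons u(2) a by (simp add: mult_free_group act_push \<delta>_closed)
qed (simp add: free_group_simps)

lemma act_carrier_closed: "x \<in> V \<Longrightarrow> w \<in> carrier F \<Longrightarrow> act x w \<in> V"
  by (simp add: act_closed carrier_free_group)

definition stab :: "'a word set" where
  "stab = {w \<in> carrier F. act x0 w = x0}"

lemma subgroup_stab: "subgroup stab F"
proof (rule free.subgroupI)
  show "stab \<noteq> {}" using x0 by (auto simp: stab_def intro!: exI[of _ "[]"] simp: free_group_simps)
  fix u v assume u: "u \<in> stab" and v: "v \<in> stab"
  show "u \<otimes>\<^bsub>F\<^esub> v \<in> stab"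
    using u v x0 by (simp add: stab_def act_mult)
  have "act x0 (u \<otimes>\<^bsub>F\<^esub> inv\<^bsub>F\<^esub> u) = act x0 (inv\<^bsub>F\<^esub> u)"
    using u x0 act_mult[of x0 u "inv\<^bsub>F\<^esub> u"] by (simp add: stab_def)
  then show "inv\<^bsub>F\<^esub> u \<in> stab"
    using u by (simp add: stab_def one_free_group)
qed (auto simp: stab_def)

lemma rep_induct [consumes 1, case_names base step]:
  assumes "x \<in> V" "P x0"
    and "\<And>y a. y \<in> V \<Longrightarrow> fst a \<in> S \<Longrightarrow> P y \<Longrightarrow> rep (\<delta> y a) = rep y \<otimes>\<^bsub>F\<^esub> [a] \<Longrightarrow> P (\<delta> y a)"
  shows "P x"
  using assms(1)
proof (induction x rule: measure_induct_rule[of d])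
  case (less x)
  then show ?case
    using assms(2,3) rep_step[of x] by (cases "x = x0") auto
qed

lemma rep_closed: "x \<in> V \<Longrightarrow> rep x \<in> carrier F"
  by (induction x rule: rep_induct)
    (simp_all add: rep_x0 free_letter, simp add: free_group_simps)

lemma act_rep: "x \<in> V \<Longrightarrow> act x0 (rep x) = x"
  by (induction x rule: rep_induct) (simp_all add: rep_x0 act_mult x0 rep_closed free_letter)

text \<open>The Schreier generator of the edge from \<open>x\<close> with label \<open>s\<close>: go
  to \<open>x\<close> through the tree, cross the edge, and return through the tree.\<close>

definition gen :: "'x \<times> 'a \<Rightarrow> 'a word" where
  "gen = (\<lambda>(x, s). rep x \<otimes>\<^bsub>F\<^esub> [(s, True)] \<otimes>\<^bsub>F\<^esub> inv\<^bsub>F\<^esub> rep (\<delta> x (s, True)))"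

text \<open>Edges with trivial generator, among them all tree edges, contribute nothing; the
  remaining edges index a basis of the stabilizer.\<close>

definition B :: "('x \<times> 'a) set" where
  "B = {e \<in> V \<times> S. gen e \<noteq> \<one>\<^bsub>F\<^esub>}"

abbreviation "E \<equiv> free_group B"

lemma gen_stab: "e \<in> V \<times> S \<Longrightarrow> gen e \<in> stab"
proof -
  assume "e \<in> V \<times> S"
  then obtain x s where e: "e = (x, s)" "x \<in> V" "s \<in> S" by auto
  define y where "y = \<delta> x (s, True)"
  have y: "y \<in> V" using e \<delta>_closed[of x "(s, True)"] by (simp add: y_def)
  have l: "[(s, True)] \<in> carrier F" using e by (simp add: free_letter)
  have "act x0 (rep x \<otimes>\<^bsub>F\<^esub> [(s, True)]) = y"
    using e l by (simp add: act_mult x0 rep_closed act_rep y_def)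
  moreover have "act y (inv\<^bsub>F\<^esub> rep y) = x0"
    using y act_mult[of x0 "rep y" "inv\<^bsub>F\<^esub> rep y"] x0
    by (simp add: rep_closed act_rep one_free_group)
  ultimately show ?thesis
    using e y l by (simp add: stab_def gen_def act_mult x0 rep_closed flip: y_def)
qed

text \<open>\<open>rho x w\<close> spells the path with label \<open>w\<close> that starts in \<open>x\<close> through the edges
  outside the spanning tree.\<close>

definition rho1 :: "'x \<Rightarrow> 'a letter \<Rightarrow> ('x \<times> 'a) word" where
  "rho1 x a = (let e = (if snd a then x else \<delta> x a, fst a) in if e \<in> B then [(e, snd a)] else [])"

primrec rho :: "'x \<Rightarrow> 'a word \<Rightarrow> ('x \<times> 'a) word" where
  "rho x [] = []"
| "rho x (a # w) = foldr push (rho1 x a) (rho (\<delta> x a) w)"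

lemma rho1_closed: "rho1 x a \<in> carrier E"
  by (auto simp: rho1_def Let_def free_group_simps reduced_def)

lemma rho_closed: "rho x w \<in> carrier E"
proof (induction w arbitrary: x)
  case (Cons a w)
  then show ?case
    using free.m_closed[OF rho1_closed Cons] by (simp add: mult_free_group)
qed (simp add: free_group_simps)

lemma rho_Cons: "rho x (a # w) = rho1 x a \<otimes>\<^bsub>E\<^esub> rho (\<delta> x a) w"
  by (simp add: mult_free_group)

text \<open>A letter and its inverse cross the same edge in opposite directions. This makes
  \<open>rho\<close> compatible with free cancellation.\<close>

lemma rho1_inv: "x \<in> V \<Longrightarrow> fst a \<in> S \<Longrightarrow> rho1 x a \<otimes>\<^bsub>E\<^esub> rho1 (\<delta> x a) (inv_letter a) = \<one>\<^bsub>E\<^esub>"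
  using \<delta>_inv[of x a]
  by (cases a) (auto simp: rho1_def Let_def inv_letter_def free_group_simps)

lemma rho_append: "rho x (u @ v) = rho x u \<otimes>\<^bsub>E\<^esub> rho (act x u) v"
proof (induction u arbitrary: x)
  case Nil
  then show ?case
    using free.l_one[OF rho_closed] by (simp add: one_free_group)
next
  case (Cons a u)
  then show ?case
    by (simp add: rho_Cons free.m_assoc rho1_closed rho_closed del: rho.simps)
qed

lemma rho_push:
  "x \<in> V \<Longrightarrow> fst a \<in> S \<Longrightarrow> fst ` set w \<subseteq> S \<Longrightarrow>
    rho x (push a w) = rho1 x a \<otimes>\<^bsub>E\<^esub> rho (\<delta> x a) w"
proof (cases w)
  case (Cons b v)
  assume *: "x \<in> V" "fst a \<in> S" "fst ` set w \<subseteq> S"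
  show ?thesis
  proof (cases "b = inv_letter a")
    case True
    then have "rho1 x a \<otimes>\<^bsub>E\<^esub> rho (\<delta> x a) w =
        (rho1 x a \<otimes>\<^bsub>E\<^esub> rho1 (\<delta> x a) (inv_letter a)) \<otimes>\<^bsub>E\<^esub> rho x v"
      using * Cons by (simp add: rho_Cons free.m_assoc rho1_closed rho_closed \<delta>_inv del: rho.simps)
    then show ?thesis
      using * Cons True by (simp add: rho1_inv rho_closed)
  qed (simp add: Cons rho_Cons del: rho.simps)
qed (simp add: mult_free_group)

lemma rho_mult:
  "x \<in> V \<Longrightarrow> u \<in> carrier F \<Longrightarrow> v \<in> carrier F \<Longrightarrow>
    rho x (u \<otimes>\<^bsub>F\<^esub> v) = rho x u \<otimes>\<^bsub>E\<^esub> rho (act x u) v"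
proof (induction u arbitrary: x)
  case Nil
  then show ?case
    using free.l_one[OF rho_closed] by (simp add: free_group_simps)
next
  case (Cons a u)
  note u = Cons_in_carrier_free_group[OF Cons.prems(2)]
  have a: "fst a \<in> S" using Cons.prems(2) by (auto simp: free_group_simps)
  have "fst ` set (u \<otimes>\<^bsub>F\<^esub> v) \<subseteq> S"
    using free.m_closed[OF u(2) Cons.prems(3)] by (simp add: carrier_free_group)
  then have "rho x ((a # u) \<otimes>\<^bsub>F\<^esub> v) = rho1 x a \<otimes>\<^bsub>E\<^esub> rho (\<delta> x a) (u \<otimes>\<^bsub>F\<^esub> v)"
    using rho_push[OF Cons.prems(1) a, of "u \<otimes>\<^bsub>F\<^esub> v"] by (simp add: mult_free_group)
  then show ?case
    using Cons u(2) a
    by (simp add: \<delta>_closed rho_Cons free.m_assoc rho1_closed rho_closed del: rho.simps)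
qed

lemma rho_inv: "x \<in> V \<Longrightarrow> w \<in> carrier F \<Longrightarrow> rho (act x w) (inv\<^bsub>F\<^esub> w) = inv\<^bsub>E\<^esub> rho x w"
proof -
  assume xw: "x \<in> V" "w \<in> carrier F"
  then have "rho x w \<otimes>\<^bsub>E\<^esub> rho (act x w) (inv\<^bsub>F\<^esub> w) = \<one>\<^bsub>E\<^esub>"
    using rho_mult[of x w "inv\<^bsub>F\<^esub> w"] by (simp add: one_free_group)
  then show ?thesis
    using free.inv_comm[OF _ rho_closed rho_closed] free.inv_equality[OF _ rho_closed rho_closed]
    by metis
qed

text \<open>Each step of a tree path crosses an edge with trivial generator, forwards or backwards
  according to the sign of the letter, and such edges are not in \<open>B\<close>.\<close>

lemma rho_rep: "x \<in> V \<Longrightarrow> rho x0 (rep x) = \<one>\<^bsub>E\<^esub>"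
proof (induction x rule: rep_induct)
  case (step y a)
  have l: "[a] \<in> carrier F" using step by (simp add: free_letter)
  have inv: "rep y = rep (\<delta> y a) \<otimes>\<^bsub>F\<^esub> inv\<^bsub>F\<^esub> [a]"
    using step l rep_closed[of y] by (simp add: free.m_assoc)
  have "rho1 y a = []"
  proof (cases a)
    case (Pair s e)
    have s: "s \<in> S" using step Pair by simp
    show ?thesis
    proof (cases e)
      case True
      then have "gen (y, s) = \<one>\<^bsub>F\<^esub>"
        using step Pair l rep_closed[of y] by (simp add: gen_def)
      then show ?thesis
        using True Pair by (simp add: rho1_def B_def Let_def)
    next
      case False
      have "\<delta> (\<delta> y a) (s, True) = y"
        using \<delta>_inv[OF step(1,2)] Pair False by (simp add: inv_letter_def)
      moreover have "inv\<^bsub>F\<^esub> [a] = [(s, True)]"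
        using s Pair False by (simp add: inv_free_letter)
      ultimately have "gen (\<delta> y a, s) = \<one>\<^bsub>F\<^esub>"
        using rep_closed[of y] step(1) arg_cong[OF inv, of "\<lambda>w. w \<otimes>\<^bsub>F\<^esub> inv\<^bsub>F\<^esub> rep y"]
        by (simp add: gen_def)
      then show ?thesis
        using False Pair by (simp add: rho1_def B_def Let_def)
    qed
  qed
  then have "rho y [a] = \<one>\<^bsub>E\<^esub>" by (simp add: one_free_group)
  then show ?case
    using step l by (simp add: rho_mult x0 rep_closed act_rep del: rho.simps)
qed (simp add: rep_x0 one_free_group)

definition sigma :: "('x \<times> 'a) word \<Rightarrow> 'a word" where
  "sigma = free_lift F gen"

lemma gen_closed: "gen \<in> B \<rightarrow> carrier F"
  using gen_stab by (auto simp: B_def stab_def)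

lemma sigma_hom: "sigma \<in> hom E F"
  unfolding sigma_def by (rule free.free_lift_hom[OF gen_closed])

text \<open>Every letter contributes itself between the tree word of its start and the inverse of
  that of its end; along a path the inner tree words telescope.\<close>

lemma sigma_rho:
  "x \<in> V \<Longrightarrow> w \<in> carrier F \<Longrightarrow> sigma (rho x w) = rep x \<otimes>\<^bsub>F\<^esub> w \<otimes>\<^bsub>F\<^esub> inv\<^bsub>F\<^esub> rep (act x w)"
proof (induction w arbitrary: x)
  case Nil
  then show ?case
    using rep_closed[of x] by (simp add: sigma_def) (simp flip: one_free_group[of S])
next
  case (Cons a w)
  note w = Cons_in_carrier_free_group[OF Cons.prems(2)]
  have a: "fst a \<in> S" using Cons.prems(2) by (auto simp: free_group_simps)
  let ?y = "\<delta> x a"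
  have y: "?y \<in> V" using Cons.prems a by (simp add: \<delta>_closed)
  have "sigma (rho1 x a) = rep x \<otimes>\<^bsub>F\<^esub> [a] \<otimes>\<^bsub>F\<^esub> inv\<^bsub>F\<^esub> rep ?y"
  proof (cases a)
    case (Pair s e)
    have s: "s \<in> S" using a Pair by simp
    show ?thesis
    proof (cases e)
      case True
      then show ?thesis
        using Pair s Cons.prems(1) rep_closed y free_letter[of "(s, True)" S]
        by (auto simp: rho1_def Let_def sigma_def B_def gen_def)
    next
      case False
      have eq: "\<delta> ?y (s, True) = x"
        using \<delta>_inv[OF Cons.prems(1) a] Pair False by (simp add: inv_letter_def)
      have "inv\<^bsub>F\<^esub> gen (?y, s) = rep x \<otimes>\<^bsub>F\<^esub> inv\<^bsub>F\<^esub> [(s, True)] \<otimes>\<^bsub>F\<^esub> inv\<^bsub>F\<^esub> rep ?y"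
        using eq rep_closed y Cons.prems(1) free_letter[of "(s, True)" S] s
        by (simp add: gen_def free.group_simps)
      then have "inv\<^bsub>F\<^esub> gen (?y, s) = rep x \<otimes>\<^bsub>F\<^esub> [a] \<otimes>\<^bsub>F\<^esub> inv\<^bsub>F\<^esub> rep ?y"
        using Pair False s by (simp add: inv_free_letter)
      moreover have "gen (?y, s) \<in> carrier F"
        using gen_stab[of "(?y, s)"] y s by (simp add: stab_def)
      ultimately show ?thesis
        using Pair False s y rep_closed[OF y] rep_closed[OF Cons.prems(1)] free_letter[OF a]
        by (auto simp: rho1_def Let_def sigma_def B_def)
    qed
  qed
  moreover have "sigma (rho x (a # w)) = sigma (rho1 x a) \<otimes>\<^bsub>F\<^esub> sigma (rho ?y w)"
    using hom_mult[OF sigma_hom rho1_closed rho_closed] by (simp only: rho_Cons)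
  moreover have "sigma (rho ?y w) = rep ?y \<otimes>\<^bsub>F\<^esub> w \<otimes>\<^bsub>F\<^esub> inv\<^bsub>F\<^esub> rep (act ?y w)"
    using Cons.IH[OF y w(2)] .
  ultimately have "sigma (rho x (a # w)) =
      rep x \<otimes>\<^bsub>F\<^esub> ([a] \<otimes>\<^bsub>F\<^esub> w) \<otimes>\<^bsub>F\<^esub> inv\<^bsub>F\<^esub> rep (act ?y w)"
    using w(1,2) rep_closed y Cons.prems(1) act_carrier_closed[OF y w(2)]
    by (simp add: free.group_simps)
  then show ?case
    by (simp only: act_simps flip: w(3))
qed

lemma rho_hom: "rho x0 \<in> hom (F\<lparr>carrier := stab\<rparr>) E"
  using x0 by (auto simp: hom_def rho_closed stab_def rho_mult)

text \<open>This is the Reidemeister-Schreier rewriting: \<open>rho x0\<close> and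
  \<open>sigma\<close> are inverse to each other. On the stabilizer this is the telescoping formula
  with empty tree words at both ends; on the other side it suffices to rewrite one generator, whose
  tree parts vanish.\<close>

lemma rho_iso: "rho x0 \<in> iso (F\<lparr>carrier := stab\<rparr>) E"
proof -
  have inj: "sigma (rho x0 w) = w" if "w \<in> stab" for w
    using that x0 sigma_rho[of x0 w] rep_x0
    by (simp add: stab_def) (simp flip: one_free_group[of S])
  interpret st: subgroup stab F by (rule subgroup_stab)
  interpret sg: group_hom E F sigma
    using sigma_hom by (simp add: group_hom_def group_hom_axioms_def)
  have sgen: "sigma [(e, True)] = gen e" if "e \<in> B" for e
    using that gen_closed by (auto simp: sigma_def Pi_iff)
  have sigma_stab: "sigma w \<in> stab" if "w \<in> carrier E" for w
  proof -
    have "{w \<in> carrier E. sigma w \<in> stab} = carrier E"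
    proof (rule free_group_subgroup_eq)
      show "subgroup {w \<in> carrier E. sigma w \<in> stab} E"
        by (rule free.subgroupI) (auto intro!: exI[of _ "\<one>\<^bsub>E\<^esub>"])
    qed (auto simp: sgen free_letter gen_stab B_def)
    with that show ?thesis by blast
  qed
  have sigma_hom': "sigma \<in> hom E (F\<lparr>carrier := stab\<rparr>)"
    using sigma_hom sigma_stab by (auto simp: hom_def)
  have "rho x0 (sigma w) = w" if "w \<in> carrier E" for w
  proof (rule free_hom_eq[OF free.is_group _ _ _ that, of "\<lambda>w. rho x0 (sigma w)" B "\<lambda>w. w"])
    show "(\<lambda>w. rho x0 (sigma w)) \<in> hom E E"
      using Group.hom_compose[OF sigma_hom' rho_hom] by (simp add: comp_def)
    show "(\<lambda>w. w) \<in> hom E E" by (simp add: hom_def)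
    fix e assume e: "e \<in> B"
    then obtain x s where xs: "e = (x, s)" "x \<in> V" "s \<in> S" by (auto simp: B_def)
    let ?y = "\<delta> x (s, True)"
    have y: "?y \<in> V" using xs \<delta>_closed[of x "(s, True)"] by simp
    have l: "[(s, True)] \<in> carrier F" using xs by (simp add: free_letter)
    have "rho x0 (gen e) = rho x0 (rep x \<otimes>\<^bsub>F\<^esub> [(s, True)]) \<otimes>\<^bsub>E\<^esub> rho ?y (inv\<^bsub>F\<^esub> rep ?y)"
      using xs y l x0 rep_closed by (simp add: gen_def rho_mult act_mult act_rep)
    also have "rho ?y (inv\<^bsub>F\<^esub> rep ?y) = \<one>\<^bsub>E\<^esub>"
      using rho_inv[OF x0 rep_closed[OF y]] y by (simp add: act_rep rho_rep)
    also have "rho x0 (rep x \<otimes>\<^bsub>F\<^esub> [(s, True)]) = rho x [(s, True)]"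
      using xs l x0 by (simp add: rho_mult rep_closed act_rep rho_rep rho_closed del: rho.simps)
    also have "\<dots> = [(e, True)]"
      using xs e by (simp add: rho1_def)
    finally have "rho x0 (gen e) = [(e, True)]"
      using free_letter[of "(e, True)" B] e by simp
    then show "rho x0 (sigma [(e, True)]) = [(e, True)]"
      using e by (simp add: sgen)
  qed
  then have "rho x0 ` stab = carrier E"
    using sigma_stab rho_closed by (auto simp: image_iff) (metis)
  moreover have "inj_on (rho x0) stab"
    by (rule inj_on_inverseI[of _ sigma]) (rule inj)
  ultimately show ?thesis
    using rho_hom by (simp add: iso_iff)
qed

lemma length_rho: "length (rho x w) \<le> length w"
proof (induction w arbitrary: x)
  case (Cons a w)
  have "length (rho x (a # w)) \<le> length (rho1 x a) + length (rho (\<delta> x a) w)"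
    by (simp add: length_foldr_push)
  also have "\<dots> \<le> 1 + length w"
    using Cons by (intro add_mono) (auto simp: rho1_def Let_def)
  finally show ?case by simp
qed simp

text \<open>The strict decrease that drives the induction for conjugacy separability: one crossing
  of an edge outside \<open>B\<close> shortens the rewritten word.\<close>

lemma length_rho_less:
  assumes "rho1 (act x u) a = []"
  shows "length (rho x (u @ a # v)) < length (u @ a # v)"
proof -
  have "rho x (u @ a # v) = rho x u \<otimes>\<^bsub>E\<^esub> rho (\<delta> (act x u) a) v"
    using assms by (simp add: rho_append)
  then have "length (rho x (u @ a # v)) \<le> length (rho x u) + length (rho (\<delta> (act x u) a) v)"
    using length_foldr_push by (metis mult_free_group)
  also have "\<dots> \<le> length u + length v"
    by (intro add_mono length_rho)
  finally show ?thesis by simp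
qed

end

text \<open>The graph is the action on the right cosets of \<open>J\<close>. Deleting the last
  letter of a shortest word in a coset leads to a coset with a shorter one, so choosing such a
  parent for every coset gives a spanning tree rooted at \<open>J\<close>.\<close>

theorem nielsen_schreier:
  fixes J :: "'a word set"
  assumes "subgroup J (free_group S)"
  shows "is_free_group ((free_group S)\<lparr>carrier := J\<rparr>)"
proof -
  interpret J: subgroup J "free_group S" by fact
  define V where "V = rcosets\<^bsub>free_group S\<^esub> J"
  define \<delta> where "\<delta> c a = c #>\<^bsub>free_group S\<^esub> [a]" for c and a :: "'a letter"
  define len where "len c = (LEAST n. \<exists>w\<in>c. length w = n)" for c :: "'a word set"
  have V: "c \<in> V \<longleftrightarrow> (\<exists>w\<in>carrier (free_group S). c = J #>\<^bsub>free_group S\<^esub> w)" for c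
    by (auto simp: V_def RCOSETS_def)
  have \<delta>_rcoset: "\<delta> (J #>\<^bsub>free_group S\<^esub> w) a = J #>\<^bsub>free_group S\<^esub> (w \<otimes>\<^bsub>free_group S\<^esub> [a])"
    if "w \<in> carrier (free_group S)" "fst a \<in> S" for w a
    using that by (simp add: \<delta>_def free.coset_mult_assoc J.subset free_letter)
  have J_V: "J \<in> V"
    unfolding V_def by (rule J.subgroup_in_rcosets) (rule free.is_group)
  have parent: "\<exists>y a. y \<in> V \<and> fst a \<in> S \<and> c = \<delta> y a \<and> len y < len c" if c: "c \<in> V" "c \<noteq> J" for c
  proof -
    obtain w0 where w0: "w0 \<in> carrier (free_group S)" "c = J #>\<^bsub>free_group S\<^esub> w0"
      using c V by blast
    then have "w0 \<in> c" using free.rcos_self[OF w0(1) assms] by simp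
    then have "\<exists>n. \<exists>w\<in>c. length w = n" by blast
    then obtain w where w: "w \<in> c" "length w = len c"
      using LeastI_ex[of "\<lambda>n. \<exists>w\<in>c. length w = n"] by (auto simp: len_def)
    have wS: "w \<in> carrier (free_group S)"
      using w(1) w0 free.r_coset_subset_G[OF J.subset] by blast
    have cw: "c = J #>\<^bsub>free_group S\<^esub> w"
      using w(1) w0 free.repr_independence[OF _ w0(1) assms] by blast
    have "w \<noteq> []"
    proof
      assume "w = []"
      then have "c = J #>\<^bsub>free_group S\<^esub> \<one>\<^bsub>free_group S\<^esub>" using cw by (simp add: one_free_group)
      then show False using c J.subset by simp
    qed
    then obtain v a where va: "w = v @ [a]" by (metis rev_exhaust)
    have v: "v \<in> carrier (free_group S)" and a: "fst a \<in> S"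
      using wS va by (auto simp: carrier_free_group reduced_append)
    have "w = v \<otimes>\<^bsub>free_group S\<^esub> [a]"
      using wS va by (simp add: free_group_simps foldr_push_append)
    then have "c = \<delta> (J #>\<^bsub>free_group S\<^esub> v) a"
      using cw \<delta>_rcoset[OF v a] by simp
    moreover have "len (J #>\<^bsub>free_group S\<^esub> v) \<le> length v"
      unfolding len_def using free.rcos_self[OF v assms] by (intro Least_le) blast
    ultimately show ?thesis
      using V v a va w(2) by (intro exI[of _ "J #>\<^bsub>free_group S\<^esub> v"] exI[of _ a]) auto
  qed
  then obtain py pa where p: "\<And>c. c \<in> V \<Longrightarrow> c \<noteq> J \<Longrightarrow>
      py c \<in> V \<and> fst (pa c) \<in> S \<and> c = \<delta> (py c) (pa c) \<and> len (py c) < len c"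
    by metis
  \<comment> \<open>The tree word of \<open>c\<close> is defined by recursion on a bound for its
    distance from \<open>J\<close>; all bounds from \<open>len c\<close> on give the same
    word.\<close>
  define R where "R = rec_nat (\<lambda>c. []) (\<lambda>n r c. if c = J then [] else r (py c) \<otimes>\<^bsub>free_group S\<^esub> [pa c])"
  have R: "R 0 c = []" "R (Suc n) c = (if c = J then [] else R n (py c) \<otimes>\<^bsub>free_group S\<^esub> [pa c])" for n c
    by (simp_all add: R_def)
  have R_stable: "R n c = R (len c) c" if "c \<in> V" "len c \<le> n" for n c
    using that
  proof (induction n arbitrary: c rule: less_induct)
    case (less n)
    show ?case
    proof (cases "c = J")
      case True
      have "R m J = []" for m by (cases m) (simp_all add: R)
      with True show ?thesis by simp
    next
      case False
      note pc = p[OF less.prems(1) False]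
      obtain m l where ml: "n = Suc m" "len c = Suc l"
        using pc less.prems(2) by (metis Suc_le_D not_less_zero old.nat.exhaust)
      have "R m (py c) = R (len (py c)) (py c)"
        using less.IH[of m "py c"] pc ml less.prems(2) by simp
      moreover have "R l (py c) = R (len (py c)) (py c)"
        using less.IH[of l "py c"] pc ml less.prems(2) by simp
      ultimately show ?thesis
        using ml False by (simp add: R)
    qed
  qed
  interpret schreier S V \<delta> J "\<lambda>c. R (len c) c" len
  proof
    show "R (len J) J = []" by (cases "len J") (simp_all add: R)
    fix c and a :: "'a letter" assume c: "c \<in> V" and a: "fst a \<in> S"
    then obtain w where w: "w \<in> carrier (free_group S)" "c = J #>\<^bsub>free_group S\<^esub> w"
      using V by blast
    then show "\<delta> c a \<in> V"
      using V a \<delta>_rcoset free.m_closed[OF w(1) free_letter[OF a]] by blast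
    have "[inv_letter a] = inv\<^bsub>free_group S\<^esub> [a]"
      using a by (simp add: inv_free_group free_letter)
    then show "\<delta> (\<delta> c a) (inv_letter a) = c"
      using w a by (simp add: \<delta>_rcoset free_letter free.m_assoc)
  next
    fix c assume c: "c \<in> V" "c \<noteq> J"
    note pc = p[OF c]
    obtain l where l: "len c = Suc l" using pc by (metis not_less_zero old.nat.exhaust)
    have "R (len c) c = R (len (py c)) (py c) \<otimes>\<^bsub>free_group S\<^esub> [pa c]"
      using R_stable[of "py c" l] pc l c by (simp add: R)
    then show "\<exists>y a. y \<in> V \<and> fst a \<in> S \<and> c = \<delta> y a \<and> len y < len c \<and>
        R (len c) c = R (len y) y \<otimes>\<^bsub>free_group S\<^esub> [a]"
      using pc by blast
  qed (rule J_V)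
  have act: "act J w = J #>\<^bsub>free_group S\<^esub> w" if "w \<in> carrier (free_group S)" for w
    using that
  proof (induction w rule: rev_induct)
    case Nil
    then show ?case
      using free.coset_mult_one[OF J.subset] by (simp add: one_free_group)
  next
    case (snoc a w)
    have w: "w \<in> carrier (free_group S)" "fst a \<in> S"
      using snoc.prems by (auto simp: carrier_free_group reduced_append)
    have "w \<otimes>\<^bsub>free_group S\<^esub> [a] = w @ [a]"
      using snoc.prems by (simp add: free_group_simps foldr_push_append)
    then show ?case
      using snoc.IH w \<delta>_rcoset[OF w] by simp
  qed
  have "stab = J"
  proof (intro subset_antisym subsetI)
    fix w assume "w \<in> stab"
    then show "w \<in> J"
      using free.coset_join1[OF _ _ assms, of w] act[of w] by (auto simp: stab_def)
  next
    fix w assume "w \<in> J"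
    then show "w \<in> stab"
      using free.coset_join2[OF _ assms, of w] act[of w] by (auto simp: stab_def)
  qed
  then have "(free_group S)\<lparr>carrier := J\<rparr> \<cong> free_group B"
    using is_isoI[OF rho_iso] by simp
  then show ?thesis
    by (rule is_free_groupI[OF J.subgroup_is_group[OF free.is_group]])
qed

section \<open>Conjugacy \<open>p\<close>-separability of free groups\<close>

lemma normal_weight: "{w \<in> carrier (free_group S). m dvd weight f w} \<lhd> free_group S"
  by (rule free.normal_invI, rule free.subgroupI)
    (auto simp: weight_mult weight_inv intro!: exI[of _ "\<one>\<^bsub>free_group S\<^esub>"], simp add: one_free_group)

lemma p_normal_weight:
  assumes "Factorial_Ring.prime p"
  shows "p_normal p (free_group S) {w \<in> carrier (free_group S). int p ^ k dvd weight f w}"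
    (is "p_normal p ?F ?K")
proof -
  have pos: "int p ^ k > 0"
    using assms prime_gt_0_nat by simp
  have "finite (rcosets\<^bsub>?F\<^esub> ?K)"
  proof (rule free.finite_rcosetsI[OF normal_imp_subgroup[OF normal_weight]])
    have "(\<lambda>w. weight f w mod int p ^ k) ` carrier ?F \<subseteq> {0..<int p ^ k}"
      using pos by auto
    then show "finite ((\<lambda>w. weight f w mod int p ^ k) ` carrier ?F)"
      using finite_subset by blast
  qed (auto simp: weight_mult weight_inv mod_eq_dvd_iff)
  moreover have "x [^]\<^bsub>?F\<^esub> (p ^ k :: nat) \<in> ?K" if "x \<in> carrier ?F" for x
    using that by (simp add: weight_pow)
  ultimately show ?thesis
    unfolding p_normal_def using normal_weight by blast
qed

lemma reduced_single_letter:
  assumes "reduced w" "fst ` set w \<subseteq> {s}"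
  obtains n e where "w = replicate n (s, e)"
  using assms
proof (induction w arbitrary: thesis)
  case (Cons a w)
  obtain n e where w: "w = replicate n (s, e)"
    using Cons.IH Cons.prems reduced_ConsD[of a w] by auto
  obtain e' where a: "a = (s, e')"
    using Cons.prems(3) by (cases a) auto
  show ?case
  proof (cases n)
    case (Suc k)
    then have "e = e'"
      using Cons.prems(2) w a by (auto simp: reduced_def inv_letter_def)
    then show ?thesis
      using Cons.prems(1)[of "Suc n" e] w a by simp
  qed (use Cons.prems(1)[of 1 e'] w a in simp)
qed simp

lemma weight_replicate: "weight f (replicate n (s, e)) = (if e then int n else - int n) * f s"
  by (induction n) (auto simp: algebra_simps)

lemma weight_two_letters:
  assumes "s \<noteq> t"
  shows "weight (\<lambda>x. if x = t then 1 else if x = s then c else 0) w =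
    c * weight (\<lambda>x. if x = s then 1 else 0) w + weight (\<lambda>x. if x = t then 1 else 0) w"
  using assms by (induction w) (auto simp: algebra_simps)

text \<open>The cyclic cover: the action of \<open>free_group S\<close> on the residues modulo \<open>m\<close> by translation
  with the weight, where the powers of \<open>s0\<close> form the spanning tree.\<close>

locale cyclic_cover =
  fixes S :: "'a set" and s0 :: 'a and f :: "'a \<Rightarrow> int" and m :: nat
  assumes s0: "s0 \<in> S" "f s0 = 1" and m: "m > 0"
begin

definition \<delta> :: "int \<Rightarrow> 'a letter \<Rightarrow> int" where
  "\<delta> i a = (i + weight f [a]) mod int m"

definition rep :: "int \<Rightarrow> 'a word" where
  "rep i = replicate (nat i) (s0, True)"

lemma rep_closed': "rep i \<in> carrier (free_group S)"
  using s0(1) by (auto simp: rep_def carrier_free_group reduced_def successively_conv_nth)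

lemma rep_Suc: "i \<ge> 0 \<Longrightarrow> rep (i + 1) = rep i \<otimes>\<^bsub>free_group S\<^esub> [(s0, True)]"
proof -
  assume "i \<ge> 0"
  then have "rep (i + 1) = rep i @ [(s0, True)]"
    by (simp add: rep_def nat_add_distrib replicate_append_same)
  with rep_closed'[of "i + 1"] show ?thesis
    by (simp add: free_group_simps foldr_push_append)
qed

sublocale schreier S "{0..<int m}" \<delta> 0 rep nat
proof
  fix i assume i: "i \<in> {0..<int m}" "i \<noteq> 0"
  then have "i = \<delta> (i - 1) (s0, True)"
    by (simp add: \<delta>_def s0)
  moreover have "rep i = rep (i - 1) \<otimes>\<^bsub>free_group S\<^esub> [(s0, True)]"
    using i rep_Suc[of "i - 1"] by simp
  ultimately show "\<exists>y a. y \<in> {0..<int m} \<and> fst a \<in> S \<and> i = \<delta> y a \<and> nat y < nat i \<and>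
      rep i = rep y \<otimes>\<^bsub>free_group S\<^esub> [a]"
    using i s0 by (intro exI[of _ "i - 1"] exI[of _ "(s0, True)"]) auto
qed (use m in \<open>auto simp: rep_def \<delta>_def inv_letter_def mod_simps\<close>)

lemma act_eq: "i \<in> {0..<int m} \<Longrightarrow> act i w = (i + weight f w) mod int m"
proof (induction w arbitrary: i)
  case (Cons a w)
  have "\<delta> i a \<in> {0..<int m}"
    using m by (simp add: \<delta>_def del: weight_simps)
  then have "act i (a # w) = (\<delta> i a + weight f w) mod int m"
    using Cons.IH by simp
  also have "\<dots> = (i + weight f (a # w)) mod int m"
    by (simp add: \<delta>_def mod_simps add.assoc)
  finally show ?case .
qed simp

lemma stab_eq: "stab = {w \<in> carrier (free_group S). int m dvd weight f w}"
  using m by (auto simp: stab_def act_eq dvd_eq_mod_eq_0)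

lemma rho1_tree: "i \<ge> 0 \<Longrightarrow> i + 1 < int m \<Longrightarrow> rho1 i (s0, True) = []"
proof -
  assume i: "i \<ge> 0" "i + 1 < int m"
  have "gen (i, s0) = \<one>\<^bsub>free_group S\<^esub>"
    using i rep_Suc[OF i(1)] rep_closed'[of "i + 1"] by (simp add: gen_def \<delta>_def s0)
  then show ?thesis
    by (simp add: rho1_def B_def)
qed

lemma rho1_tree_inv: "i > 0 \<Longrightarrow> i < int m \<Longrightarrow> rho1 i (s0, False) = []"
proof -
  assume i: "i > 0" "i < int m"
  have "gen (i - 1, s0) = \<one>\<^bsub>free_group S\<^esub>"
    using i rep_Suc[of "i - 1"] rep_closed'[of i] by (simp add: gen_def \<delta>_def s0)
  then show ?thesis
    using i by (simp add: rho1_def B_def \<delta>_def s0)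
qed

text \<open>Conjugation by \<open>rep i\<close> moves the base point: the tree parts rewrite to the
  identity and what is left is \<open>w\<close> read from the vertex \<open>i\<close>. So this
  conjugation does not make the rewritten word longer than \<open>w\<close>.\<close>

lemma rho_conj_rep:
  assumes "i \<in> {0..<int m}" "w \<in> stab"
  shows "rho 0 (rep i \<otimes>\<^bsub>F\<^esub> w \<otimes>\<^bsub>F\<^esub> inv\<^bsub>F\<^esub> rep i) = rho i w"
proof -
  have w: "w \<in> carrier F" "act i w = i"
    using assms m by (auto simp: stab_eq act_eq mod_simps)
  have "act 0 (rep i) = i"
    by (rule act_rep[OF assms(1)])
  then show ?thesis
    using w assms(1) m rho_inv[of 0 "rep i"] rep_closed'
    by (simp add: rho_mult act_mult rho_rep rho_closed)
qed

end

text \<open>The induction is on the total length and leaves \<open>S\<close> arbitrary, since the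
  kernel has a different basis. Different exponent sums are separated in a cyclic quotient.
  Otherwise some weight is divisible by \<open>p\<close> on both words and equals 1 on a letter
  \<open>s0\<close> that occurs; with \<open>s0\<close> as tree label, an occurrence of it can be
  made to disappear.\<close>

theorem free_group_conj_separated:
  fixes S :: "nat set"
  assumes p: "Factorial_Ring.prime p"
    and "u \<in> carrier (free_group S)" "v \<in> carrier (free_group S)"
    and "\<not> conjugate_in (free_group S) u v"
  shows "conj_separated p (free_group S) u v"
  using assms(2-)
proof (induction "length u + length v" arbitrary: S u v rule: less_induct)
  case less
  let ?F = "free_group S"
  text \<open>In the kernel of the weight modulo \<open>p\<close>, a suitable conjugate of \<open>x\<close> is shorter than \<open>x\<close>,
    while no conjugate of \<open>y\<close> by an element of the transversal is longer than \<open>y\<close>.\<close>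
  have step: "conj_separated p ?F x y"
    if x: "x \<in> carrier ?F" and y: "y \<in> carrier ?F" and len: "length x + length y = length u + length v"
      and nc: "\<not> conjugate_in ?F x y" and s0: "s0 \<in> fst ` set x" "f s0 = 1"
      and fx: "int p dvd weight f x" and fy: "int p dvd weight f y" for x y s0 f
  proof -
    have p2: "p \<ge> 2" using p prime_ge_2_nat by blast
    obtain a where a: "a \<in> set x" "fst a = s0" using s0 by auto
    obtain x1 x2 where x12: "x = x1 @ a # x2" using a(1) by (meson split_list)
    have s0S: "s0 \<in> S" using s0(1) x by (auto simp: carrier_free_group)
    interpret cyclic_cover S s0 f p
      by standard (use s0S s0 p2 in auto)
    have xL: "x \<in> stab" and yL: "y \<in> stab"
      using x y fx fy by (auto simp: stab_eq)
    have pn: "p_normal p F stab"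
      using p_normal_weight[OF p, of S 1 f] by (simp add: stab_eq)
    interpret L: normal stab F using pn by (rule p_normal_imp_normal)
    interpret GL: group "F\<lparr>carrier := stab\<rparr>"
      by (rule L.subgroup_is_group) (rule free.is_group)
    \<comment> \<open>From this vertex the path reads the chosen occurrence of \<open>s0\<close>
      exactly while it crosses the tree edge between 0 and 1: it arrives at 0 if the letter is
      positive and at 1 if it is inverse.\<close>
    define i where "i = ((if snd a then 0 else 1) - weight f x1) mod int p"
    have i: "i \<in> {0..<int p}" using p2 by (simp add: i_def)
    have act_i: "act i x1 = (if snd a then 0 else 1)"
      using p2 i by (simp add: act_eq i_def mod_simps)
    have "rho1 (act i x1) a = []"
      using rho1_tree[of 0] rho1_tree_inv[of 1] p2 a(2) act_i by (cases a; cases "snd a") auto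
    then have len_x: "length (rho i x) < length x"
      using length_rho_less x12 by blast
    define x' where "x' = rep i \<otimes>\<^bsub>F\<^esub> x \<otimes>\<^bsub>F\<^esub> inv\<^bsub>F\<^esub> rep i"
    have x'L: "x' \<in> stab"
      unfolding x'_def using xL rep_closed' by (intro L.inv_op_closed2)
    have x'F: "x' \<in> carrier F" using x'L by (rule L.mem_carrier)
    have x'_conj: "inv\<^bsub>F\<^esub> (inv\<^bsub>F\<^esub> rep i) \<otimes>\<^bsub>F\<^esub> x \<otimes>\<^bsub>F\<^esub> inv\<^bsub>F\<^esub> rep i = x'"
      using rep_closed' by (simp add: x'_def)
    \<comment> \<open>The basis of the kernel consists of pairs; the induction hypothesis is for
      sets of natural numbers.\<close>
    define h where "h = map (apfst (to_nat :: int \<times> nat \<Rightarrow> nat)) \<circ> rho 0"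
    have h: "h \<in> iso (F\<lparr>carrier := stab\<rparr>) (free_group (to_nat ` B))"
      unfolding h_def by (rule iso_set_trans[OF rho_iso free_group_relabel]) (rule inj_on_subset[OF inj_to_nat], simp)
    have h_hom: "h \<in> hom (F\<lparr>carrier := stab\<rparr>) (free_group (to_nat ` B))"
      using h by (rule iso_imp_homomorphism)
    have sep: "conj_separated p (F\<lparr>carrier := stab\<rparr>) x' (rep j \<otimes>\<^bsub>F\<^esub> y \<otimes>\<^bsub>F\<^esub> inv\<^bsub>F\<^esub> rep j)"
      if j: "j \<in> {0..<int p}" for j
    proof -
      let ?y = "rep j \<otimes>\<^bsub>F\<^esub> y \<otimes>\<^bsub>F\<^esub> inv\<^bsub>F\<^esub> rep j"
      have yL': "?y \<in> stab"
        using yL rep_closed' by (intro L.inv_op_closed2)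
      have "\<not> conjugate_in (F\<lparr>carrier := stab\<rparr>) x' ?y"
      proof
        assume "conjugate_in (F\<lparr>carrier := stab\<rparr>) x' ?y"
        then obtain g where g: "g \<in> stab" "?y = inv\<^bsub>F\<^esub> g \<otimes>\<^bsub>F\<^esub> x' \<otimes>\<^bsub>F\<^esub> g"
          by (auto simp: conjugate_in_def L.subgroup_axioms)
        have "y = inv\<^bsub>F\<^esub> rep j \<otimes>\<^bsub>F\<^esub> ?y \<otimes>\<^bsub>F\<^esub> rep j"
          using y rep_closed' by (simp add: free.group_simps)
        also have "\<dots> = inv\<^bsub>F\<^esub> (inv\<^bsub>F\<^esub> rep i \<otimes>\<^bsub>F\<^esub> g \<otimes>\<^bsub>F\<^esub> rep j) \<otimes>\<^bsub>F\<^esub> x \<otimes>\<^bsub>F\<^esub>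
            (inv\<^bsub>F\<^esub> rep i \<otimes>\<^bsub>F\<^esub> g \<otimes>\<^bsub>F\<^esub> rep j)"
          unfolding g(2) x'_def using g(1) x rep_closed' by (simp add: free.group_simps)
        finally have "conjugate_in F x y"
          using g(1) rep_closed' unfolding conjugate_in_def
          by (intro bexI[of _ "inv\<^bsub>F\<^esub> rep i \<otimes>\<^bsub>F\<^esub> g \<otimes>\<^bsub>F\<^esub> rep j"]) simp_all
        with nc show False ..
      qed
      then have nch: "\<not> conjugate_in (free_group (to_nat ` B)) (h x') (h ?y)"
        using conjugate_in_iso[OF GL.is_group free.is_group h, of x' ?y] x'L yL' by auto
      have closed: "h x' \<in> carrier (free_group (to_nat ` B))" "h ?y \<in> carrier (free_group (to_nat ` B))"
        using hom_in_carrier[OF h_hom] x'L yL' by simp_all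
      have "length (h x') + length (h ?y) = length (rho i x) + length (rho j y)"
        using rho_conj_rep[OF i xL] rho_conj_rep[OF j yL] by (simp add: h_def x'_def)
      also have "\<dots> < length u + length v"
        using len_x length_rho[of j y] len by linarith
      finally have "conj_separated p (free_group (to_nat ` B)) (h x') (h ?y)"
        using less.hyps closed nch by blast
      then show ?thesis
        using GL.conj_separated_hom[OF free.is_group h_hom] x'L yL' by simp
    qed
    have "conj_separated p F x' y"
    proof (rule free.conj_separated_extend[OF pn x'L yL])
      show "finite (rep ` {0..<int p})" "rep ` {0..<int p} \<subseteq> carrier F"
        using rep_closed' by auto
      fix g assume g: "g \<in> carrier F"
      let ?j = "act 0 g"
      have j: "?j \<in> {0..<int p}" using act_carrier_closed[OF x0 g] .
      have "act 0 (g \<otimes>\<^bsub>F\<^esub> inv\<^bsub>F\<^esub> rep ?j) = 0"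
        using act_mult[OF x0, of "rep ?j" "inv\<^bsub>F\<^esub> rep ?j"] act_mult[OF x0 g, of "inv\<^bsub>F\<^esub> rep ?j"]
          act_rep[OF j] rep_closed' by (simp add: one_free_group)
      moreover have "g \<otimes>\<^bsub>F\<^esub> inv\<^bsub>F\<^esub> rep ?j \<in> carrier F"
        using g free.inv_closed[OF rep_closed'] by (rule free.m_closed)
      ultimately have "g \<otimes>\<^bsub>F\<^esub> inv\<^bsub>F\<^esub> rep ?j \<in> stab"
        unfolding stab_def by blast
      moreover have "g = (g \<otimes>\<^bsub>F\<^esub> inv\<^bsub>F\<^esub> rep ?j) \<otimes>\<^bsub>F\<^esub> rep ?j"
        using g rep_closed' by (simp add: free.group_simps)
      ultimately show "\<exists>l\<in>stab. \<exists>t\<in>rep ` {0..<int p}. g = l \<otimes>\<^bsub>F\<^esub> t"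
        using j by blast
    next
      fix t assume "t \<in> rep ` {0..<int p}"
      then show "conj_separated p (F\<lparr>carrier := stab\<rparr>) x' (t \<otimes>\<^bsub>F\<^esub> y \<otimes>\<^bsub>F\<^esub> inv\<^bsub>F\<^esub> t)"
        using sep by blast
    qed
    then show ?thesis
      using free.conj_separated_conj[of p S "inv\<^bsub>F\<^esub> rep i" x y] x y rep_closed' x'_conj by simp
  qed
  note u = less.prems(1) and v = less.prems(2) and nc = less.prems(3)
  let ?e = "\<lambda>s w. weight (\<lambda>x. if x = s then 1 else 0) w"
  show ?case
  proof (cases "\<exists>s. ?e s u \<noteq> ?e s v")
    case True
    then obtain s where s: "?e s u \<noteq> ?e s v" by blast
    \<comment> \<open>The difference itself is a sufficient exponent, because
      \<open>p ^ k \<ge> 2 ^ k > k\<close>; a nonzero number below \<open>p ^ k\<close> in absolute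
      value is not divisible by it.\<close>
    define k where "k = nat \<bar>?e s u - ?e s v\<bar>"
    have "\<bar>?e s u - ?e s v\<bar> = int k"
      by (simp add: k_def)
    also have "\<dots> < int (2 ^ k)"
      by (simp only: of_nat_less_iff less_exp)
    also have "\<dots> \<le> int p ^ k"
      using prime_ge_2_nat[OF p] by (simp add: power_mono)
    finally have k: "int p ^ k > \<bar>?e s u - ?e s v\<bar>" .
    show ?thesis
      unfolding conj_separated_def
    proof (intro exI conjI ballI)
      show "p_normal p ?F {w \<in> carrier ?F. int p ^ k dvd ?e s w}"
        by (rule p_normal_weight[OF p])
      fix g assume g: "g \<in> carrier ?F"
      have "\<not> int p ^ k dvd ?e s u - ?e s v"
        using k s dvd_imp_le_int[of "?e s u - ?e s v" "int p ^ k"] by auto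
      then show "inv\<^bsub>?F\<^esub> g \<otimes>\<^bsub>?F\<^esub> u \<otimes>\<^bsub>?F\<^esub> g \<otimes>\<^bsub>?F\<^esub> inv\<^bsub>?F\<^esub> v \<notin> {w \<in> carrier ?F. int p ^ k dvd ?e s w}"
        using g u v by (simp add: weight_mult weight_inv)
    qed
  next
    case False
    then have eq: "?e s u = ?e s v" for s by blast
    \<comment> \<open>A reduced word in a single letter is determined by its exponent sum, and the
      sums agree, while \<open>u\<close> and \<open>v\<close> differ.\<close>
    have "\<exists>s t. s \<in> fst ` set u \<union> fst ` set v \<and> t \<in> fst ` set u \<union> fst ` set v \<and> s \<noteq> t"
    proof (rule ccontr)
      assume *: "\<not> ?thesis"
      then obtain s where s: "fst ` set u \<subseteq> {s}" "fst ` set v \<subseteq> {s}"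
        by (cases "fst ` set u \<union> fst ` set v = {}") blast+
      obtain n e n' e' where "u = replicate n (s, e)" "v = replicate n' (s, e')"
        using reduced_single_letter[of u s] reduced_single_letter[of v s] s u v
        by (metis carrier_free_group)
      moreover from this have "n = n' \<and> (n = 0 \<or> e = e')"
        using eq[of s] by (auto simp: weight_replicate split: if_splits)
      ultimately have "u = v" by auto
      then show False
        using nc free.conjugate_in_refl[OF u] by simp
    qed
    then obtain s t where st: "s \<in> fst ` set u \<union> fst ` set v" "t \<in> fst ` set u \<union> fst ` set v" "s \<noteq> t"
      by blast
    \<comment> \<open>If \<open>p\<close> divides the exponent sum of \<open>s\<close>, that sum is
      the weight. Otherwise let \<open>c\<close> invert it modulo \<open>p\<close>; giving
      \<open>t\<close> the weight 1 and \<open>s\<close> the weight \<open>- c * ?e t u\<close>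
      makes the total divisible by \<open>p\<close>.\<close>
    have "\<exists>s0 f. s0 \<in> fst ` set u \<union> fst ` set v \<and> f s0 = 1 \<and> int p dvd weight f u \<and> weight f u = weight f v"
    proof (cases "int p dvd ?e s u")
      case True
      then show ?thesis
        using st eq by (intro exI[of _ s] exI[of _ "\<lambda>x. if x = s then 1 else 0"]) auto
    next
      case False
      then have "coprime (?e s u) (int p)"
        using p by (metis coprime_commute prime_imp_coprime prime_nat_int_transfer)
      then obtain c d where "c * ?e s u + d * int p = 1"
        using bezout_int[of "?e s u" "int p"] by auto
      then have "1 - c * ?e s u = d * int p" by simp
      moreover have "(- c * ?e t u) * ?e s u + ?e t u = (1 - c * ?e s u) * ?e t u"
        by (simp add: algebra_simps)
      ultimately have "int p dvd (- c * ?e t u) * ?e s u + ?e t u"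
        by simp
      then show ?thesis
        using st(2) eq st(3)
        by (intro exI[of _ t] exI[of _ "\<lambda>x. if x = t then 1 else if x = s then - c * ?e t u else 0"])
          (simp add: weight_two_letters)
    qed
    then obtain s0 f where s0: "s0 \<in> fst ` set u \<union> fst ` set v" "f s0 = 1"
      and f: "int p dvd weight f u" "int p dvd weight f v"
      by metis
    show ?thesis
    proof (cases "s0 \<in> fst ` set u")
      case True
      then show ?thesis using step[OF u v _ nc True s0(2) f] by simp
    next
      case False
      then have "s0 \<in> fst ` set v" using s0 by blast
      moreover have "\<not> conjugate_in ?F v u"
        using nc free.conjugate_in_sym u v by blast
      ultimately have "conj_separated p ?F v u"
        using step[OF v u] s0(2) f by simp
      then show ?thesis
        using free.conj_separated_sym u v by blast
    qed
  qed
qed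

corollary is_free_group_p_conjugacy_separable:
  fixes G :: "('g::countable, 'm) monoid_scheme"
  assumes "Factorial_Ring.prime p" "is_free_group G"
  shows "p_conjugacy_separable p G"
proof -
  obtain T :: "nat set" where "G \<cong> free_group T"
    using countable_free_group[OF assms(2)] .
  then obtain h where h: "h \<in> iso G (free_group T)"
    by (auto simp: is_iso_def)
  have "p_conjugacy_separable p (free_group T)"
    using free_group_conj_separated[OF assms(1)]
    by (auto simp: p_conjugacy_separable_iff[OF assms(1)])
  with p_conjugacy_separable_iso[OF assms(1) _ free.is_group h] assms(2) show ?thesis
    by (simp add: is_free_group_def)
qed

text \<open>The point is that \<open>x\<close> and its conjugates can be separated already in the free group
  \<open>L \<langle>x\<rangle>\<close>, in which the conjugacy classes are the orbits under \<open>L\<close>.\<close>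

lemma free_group_centralizer_condition:
  fixes S :: "nat set"
  assumes p: "Factorial_Ring.prime p" and L: "p_normal p (free_group S) L"
    and x: "x \<in> carrier (free_group S)"
  obtains K where "p_normal p (free_group S) K"
    "\<And>g. g \<in> carrier (free_group S) \<Longrightarrow>
      inv\<^bsub>free_group S\<^esub> g \<otimes>\<^bsub>free_group S\<^esub> x \<otimes>\<^bsub>free_group S\<^esub> g \<otimes>\<^bsub>free_group S\<^esub> inv\<^bsub>free_group S\<^esub> x \<in> K \<Longrightarrow>
      \<exists>c\<in>carrier (free_group S). c \<otimes>\<^bsub>free_group S\<^esub> x = x \<otimes>\<^bsub>free_group S\<^esub> c \<and>
        inv\<^bsub>free_group S\<^esub> c \<otimes>\<^bsub>free_group S\<^esub> g \<in> L"
proof -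
  let ?F = "free_group S"
  interpret L: normal L ?F using L by (rule p_normal_imp_normal)
  interpret GL: group "?F\<lparr>carrier := L\<rparr>"
    by (rule L.subgroup_is_group) (rule free.is_group)
  define J where "J = {w \<in> carrier ?F. \<exists>i::int. w \<otimes>\<^bsub>?F\<^esub> x [^]\<^bsub>?F\<^esub> i \<in> L}"
  have J: "subgroup J ?F"
  proof (rule free.subgroupI)
    show "J \<noteq> {}"
      by (auto simp: J_def intro!: exI[of _ "\<one>\<^bsub>?F\<^esub>"] exI[of _ "0 :: int"])
    fix w assume "w \<in> J"
    then obtain i :: int where w: "w \<in> carrier ?F" "w \<otimes>\<^bsub>?F\<^esub> x [^]\<^bsub>?F\<^esub> i \<in> L"
      by (auto simp: J_def)
    have "inv\<^bsub>?F\<^esub> (x [^]\<^bsub>?F\<^esub> i \<otimes>\<^bsub>?F\<^esub> w) \<in> L"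
      using free.normal_mult_commute[OF L.normal_axioms w(1) _ w(2)] x by simp
    then have "inv\<^bsub>?F\<^esub> w \<otimes>\<^bsub>?F\<^esub> x [^]\<^bsub>?F\<^esub> (- i) \<in> L"
      using w x by (simp add: free.inv_mult_group free.int_pow_neg)
    then show "inv\<^bsub>?F\<^esub> w \<in> J"
      using w by (auto simp: J_def)
    fix w' assume "w' \<in> J"
    then obtain j :: int where w': "w' \<in> carrier ?F" "w' \<otimes>\<^bsub>?F\<^esub> x [^]\<^bsub>?F\<^esub> j \<in> L"
      by (auto simp: J_def)
    define Y where "Y = x [^]\<^bsub>?F\<^esub> i"
    have Y: "Y \<in> carrier ?F" using x by (simp add: Y_def)
    have "inv\<^bsub>?F\<^esub> Y \<otimes>\<^bsub>?F\<^esub> (w' \<otimes>\<^bsub>?F\<^esub> x [^]\<^bsub>?F\<^esub> j) \<otimes>\<^bsub>?F\<^esub> Y \<in> L"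
      using w'(2) Y by (intro L.inv_op_closed1)
    with w(2) have "(w \<otimes>\<^bsub>?F\<^esub> Y) \<otimes>\<^bsub>?F\<^esub> (inv\<^bsub>?F\<^esub> Y \<otimes>\<^bsub>?F\<^esub> (w' \<otimes>\<^bsub>?F\<^esub> x [^]\<^bsub>?F\<^esub> j) \<otimes>\<^bsub>?F\<^esub> Y) \<in> L"
      by (simp add: Y_def)
    moreover have "(w \<otimes>\<^bsub>?F\<^esub> Y) \<otimes>\<^bsub>?F\<^esub> (inv\<^bsub>?F\<^esub> Y \<otimes>\<^bsub>?F\<^esub> (w' \<otimes>\<^bsub>?F\<^esub> x [^]\<^bsub>?F\<^esub> j) \<otimes>\<^bsub>?F\<^esub> Y) =
        (w \<otimes>\<^bsub>?F\<^esub> w') \<otimes>\<^bsub>?F\<^esub> x [^]\<^bsub>?F\<^esub> (j + i)"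
      using w(1) w'(1) x Y by (simp add: free.group_simps free.int_pow_mult Y_def)
    ultimately show "w \<otimes>\<^bsub>?F\<^esub> w' \<in> J"
      using w w' by (auto simp: J_def)
  qed (auto simp: J_def)
  interpret J: subgroup J ?F by (rule J)
  have LJ: "L \<subseteq> J"
  proof
    fix l assume "l \<in> L"
    then have "l \<in> carrier ?F" "l \<otimes>\<^bsub>?F\<^esub> x [^]\<^bsub>?F\<^esub> (0 :: int) \<in> L"
      by simp_all
    then show "l \<in> J" unfolding J_def by blast
  qed
  have pcsJ: "p_conjugacy_separable p (?F\<lparr>carrier := J\<rparr>)"
    by (rule is_free_group_p_conjugacy_separable[OF p nielsen_schreier[OF J]])
  \<comment> \<open>A coset \<open>t L\<close> that misses the centralizer of \<open>x\<close> is
    excluded as a whole by a single \<open>K\<close>.\<close>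
  have coset: "\<exists>K. p_normal p ?F K \<and> (\<forall>l\<in>L. inv\<^bsub>?F\<^esub> (t \<otimes>\<^bsub>?F\<^esub> l) \<otimes>\<^bsub>?F\<^esub> x \<otimes>\<^bsub>?F\<^esub> (t \<otimes>\<^bsub>?F\<^esub> l) \<otimes>\<^bsub>?F\<^esub> inv\<^bsub>?F\<^esub> x \<notin> K)"
    if t: "t \<in> carrier ?F" and nl: "\<And>l. l \<in> L \<Longrightarrow> (t \<otimes>\<^bsub>?F\<^esub> l) \<otimes>\<^bsub>?F\<^esub> x \<noteq> x \<otimes>\<^bsub>?F\<^esub> (t \<otimes>\<^bsub>?F\<^esub> l)" for t
  proof -
    define y where "y = inv\<^bsub>?F\<^esub> t \<otimes>\<^bsub>?F\<^esub> x \<otimes>\<^bsub>?F\<^esub> t"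
    have y: "y \<in> carrier ?F" using t x by (simp add: y_def)
    have conj_tl: "inv\<^bsub>?F\<^esub> (t \<otimes>\<^bsub>?F\<^esub> l) \<otimes>\<^bsub>?F\<^esub> x \<otimes>\<^bsub>?F\<^esub> (t \<otimes>\<^bsub>?F\<^esub> l) = inv\<^bsub>?F\<^esub> l \<otimes>\<^bsub>?F\<^esub> y \<otimes>\<^bsub>?F\<^esub> l"
      if "l \<in> carrier ?F" for l
      using that t x by (simp add: y_def free.group_simps)
    show ?thesis
    \<comment> \<open>If \<open>y\<close> lies outside \<open>J\<close>, then \<open>L\<close>
      itself works: conjugation by an element of \<open>L\<close> does not change \<open>y\<close>
      modulo \<open>L\<close>, and \<open>y\<close> congruent to \<open>x\<close> would put
      \<open>y\<close> in \<open>J\<close>.\<close>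
    proof (cases "y \<in> J")
      case False
      have "inv\<^bsub>?F\<^esub> l \<otimes>\<^bsub>?F\<^esub> y \<otimes>\<^bsub>?F\<^esub> l \<otimes>\<^bsub>?F\<^esub> inv\<^bsub>?F\<^esub> x \<notin> L" if l: "l \<in> L" for l
      proof
        assume *: "inv\<^bsub>?F\<^esub> l \<otimes>\<^bsub>?F\<^esub> y \<otimes>\<^bsub>?F\<^esub> l \<otimes>\<^bsub>?F\<^esub> inv\<^bsub>?F\<^esub> x \<in> L"
        have "y \<otimes>\<^bsub>?F\<^esub> inv\<^bsub>?F\<^esub> l \<otimes>\<^bsub>?F\<^esub> inv\<^bsub>?F\<^esub> y \<in> L"
          using l y by (intro L.inv_op_closed2) simp_all
        from L.m_closed[OF this L.m_closed[OF l *]] have "(y \<otimes>\<^bsub>?F\<^esub> inv\<^bsub>?F\<^esub> l \<otimes>\<^bsub>?F\<^esub> inv\<^bsub>?F\<^esub> y) \<otimes>\<^bsub>?F\<^esub>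
            (l \<otimes>\<^bsub>?F\<^esub> (inv\<^bsub>?F\<^esub> l \<otimes>\<^bsub>?F\<^esub> y \<otimes>\<^bsub>?F\<^esub> l \<otimes>\<^bsub>?F\<^esub> inv\<^bsub>?F\<^esub> x)) \<in> L" .
        moreover have "(y \<otimes>\<^bsub>?F\<^esub> inv\<^bsub>?F\<^esub> l \<otimes>\<^bsub>?F\<^esub> inv\<^bsub>?F\<^esub> y) \<otimes>\<^bsub>?F\<^esub>
            (l \<otimes>\<^bsub>?F\<^esub> (inv\<^bsub>?F\<^esub> l \<otimes>\<^bsub>?F\<^esub> y \<otimes>\<^bsub>?F\<^esub> l \<otimes>\<^bsub>?F\<^esub> inv\<^bsub>?F\<^esub> x)) = y \<otimes>\<^bsub>?F\<^esub> x [^]\<^bsub>?F\<^esub> (- 1 :: int)"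
          using l x y by (simp add: free.group_simps free.int_pow_neg)
        ultimately have "y \<otimes>\<^bsub>?F\<^esub> x [^]\<^bsub>?F\<^esub> (- 1 :: int) \<in> L" by simp
        with y have "y \<in> J" unfolding J_def by blast
        with False show False ..
      qed
      then show ?thesis
        using L conj_tl by (intro exI[of _ L]) simp
    next
      case True
      have xJ: "x \<in> J"
      proof -
        have "x \<otimes>\<^bsub>?F\<^esub> x [^]\<^bsub>?F\<^esub> (- 1 :: int) \<in> L"
          using x L.one_closed by (simp add: free.int_pow_neg)
        with x show ?thesis unfolding J_def by blast
      qed
      \<comment> \<open>A conjugator \<open>j\<close> in \<open>J\<close> can be corrected by a
        power of \<open>x\<close> to lie in \<open>L\<close> and still conjugates \<open>y\<close>
        to \<open>x\<close>; then \<open>t\<close> times it would centralize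
        \<open>x\<close>.\<close>
      have "\<not> conjugate_in (?F\<lparr>carrier := J\<rparr>) y x"
      proof
        assume "conjugate_in (?F\<lparr>carrier := J\<rparr>) y x"
        then obtain j where j: "j \<in> J" "x = inv\<^bsub>?F\<^esub> j \<otimes>\<^bsub>?F\<^esub> y \<otimes>\<^bsub>?F\<^esub> j"
          unfolding conjugate_in_def by (auto simp: free.m_inv_consistent[OF J])
        then obtain i :: int where i: "j \<otimes>\<^bsub>?F\<^esub> x [^]\<^bsub>?F\<^esub> i \<in> L"
          unfolding J_def by blast
        let ?X = "x [^]\<^bsub>?F\<^esub> i"
        have jF: "j \<in> carrier ?F" using j(1) by (rule J.mem_carrier)
        have Y: "?X \<in> carrier ?F" using x by simp
        have "x \<otimes>\<^bsub>?F\<^esub> ?X = ?X \<otimes>\<^bsub>?F\<^esub> x"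
          using free.int_pow_mult[OF x, of 1 i] free.int_pow_mult[OF x, of i 1] x
          by (simp add: add.commute)
        moreover have "j \<otimes>\<^bsub>?F\<^esub> x = y \<otimes>\<^bsub>?F\<^esub> j"
          using arg_cong[OF j(2), of "\<lambda>z. j \<otimes>\<^bsub>?F\<^esub> z"] jF y by (simp add: free.group_simps)
        ultimately have "(j \<otimes>\<^bsub>?F\<^esub> ?X) \<otimes>\<^bsub>?F\<^esub> x = y \<otimes>\<^bsub>?F\<^esub> (j \<otimes>\<^bsub>?F\<^esub> ?X)"
          using jF Y x y by (metis free.m_assoc)
        then have "(t \<otimes>\<^bsub>?F\<^esub> (j \<otimes>\<^bsub>?F\<^esub> ?X)) \<otimes>\<^bsub>?F\<^esub> x = t \<otimes>\<^bsub>?F\<^esub> (y \<otimes>\<^bsub>?F\<^esub> (j \<otimes>\<^bsub>?F\<^esub> ?X))"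
          using t jF Y x by (simp add: free.m_assoc)
        also have "\<dots> = x \<otimes>\<^bsub>?F\<^esub> (t \<otimes>\<^bsub>?F\<^esub> (j \<otimes>\<^bsub>?F\<^esub> ?X))"
          using t jF Y x by (simp add: y_def free.group_simps)
        finally show False using nl[OF i] by simp
      qed
      then have "conj_separated p (?F\<lparr>carrier := J\<rparr>) y x"
        using pcsJ True xJ by (simp add: p_conjugacy_separable_iff[OF p])
      then obtain K where K: "p_normal p (?F\<lparr>carrier := J\<rparr>) K"
        and sep: "\<And>g. g \<in> J \<Longrightarrow> inv\<^bsub>?F\<^esub> g \<otimes>\<^bsub>?F\<^esub> y \<otimes>\<^bsub>?F\<^esub> g \<otimes>\<^bsub>?F\<^esub> inv\<^bsub>?F\<^esub> x \<notin> K"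
        using xJ by (auto simp: conj_separated_def J)
      have "(\<lambda>w. w) \<in> hom (?F\<lparr>carrier := L\<rparr>) (?F\<lparr>carrier := J\<rparr>)"
        using LJ by (auto simp: hom_def)
      from GL.p_normal_vimage[OF J.subgroup_is_group[OF free.is_group] this K]
      have "p_normal p (?F\<lparr>carrier := L\<rparr>) {g \<in> L. g \<in> K}"
        by simp
      then obtain D where "p_normal p ?F D" "D \<subseteq> {g \<in> L. g \<in> K}"
        using free.p_normal_core[OF L] by metis
      then have "p_normal p ?F D" "D \<subseteq> K" by auto
      moreover have "inv\<^bsub>?F\<^esub> (t \<otimes>\<^bsub>?F\<^esub> l) \<otimes>\<^bsub>?F\<^esub> x \<otimes>\<^bsub>?F\<^esub> (t \<otimes>\<^bsub>?F\<^esub> l) \<otimes>\<^bsub>?F\<^esub> inv\<^bsub>?F\<^esub> x \<notin> K" if "l \<in> L" for l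
        using sep[of l] LJ that by (subst conj_tl) auto
      ultimately show ?thesis by blast
    qed
  qed
  obtain T where T: "finite T" "T \<subseteq> carrier ?F"
    "\<And>g. g \<in> carrier ?F \<Longrightarrow> \<exists>l\<in>L. \<exists>t\<in>T. g = l \<otimes>\<^bsub>?F\<^esub> t"
    using free.finite_index_reps[OF L.subgroup_axioms] L by (auto simp: p_normal_def)
  \<comment> \<open>Representatives of the cosets that miss the centralizer. An element that
    commutes with \<open>x\<close> modulo all their \<open>K t\<close> lies in one of the other
    cosets, where it agrees modulo \<open>L\<close> with a centralizing element.\<close>
  define T' where "T' = {t \<in> T. \<forall>l\<in>L. (t \<otimes>\<^bsub>?F\<^esub> l) \<otimes>\<^bsub>?F\<^esub> x \<noteq> x \<otimes>\<^bsub>?F\<^esub> (t \<otimes>\<^bsub>?F\<^esub> l)}"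
  have "\<forall>t\<in>T'. \<exists>K. p_normal p ?F K \<and> (\<forall>l\<in>L. inv\<^bsub>?F\<^esub> (t \<otimes>\<^bsub>?F\<^esub> l) \<otimes>\<^bsub>?F\<^esub> x \<otimes>\<^bsub>?F\<^esub> (t \<otimes>\<^bsub>?F\<^esub> l) \<otimes>\<^bsub>?F\<^esub> inv\<^bsub>?F\<^esub> x \<notin> K)"
    using coset T(2) by (auto simp: T'_def)
  then obtain K where K: "\<And>t. t \<in> T' \<Longrightarrow> p_normal p ?F (K t)"
    "\<And>t l. t \<in> T' \<Longrightarrow> l \<in> L \<Longrightarrow> inv\<^bsub>?F\<^esub> (t \<otimes>\<^bsub>?F\<^esub> l) \<otimes>\<^bsub>?F\<^esub> x \<otimes>\<^bsub>?F\<^esub> (t \<otimes>\<^bsub>?F\<^esub> l) \<otimes>\<^bsub>?F\<^esub> inv\<^bsub>?F\<^esub> x \<notin> K t"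
    by metis
  show ?thesis
  proof (rule that)
    show "p_normal p ?F (carrier ?F \<inter> (\<Inter>t\<in>T'. K t))"
      using T(1) K(1) by (intro free.p_normal_INT) (auto simp: T'_def)
    fix g assume g: "g \<in> carrier ?F"
      and gK: "inv\<^bsub>?F\<^esub> g \<otimes>\<^bsub>?F\<^esub> x \<otimes>\<^bsub>?F\<^esub> g \<otimes>\<^bsub>?F\<^esub> inv\<^bsub>?F\<^esub> x \<in> carrier ?F \<inter> (\<Inter>t\<in>T'. K t)"
    obtain l t where lt: "l \<in> L" "t \<in> T" "g = l \<otimes>\<^bsub>?F\<^esub> t"
      using T(3)[OF g] by blast
    have t: "t \<in> carrier ?F" using lt T by blast
    define l' where "l' = inv\<^bsub>?F\<^esub> t \<otimes>\<^bsub>?F\<^esub> l \<otimes>\<^bsub>?F\<^esub> t"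
    have l': "l' \<in> L" "g = t \<otimes>\<^bsub>?F\<^esub> l'"
      using lt t by (auto simp: l'_def free.group_simps L.inv_op_closed1 simp del: free.m_assoc)
       (simp add: free.group_simps)
    have "t \<notin> T'"
      using K(2)[OF _ l'(1), of t] gK l'(2) by auto
    then obtain k where k: "k \<in> L" "(t \<otimes>\<^bsub>?F\<^esub> k) \<otimes>\<^bsub>?F\<^esub> x = x \<otimes>\<^bsub>?F\<^esub> (t \<otimes>\<^bsub>?F\<^esub> k)"
      using lt by (auto simp: T'_def)
    have "inv\<^bsub>?F\<^esub> (t \<otimes>\<^bsub>?F\<^esub> k) \<otimes>\<^bsub>?F\<^esub> g = inv\<^bsub>?F\<^esub> k \<otimes>\<^bsub>?F\<^esub> l'"
      using l' k(1) t by (simp add: free.group_simps)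
    then show "\<exists>c\<in>carrier ?F. c \<otimes>\<^bsub>?F\<^esub> x = x \<otimes>\<^bsub>?F\<^esub> c \<and> inv\<^bsub>?F\<^esub> c \<otimes>\<^bsub>?F\<^esub> g \<in> L"
      using k l' t by (intro bexI[of _ "t \<otimes>\<^bsub>?F\<^esub> k"]) auto
  qed
qed

section \<open>Normal subgroups of free groups\<close>

lemma nth_concat_replicate:
  "i < m * length z \<Longrightarrow> concat (replicate m z) ! i = z ! (i mod length z)"
proof (induction m arbitrary: i)
  case (Suc m)
  then show ?case
    by (cases "i < length z") (auto simp: nth_append le_mod_geq)
qed simp

text \<open>Two generators give four letters. Three is the number of seams that a letter inserted
  between given words has to respect below.\<close>

lemma avoid_three_letters:
  assumes "a \<noteq> b"
  obtains f :: "'a letter" where "fst f \<in> {a, b}" "f \<notin> {x, y, z}"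
proof -
  have "card ({a, b} \<times> (UNIV :: bool set)) = 4"
    using assms by (simp add: card_cartesian_product)
  moreover have "card {x, y, z} \<le> 3"
    by (simp add: card_insert_if)
  ultimately have "\<not> {a, b} \<times> UNIV \<subseteq> {x, y, z}"
    using card_mono[of "{x, y, z}" "{a, b} \<times> UNIV"] by auto
  then show ?thesis using that by fastforce
qed

text \<open>A proper power has a period of at most half its length. In a word that contains long blocks
  of \<open>f\<close> and of \<open>inv_letter f\<close> which make up more than half of it, such a period would
  move a letter \<open>f\<close> onto a letter \<open>inv_letter f\<close>.\<close>

lemma not_proper_power:
  assumes u: "u = h @ replicate K f @ v @ replicate K (inv_letter f)"
    and K: "length h + length v \<le> K" "2 \<le> K"
    and z: "u = concat (replicate m z)"
  shows "m < 2"
proof (rule ccontr)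
  assume m: "\<not> m < 2"
  define d n where "d = length z" and "n = length u"
  have n: "n = m * d"
    by (simp add: n_def z d_def length_concat sum_list_replicate)
  have n': "n = length h + length v + 2 * K"
    by (simp add: n_def u)
  have d0: "d > 0" using n n' K by (cases d) auto
  have "2 * d \<le> m * d" using m by simp
  then have dK: "d \<le> 2 * K - 1"
    using n n' K by linarith
  have per: "u ! i = z ! (i mod d)" if "i < n" for i
    using nth_concat_replicate[of i m z] that n by (simp add: z d_def)
  have f: "u ! i = f" if "length h \<le> i" "i < length h + K" for i
    using that by (auto simp: u nth_append)
  have f': "u ! j = inv_letter f" if "length h + length v + K \<le> j" "j < n" for j
    using that n' by (auto simp: u nth_append)
  \<comment> \<open>The least distance from a letter of the first block to a letter of the second.
    The number \<open>q * d\<close> below is the first multiple of the period that reaches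
    it.\<close>
  define L where "L = length v + 1"
  define q where "q = (L + d - 1) div d"
  have "q * d \<ge> L" "q * d < L + d"
    using d0 div_mult_mod_eq[of "L + d - 1" d] mod_less_divisor[OF d0, of "L + d - 1"]
    unfolding q_def L_def by linarith+
  then obtain r where r: "q * d = L + r" "r < d"
    by (metis add_less_cancel_left le_Suc_ex)
  \<comment> \<open>The distance \<open>L + r\<close> is realised by sliding the end point through
    the second block as long as \<open>r < K\<close>, and otherwise by moving the start back through
    the first; \<open>d \<le> 2 * K - 1\<close> leaves enough room.\<close>
  have "\<exists>i j. length h \<le> i \<and> i < length h + K \<and> length h + length v + K \<le> j \<and> j < n \<and> j = i + q * d"
  proof (cases "r < K")
    case True
    then show ?thesis
      using r n' K by (intro exI[of _ "length h + K - 1"] exI[of _ "length h + length v + K + r"])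
        (auto simp: L_def)
  next
    case False
    then show ?thesis
      using r n' dK K by (intro exI[of _ "length h + 2 * K - 2 - r"] exI[of _ "n - 1"])
        (auto simp: L_def)
  qed
  then obtain i j where ij: "length h \<le> i" "i < length h + K" "length h + length v + K \<le> j" "j < n"
    "j = i + q * d" by blast
  then have "f = inv_letter f"
    using f[of i] f'[of j] per[of i] per[of j] by simp
  then show False by simp
qed

text \<open>\<open>g\<close> is a long block of one letter \<open>f\<close> followed by a letter
  \<open>l\<close>, so that the two blocks from \<open>g\<close> and its inverse dominate the word
  and exclude a short period. The letters are chosen to prevent cancellation at all seams, including
  the cyclic one.\<close>

lemma primitive_word:
  fixes a b :: 'a
  assumes ab: "a \<in> S" "b \<in> S" "a \<noteq> b"
    and h: "h \<in> carrier (free_group S)" "h \<noteq> []" and w: "w \<in> carrier (free_group S)" "w \<noteq> []"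
  obtains g where "g \<in> carrier (free_group S)" "g \<noteq> []" "hd g \<noteq> hd h"
    "cyc_reduced (h @ g @ w @ rev (map inv_letter g))"
    "\<forall>z m. h @ g @ w @ rev (map inv_letter g) = concat (replicate m z) \<longrightarrow> m < 2"
proof -
  \<comment> \<open>The last letter of the word will be \<open>inv_letter f\<close>, so
    \<open>f \<noteq> hd h\<close> keeps it cyclically reduced; the other restriction concerns the
    seam between \<open>h\<close> and \<open>f\<close>. The repeated entry only fills the third
    slot.\<close>
  obtain f :: "'a letter" where f: "fst f \<in> {a, b}" "f \<notin> {hd h, inv_letter (last h), hd h}"
    using avoid_three_letters[OF ab(3)] .
  \<comment> \<open>These are the seams of \<open>l\<close> with \<open>w\<close>, of
    \<open>w\<close> with \<open>inv_letter l\<close>, and of \<open>l\<close> with the block of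
    \<open>f\<close>, whose mirror image is the seam at the end.\<close>
  obtain l :: "'a letter" where l: "fst l \<in> {a, b}"
      "l \<notin> {inv_letter (hd w), last w, inv_letter f}"
    using avoid_three_letters[OF ab(3)] .
  \<comment> \<open>The middle part \<open>[l] @ w @ [inv_letter l]\<close> has length
    \<open>length w + 2\<close>, so \<open>K\<close> is just long enough for the exclusion of proper
    powers.\<close>
  define K where "K = length h + length w + 2"
  define g where "g = replicate K f @ [l]"
  define u where "u = h @ g @ w @ rev (map inv_letter g)"
  have red_f: "reduced (replicate k f)" for f :: "'a letter" and k
    by (auto simp: reduced_def successively_conv_nth)
  have red: "reduced h" "reduced w"
    using h w by (auto simp: carrier_free_group)
  have l': "inv_letter l \<noteq> f" "l \<noteq> inv_letter f" "hd w \<noteq> inv_letter l"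
    using l(2) by auto
  have K0: "K > 0" by (simp add: K_def)
  have u_eq: "u = h @ replicate K f @ ([l] @ w @ [inv_letter l]) @ replicate K (inv_letter f)"
    by (simp add: u_def g_def map_replicate_const rev_replicate)
  have "reduced u"
    unfolding u_eq using red red_f f l l' h(2) w(2) K0
    by (auto simp: reduced_append hd_append last_append hd_replicate last_replicate reduced_Cons)
  moreover have "hd u \<noteq> inv_letter (last u)"
    using f h(2) K0 by (auto simp: u_eq last_append last_replicate)
  ultimately have "cyc_reduced u"
    by (simp add: cyc_reduced_def)
  moreover have "g \<in> carrier (free_group S)"
    using ab f(1) l(1) l'(2) red_f K0
    by (auto simp: g_def carrier_free_group reduced_append last_replicate reduced_Cons)
  moreover have "m < 2" if "u = concat (replicate m z)" for z m
    by (rule not_proper_power[OF u_eq _ _ that]) (auto simp: K_def)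
  moreover have "g \<noteq> []" "hd g \<noteq> hd h"
    using f K0 by (auto simp: g_def hd_append hd_replicate)
  ultimately show ?thesis
    using that by (simp add: u_def)
qed

context
  fixes S :: "'a set" and N :: "'a word set" and a b :: 'a
  assumes ab: "a \<in> S" "b \<in> S" "a \<noteq> b"
    and N: "N \<lhd> free_group S" "N \<noteq> {\<one>\<^bsub>free_group S\<^esub>}"
begin

lemma nontrivial_element: obtains w where "w \<in> N" "w \<in> carrier (free_group S)" "w \<noteq> []"
proof -
  interpret N: normal N "free_group S" by (rule N)
  have "\<exists>w\<in>N. w \<noteq> \<one>\<^bsub>free_group S\<^esub>"
    using N.one_closed N(2) by blast
  then show ?thesis
    using that N.mem_carrier by (auto simp: one_free_group)
qed

lemma mult_primitive_word:
  assumes "g \<in> carrier (free_group S)" "h \<in> carrier (free_group S)" "w \<in> carrier (free_group S)"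
    "cyc_reduced (h @ g @ w @ rev (map inv_letter g))"
  shows "h \<otimes>\<^bsub>free_group S\<^esub> (g \<otimes>\<^bsub>free_group S\<^esub> w \<otimes>\<^bsub>free_group S\<^esub> inv\<^bsub>free_group S\<^esub> g) =
    h @ g @ w @ rev (map inv_letter g)"
proof -
  have "reduced (h @ g @ w @ rev (map inv_letter g))"
    using assms(4) by (simp add: cyc_reduced_def)
  moreover from this have "reduced (g @ w @ rev (map inv_letter g))" "reduced (w @ rev (map inv_letter g))"
    by (simp_all add: reduced_append)
  ultimately have "h \<otimes>\<^bsub>free_group S\<^esub> (g \<otimes>\<^bsub>free_group S\<^esub> (w \<otimes>\<^bsub>free_group S\<^esub> rev (map inv_letter g)))
      = h @ g @ w @ rev (map inv_letter g)"
    by (simp only: mult_free_group foldr_push_append)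
  then show ?thesis
    using assms(1-3) by (simp only: free.m_assoc free.inv_closed flip: inv_free_group)
qed

text \<open>Multiplying \<open>h\<close> by a conjugate of a nontrivial element of \<open>N\<close>
  stays in the coset, and the conjugator can be chosen such that the product is cyclically reduced
  and no proper power. Its centralizer then consists of its powers.\<close>

lemma primitive_in_coset:
  assumes h: "h \<in> carrier (free_group S)"
  obtains n where "n \<in> N"
    "\<And>c. c \<in> carrier (free_group S) \<Longrightarrow>
      (h \<otimes>\<^bsub>free_group S\<^esub> n) \<otimes>\<^bsub>free_group S\<^esub> c = c \<otimes>\<^bsub>free_group S\<^esub> (h \<otimes>\<^bsub>free_group S\<^esub> n) \<Longrightarrow>
      \<exists>i::int. c = (h \<otimes>\<^bsub>free_group S\<^esub> n) [^]\<^bsub>free_group S\<^esub> i"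
proof -
  let ?F = "free_group S"
  interpret N: normal N ?F by (rule N)
  obtain w where w: "w \<in> N" "w \<in> carrier ?F" "w \<noteq> []" by (rule nontrivial_element)
  have main: "\<exists>n\<in>N. \<forall>c\<in>carrier ?F. (h \<otimes>\<^bsub>?F\<^esub> n) \<otimes>\<^bsub>?F\<^esub> c = c \<otimes>\<^bsub>?F\<^esub> (h \<otimes>\<^bsub>?F\<^esub> n) \<longrightarrow>
      (\<exists>i::int. c = (h \<otimes>\<^bsub>?F\<^esub> n) [^]\<^bsub>?F\<^esub> i)" if h: "h \<in> carrier ?F" "h \<noteq> []" for h
  proof -
    obtain g where g: "g \<in> carrier ?F" "g \<noteq> []" "hd g \<noteq> hd h"
      and cyc: "cyc_reduced (h @ g @ w @ rev (map inv_letter g))"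
      and prim: "\<forall>z m. h @ g @ w @ rev (map inv_letter g) = concat (replicate m z) \<longrightarrow> m < 2"
      using primitive_word[OF ab h w(2,3)] by metis
    let ?n = "g \<otimes>\<^bsub>?F\<^esub> w \<otimes>\<^bsub>?F\<^esub> inv\<^bsub>?F\<^esub> g"
    have eq: "h \<otimes>\<^bsub>?F\<^esub> ?n = h @ g @ w @ rev (map inv_letter g)"
      by (rule mult_primitive_word[OF g(1) h(1) w(2) cyc])
    have n: "?n \<in> N" using w(1) g(1) by (intro N.inv_op_closed2)
    have u: "h \<otimes>\<^bsub>?F\<^esub> ?n \<in> carrier ?F" using h(1) N.mem_carrier[OF n] by simp
    have "\<exists>i::int. c = (h \<otimes>\<^bsub>?F\<^esub> ?n) [^]\<^bsub>?F\<^esub> i"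
      if "c \<in> carrier ?F" "(h \<otimes>\<^bsub>?F\<^esub> ?n) \<otimes>\<^bsub>?F\<^esub> c = c \<otimes>\<^bsub>?F\<^esub> (h \<otimes>\<^bsub>?F\<^esub> ?n)" for c
      using centralizer_primitive[OF u _ _ that] cyc prim h(2) by (metis eq append_is_Nil_conv)
    with n show ?thesis by blast
  qed
  show ?thesis
  \<comment> \<open>The construction needs a nonempty \<open>h\<close>. The coset of the identity is
    also the coset of \<open>w\<close>, which replaces it.\<close>
  proof (cases "h = []")
    case False
    then show ?thesis using main[OF h] that by blast
  next
    case True
    obtain n where n: "n \<in> N" "\<forall>c\<in>carrier ?F. (w \<otimes>\<^bsub>?F\<^esub> n) \<otimes>\<^bsub>?F\<^esub> c = c \<otimes>\<^bsub>?F\<^esub> (w \<otimes>\<^bsub>?F\<^esub> n) \<longrightarrow>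
      (\<exists>i::int. c = (w \<otimes>\<^bsub>?F\<^esub> n) [^]\<^bsub>?F\<^esub> i)"
      using main[OF w(2,3)] by blast
    have "h \<otimes>\<^bsub>?F\<^esub> (w \<otimes>\<^bsub>?F\<^esub> n) = w \<otimes>\<^bsub>?F\<^esub> n"
      using True w(2) N.mem_carrier[OF n(1)] by (simp flip: one_free_group[of S])
    with that[of "w \<otimes>\<^bsub>?F\<^esub> n"] n w(1) show ?thesis by simp
  qed
qed

text \<open>For a suitable \<open>g\<close> neither product of \<open>w\<close> with its conjugate
  \<open>g w g^-1\<close> has cancellation, and the two products begin with the different letters
  \<open>hd w\<close> and \<open>hd g\<close>.\<close>

lemma normal_noncommuting:
  obtains x y where "x \<in> N" "y \<in> N" "x \<otimes>\<^bsub>free_group S\<^esub> y \<noteq> y \<otimes>\<^bsub>free_group S\<^esub> x"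
proof -
  let ?F = "free_group S"
  interpret N: normal N ?F by (rule N)
  obtain w where w: "w \<in> N" "w \<in> carrier ?F" "w \<noteq> []" by (rule nontrivial_element)
  obtain g where g: "g \<in> carrier ?F" "g \<noteq> []" "hd g \<noteq> hd w"
    and cyc: "cyc_reduced (w @ g @ w @ rev (map inv_letter g))"
    using primitive_word[OF ab w(2,3) w(2,3)] by metis
  let ?y = "g \<otimes>\<^bsub>?F\<^esub> w \<otimes>\<^bsub>?F\<^esub> inv\<^bsub>?F\<^esub> g"
  have red: "reduced (g @ w @ rev (map inv_letter g))"
    using cyc by (simp add: cyc_reduced_def reduced_append)
  then have y: "?y = g @ w @ rev (map inv_letter g)"
  proof -
    have "reduced (w @ rev (map inv_letter g))"
      using red by (simp add: reduced_append)
    then have "g \<otimes>\<^bsub>?F\<^esub> (w \<otimes>\<^bsub>?F\<^esub> rev (map inv_letter g)) = g @ w @ rev (map inv_letter g)"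
      using red by (simp only: mult_free_group foldr_push_append)
    then show ?thesis
      using g(1) w(2) by (simp only: free.m_assoc free.inv_closed flip: inv_free_group)
  qed
  have "last (rev (map inv_letter g)) = inv_letter (hd g)"
    using g(2) by (simp add: last_rev hd_map)
  then have "reduced ((g @ w @ rev (map inv_letter g)) @ w)"
    using red w g by (subst reduced_append) (auto simp: carrier_free_group last_append)
  then have yw: "?y \<otimes>\<^bsub>?F\<^esub> w = (g @ w @ rev (map inv_letter g)) @ w"
    unfolding y by (simp only: mult_free_group foldr_push_append)
  have "w \<otimes>\<^bsub>?F\<^esub> ?y \<noteq> ?y \<otimes>\<^bsub>?F\<^esub> w"
  proof
    assume "w \<otimes>\<^bsub>?F\<^esub> ?y = ?y \<otimes>\<^bsub>?F\<^esub> w"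
    then have "w @ g @ w @ rev (map inv_letter g) = (g @ w @ rev (map inv_letter g)) @ w"
      using mult_primitive_word[OF g(1) w(2) w(2) cyc] yw by simp
    then have "hd w = hd g"
      using w(3) g(2) by (metis append.assoc hd_append2)
    with g(3) show False by simp
  qed
  with that[of w ?y] w(1) g(1) show ?thesis
    by (simp add: N.inv_op_closed2)
qed

end

text \<open>The exponent sum is injective in rank at most one, so residues modulo that of a
  nontrivial element of \<open>N\<close> bound the index. Hence a nontrivial normal subgroup of
  infinite index provides the two generators that primitive words require.\<close>

lemma cyclic_free_group_finite_index:
  assumes S: "S \<subseteq> {s}" and N: "N \<lhd> free_group S" "N \<noteq> {\<one>\<^bsub>free_group S\<^esub>}"
  shows "finite (rcosets\<^bsub>free_group S\<^esub> N)"
proof -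
  let ?F = "free_group S" and ?e = "weight (\<lambda>x. 1)"
  interpret N: normal N ?F by (rule N)
  have inj: "u = v" if "u \<in> carrier ?F" "v \<in> carrier ?F" "?e u = ?e v" for u v
  proof -
    have "reduced u" "fst ` set u \<subseteq> {s}" "reduced v" "fst ` set v \<subseteq> {s}"
      using that(1,2) S by (auto simp: carrier_free_group)
    then obtain n e n' e' where "u = replicate n (s, e)" "v = replicate n' (s, e')"
      by (elim reduced_single_letter)
    moreover from this have "n = n' \<and> (n = 0 \<or> e = e')"
      using that(3) by (auto simp: weight_replicate split: if_splits)
    ultimately show ?thesis by auto
  qed
  obtain w where w: "w \<in> N" "w \<noteq> \<one>\<^bsub>?F\<^esub>"
    using N.one_closed N(2) by blast
  have wF: "w \<in> carrier ?F" using w(1) by (rule N.mem_carrier)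
  have w0: "?e w \<noteq> 0"
    using inj[OF wF free.one_closed] w(2) by (auto simp: one_free_group)
  have pow: "w [^]\<^bsub>?F\<^esub> i \<in> N" for i :: int
    using free.subgroup_int_pow_closed[OF N.subgroup_axioms w(1)] .
  have wpow: "?e (w [^]\<^bsub>?F\<^esub> i) = i * ?e w" for i :: int
    using wF by (cases i rule: int_cases2)
      (auto simp: int_pow_int weight_pow free.int_pow_neg weight_inv)
  show ?thesis
  proof (rule free.finite_rcosetsI[OF N.subgroup_axioms])
    have "(\<lambda>x. ?e x mod \<bar>?e w\<bar>) ` carrier ?F \<subseteq> {0..<\<bar>?e w\<bar>}"
      using w0 by auto
    then show "finite ((\<lambda>x. ?e x mod \<bar>?e w\<bar>) ` carrier ?F)"
      using finite_subset by blast
    fix x y assume xy: "x \<in> carrier ?F" "y \<in> carrier ?F" "?e x mod \<bar>?e w\<bar> = ?e y mod \<bar>?e w\<bar>"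
    then have "?e w dvd ?e x - ?e y"
      by (simp add: mod_eq_dvd_iff)
    then obtain i where i: "?e x - ?e y = ?e w * i"
      by (elim dvdE)
    have "x \<otimes>\<^bsub>?F\<^esub> inv\<^bsub>?F\<^esub> y = w [^]\<^bsub>?F\<^esub> i"
      using xy i wF by (intro inj) (simp_all add: weight_mult weight_inv wpow)
    then show "x \<otimes>\<^bsub>?F\<^esub> inv\<^bsub>?F\<^esub> y \<in> N"
      using pow by simp
  qed
qed

text \<open>Up to conjugacy \<open>x\<close> is a cyclically reduced word \<open>u\<close> and its
  centralizer consists of elements \<open>u^i\<close> times a remainder. Some \<open>u^n\<close> is
  in \<open>N\<close>, so only \<open>i\<close> modulo \<open>n\<close> and the finitely many
  remainders matter.\<close>

lemma centralizer_finite_mod: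
  assumes x: "x \<in> carrier (free_group S)" "x \<noteq> \<one>\<^bsub>free_group S\<^esub>" and N: "N \<lhd> free_group S"
    and tors: "\<And>y. y \<in> carrier (free_group S) \<Longrightarrow> \<exists>n>0. y [^]\<^bsub>free_group S\<^esub> (n :: nat) \<in> N"
  obtains T where "finite T"
    "\<And>t. t \<in> T \<Longrightarrow> t \<in> carrier (free_group S) \<and> t \<otimes>\<^bsub>free_group S\<^esub> x = x \<otimes>\<^bsub>free_group S\<^esub> t"
    "\<And>c. c \<in> carrier (free_group S) \<Longrightarrow> c \<otimes>\<^bsub>free_group S\<^esub> x = x \<otimes>\<^bsub>free_group S\<^esub> c \<Longrightarrow>
      \<exists>t\<in>T. c \<otimes>\<^bsub>free_group S\<^esub> inv\<^bsub>free_group S\<^esub> t \<in> N"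
proof -
  let ?F = "free_group S"
  interpret N: normal N ?F by (rule N)
  obtain g u where gu: "g \<in> carrier ?F" "u \<in> carrier ?F" "cyc_reduced u"
    "x = g \<otimes>\<^bsub>?F\<^esub> u \<otimes>\<^bsub>?F\<^esub> inv\<^bsub>?F\<^esub> g"
    using conj_cyc_reduced[OF x(1)] .
  have u: "u \<noteq> []"
    using x(2) gu by (auto simp flip: one_free_group[of S])
  obtain n :: nat where n: "n > 0" "u [^]\<^bsub>?F\<^esub> n \<in> N"
    using tors[OF gu(2)] by blast
  define R where "R = {c. c \<in> carrier ?F \<and> c \<otimes>\<^bsub>?F\<^esub> u = u \<otimes>\<^bsub>?F\<^esub> c} \<inter>
    (\<lambda>(k, r). u [^]\<^bsub>?F\<^esub> (k :: int) \<otimes>\<^bsub>?F\<^esub> take r u) ` ({0..<int n} \<times> {..<length u})"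
  have R: "\<exists>t\<in>R. c \<otimes>\<^bsub>?F\<^esub> inv\<^bsub>?F\<^esub> t \<in> N" if c: "c \<in> carrier ?F" "c \<otimes>\<^bsub>?F\<^esub> u = u \<otimes>\<^bsub>?F\<^esub> c" for c
  proof -
    obtain i :: int and r where ir: "c = u [^]\<^bsub>?F\<^esub> i \<otimes>\<^bsub>?F\<^esub> take r u" "r < length u"
      using centralizer_cyc_reduced[OF gu(2,3) u c(1) c(2)[symmetric]] by blast
    have tk: "take r u \<in> carrier ?F"
      using gu(2) by (metis append_take_drop_id carrier_free_group image_mono order.trans reduced_append set_take_subset)
    define P where "P = u [^]\<^bsub>?F\<^esub> (i div int n * int n)"
    have P: "P \<in> carrier ?F" using gu(2) by (simp add: P_def)
    have PN: "P \<in> N"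
      using free.subgroup_int_pow_closed[OF N.subgroup_axioms n(2), of "i div int n"] gu(2)
      by (simp add: P_def free.int_pow_pow mult.commute flip: int_pow_int)
    define t where "t = u [^]\<^bsub>?F\<^esub> (i mod int n) \<otimes>\<^bsub>?F\<^esub> take r u"
    have t: "t \<in> carrier ?F" using gu(2) tk by (simp add: t_def)
    have cPt: "c = P \<otimes>\<^bsub>?F\<^esub> t"
      using gu(2) tk free.int_pow_mult[OF gu(2), of "i div int n * int n" "i mod int n"]
      by (simp add: ir(1) P_def t_def free.m_assoc)
    let ?i = "i div int n * int n"
    have "P \<otimes>\<^bsub>?F\<^esub> u = u \<otimes>\<^bsub>?F\<^esub> P"
      using free.int_pow_mult[OF gu(2), of 1 ?i] free.int_pow_mult[OF gu(2), of ?i 1] gu(2)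
      by (simp add: P_def add.commute)
    then have "P \<otimes>\<^bsub>?F\<^esub> (t \<otimes>\<^bsub>?F\<^esub> u) = P \<otimes>\<^bsub>?F\<^esub> (u \<otimes>\<^bsub>?F\<^esub> t)"
      using c(2) P t gu(2) unfolding cPt by (metis free.m_assoc)
    then have "t \<otimes>\<^bsub>?F\<^esub> u = u \<otimes>\<^bsub>?F\<^esub> t"
      using P t gu(2) by simp
    then have "t \<in> R"
      using t n(1) ir(2) by (auto simp: R_def t_def)
    moreover have "c \<otimes>\<^bsub>?F\<^esub> inv\<^bsub>?F\<^esub> t \<in> N"
      using PN P t by (simp add: cPt free.m_assoc)
    ultimately show ?thesis by blast
  qed
  define T where "T = (\<lambda>t. g \<otimes>\<^bsub>?F\<^esub> t \<otimes>\<^bsub>?F\<^esub> inv\<^bsub>?F\<^esub> g) ` R"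
  have comm_iff: "(g \<otimes>\<^bsub>?F\<^esub> t \<otimes>\<^bsub>?F\<^esub> inv\<^bsub>?F\<^esub> g) \<otimes>\<^bsub>?F\<^esub> x = x \<otimes>\<^bsub>?F\<^esub> (g \<otimes>\<^bsub>?F\<^esub> t \<otimes>\<^bsub>?F\<^esub> inv\<^bsub>?F\<^esub> g) \<longleftrightarrow>
    t \<otimes>\<^bsub>?F\<^esub> u = u \<otimes>\<^bsub>?F\<^esub> t" if "t \<in> carrier ?F" for t
  proof -
    have "(g \<otimes>\<^bsub>?F\<^esub> t \<otimes>\<^bsub>?F\<^esub> inv\<^bsub>?F\<^esub> g) \<otimes>\<^bsub>?F\<^esub> x = g \<otimes>\<^bsub>?F\<^esub> (t \<otimes>\<^bsub>?F\<^esub> u) \<otimes>\<^bsub>?F\<^esub> inv\<^bsub>?F\<^esub> g"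
      "x \<otimes>\<^bsub>?F\<^esub> (g \<otimes>\<^bsub>?F\<^esub> t \<otimes>\<^bsub>?F\<^esub> inv\<^bsub>?F\<^esub> g) = g \<otimes>\<^bsub>?F\<^esub> (u \<otimes>\<^bsub>?F\<^esub> t) \<otimes>\<^bsub>?F\<^esub> inv\<^bsub>?F\<^esub> g"
      using gu that by (simp_all add: free.group_simps)
    then show ?thesis
      using gu that by simp
  qed
  show ?thesis
  proof (rule that)
    show "finite T" by (simp add: T_def R_def)
    show "t \<in> carrier ?F \<and> t \<otimes>\<^bsub>?F\<^esub> x = x \<otimes>\<^bsub>?F\<^esub> t" if "t \<in> T" for t
      using that comm_iff gu(1) by (auto simp: T_def R_def)
    fix c assume c: "c \<in> carrier ?F" "c \<otimes>\<^bsub>?F\<^esub> x = x \<otimes>\<^bsub>?F\<^esub> c"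
    define c' where "c' = inv\<^bsub>?F\<^esub> g \<otimes>\<^bsub>?F\<^esub> c \<otimes>\<^bsub>?F\<^esub> g"
    have c': "c' \<in> carrier ?F" "c = g \<otimes>\<^bsub>?F\<^esub> c' \<otimes>\<^bsub>?F\<^esub> inv\<^bsub>?F\<^esub> g"
      using c(1) gu(1) by (simp_all add: c'_def free.group_simps)
    then obtain t where t: "t \<in> R" "c' \<otimes>\<^bsub>?F\<^esub> inv\<^bsub>?F\<^esub> t \<in> N"
      using R comm_iff c(2) by metis
    have tF: "t \<in> carrier ?F" using t(1) by (simp add: R_def)
    have "c \<otimes>\<^bsub>?F\<^esub> inv\<^bsub>?F\<^esub> (g \<otimes>\<^bsub>?F\<^esub> t \<otimes>\<^bsub>?F\<^esub> inv\<^bsub>?F\<^esub> g) = g \<otimes>\<^bsub>?F\<^esub> (c' \<otimes>\<^bsub>?F\<^esub> inv\<^bsub>?F\<^esub> t) \<otimes>\<^bsub>?F\<^esub> inv\<^bsub>?F\<^esub> g"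
      using c' tF gu(1) by (simp add: free.group_simps)
    also have "\<dots> \<in> N"
      using t(2) gu(1) by (intro N.inv_op_closed2)
    finally show "\<exists>t\<in>T. c \<otimes>\<^bsub>?F\<^esub> inv\<^bsub>?F\<^esub> t \<in> N"
      using t(1) by (auto simp: T_def)
  qed
qed

section \<open>Fibre products\<close>

definition fibre_product :: "('g, 'm) monoid_scheme \<Rightarrow> 'g set \<Rightarrow> ('g \<times> 'g) set" where
  "fibre_product G N = {(x, y). x \<in> carrier G \<and> y \<in> carrier G \<and> x \<otimes>\<^bsub>G\<^esub> inv\<^bsub>G\<^esub> y \<in> N}"

lemma (in group) rcoset_hom:
  assumes "N \<lhd> G"
  shows "group_hom G (G Mod N) (\<lambda>x. N #> x)"
  using assms by (simp add: group_hom_def group_hom_axioms_def normal.r_coset_hom_Mod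
      normal.factorgroup_is_group is_group)

lemma (in group) subgroup_fibre_product:
  assumes "N \<lhd> G"
  shows "subgroup (fibre_product G N) (G \<times>\<times> G)"
proof -
  interpret N: normal N G by fact
  interpret P: group "G \<times>\<times> G" by (rule DirProd_group[OF is_group is_group])
  interpret q: group_hom G "G Mod N" "\<lambda>x. N #> x" by (rule rcoset_hom[OF assms])
  have "fibre_product G N = {(x, y). x \<in> carrier G \<and> y \<in> carrier G \<and> N #> x = N #> y}"
    unfolding fibre_product_def
    by (rule Collect_cong) (simp add: split_beta rcoset_eq_iff N.subgroup_axioms cong: conj_cong)
  moreover have "subgroup \<dots> (G \<times>\<times> G)"
  proof (rule P.subgroupI)
    show "{(x, y). x \<in> carrier G \<and> y \<in> carrier G \<and> N #> x = N #> y} \<noteq> {}"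
      by (auto intro!: exI[of _ \<one>])
  qed (auto simp: inv_DirProd[OF is_group is_group] q.hom_mult[simplified] q.hom_inv
      simp del: mult_FactGroup)
  ultimately show ?thesis by simp
qed

text \<open>Pairs that are not conjugate in some coordinate are separated there, as \<open>F\<close>
  is free. Otherwise all conjugators have the form \<open>(c1 c, c2 d)\<close> with
  \<open>c1\<close>, \<open>c2\<close> in the centralizers. Finiteness of these modulo
  \<open>N\<close> yields one \<open>L\<close> above \<open>N\<close> that keeps the two entries of
  every such pair apart, and the centralizer condition relative to \<open>L\<close> supplies the
  quotient.\<close>

lemma fibre_product_p_conjugacy_separable:
  fixes S :: "nat set"
  defines "F \<equiv> free_group S"
  assumes p: "Factorial_Ring.prime p" and N: "N \<lhd> F"
    and tors: "\<And>x. x \<in> carrier F \<Longrightarrow> \<exists>k. x [^]\<^bsub>F\<^esub> (p ^ k :: nat) \<in> N"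
    and rf: "\<And>x. x \<in> carrier F \<Longrightarrow> x \<notin> N \<Longrightarrow>
      \<exists>L. L \<lhd> F \<and> finite (rcosets\<^bsub>F\<^esub> L) \<and> N \<subseteq> L \<and> x \<notin> L"
  shows "p_conjugacy_separable p ((F \<times>\<times> F)\<lparr>carrier := fibre_product F N\<rparr>)"
proof -
  interpret F: group F by (simp add: F_def free.is_group)
  interpret N: normal N F by fact
  define G where "G = fibre_product F N"
  define P where "P = (F \<times>\<times> F)\<lparr>carrier := G\<rparr>"
  interpret FF: group "F \<times>\<times> F" by (rule DirProd_group[OF F.is_group F.is_group])
  have G: "subgroup G (F \<times>\<times> F)" unfolding G_def by (rule F.subgroup_fibre_product[OF N])
  interpret P: group P unfolding P_def by (rule subgroup.subgroup_is_group[OF G FF.is_group])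
  have G_iff: "(x, y) \<in> G \<longleftrightarrow> x \<in> carrier F \<and> y \<in> carrier F \<and> x \<otimes>\<^bsub>F\<^esub> inv\<^bsub>F\<^esub> y \<in> N" for x y
    by (simp add: G_def fibre_product_def)
  have carrier_P: "carrier P = G" and mult_P: "(a, b) \<otimes>\<^bsub>P\<^esub> (c, d) = (a \<otimes>\<^bsub>F\<^esub> c, b \<otimes>\<^bsub>F\<^esub> d)" for a b c d
    by (simp_all add: P_def)
  have inv_P: "inv\<^bsub>P\<^esub> (a, b) = (inv\<^bsub>F\<^esub> a, inv\<^bsub>F\<^esub> b)" if "(a, b) \<in> G" for a b
    using that G_iff by (simp add: P_def FF.m_inv_consistent[OF G] inv_DirProd[OF F.is_group F.is_group])
  have fst_hom: "fst \<in> hom P F" and snd_hom: "snd \<in> hom P F"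
    using G_iff by (auto simp: hom_def carrier_P mult_P)
  have "conj_separated p P x y" if x: "x \<in> carrier P" and y: "y \<in> carrier P" and nc: "\<not> conjugate_in P x y" for x y
  proof -
    obtain x1 x2 y1 y2 where xy: "x = (x1, x2)" "y = (y1, y2)" by (cases x; cases y)
    have xG: "(x1, x2) \<in> G" and yG: "(y1, y2) \<in> G"
      using x y by (simp_all add: xy carrier_P)
    then have closed: "x1 \<in> carrier F" "x2 \<in> carrier F" "y1 \<in> carrier F" "y2 \<in> carrier F"
      using G_iff by auto
    show ?thesis
    proof (cases "conjugate_in F x1 y1 \<and> conjugate_in F x2 y2")
      case False
      then consider "\<not> conjugate_in F x1 y1" | "\<not> conjugate_in F x2 y2" by blast
      then show ?thesis
      proof cases
        case 1
        then have "conj_separated p F (fst x) (fst y)"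
          using free_group_conj_separated[OF p] closed by (simp add: F_def xy)
        then show ?thesis
          by (rule P.conj_separated_hom[OF F.is_group fst_hom x y])
      next
        case 2
        then have "conj_separated p F (snd x) (snd y)"
          using free_group_conj_separated[OF p] closed by (simp add: F_def xy)
        then show ?thesis
          by (rule P.conj_separated_hom[OF F.is_group snd_hom x y])
      qed
    next
      case True
      then obtain c d where cd: "c \<in> carrier F" "y1 = inv\<^bsub>F\<^esub> c \<otimes>\<^bsub>F\<^esub> x1 \<otimes>\<^bsub>F\<^esub> c"
        "d \<in> carrier F" "y2 = inv\<^bsub>F\<^esub> d \<otimes>\<^bsub>F\<^esub> x2 \<otimes>\<^bsub>F\<^esub> d"
        by (auto simp: conjugate_in_def)
      have not_N: "(c1 \<otimes>\<^bsub>F\<^esub> c) \<otimes>\<^bsub>F\<^esub> inv\<^bsub>F\<^esub> (c2 \<otimes>\<^bsub>F\<^esub> d) \<notin> N"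
        if c1: "c1 \<in> carrier F" "c1 \<otimes>\<^bsub>F\<^esub> x1 = x1 \<otimes>\<^bsub>F\<^esub> c1"
          and c2: "c2 \<in> carrier F" "c2 \<otimes>\<^bsub>F\<^esub> x2 = x2 \<otimes>\<^bsub>F\<^esub> c2" for c1 c2
      proof
        assume "(c1 \<otimes>\<^bsub>F\<^esub> c) \<otimes>\<^bsub>F\<^esub> inv\<^bsub>F\<^esub> (c2 \<otimes>\<^bsub>F\<^esub> d) \<in> N"
        then have mem: "(c1 \<otimes>\<^bsub>F\<^esub> c, c2 \<otimes>\<^bsub>F\<^esub> d) \<in> G"
          using c1 c2 cd by (simp add: G_iff)
        have conj_eq: "inv\<^bsub>F\<^esub> (k \<otimes>\<^bsub>F\<^esub> e) \<otimes>\<^bsub>F\<^esub> z \<otimes>\<^bsub>F\<^esub> (k \<otimes>\<^bsub>F\<^esub> e) = inv\<^bsub>F\<^esub> e \<otimes>\<^bsub>F\<^esub> z \<otimes>\<^bsub>F\<^esub> e"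
          if "k \<otimes>\<^bsub>F\<^esub> z = z \<otimes>\<^bsub>F\<^esub> k" "k \<in> carrier F" "z \<in> carrier F" "e \<in> carrier F" for k z e
        proof -
          have "inv\<^bsub>F\<^esub> (k \<otimes>\<^bsub>F\<^esub> e) \<otimes>\<^bsub>F\<^esub> z \<otimes>\<^bsub>F\<^esub> (k \<otimes>\<^bsub>F\<^esub> e) = inv\<^bsub>F\<^esub> e \<otimes>\<^bsub>F\<^esub> (inv\<^bsub>F\<^esub> k \<otimes>\<^bsub>F\<^esub> (z \<otimes>\<^bsub>F\<^esub> k)) \<otimes>\<^bsub>F\<^esub> e"
            using that(2-) by (simp add: F.group_simps)
          also have "inv\<^bsub>F\<^esub> k \<otimes>\<^bsub>F\<^esub> (z \<otimes>\<^bsub>F\<^esub> k) = z"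
            using that(2-) by (simp add: F.inv_cancel flip: that(1))
          finally show ?thesis .
        qed
        have "y = inv\<^bsub>P\<^esub> (c1 \<otimes>\<^bsub>F\<^esub> c, c2 \<otimes>\<^bsub>F\<^esub> d) \<otimes>\<^bsub>P\<^esub> x \<otimes>\<^bsub>P\<^esub> (c1 \<otimes>\<^bsub>F\<^esub> c, c2 \<otimes>\<^bsub>F\<^esub> d)"
          unfolding xy inv_P[OF mem] mult_P
          using conj_eq[OF c1(2,1) closed(1) cd(1)] conj_eq[OF c2(2,1) closed(2) cd(3)] cd by simp
        then have "conjugate_in P x y"
          using mem unfolding conjugate_in_def carrier_P by blast
        with nc show False ..
      qed
      \<comment> \<open>The centralizer of the identity is all of \<open>F\<close> and could absorb
        any discrepancy between \<open>c\<close> and \<open>d\<close>.\<close>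
      have x1: "x1 \<noteq> \<one>\<^bsub>F\<^esub>"
      proof
        assume "x1 = \<one>\<^bsub>F\<^esub>"
        then show False
          using not_N[of "d \<otimes>\<^bsub>F\<^esub> inv\<^bsub>F\<^esub> c" "\<one>\<^bsub>F\<^esub>"] cd closed N.one_closed by (simp add: F.group_simps)
      qed
      have x2: "x2 \<noteq> \<one>\<^bsub>F\<^esub>"
      proof
        assume "x2 = \<one>\<^bsub>F\<^esub>"
        then show False
          using not_N[of "\<one>\<^bsub>F\<^esub>" "c \<otimes>\<^bsub>F\<^esub> inv\<^bsub>F\<^esub> d"] cd closed N.one_closed by (simp add: F.group_simps)
      qed
      have tors': "\<exists>n>0. y [^]\<^bsub>F\<^esub> (n :: nat) \<in> N" if "y \<in> carrier F" for y
        using tors[OF that] p prime_gt_0_nat by (metis zero_less_power)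
      obtain T1 where T1: "finite T1" "\<And>t. t \<in> T1 \<Longrightarrow> t \<in> carrier F \<and> t \<otimes>\<^bsub>F\<^esub> x1 = x1 \<otimes>\<^bsub>F\<^esub> t"
        "\<And>c. c \<in> carrier F \<Longrightarrow> c \<otimes>\<^bsub>F\<^esub> x1 = x1 \<otimes>\<^bsub>F\<^esub> c \<Longrightarrow> \<exists>t\<in>T1. c \<otimes>\<^bsub>F\<^esub> inv\<^bsub>F\<^esub> t \<in> N"
        using centralizer_finite_mod[of x1 S N] closed x1 N tors' unfolding F_def by blast
      obtain T2 where T2: "finite T2" "\<And>t. t \<in> T2 \<Longrightarrow> t \<in> carrier F \<and> t \<otimes>\<^bsub>F\<^esub> x2 = x2 \<otimes>\<^bsub>F\<^esub> t"
        "\<And>c. c \<in> carrier F \<Longrightarrow> c \<otimes>\<^bsub>F\<^esub> x2 = x2 \<otimes>\<^bsub>F\<^esub> c \<Longrightarrow> \<exists>t\<in>T2. c \<otimes>\<^bsub>F\<^esub> inv\<^bsub>F\<^esub> t \<in> N"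
        using centralizer_finite_mod[of x2 S N] closed x2 N tors' unfolding F_def by blast
      define z where "z = (\<lambda>(s, t). (s \<otimes>\<^bsub>F\<^esub> c) \<otimes>\<^bsub>F\<^esub> inv\<^bsub>F\<^esub> (t \<otimes>\<^bsub>F\<^esub> d))"
      have "\<forall>i\<in>T1 \<times> T2. \<exists>L. p_normal p F L \<and> N \<subseteq> L \<and> z i \<notin> L"
      proof
        fix i assume "i \<in> T1 \<times> T2"
        then obtain s t where st: "i = (s, t)" "s \<in> T1" "t \<in> T2" by blast
        then have "z i \<in> carrier F" "z i \<notin> N"
          using T1(2) T2(2) cd not_N by (simp_all add: z_def)
        then obtain L where L: "L \<lhd> F" "finite (rcosets\<^bsub>F\<^esub> L)" "N \<subseteq> L" "z i \<notin> L"
          using rf by blast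
        \<comment> \<open>Here the torsion of the quotient enters: powers with exponent
          \<open>p ^ k\<close> already fall into \<open>N\<close>, so any normal subgroup of finite
          index above \<open>N\<close> qualifies.\<close>
        then have "p_normal p F L"
          using tors unfolding p_normal_def by blast
        with L show "\<exists>L. p_normal p F L \<and> N \<subseteq> L \<and> z i \<notin> L" by blast
      qed
      then obtain Lz where Lz: "\<And>i. i \<in> T1 \<times> T2 \<Longrightarrow> p_normal p F (Lz i)"
        "\<And>i. i \<in> T1 \<times> T2 \<Longrightarrow> N \<subseteq> Lz i" "\<And>i. i \<in> T1 \<times> T2 \<Longrightarrow> z i \<notin> Lz i"
        by metis
      define L where "L = carrier F \<inter> (\<Inter>i\<in>T1 \<times> T2. Lz i)"
      have pL: "p_normal p F L"
        unfolding L_def using T1(1) T2(1) Lz(1) by (intro F.p_normal_INT) auto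
      have NL: "N \<subseteq> L"
        using Lz(2) N.subset by (auto simp: L_def)
      have zL: "z (s, t) \<notin> L" if "s \<in> T1" "t \<in> T2" for s t
        using Lz(3)[of "(s, t)"] that by (auto simp: L_def)
      interpret L: normal L F using pL by (rule p_normal_imp_normal)
      interpret q: group_hom F "F Mod L" "\<lambda>x. L #>\<^bsub>F\<^esub> x" by (rule F.rcoset_hom[OF L.normal_axioms])
      have q_eq: "L #>\<^bsub>F\<^esub> a = L #>\<^bsub>F\<^esub> b" if "a \<otimes>\<^bsub>F\<^esub> inv\<^bsub>F\<^esub> b \<in> L" "a \<in> carrier F" "b \<in> carrier F" for a b
        using that by (simp add: F.rcoset_eq_iff L.subgroup_axioms)
      obtain K1 where K1: "p_normal p F K1" "\<And>g. g \<in> carrier F \<Longrightarrow>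
          inv\<^bsub>F\<^esub> g \<otimes>\<^bsub>F\<^esub> x1 \<otimes>\<^bsub>F\<^esub> g \<otimes>\<^bsub>F\<^esub> inv\<^bsub>F\<^esub> x1 \<in> K1 \<Longrightarrow>
          \<exists>c\<in>carrier F. c \<otimes>\<^bsub>F\<^esub> x1 = x1 \<otimes>\<^bsub>F\<^esub> c \<and> inv\<^bsub>F\<^esub> c \<otimes>\<^bsub>F\<^esub> g \<in> L"
        using free_group_centralizer_condition[OF p, of S L x1] pL closed unfolding F_def by blast
      obtain K2 where K2: "p_normal p F K2" "\<And>g. g \<in> carrier F \<Longrightarrow>
          inv\<^bsub>F\<^esub> g \<otimes>\<^bsub>F\<^esub> x2 \<otimes>\<^bsub>F\<^esub> g \<otimes>\<^bsub>F\<^esub> inv\<^bsub>F\<^esub> x2 \<in> K2 \<Longrightarrow>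
          \<exists>c\<in>carrier F. c \<otimes>\<^bsub>F\<^esub> x2 = x2 \<otimes>\<^bsub>F\<^esub> c \<and> inv\<^bsub>F\<^esub> c \<otimes>\<^bsub>F\<^esub> g \<in> L"
        using free_group_centralizer_condition[OF p, of S L x2] pL closed unfolding F_def by blast
      \<comment> \<open>An element that conjugates \<open>w\<close> to
        \<open>inv e \<otimes> w \<otimes> e\<close> modulo \<open>K\<close> is, modulo
        \<open>L\<close>, one of the finitely many centralizer representatives times
        \<open>e\<close>.\<close>
      have almost: "\<exists>t\<in>T. L #>\<^bsub>F\<^esub> g = (L #>\<^bsub>F\<^esub> t) \<otimes>\<^bsub>F Mod L\<^esub> (L #>\<^bsub>F\<^esub> e)"
        if pK: "p_normal p F K" and K: "\<And>g. g \<in> carrier F \<Longrightarrow>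
          inv\<^bsub>F\<^esub> g \<otimes>\<^bsub>F\<^esub> w \<otimes>\<^bsub>F\<^esub> g \<otimes>\<^bsub>F\<^esub> inv\<^bsub>F\<^esub> w \<in> K \<Longrightarrow>
          \<exists>c\<in>carrier F. c \<otimes>\<^bsub>F\<^esub> w = w \<otimes>\<^bsub>F\<^esub> c \<and> inv\<^bsub>F\<^esub> c \<otimes>\<^bsub>F\<^esub> g \<in> L"
          and T: "\<And>t. t \<in> T \<Longrightarrow> t \<in> carrier F"
            "\<And>c. c \<in> carrier F \<Longrightarrow> c \<otimes>\<^bsub>F\<^esub> w = w \<otimes>\<^bsub>F\<^esub> c \<Longrightarrow> \<exists>t\<in>T. c \<otimes>\<^bsub>F\<^esub> inv\<^bsub>F\<^esub> t \<in> N"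
          and e: "e \<in> carrier F" and w: "w \<in> carrier F" and g: "g \<in> carrier F"
          and gK: "inv\<^bsub>F\<^esub> g \<otimes>\<^bsub>F\<^esub> w \<otimes>\<^bsub>F\<^esub> g \<otimes>\<^bsub>F\<^esub> inv\<^bsub>F\<^esub> (inv\<^bsub>F\<^esub> e \<otimes>\<^bsub>F\<^esub> w \<otimes>\<^bsub>F\<^esub> e) \<in> K"
        for K w T e g
      proof -
        interpret K: normal K F using pK by (rule p_normal_imp_normal)
        define g' where "g' = g \<otimes>\<^bsub>F\<^esub> inv\<^bsub>F\<^esub> e"
        have g': "g' \<in> carrier F" using g e by (simp add: g'_def)
        have "e \<otimes>\<^bsub>F\<^esub> (inv\<^bsub>F\<^esub> g \<otimes>\<^bsub>F\<^esub> w \<otimes>\<^bsub>F\<^esub> g \<otimes>\<^bsub>F\<^esub> inv\<^bsub>F\<^esub> (inv\<^bsub>F\<^esub> e \<otimes>\<^bsub>F\<^esub> w \<otimes>\<^bsub>F\<^esub> e)) \<otimes>\<^bsub>F\<^esub> inv\<^bsub>F\<^esub> e \<in> K"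
          using gK e by (intro K.inv_op_closed2)
        then have "inv\<^bsub>F\<^esub> g' \<otimes>\<^bsub>F\<^esub> w \<otimes>\<^bsub>F\<^esub> g' \<otimes>\<^bsub>F\<^esub> inv\<^bsub>F\<^esub> w \<in> K"
          using g e w by (simp add: g'_def F.group_simps)
        then obtain k where k: "k \<in> carrier F" "k \<otimes>\<^bsub>F\<^esub> w = w \<otimes>\<^bsub>F\<^esub> k" "inv\<^bsub>F\<^esub> k \<otimes>\<^bsub>F\<^esub> g' \<in> L"
          using K[OF g'] by blast
        obtain t where t: "t \<in> T" "k \<otimes>\<^bsub>F\<^esub> inv\<^bsub>F\<^esub> t \<in> N"
          using T(2)[OF k(1,2)] by blast
        have tF: "t \<in> carrier F" using T(1) t(1) by blast
        have "g' \<otimes>\<^bsub>F\<^esub> inv\<^bsub>F\<^esub> k \<in> L"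
          using F.normal_mult_commute[OF L.normal_axioms _ g' k(3)] k(1) by simp
        then have "L #>\<^bsub>F\<^esub> g' = L #>\<^bsub>F\<^esub> t"
          using q_eq[of g' k] q_eq[of k t] t NL g' k(1) tF by auto
        moreover have "g = g' \<otimes>\<^bsub>F\<^esub> e"
          using g e by (simp add: g'_def F.group_simps)
        ultimately show ?thesis
          using t(1) g' e q.hom_mult by metis
      qed
      let ?K = "{g \<in> carrier P. fst g \<in> K1} \<inter> {g \<in> carrier P. snd g \<in> K2}"
      show ?thesis
        unfolding conj_separated_def
      proof (intro exI conjI ballI)
        show "p_normal p P ?K"
          by (intro P.p_normal_Int P.p_normal_vimage[OF F.is_group fst_hom K1(1)]
              P.p_normal_vimage[OF F.is_group snd_hom K2(1)])
        fix gh assume gh: "gh \<in> carrier P"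
        obtain g h where gh_eq: "gh = (g, h)" by (cases gh)
        have ghG: "(g, h) \<in> G" using gh by (simp add: gh_eq carrier_P)
        then have ghF: "g \<in> carrier F" "h \<in> carrier F" "g \<otimes>\<^bsub>F\<^esub> inv\<^bsub>F\<^esub> h \<in> L"
          using G_iff NL by auto
        show "inv\<^bsub>P\<^esub> gh \<otimes>\<^bsub>P\<^esub> x \<otimes>\<^bsub>P\<^esub> gh \<otimes>\<^bsub>P\<^esub> inv\<^bsub>P\<^esub> y \<notin> ?K"
        proof
          assume "inv\<^bsub>P\<^esub> gh \<otimes>\<^bsub>P\<^esub> x \<otimes>\<^bsub>P\<^esub> gh \<otimes>\<^bsub>P\<^esub> inv\<^bsub>P\<^esub> y \<in> ?K"
          then have "inv\<^bsub>F\<^esub> g \<otimes>\<^bsub>F\<^esub> x1 \<otimes>\<^bsub>F\<^esub> g \<otimes>\<^bsub>F\<^esub> inv\<^bsub>F\<^esub> y1 \<in> K1"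
            "inv\<^bsub>F\<^esub> h \<otimes>\<^bsub>F\<^esub> x2 \<otimes>\<^bsub>F\<^esub> h \<otimes>\<^bsub>F\<^esub> inv\<^bsub>F\<^esub> y2 \<in> K2"
            by (simp_all add: gh_eq xy inv_P[OF ghG] inv_P[OF yG] mult_P)
          then obtain s t where s: "s \<in> T1" "L #>\<^bsub>F\<^esub> g = (L #>\<^bsub>F\<^esub> s) \<otimes>\<^bsub>F Mod L\<^esub> (L #>\<^bsub>F\<^esub> c)"
            and t: "t \<in> T2" "L #>\<^bsub>F\<^esub> h = (L #>\<^bsub>F\<^esub> t) \<otimes>\<^bsub>F Mod L\<^esub> (L #>\<^bsub>F\<^esub> d)"
            using almost[OF K1 _ T1(3), of c g] almost[OF K2 _ T2(3), of d h] T1(2) T2(2) cd closed ghF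
            by metis
          have stF: "s \<in> carrier F" "t \<in> carrier F" using s t T1(2) T2(2) by auto
          have "L #>\<^bsub>F\<^esub> g = L #>\<^bsub>F\<^esub> h"
            by (rule q_eq[OF ghF(3,1,2)])
          then have "L #>\<^bsub>F\<^esub> (s \<otimes>\<^bsub>F\<^esub> c) = L #>\<^bsub>F\<^esub> (t \<otimes>\<^bsub>F\<^esub> d)"
            using s t stF cd by (simp add: q.hom_mult del: mult_FactGroup)
          then have "(s \<otimes>\<^bsub>F\<^esub> c) \<otimes>\<^bsub>F\<^esub> inv\<^bsub>F\<^esub> (t \<otimes>\<^bsub>F\<^esub> d) \<in> L"
            by (rule iffD1[OF F.rcoset_eq_iff[OF L.subgroup_axioms
                  F.m_closed[OF stF(1) cd(1)] F.m_closed[OF stF(2) cd(3)]]])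
          then have "z (s, t) \<in> L"
            by (simp add: z_def)
          with zL s t show False by blast
        qed
      qed
    qed
  qed
  then show ?thesis
    unfolding P_def[symmetric] G_def[symmetric] p_conjugacy_separable_iff[OF p]
    using P.is_group by blast
qed

text \<open>Generators are the diagonal pairs of \<open>A\<close> and the pairs
  \<open>(r, 1)\<close>. They generate the whole diagonal, which conjugates \<open>(x, 1)\<close> to
  \<open>(g x g^-1, 1)\<close>; so the elements \<open>x\<close> reached in the first coordinate
  form a normal subgroup and include \<open>N\<close>.\<close>

lemma (in group) finitely_generated_fibre_product:
  assumes "finite A" "A \<subseteq> carrier G" "generate G A = carrier G"
    and "finite R" "R \<subseteq> carrier G" and N: "N = normal_closure G R" "N \<lhd> G"
  shows "finitely_generated_group ((G \<times>\<times> G)\<lparr>carrier := fibre_product G N\<rparr>)"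
proof -
  interpret P: group "G \<times>\<times> G" by (rule DirProd_group[OF is_group is_group])
  interpret N: normal N G by (rule N)
  have sub: "subgroup (fibre_product G N) (G \<times>\<times> G)" by (rule subgroup_fibre_product[OF N(2)])
  have R_N: "R \<subseteq> N" by (auto simp: N(1) normal_closure_def)
  define B where "B = (\<lambda>a. (a, a)) ` A \<union> (\<lambda>r. (r, \<one>)) ` R"
  have B: "finite B" "B \<subseteq> fibre_product G N"
    using assms(1,4) assms(2,5)[THEN subsetD] R_N[THEN subsetD] N.one_closed
    by (auto simp: B_def fibre_product_def)
  have BG: "B \<subseteq> carrier (G \<times>\<times> G)"
    using B(2) sub subgroup.subset by blast
  interpret D: subgroup "generate (G \<times>\<times> G) B" "G \<times>\<times> G"
    by (rule P.generate_is_subgroup[OF BG])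
  let ?D = "generate (G \<times>\<times> G) B"
  have diag: "(x, x) \<in> ?D" if "x \<in> carrier G" for x
  proof -
    have "x \<in> generate G A" using that assms(3) by simp
    then show ?thesis
    proof (induction rule: generate.induct)
      case one
      then show ?case using D.one_closed by simp
    next
      case (incl h)
      then show ?case by (auto simp: B_def intro!: generate.incl)
    next
      case (inv h)
      then have "(h, h) \<in> ?D" "h \<in> carrier G"
        using assms(2) by (auto simp: B_def intro!: generate.incl)
      then show ?case
        using D.m_inv_closed[of "(h, h)"] by (simp add: inv_DirProd[OF is_group is_group])
    next
      case (eng h1 h2)
      then show ?case
        using D.m_closed[of "(h1, h1)" "(h2, h2)"] by simp
    qed
  qed
  define M where "M = {x \<in> carrier G. (x, \<one>) \<in> ?D}"
  have "M \<lhd> G"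
  proof (rule normal_invI)
    show "subgroup M G"
    proof (rule subgroupI)
      show "M \<noteq> {}" using D.one_closed by (auto simp: M_def)
      fix x assume "x \<in> M"
      then have x: "x \<in> carrier G" "(x, \<one>) \<in> ?D" by (auto simp: M_def)
      then show "inv x \<in> M"
        using D.m_inv_closed[OF x(2)] by (simp add: M_def inv_DirProd[OF is_group is_group])
      fix y assume "y \<in> M"
      then show "x \<otimes> y \<in> M"
        using x D.m_closed[of "(x, \<one>)" "(y, \<one>)"] by (simp add: M_def)
    qed (auto simp: M_def)
    fix x h assume x: "x \<in> carrier G" and h: "h \<in> M"
    then have "(x, x) \<otimes>\<^bsub>G \<times>\<times> G\<^esub> (h, \<one>) \<otimes>\<^bsub>G \<times>\<times> G\<^esub> inv\<^bsub>G \<times>\<times> G\<^esub> (x, x) \<in> ?D"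
      using diag[OF x] by (intro D.m_closed D.m_inv_closed) (auto simp: M_def)
    then show "x \<otimes> h \<otimes> inv x \<in> M"
      using x h by (simp add: M_def inv_DirProd[OF is_group is_group])
  qed
  moreover have "R \<subseteq> M"
    using assms(5) by (auto simp: M_def B_def intro!: generate.incl)
  ultimately have NM: "N \<subseteq> M"
    by (auto simp: N(1) normal_closure_def)
  have "fibre_product G N \<subseteq> ?D"
  proof
    fix z assume "z \<in> fibre_product G N"
    then obtain x y where xy: "z = (x, y)" "x \<in> carrier G" "y \<in> carrier G" "x \<otimes> inv y \<in> N"
      by (auto simp: fibre_product_def)
    then have "(x \<otimes> inv y, \<one>) \<otimes>\<^bsub>G \<times>\<times> G\<^esub> (y, y) \<in> ?D"
      using NM diag by (intro D.m_closed) (auto simp: M_def)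
    then show "z \<in> ?D"
      using xy by (simp add: m_assoc)
  qed
  moreover have "?D \<subseteq> fibre_product G N"
    by (rule P.generate_subgroup_incl[OF B(2) sub])
  ultimately have "generate (G \<times>\<times> G) B = fibre_product G N" by blast
  then have "generate ((G \<times>\<times> G)\<lparr>carrier := fibre_product G N\<rparr>) B = fibre_product G N"
    using P.generate_consistent[OF B(2) sub] by simp
  then show ?thesis
    using B subgroup.subgroup_is_group[OF sub P.is_group]
    by (auto simp: finitely_generated_group_def)
qed

section \<open>Virtual products of free groups\<close>

lemma is_free_group_commute_trans:
  assumes "is_free_group A" "w \<in> carrier A" "x \<in> carrier A" "y \<in> carrier A" "w \<noteq> \<one>\<^bsub>A\<^esub>"
    and "w \<otimes>\<^bsub>A\<^esub> x = x \<otimes>\<^bsub>A\<^esub> w" "w \<otimes>\<^bsub>A\<^esub> y = y \<otimes>\<^bsub>A\<^esub> w"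
  shows "x \<otimes>\<^bsub>A\<^esub> y = y \<otimes>\<^bsub>A\<^esub> x"
proof -
  interpret A: group A using assms(1) by (simp add: is_free_group_def)
  obtain S :: "'a set" and h where h: "h \<in> iso A (free_group S)"
    using assms(1) by (auto simp: is_free_group_def is_iso_def)
  interpret h: group_hom A "free_group S" h
    using h by (simp add: group_hom_def group_hom_axioms_def A.is_group iso_imp_homomorphism)
  have inj: "inj_on h (carrier A)" using h by (simp add: iso_iff)
  have "h w \<noteq> \<one>\<^bsub>free_group S\<^esub>"
    using inj_onD[OF inj, of w "\<one>\<^bsub>A\<^esub>"] assms(2,5) by auto
  moreover have "h w \<otimes>\<^bsub>free_group S\<^esub> h x = h x \<otimes>\<^bsub>free_group S\<^esub> h w"
    "h w \<otimes>\<^bsub>free_group S\<^esub> h y = h y \<otimes>\<^bsub>free_group S\<^esub> h w"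
    using arg_cong[OF assms(6), of h] arg_cong[OF assms(7), of h] assms(2-4) by simp_all
  ultimately have "h x \<otimes>\<^bsub>free_group S\<^esub> h y = h y \<otimes>\<^bsub>free_group S\<^esub> h x"
    using free_group_commute_trans[OF h.hom_closed[OF assms(2)] h.hom_closed[OF assms(3)]
        h.hom_closed[OF assms(4)]] by blast
  then show ?thesis
    using assms(2-4) inj_onD[OF inj, of "x \<otimes>\<^bsub>A\<^esub> y" "y \<otimes>\<^bsub>A\<^esub> x"] by simp
qed

lemma (in group) finite_index_pow_mem:
  assumes K: "subgroup K G" "finite (rcosets K)" and x: "x \<in> carrier G"
  obtains n :: nat where "n > 0" "x [^] n \<in> K"
proof -
  have "finite ((\<lambda>n::nat. K #> x [^] n) ` UNIV)"
    using K(2) x by (auto simp: finite_image_rcosets elim!: rev_finite_subset)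
  then have "\<not> inj (\<lambda>n::nat. K #> x [^] n)"
    using finite_imageD infinite_UNIV_nat by blast
  then obtain i j :: nat where ij: "i < j" "K #> x [^] j = K #> x [^] i"
    by (metis (mono_tags, lifting) injI linorder_neqE_nat)
  have "x [^] j \<otimes> inv (x [^] i) \<in> K"
    using rcoset_eq_iff[OF K(1), of "x [^] j" "x [^] i"] x ij(2) by simp
  moreover have "x [^] j = x [^] (j - i) \<otimes> x [^] i"
    using x ij(1) by (simp add: nat_pow_mult)
  ultimately have "x [^] (j - i) \<in> K"
    using x by (simp add: m_assoc)
  with that ij(1) show ?thesis by (meson zero_less_diff)
qed

text \<open>Lets noncommuting elements descend to a subgroup of finite index. Nontrivial powers have
  no larger centralizers, by transitivity of commuting and torsion-freeness.\<close>

lemma free_pow_noncommuting: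
  assumes "x \<in> carrier (free_group S)" "y \<in> carrier (free_group S)" "n > 0" "m > 0"
    and "x \<otimes>\<^bsub>free_group S\<^esub> y \<noteq> y \<otimes>\<^bsub>free_group S\<^esub> x"
  shows "x [^]\<^bsub>free_group S\<^esub> (n :: nat) \<otimes>\<^bsub>free_group S\<^esub> y [^]\<^bsub>free_group S\<^esub> (m :: nat) \<noteq>
    y [^]\<^bsub>free_group S\<^esub> m \<otimes>\<^bsub>free_group S\<^esub> x [^]\<^bsub>free_group S\<^esub> n"
proof
  let ?F = "free_group S"
  assume comm: "x [^]\<^bsub>?F\<^esub> n \<otimes>\<^bsub>?F\<^esub> y [^]\<^bsub>?F\<^esub> m = y [^]\<^bsub>?F\<^esub> m \<otimes>\<^bsub>?F\<^esub> x [^]\<^bsub>?F\<^esub> n"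
  have ne: "x \<noteq> \<one>\<^bsub>?F\<^esub>" "y \<noteq> \<one>\<^bsub>?F\<^esub>" using assms by auto
  have pow_ne: "x [^]\<^bsub>?F\<^esub> n \<noteq> \<one>\<^bsub>?F\<^esub>" "y [^]\<^bsub>?F\<^esub> m \<noteq> \<one>\<^bsub>?F\<^esub>"
    using free_group_torsion_free assms ne by blast+
  have pow_comm: "z [^]\<^bsub>?F\<^esub> k \<otimes>\<^bsub>?F\<^esub> z = z \<otimes>\<^bsub>?F\<^esub> z [^]\<^bsub>?F\<^esub> k" if "z \<in> carrier ?F" for z and k :: nat
    using free.nat_pow_Suc2[OF that, of k] by simp
  have "y [^]\<^bsub>?F\<^esub> m \<otimes>\<^bsub>?F\<^esub> x = x \<otimes>\<^bsub>?F\<^esub> y [^]\<^bsub>?F\<^esub> m"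
    using free_group_commute_trans[OF _ _ _ pow_ne(1) comm pow_comm[OF assms(1)]] assms(1,2)
    by simp
  then have "x \<otimes>\<^bsub>?F\<^esub> y = y \<otimes>\<^bsub>?F\<^esub> x"
    using free_group_commute_trans[OF _ _ _ pow_ne(2) _ pow_comm[OF assms(2)]] assms(1,2)
    by simp
  with assms(5) show False ..
qed

text \<open>Since commuting is transitive away from the identity in free groups, one of two commuting
  subgroups that together project onto a nonabelian subgroup of a free group has trivial projection.\<close>

lemma commuting_images:
  assumes F: "is_free_group F" and h: "group_hom P F h"
    and A: "A \<subseteq> carrier P" and B: "B \<subseteq> carrier P"
    and comm: "\<And>a b. a \<in> A \<Longrightarrow> b \<in> B \<Longrightarrow> a \<otimes>\<^bsub>P\<^esub> b = b \<otimes>\<^bsub>P\<^esub> a"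
    and K: "\<And>k. k \<in> K \<longleftrightarrow> (\<exists>a\<in>A. \<exists>b\<in>B. k = a \<otimes>\<^bsub>P\<^esub> b)"
    and uv: "u \<in> K" "v \<in> K" "h u \<otimes>\<^bsub>F\<^esub> h v \<noteq> h v \<otimes>\<^bsub>F\<^esub> h u"
  shows "(\<forall>a\<in>A. h a = \<one>\<^bsub>F\<^esub>) \<or> (\<forall>b\<in>B. h b = \<one>\<^bsub>F\<^esub>)"
proof (rule ccontr)
  assume "\<not> ?thesis"
  then obtain a0 b0 where a0: "a0 \<in> A" "h a0 \<noteq> \<one>\<^bsub>F\<^esub>" and b0: "b0 \<in> B" "h b0 \<noteq> \<one>\<^bsub>F\<^esub>"
    by blast
  interpret F: group F using F by (simp add: is_free_group_def)
  interpret h: group_hom P F h by (rule h)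
  have hc: "h a \<in> carrier F" if "a \<in> A \<union> B" for a
    using that A B by auto
  have hab: "h a \<otimes>\<^bsub>F\<^esub> h b = h b \<otimes>\<^bsub>F\<^esub> h a" if "a \<in> A" "b \<in> B" for a b
    using arg_cong[OF comm[OF that], of h] subsetD[OF A that(1)] subsetD[OF B that(2)] by simp
  have hA: "h a \<otimes>\<^bsub>F\<^esub> h a' = h a' \<otimes>\<^bsub>F\<^esub> h a" if "a \<in> A" "a' \<in> A" for a a'
    using is_free_group_commute_trans[OF F _ _ _ b0(2), of "h a" "h a'"] hc
      hab[OF that(1) b0(1)] hab[OF that(2) b0(1)] that b0 by simp
  have hB: "h b \<otimes>\<^bsub>F\<^esub> h b' = h b' \<otimes>\<^bsub>F\<^esub> h b" if "b \<in> B" "b' \<in> B" for b b'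
    using is_free_group_commute_trans[OF F _ _ _ a0(2), of "h b" "h b'"] hc
      hab[OF a0(1) that(1)] hab[OF a0(1) that(2)] that a0 by simp
  obtain a b a' b' where ab: "a \<in> A" "b \<in> B" "u = a \<otimes>\<^bsub>P\<^esub> b" "a' \<in> A" "b' \<in> B" "v = a' \<otimes>\<^bsub>P\<^esub> b'"
    using uv(1,2) K by blast
  have abP: "a \<in> carrier P" "b \<in> carrier P" "a' \<in> carrier P" "b' \<in> carrier P"
    using ab A B by auto
  have "h u \<otimes>\<^bsub>F\<^esub> h v = h a \<otimes>\<^bsub>F\<^esub> (h b \<otimes>\<^bsub>F\<^esub> h a') \<otimes>\<^bsub>F\<^esub> h b'"
    using abP by (simp add: ab F.m_assoc)
  also have "\<dots> = (h a \<otimes>\<^bsub>F\<^esub> h a') \<otimes>\<^bsub>F\<^esub> (h b \<otimes>\<^bsub>F\<^esub> h b')"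
    using abP by (simp add: F.m_assoc flip: hab[OF ab(4,2)])
  also have "\<dots> = (h a' \<otimes>\<^bsub>F\<^esub> h a) \<otimes>\<^bsub>F\<^esub> (h b' \<otimes>\<^bsub>F\<^esub> h b)"
    by (simp only: hA[OF ab(1,4)] hB[OF ab(2,5)])
  also have "\<dots> = h a' \<otimes>\<^bsub>F\<^esub> (h a \<otimes>\<^bsub>F\<^esub> h b') \<otimes>\<^bsub>F\<^esub> h b"
    using abP by (simp add: F.m_assoc)
  also have "\<dots> = h a' \<otimes>\<^bsub>F\<^esub> (h b' \<otimes>\<^bsub>F\<^esub> h a) \<otimes>\<^bsub>F\<^esub> h b"
    by (simp only: hab[OF ab(1,5)])
  also have "\<dots> = h v \<otimes>\<^bsub>F\<^esub> h u"
    using abP by (simp add: ab F.m_assoc)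
  finally show False using uv(3) by blast
qed

text \<open>In each coordinate one of \<open>A\<close> and \<open>B\<close> projects trivially. It
  cannot be the same one in both, for then \<open>K\<close> would lie in the other; but commuting is
  transitive there, whereas in \<open>K\<close> the element \<open>(1, x')\<close> commutes with
  \<open>(x, 1)\<close> and \<open>(y, 1)\<close>, which do not commute. Hence \<open>A\<close> and
  \<open>B\<close> are the coordinate parts of \<open>K\<close>.\<close>

lemma commuting_factors:
  assumes F: "is_free_group F1" "is_free_group F2" and P: "P = F1 \<times>\<times> F2"
    and A: "A \<subseteq> carrier P" "\<one>\<^bsub>P\<^esub> \<in> A" and B: "B \<subseteq> carrier P" "\<one>\<^bsub>P\<^esub> \<in> B"
    and comm: "\<And>a b. a \<in> A \<Longrightarrow> b \<in> B \<Longrightarrow> a \<otimes>\<^bsub>P\<^esub> b = b \<otimes>\<^bsub>P\<^esub> a"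
    and K: "\<And>k. k \<in> K \<longleftrightarrow> (\<exists>a\<in>A. \<exists>b\<in>B. k = a \<otimes>\<^bsub>P\<^esub> b)"
    and transA: "\<And>w x y. w \<in> A \<Longrightarrow> x \<in> A \<Longrightarrow> y \<in> A \<Longrightarrow> w \<noteq> \<one>\<^bsub>P\<^esub> \<Longrightarrow>
      w \<otimes>\<^bsub>P\<^esub> x = x \<otimes>\<^bsub>P\<^esub> w \<Longrightarrow> w \<otimes>\<^bsub>P\<^esub> y = y \<otimes>\<^bsub>P\<^esub> w \<Longrightarrow> x \<otimes>\<^bsub>P\<^esub> y = y \<otimes>\<^bsub>P\<^esub> x"
    and transB: "\<And>w x y. w \<in> B \<Longrightarrow> x \<in> B \<Longrightarrow> y \<in> B \<Longrightarrow> w \<noteq> \<one>\<^bsub>P\<^esub> \<Longrightarrow>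
      w \<otimes>\<^bsub>P\<^esub> x = x \<otimes>\<^bsub>P\<^esub> w \<Longrightarrow> w \<otimes>\<^bsub>P\<^esub> y = y \<otimes>\<^bsub>P\<^esub> w \<Longrightarrow> x \<otimes>\<^bsub>P\<^esub> y = y \<otimes>\<^bsub>P\<^esub> x"
    and x: "(x, \<one>\<^bsub>F2\<^esub>) \<in> K" "(y, \<one>\<^bsub>F2\<^esub>) \<in> K" "x \<otimes>\<^bsub>F1\<^esub> y \<noteq> y \<otimes>\<^bsub>F1\<^esub> x"
    and x': "(\<one>\<^bsub>F1\<^esub>, x') \<in> K" "(\<one>\<^bsub>F1\<^esub>, y') \<in> K" "x' \<otimes>\<^bsub>F2\<^esub> y' \<noteq> y' \<otimes>\<^bsub>F2\<^esub> x'"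
    and k: "k \<in> K"
  shows "(fst k, \<one>\<^bsub>F2\<^esub>) \<in> K"
proof -
  interpret F1: group F1 using F(1) by (simp add: is_free_group_def)
  interpret F2: group F2 using F(2) by (simp add: is_free_group_def)
  interpret P: group P unfolding P by (rule DirProd_group[OF F1.is_group F2.is_group])
  have fst_hom: "group_hom P F1 fst"
    using P.is_group F1.is_group by (auto simp: group_hom_def group_hom_axioms_def hom_def P)
  have snd_hom: "group_hom P F2 snd"
    using P.is_group F2.is_group by (auto simp: group_hom_def group_hom_axioms_def hom_def P)
  have proj1: "(\<forall>a\<in>A. fst a = \<one>\<^bsub>F1\<^esub>) \<or> (\<forall>b\<in>B. fst b = \<one>\<^bsub>F1\<^esub>)"
    by (rule commuting_images[OF F(1) fst_hom A(1) B(1) comm K x(1,2)]) (use x(3) in simp_all)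
  have proj2: "(\<forall>a\<in>A. snd a = \<one>\<^bsub>F2\<^esub>) \<or> (\<forall>b\<in>B. snd b = \<one>\<^bsub>F2\<^esub>)"
    by (rule commuting_images[OF F(2) snd_hom A(1) B(1) comm K x'(1,2)]) (use x'(3) in simp_all)
  have one_P: "\<one>\<^bsub>P\<^esub> = (\<one>\<^bsub>F1\<^esub>, \<one>\<^bsub>F2\<^esub>)" by (simp add: P)
  have KP: "K \<subseteq> carrier P"
  proof
    fix k assume "k \<in> K"
    then obtain a b where "a \<in> A" "b \<in> B" "k = a \<otimes>\<^bsub>P\<^esub> b" unfolding K by blast
    then show "k \<in> carrier P"
      using P.m_closed[of a b] A(1) B(1) by blast
  qed
  have xF: "x \<in> carrier F1" "y \<in> carrier F1" "x' \<in> carrier F2" "y' \<in> carrier F2"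
    using x(1,2) x'(1,2) KP by (auto simp: P)
  have x'1: "(\<one>\<^bsub>F1\<^esub>, x') \<noteq> \<one>\<^bsub>P\<^esub>"
    using x'(3) xF by (auto simp: one_P)
  have comm_x: "(\<one>\<^bsub>F1\<^esub>, x') \<otimes>\<^bsub>P\<^esub> (z, \<one>\<^bsub>F2\<^esub>) = (z, \<one>\<^bsub>F2\<^esub>) \<otimes>\<^bsub>P\<^esub> (\<one>\<^bsub>F1\<^esub>, x')" if "z \<in> carrier F1" for z
    using that xF by (simp add: P)
  have nc: "(x, \<one>\<^bsub>F2\<^esub>) \<otimes>\<^bsub>P\<^esub> (y, \<one>\<^bsub>F2\<^esub>) \<noteq> (y, \<one>\<^bsub>F2\<^esub>) \<otimes>\<^bsub>P\<^esub> (x, \<one>\<^bsub>F2\<^esub>)"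
    using x(3) by (simp add: P)
  have "\<not> K \<subseteq> A"
    using transA[OF _ _ _ x'1 comm_x[OF xF(1)] comm_x[OF xF(2)]] x x' nc by blast
  moreover have "\<not> K \<subseteq> B"
    using transB[OF _ _ _ x'1 comm_x[OF xF(1)] comm_x[OF xF(2)]] x x' nc by blast
  moreover have "K \<subseteq> B" if "\<forall>a\<in>A. a = \<one>\<^bsub>P\<^esub>"
  proof
    fix k assume "k \<in> K"
    then obtain a b where "a \<in> A" "b \<in> B" "k = a \<otimes>\<^bsub>P\<^esub> b" unfolding K by blast
    with that B(1) show "k \<in> B" by (metis P.l_one subsetD)
  qed
  moreover have "K \<subseteq> A" if "\<forall>b\<in>B. b = \<one>\<^bsub>P\<^esub>"
  proof
    fix k assume "k \<in> K"
    then obtain a b where "a \<in> A" "b \<in> B" "k = a \<otimes>\<^bsub>P\<^esub> b" unfolding K by blast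
    with that A(1) show "k \<in> A" by (metis P.r_one subsetD)
  qed
  ultimately consider "\<forall>a\<in>A. fst a = \<one>\<^bsub>F1\<^esub>" "\<forall>b\<in>B. snd b = \<one>\<^bsub>F2\<^esub>"
    | "\<forall>a\<in>A. snd a = \<one>\<^bsub>F2\<^esub>" "\<forall>b\<in>B. fst b = \<one>\<^bsub>F1\<^esub>"
    using proj1 proj2 by (auto simp: one_P prod_eq_iff)
  then show ?thesis
  proof cases
    case 1
    obtain a b where ab: "a \<in> A" "b \<in> B" "k = a \<otimes>\<^bsub>P\<^esub> b" using k K by blast
    then have "(fst k, \<one>\<^bsub>F2\<^esub>) = \<one>\<^bsub>P\<^esub> \<otimes>\<^bsub>P\<^esub> b"
      using 1 A B by (auto simp: P mult_DirProd' prod_eq_iff subset_iff)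
    then show ?thesis using K A(2) ab(2) by blast
  next
    case 2
    obtain a b where ab: "a \<in> A" "b \<in> B" "k = a \<otimes>\<^bsub>P\<^esub> b" using k K by blast
    then have "(fst k, \<one>\<^bsub>F2\<^esub>) = a \<otimes>\<^bsub>P\<^esub> \<one>\<^bsub>P\<^esub>"
      using 2 A B by (auto simp: P mult_DirProd' prod_eq_iff subset_iff)
    then show ?thesis using K B(2) ab(1) by blast
  qed
qed

lemma not_virtually_product:
  fixes S1 :: "'a set" and S2 :: "'b set"
  defines "F1 \<equiv> free_group S1" and "F2 \<equiv> free_group S2"
  assumes G: "subgroup G (F1 \<times>\<times> F2)"
    and x: "(x, \<one>\<^bsub>F2\<^esub>) \<in> G" "(y, \<one>\<^bsub>F2\<^esub>) \<in> G" "x \<otimes>\<^bsub>F1\<^esub> y \<noteq> y \<otimes>\<^bsub>F1\<^esub> x"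
    and x': "(\<one>\<^bsub>F1\<^esub>, x') \<in> G" "(\<one>\<^bsub>F1\<^esub>, y') \<in> G" "x' \<otimes>\<^bsub>F2\<^esub> y' \<noteq> y' \<otimes>\<^bsub>F2\<^esub> x'"
    and inf: "\<And>T. finite T \<Longrightarrow> T \<subseteq> fst ` G \<Longrightarrow> \<exists>g\<in>G. \<forall>t\<in>T. (fst g \<otimes>\<^bsub>F1\<^esub> inv\<^bsub>F1\<^esub> t, \<one>\<^bsub>F2\<^esub>) \<notin> G"
  shows "\<not> virtually_product_of_two_free_groups ((F1 \<times>\<times> F2)\<lparr>carrier := G\<rparr>)"
proof
  define P where "P = F1 \<times>\<times> F2"
  define PG where "PG = P\<lparr>carrier := G\<rparr>"
  interpret F1: group F1 by (simp add: F1_def free.is_group)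
  interpret F2: group F2 by (simp add: F2_def free.is_group)
  interpret P: group P unfolding P_def by (rule DirProd_group[OF F1.is_group F2.is_group])
  have F1_free: "is_free_group F1" and F2_free: "is_free_group F2"
    unfolding F1_def F2_def by (rule is_free_groupI[OF free.is_group iso_refl])+
  have GP: "subgroup G P" using G by (simp add: P_def)
  interpret PG: group PG unfolding PG_def by (rule subgroup.subgroup_is_group[OF GP P.is_group])
  have GF: "G \<subseteq> carrier F1 \<times> carrier F2" using subgroup.subset[OF G] by simp
  assume "virtually_product_of_two_free_groups ((F1 \<times>\<times> F2)\<lparr>carrier := G\<rparr>)"
  then obtain K and A B :: "('a word \<times> 'b word) monoid" where K: "subgroup K PG" "finite (rcosets\<^bsub>PG\<^esub> K)"
    and AB: "is_free_group A" "is_free_group B" and iso: "PG\<lparr>carrier := K\<rparr> \<cong> A \<times>\<times> B"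
    by (auto simp: virtually_product_of_two_free_groups_def finite_index_def PG_def P_def)
  interpret A: group A using AB(1) by (simp add: is_free_group_def)
  interpret B: group B using AB(2) by (simp add: is_free_group_def)
  interpret AB: group "A \<times>\<times> B" by (rule DirProd_group[OF A.is_group B.is_group])
  have KG: "K \<subseteq> G" using subgroup.subset[OF K(1)] by (simp add: PG_def)
  interpret PK: group "PG\<lparr>carrier := K\<rparr>"
    by (rule subgroup.subgroup_is_group[OF K(1) PG.is_group])
  obtain h where h: "h \<in> iso (A \<times>\<times> B) (PG\<lparr>carrier := K\<rparr>)"
    using PK.iso_sym[OF iso] by (auto simp: is_iso_def)
  interpret h: group_hom "A \<times>\<times> B" "PG\<lparr>carrier := K\<rparr>" h
    using h by (simp add: group_hom_def group_hom_axioms_def AB.is_group PK.is_group iso_imp_homomorphism)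
  have inj: "inj_on h (carrier A \<times> carrier B)" and surj: "h ` (carrier A \<times> carrier B) = K"
    using h by (auto simp: iso_iff)
  have h_mult: "h (a, b) \<otimes>\<^bsub>P\<^esub> h (a', b') = h (a \<otimes>\<^bsub>A\<^esub> a', b \<otimes>\<^bsub>B\<^esub> b')"
    if "a \<in> carrier A" "a' \<in> carrier A" "b \<in> carrier B" "b' \<in> carrier B" for a a' b b'
    using h.hom_mult[of "(a, b)" "(a', b')"] that by (simp add: PG_def)
  have h_one: "h (\<one>\<^bsub>A\<^esub>, \<one>\<^bsub>B\<^esub>) = \<one>\<^bsub>P\<^esub>"
    using h.hom_one by (simp add: PG_def)
  have h_closed: "h (a, b) \<in> K" if "a \<in> carrier A" "b \<in> carrier B" for a b
    using surj that by blast
  have h_eq: "h (a, b) = h (a', b') \<longleftrightarrow> a = a' \<and> b = b'"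
    if "a \<in> carrier A" "a' \<in> carrier A" "b \<in> carrier B" "b' \<in> carrier B" for a a' b b'
    using inj_on_eq_iff[OF inj, of "(a, b)" "(a', b')"] that by simp
  define A' B' where "A' = (\<lambda>a. h (a, \<one>\<^bsub>B\<^esub>)) ` carrier A" and "B' = (\<lambda>b. h (\<one>\<^bsub>A\<^esub>, b)) ` carrier B"
  have fst_K: "(fst k, \<one>\<^bsub>F2\<^esub>) \<in> K" if k: "k \<in> K" for k
  proof -
    \<comment> \<open>Suitable powers of the given noncommuting elements land in \<open>K\<close>
      and still do not commute.\<close>
    have pow: "\<exists>n>0. z [^]\<^bsub>P\<^esub> (n :: nat) \<in> K" if "z \<in> G" for z
      using PG.finite_index_pow_mem[OF K, of z] that
      by (metis PG_def P.nat_pow_consistent partial_object.select_convs(1) partial_object.surjective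
          partial_object.update_convs(1))
    have pow_fst: "(z, \<one>\<^bsub>F2\<^esub>) [^]\<^bsub>P\<^esub> (n :: nat) = (z [^]\<^bsub>F1\<^esub> n, \<one>\<^bsub>F2\<^esub>)" for z n
      by (induction n) (simp_all add: P_def)
    have pow_snd: "(\<one>\<^bsub>F1\<^esub>, z) [^]\<^bsub>P\<^esub> (n :: nat) = (\<one>\<^bsub>F1\<^esub>, z [^]\<^bsub>F2\<^esub> n)" for z n
      by (induction n) (simp_all add: P_def)
    obtain n1 n2 n3 n4 :: nat where n: "n1 > 0" "(x [^]\<^bsub>F1\<^esub> n1, \<one>\<^bsub>F2\<^esub>) \<in> K"
      "n2 > 0" "(y [^]\<^bsub>F1\<^esub> n2, \<one>\<^bsub>F2\<^esub>) \<in> K" "n3 > 0" "(\<one>\<^bsub>F1\<^esub>, x' [^]\<^bsub>F2\<^esub> n3) \<in> K"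
      "n4 > 0" "(\<one>\<^bsub>F1\<^esub>, y' [^]\<^bsub>F2\<^esub> n4) \<in> K"
      using pow[OF x(1)] pow[OF x(2)] pow[OF x'(1)] pow[OF x'(2)] unfolding pow_fst pow_snd by metis
    have xF: "x \<in> carrier F1" "y \<in> carrier F1" "x' \<in> carrier F2" "y' \<in> carrier F2"
      using x(1,2) x'(1,2) GF by auto
    have nc: "x [^]\<^bsub>F1\<^esub> n1 \<otimes>\<^bsub>F1\<^esub> y [^]\<^bsub>F1\<^esub> n2 \<noteq> y [^]\<^bsub>F1\<^esub> n2 \<otimes>\<^bsub>F1\<^esub> x [^]\<^bsub>F1\<^esub> n1"
      "x' [^]\<^bsub>F2\<^esub> n3 \<otimes>\<^bsub>F2\<^esub> y' [^]\<^bsub>F2\<^esub> n4 \<noteq> y' [^]\<^bsub>F2\<^esub> n4 \<otimes>\<^bsub>F2\<^esub> x' [^]\<^bsub>F2\<^esub> n3"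
      using free_pow_noncommuting n(1,3,5,7) x(3) x'(3) xF unfolding F1_def F2_def by blast+
    show ?thesis
    proof (rule commuting_factors[OF F1_free F2_free P_def, where A = A' and B = B' and K = K])
      have "A' \<subseteq> K" "B' \<subseteq> K"
        unfolding A'_def B'_def using h_closed by blast+
      then show "A' \<subseteq> carrier P" "B' \<subseteq> carrier P"
        using KG subgroup.subset[OF GP] by blast+
      show "\<one>\<^bsub>P\<^esub> \<in> A'" "\<one>\<^bsub>P\<^esub> \<in> B'"
        using h_one by (auto simp: A'_def B'_def image_iff intro: bexI[of _ "\<one>\<^bsub>A\<^esub>"] bexI[of _ "\<one>\<^bsub>B\<^esub>"])
      show "a \<otimes>\<^bsub>P\<^esub> b = b \<otimes>\<^bsub>P\<^esub> a" if "a \<in> A'" "b \<in> B'" for a b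
        using that by (auto simp: A'_def B'_def h_mult)
      show "k \<in> K \<longleftrightarrow> (\<exists>a\<in>A'. \<exists>b\<in>B'. k = a \<otimes>\<^bsub>P\<^esub> b)" for k
        unfolding surj[symmetric] by (force simp: A'_def B'_def h_mult)
      show "u \<otimes>\<^bsub>P\<^esub> v = v \<otimes>\<^bsub>P\<^esub> u" if *: "w \<in> A'" "u \<in> A'" "v \<in> A'" "w \<noteq> \<one>\<^bsub>P\<^esub>"
        "w \<otimes>\<^bsub>P\<^esub> u = u \<otimes>\<^bsub>P\<^esub> w" "w \<otimes>\<^bsub>P\<^esub> v = v \<otimes>\<^bsub>P\<^esub> w" for w u v
      proof -
        obtain a b c where abc: "a \<in> carrier A" "b \<in> carrier A" "c \<in> carrier A"
          "w = h (a, \<one>\<^bsub>B\<^esub>)" "u = h (b, \<one>\<^bsub>B\<^esub>)" "v = h (c, \<one>\<^bsub>B\<^esub>)"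
          using *(1-3) by (auto simp: A'_def)
        have "a \<otimes>\<^bsub>A\<^esub> b = b \<otimes>\<^bsub>A\<^esub> a" "a \<otimes>\<^bsub>A\<^esub> c = c \<otimes>\<^bsub>A\<^esub> a"
          using *(5,6) abc by (simp_all add: h_mult h_eq)
        moreover have "a \<noteq> \<one>\<^bsub>A\<^esub>" using *(4) h_one abc(4) by blast
        ultimately have "b \<otimes>\<^bsub>A\<^esub> c = c \<otimes>\<^bsub>A\<^esub> b"
          using is_free_group_commute_trans[OF AB(1) abc(1-3)] by blast
        then show ?thesis using abc by (simp add: h_mult)
      qed
      show "u \<otimes>\<^bsub>P\<^esub> v = v \<otimes>\<^bsub>P\<^esub> u" if *: "w \<in> B'" "u \<in> B'" "v \<in> B'" "w \<noteq> \<one>\<^bsub>P\<^esub>"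
        "w \<otimes>\<^bsub>P\<^esub> u = u \<otimes>\<^bsub>P\<^esub> w" "w \<otimes>\<^bsub>P\<^esub> v = v \<otimes>\<^bsub>P\<^esub> w" for w u v
      proof -
        obtain a b c where abc: "a \<in> carrier B" "b \<in> carrier B" "c \<in> carrier B"
          "w = h (\<one>\<^bsub>A\<^esub>, a)" "u = h (\<one>\<^bsub>A\<^esub>, b)" "v = h (\<one>\<^bsub>A\<^esub>, c)"
          using *(1-3) by (auto simp: B'_def)
        have "a \<otimes>\<^bsub>B\<^esub> b = b \<otimes>\<^bsub>B\<^esub> a" "a \<otimes>\<^bsub>B\<^esub> c = c \<otimes>\<^bsub>B\<^esub> a"
          using *(5,6) abc by (simp_all add: h_mult h_eq)
        moreover have "a \<noteq> \<one>\<^bsub>B\<^esub>" using *(4) h_one abc(4) by blast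
        ultimately have "b \<otimes>\<^bsub>B\<^esub> c = c \<otimes>\<^bsub>B\<^esub> b"
          using is_free_group_commute_trans[OF AB(2) abc(1-3)] by blast
        then show ?thesis using abc by (simp add: h_mult)
      qed
    qed (use n nc k in auto)
  qed
  obtain T where T: "finite T" "T \<subseteq> carrier PG"
    "\<And>g. g \<in> carrier PG \<Longrightarrow> \<exists>l\<in>K. \<exists>t\<in>T. g = l \<otimes>\<^bsub>PG\<^esub> t"
    using PG.finite_index_reps[OF K] by blast
  have TG: "T \<subseteq> G" using T(2) by (simp add: PG_def)
  obtain g where g: "g \<in> G" "\<forall>t\<in>fst ` T. (fst g \<otimes>\<^bsub>F1\<^esub> inv\<^bsub>F1\<^esub> t, \<one>\<^bsub>F2\<^esub>) \<notin> G"
    using inf[of "fst ` T"] T(1) TG by blast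
  obtain l t where lt: "l \<in> K" "t \<in> T" "g = l \<otimes>\<^bsub>PG\<^esub> t"
    using T(3)[of g] g(1) by (auto simp: PG_def)
  have closed: "fst l \<in> carrier F1" "fst t \<in> carrier F1" using lt KG TG GF by auto
  have "fst g = fst l \<otimes>\<^bsub>F1\<^esub> fst t"
    by (simp add: lt(3) PG_def P_def mult_DirProd')
  then have "fst g \<otimes>\<^bsub>F1\<^esub> inv\<^bsub>F1\<^esub> fst t = fst l"
    using closed by (simp add: F1.m_assoc)
  then show False
    using g(2) lt(2) fst_K[OF lt(1)] KG by (metis image_eqI subsetD)
qed

text \<open>In the cyclic cover in which the letter 0 moves the vertices and the letter 1 fixes
  them, the loops labelled 1 belong to the basis of the stabilizer. Degree \<open>Suc n\<close>
  provides at least \<open>n\<close> of them and is positive also for \<open>n = 0\<close>.\<close>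

lemma free_group_embeds_rank_2:
  obtains \<iota> where "\<iota> \<in> hom (free_group {..<n :: nat}) (free_group {..<2 :: nat})"
    "inj_on \<iota> (carrier (free_group {..<n}))"
proof -
  interpret cyclic_cover "{..<2 :: nat}" 0 "\<lambda>x. if x = 0 then 1 else 0" "Suc n"
    by standard auto
  \<comment> \<open>The loop labelled 1 at the vertex \<open>i\<close>. Its generator has exponent
    sum 1 in the letter 1 and is therefore nontrivial.\<close>
  define f :: "nat \<Rightarrow> int \<times> nat" where "f i = (int i, 1)" for i
  have f_inj: "inj_on f {..<n}" by (auto simp: f_def inj_on_def)
  have f_B: "f ` {..<n} \<subseteq> B"
  proof
    fix e assume "e \<in> f ` {..<n}"
    then obtain i where i: "i < n" "e = (int i, 1)" by (auto simp: f_def)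
    have d: "\<delta> (int i) (1, True) = int i" using i by (simp add: \<delta>_def)
    have "weight (\<lambda>x. if x = 1 then 1 else 0) (gen e) = 1"
      using i d rep_closed'[of "int i"] by (simp add: gen_def weight_mult weight_inv)
    then have "gen e \<noteq> \<one>\<^bsub>F\<^esub>" by (auto simp: one_free_group)
    then show "e \<in> B" using i unfolding B_def by auto
  qed
  let ?r = "map (apfst f)"
  have r: "?r \<in> iso (free_group {..<n}) (free_group (f ` {..<n}))"
    by (rule free_group_relabel[OF f_inj])
  have r_hom: "?r \<in> hom (free_group {..<n}) E"
    using Group.hom_compose[OF iso_imp_homomorphism[OF r] free_group_inclusion[OF f_B]]
    by (simp add: comp_def)
  interpret L: group "F\<lparr>carrier := stab\<rparr>"
    by (rule subgroup.subgroup_is_group[OF subgroup_stab free.is_group])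
  define k where "k = inv_into stab (rho 0)"
  have k: "k \<in> iso E (F\<lparr>carrier := stab\<rparr>)"
    using L.iso_set_sym[OF rho_iso] by (simp add: k_def)
  have incl: "(\<lambda>w. w) \<in> hom (F\<lparr>carrier := stab\<rparr>) F"
    using subgroup.subset[OF subgroup_stab] by (auto simp: hom_def)
  have k_hom: "k \<in> hom E F"
    using Group.hom_compose[OF iso_imp_homomorphism[OF k] incl] by (simp add: comp_def)
  have "k \<circ> ?r \<in> hom (free_group {..<n}) F"
    by (rule Group.hom_compose[OF r_hom k_hom])
  moreover have "inj_on (k \<circ> ?r) (carrier (free_group {..<n}))"
  proof (rule comp_inj_on)
    show "inj_on ?r (carrier (free_group {..<n}))" using r by (simp add: iso_iff)
    have "?r ` carrier (free_group {..<n}) \<subseteq> carrier E"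
      using r_hom by (auto simp: hom_def)
    moreover have "inj_on k (carrier E)" using k by (simp add: iso_iff)
    ultimately show "inj_on k (?r ` carrier (free_group {..<n}))"
      using inj_on_subset by blast
  qed
  ultimately show ?thesis using that by blast
qed

section \<open>From presentations to subgroups of a product of free groups\<close>

lemma (in group) normal_closure_normal:
  assumes "R \<subseteq> carrier G"
  shows "normal_closure G R \<lhd> G"
proof -
  have "carrier G \<lhd> G"
    by (rule normal_invI[OF subgroup_self]) simp
  then have ne: "carrier G \<in> {N. N \<lhd> G \<and> R \<subseteq> N}" using assms by simp
  show ?thesis
  proof (rule normal_invI)
    show "subgroup (normal_closure G R) G"
      unfolding normal_closure_def using ne
      by (intro subgroups_Inter) (auto dest: normal_imp_subgroup)
  qed (auto simp: normal_closure_def intro: normal.inv_op_closed2)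
qed

lemma (in group) FactGroup_iso_hom:
  assumes N: "N \<lhd> G" and Q: "group Q" "Q \<cong> G Mod N"
  obtains \<psi> where "\<psi> \<in> hom G Q" "\<psi> ` carrier G = carrier Q"
    "\<And>x. x \<in> carrier G \<Longrightarrow> \<psi> x = \<one>\<^bsub>Q\<^esub> \<longleftrightarrow> x \<in> N"
proof -
  interpret N: normal N G by fact
  interpret Q: group Q by fact
  interpret M: group "G Mod N" by (rule N.factorgroup_is_group)
  interpret q: group_hom G "G Mod N" "\<lambda>x. N #> x" by (rule rcoset_hom[OF N])
  obtain h where h: "h \<in> iso (G Mod N) Q"
    using Q.iso_sym[OF Q(2)] by (auto simp: is_iso_def)
  then interpret h: group_hom "G Mod N" Q h
    by (simp add: group_hom_def group_hom_axioms_def M.is_group Q.is_group iso_imp_homomorphism)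
  show ?thesis
  proof (rule that[of "\<lambda>x. h (N #> x)"])
    show "(\<lambda>x. h (N #> x)) \<in> hom G Q"
      using Group.hom_compose[OF q.homh h.homh] by (simp add: comp_def)
    have "(\<lambda>x. h (N #> x)) ` carrier G = h ` carrier (G Mod N)"
      by (auto simp: carrier_FactGroup)
    then show "(\<lambda>x. h (N #> x)) ` carrier G = carrier Q"
      using h by (simp add: iso_iff)
    fix x assume x: "x \<in> carrier G"
    have "h (N #> x) = \<one>\<^bsub>Q\<^esub> \<longleftrightarrow> h (N #> x) = h (N #> \<one>)"
      using h.hom_one N.subset by simp
    also have "\<dots> \<longleftrightarrow> N #> x = N #> \<one>"
    proof (rule inj_on_eq_iff)
      show "inj_on h (carrier (G Mod N))" using h by (simp add: iso_iff)
      show "N #> x \<in> carrier (G Mod N)" "N #> \<one> \<in> carrier (G Mod N)"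
        unfolding carrier_FactGroup using x by blast+
    qed
    also have "\<dots> \<longleftrightarrow> x \<in> N"
      using rcoset_eq_iff[OF N.subgroup_axioms x one_closed] x by simp
    finally show "h (N #> x) = \<one>\<^bsub>Q\<^esub> \<longleftrightarrow> x \<in> N" .
  qed
qed

lemma finitely_generated_hom_image:
  assumes fg: "finitely_generated_group G" and "group H" "h \<in> hom G H" "h ` carrier G = carrier H"
  shows "finitely_generated_group H"
proof -
  obtain A where A: "finite A" "A \<subseteq> carrier G" "generate G A = carrier G" and "group G"
    using fg by (auto simp: finitely_generated_group_def)
  then interpret h: group_hom G H h
    using assms by (simp add: group_hom_def group_hom_axioms_def)
  have "generate H (h ` A) = carrier H"
    using h.generate_img[OF A(2)] A(3) assms(4) by simp
  moreover have "h ` A \<subseteq> carrier H" using A(2) by auto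
  ultimately show ?thesis
    using A(1) assms(2) by (auto simp: finitely_generated_group_def)
qed

lemma restrict_iso:
  assumes "group G" "group H" "h \<in> hom G H" "inj_on h K" "subgroup K G"
  shows "subgroup (h ` K) H" "h \<in> iso (G\<lparr>carrier := K\<rparr>) (H\<lparr>carrier := h ` K\<rparr>)"
proof -
  interpret h: group_hom G H h
    using assms by (simp add: group_hom_def group_hom_axioms_def)
  show "subgroup (h ` K) H" by (rule h.subgroup_img_is_subgroup[OF assms(5)])
  show "h \<in> iso (G\<lparr>carrier := K\<rparr>) (H\<lparr>carrier := h ` K\<rparr>)"
    using assms(4) subgroup.subset[OF assms(5)] by (auto simp: iso_iff hom_def subset_iff)
qed

text \<open>The fibre product over \<open>Q\<close> lives in the square of a free group whose rank
  depends on the presentation; embedding that group in rank 2 carries it into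
  \<open>H \<times> H\<close>. Noncommuting elements in the kernel and its infinite index prevent a
  virtual decomposition.\<close>

lemma subgroup_of_square:
  fixes Q :: "'q monoid" and p :: nat and H :: "nat word monoid"
  assumes p: "Factorial_Ring.prime p"
  defines "H \<equiv> free_group {..<2}"
  assumes Q: "group Q" "infinite (carrier Q)" "finitely_presented_group Q" "residually_finite Q" "p_group p Q"
  shows "\<exists>G. subgroup G (H \<times>\<times> H) \<and> finitely_generated_group ((H \<times>\<times> H)\<lparr>carrier := G\<rparr>) \<and>
          p_conjugacy_separable p ((H \<times>\<times> H)\<lparr>carrier := G\<rparr>) \<and>
          \<not> virtually_product_of_two_free_groups ((H \<times>\<times> H)\<lparr>carrier := G\<rparr>)"
proof -
  obtain n :: nat and R where R: "finite R" "R \<subseteq> carrier (free_group {..<n})"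
    and iso: "Q \<cong> free_group {..<n} Mod normal_closure (free_group {..<n}) R"
    using Q(3) by (auto simp: finitely_presented_group_def)
  define F where "F = free_group {..<n}"
  define N where "N = normal_closure F R"
  interpret F: group F by (simp add: F_def free.is_group)
  interpret Q: group Q by fact
  have N: "N \<lhd> F" unfolding N_def using R(2) by (intro F.normal_closure_normal) (simp add: F_def)
  interpret N: normal N F by (rule N)
  obtain \<psi> where \<psi>: "\<psi> \<in> hom F Q" "\<psi> ` carrier F = carrier Q"
    "\<And>x. x \<in> carrier F \<Longrightarrow> \<psi> x = \<one>\<^bsub>Q\<^esub> \<longleftrightarrow> x \<in> N"
    using F.FactGroup_iso_hom[OF N Q(1)] iso unfolding F_def N_def by blast
  interpret \<psi>: group_hom F Q \<psi>
    using \<psi>(1) by (simp add: group_hom_def group_hom_axioms_def F.is_group Q.is_group)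
  have tors: "\<exists>k. x [^]\<^bsub>F\<^esub> (p ^ k :: nat) \<in> N" if x: "x \<in> carrier F" for x
  proof -
    obtain k where "Q.ord (\<psi> x) = p ^ k"
      using Q(5) \<psi>.hom_closed[OF x] unfolding p_group_def by blast
    then have "\<psi> x [^]\<^bsub>Q\<^esub> (p ^ k :: nat) = \<one>\<^bsub>Q\<^esub>"
      using Q.pow_eq_id[OF \<psi>.hom_closed[OF x]] by simp
    then have "\<psi> (x [^]\<^bsub>F\<^esub> (p ^ k :: nat)) = \<one>\<^bsub>Q\<^esub>"
      using x by (simp add: \<psi>.hom_nat_pow)
    then show ?thesis
      using \<psi>(3) x by blast
  qed
  have rf: "\<exists>L. L \<lhd> F \<and> finite (rcosets\<^bsub>F\<^esub> L) \<and> N \<subseteq> L \<and> x \<notin> L" if x: "x \<in> carrier F" "x \<notin> N" for x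
  proof -
    have "\<psi> x \<in> carrier Q" "\<psi> x \<noteq> \<one>\<^bsub>Q\<^esub>" using x \<psi>(3) by auto
    then obtain M :: "nat monoid" and \<phi> where M: "group M" "finite (carrier M)" "\<phi> \<in> hom Q M" "\<phi> (\<psi> x) \<noteq> \<one>\<^bsub>M\<^esub>"
      using Q(4) unfolding residually_finite_def by blast
    interpret M: group M by fact
    interpret \<phi>: group_hom Q M \<phi>
      using M(3) by (simp add: group_hom_def group_hom_axioms_def M.is_group Q.is_group)
    have h: "(\<lambda>x. \<phi> (\<psi> x)) \<in> hom F M"
      using Group.hom_compose[OF \<psi>(1) M(3)] by (simp add: comp_def)
    let ?L = "{g \<in> carrier F. \<phi> (\<psi> g) \<in> {\<one>\<^bsub>M\<^esub>}}"
    have "finite (rcosets\<^bsub>M\<^esub> {\<one>\<^bsub>M\<^esub>})"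
      using M(2) by (simp add: M.finite_image_rcosets)
    then have "finite (rcosets\<^bsub>F\<^esub> ?L)"
      by (rule F.finite_index_vimage(2)[OF M(1) h M.triv_subgroup])
    moreover have "?L \<lhd> F"
      by (rule F.normal_vimage[OF M(1) h M.one_is_normal])
    moreover have "N \<subseteq> ?L"
    proof
      fix z assume "z \<in> N"
      then have "z \<in> carrier F" "\<psi> z = \<one>\<^bsub>Q\<^esub>" using \<psi>(3) by auto
      then show "z \<in> ?L" by simp
    qed
    ultimately show ?thesis using M(4) by blast
  qed
  have inf: "\<not> finite (rcosets\<^bsub>F\<^esub> N)"
  proof
    assume "finite (rcosets\<^bsub>F\<^esub> N)"
    then have "finite (carrier (F Mod N))" by (simp add: FactGroup_def)
    then show False
      using Q(2) iso_finite[OF iso] by (simp add: F_def N_def)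
  qed
  have pk: "(p ^ k :: nat) > 0" for k using p prime_gt_0_nat by simp
  \<comment> \<open>Otherwise the torsion of \<open>Q\<close> would be torsion in the free group
    \<open>F\<close>, which would be trivial, against the infinite index.\<close>
  have N_ne: "N \<noteq> {\<one>\<^bsub>F\<^esub>}"
  proof
    assume N1: "N = {\<one>\<^bsub>F\<^esub>}"
    have "x = \<one>\<^bsub>F\<^esub>" if "x \<in> carrier F" for x
      using tors[OF that] N1 free_group_torsion_free pk that unfolding F_def by blast
    then have "carrier F \<subseteq> {\<one>\<^bsub>F\<^esub>}" by blast
    then have "finite (carrier F)" using finite_subset by blast
    then show False using inf by (simp add: F.finite_image_rcosets)
  qed
  have n: "0 \<in> {..<n}" "1 \<in> {..<n}"
  proof -
    have "\<not> {..<n} \<subseteq> {0}"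
      using cyclic_free_group_finite_index[of "{..<n}" 0 N] N N_ne inf by (auto simp: F_def)
    then show "0 \<in> {..<n}" "1 \<in> {..<n}" by auto
  qed
  obtain x y where xy: "x \<in> N" "y \<in> N" "x \<otimes>\<^bsub>F\<^esub> y \<noteq> y \<otimes>\<^bsub>F\<^esub> x"
    using normal_noncommuting[OF n] N N_ne unfolding F_def by auto
  have xyF: "x \<in> carrier F" "y \<in> carrier F" using xy by auto
  obtain \<iota> where \<iota>: "\<iota> \<in> hom F H" "inj_on \<iota> (carrier F)"
    using free_group_embeds_rank_2[of n] unfolding F_def H_def by blast
  interpret H: group H by (simp add: H_def free.is_group)
  interpret \<iota>: group_hom F H \<iota>
    using \<iota>(1) by (simp add: group_hom_def group_hom_axioms_def F.is_group H.is_group)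
  define G0 where "G0 = fibre_product F N"
  have G0_iff: "(a, b) \<in> G0 \<longleftrightarrow> a \<in> carrier F \<and> b \<in> carrier F \<and> a \<otimes>\<^bsub>F\<^esub> inv\<^bsub>F\<^esub> b \<in> N" for a b
    by (simp add: G0_def fibre_product_def)
  interpret FF: group "F \<times>\<times> F" by (rule DirProd_group[OF F.is_group F.is_group])
  interpret HH: group "H \<times>\<times> H" by (rule DirProd_group[OF H.is_group H.is_group])
  have G0: "subgroup G0 (F \<times>\<times> F)" unfolding G0_def by (rule F.subgroup_fibre_product[OF N])
  define h where "h = (\<lambda>(a, b). (\<iota> a, \<iota> b))"
  have h_hom: "h \<in> hom (F \<times>\<times> F) (H \<times>\<times> H)"
    unfolding h_def using \<iota>(1) by (auto simp: hom_def)
  have h_inj: "inj_on h (carrier (F \<times>\<times> F))"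
    using \<iota>(2) by (auto simp: h_def inj_on_def)
  have h_inj': "inj_on h G0"
    using h_inj subgroup.subset[OF G0] inj_on_subset by blast
  define G where "G = h ` G0"
  note G = restrict_iso[OF FF.is_group HH.is_group h_hom h_inj' G0, folded G_def]
  interpret P0: group "(F \<times>\<times> F)\<lparr>carrier := G0\<rparr>"
    by (rule subgroup.subgroup_is_group[OF G0 FF.is_group])
  interpret PG: group "(H \<times>\<times> H)\<lparr>carrier := G\<rparr>"
    by (rule subgroup.subgroup_is_group[OF G(1) HH.is_group])
  have G_iff: "(\<iota> a, \<iota> b) \<in> G \<longleftrightarrow> (a, b) \<in> G0" if "a \<in> carrier F" "b \<in> carrier F" for a b
  proof -
    have "(\<iota> a, \<iota> b) \<in> G \<longleftrightarrow> h (a, b) \<in> h ` G0" by (simp add: G_def h_def)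
    also have "\<dots> \<longleftrightarrow> (a, b) \<in> G0"
      using that subgroup.subset[OF G0] by (intro inj_on_image_mem_iff[OF h_inj]) auto
    finally show ?thesis .
  qed
  have "finitely_generated_group ((F \<times>\<times> F)\<lparr>carrier := G0\<rparr>)"
    unfolding G0_def
  proof (rule F.finitely_generated_fibre_product)
    show "finite ((\<lambda>x. [(x, True)]) ` {..<n})" "(\<lambda>x. [(x, True)]) ` {..<n} \<subseteq> carrier F"
      by (auto simp: F_def free_letter)
    show "generate F ((\<lambda>x. [(x, True)]) ` {..<n}) = carrier F"
      unfolding F_def by (rule generate_free_group)
  qed (use R N N_def F_def in auto)
  then have "finitely_generated_group ((H \<times>\<times> H)\<lparr>carrier := G\<rparr>)"
    by (rule finitely_generated_hom_image[OF _ PG.is_group, where h = h])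
      (use G(2) in \<open>auto simp: iso_iff\<close>)
  moreover have "p_conjugacy_separable p ((F \<times>\<times> F)\<lparr>carrier := G0\<rparr>)"
    unfolding G0_def F_def
    by (rule fibre_product_p_conjugacy_separable[OF p]) (use N tors rf in \<open>simp_all add: F_def\<close>)
  then have "p_conjugacy_separable p ((H \<times>\<times> H)\<lparr>carrier := G\<rparr>)"
    by (rule p_conjugacy_separable_iso[OF p PG.is_group P0.is_group P0.iso_set_sym[OF G(2)]])
  moreover have "\<not> virtually_product_of_two_free_groups ((H \<times>\<times> H)\<lparr>carrier := G\<rparr>)"
  proof -
    have in1: "(\<iota> z, \<one>\<^bsub>H\<^esub>) \<in> G \<longleftrightarrow> z \<in> N" if "z \<in> carrier F" for z
      using G_iff[OF that F.one_closed] that by (simp add: G0_iff)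
    have in2: "(\<one>\<^bsub>H\<^esub>, \<iota> z) \<in> G" if "z \<in> N" for z
      using G_iff[OF F.one_closed N.mem_carrier[OF that]] that by (simp add: G0_iff)
    have nc: "\<iota> x \<otimes>\<^bsub>H\<^esub> \<iota> y \<noteq> \<iota> y \<otimes>\<^bsub>H\<^esub> \<iota> x"
      using xyF xy(3) inj_onD[OF \<iota>(2), of "x \<otimes>\<^bsub>F\<^esub> y" "y \<otimes>\<^bsub>F\<^esub> x"] by auto
    have fst_G: "fst ` G \<subseteq> \<iota> ` carrier F"
      using G0_iff by (force simp: G_def h_def)
    \<comment> \<open>A finite \<open>T\<close> without such a \<open>g\<close> would give finitely
      many representatives for all cosets of \<open>N\<close>, tested on the diagonal of the fibre
      product.\<close>
    have "\<exists>g\<in>G. \<forall>t\<in>T. (fst g \<otimes>\<^bsub>H\<^esub> inv\<^bsub>H\<^esub> t, \<one>\<^bsub>H\<^esub>) \<notin> G" if T: "finite T" "T \<subseteq> fst ` G" for T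
    proof (rule ccontr)
      assume *: "\<not> ?thesis"
      obtain T0 where T0: "T0 \<subseteq> carrier F" "finite T0" "T = \<iota> ` T0"
        using finite_subset_image[OF T(1), of \<iota> "carrier F"] T(2) fst_G by blast
      have "\<exists>t\<in>T0. N #>\<^bsub>F\<^esub> z = N #>\<^bsub>F\<^esub> t" if z: "z \<in> carrier F" for z
      proof -
        have "(\<iota> z, \<iota> z) \<in> G"
          using z G_iff[OF z z] N.one_closed by (simp add: G0_iff)
        then have "\<exists>t\<in>T. (\<iota> z \<otimes>\<^bsub>H\<^esub> inv\<^bsub>H\<^esub> t, \<one>\<^bsub>H\<^esub>) \<in> G"
          using * by force
        then obtain t where t: "t \<in> T0" "(\<iota> z \<otimes>\<^bsub>H\<^esub> inv\<^bsub>H\<^esub> \<iota> t, \<one>\<^bsub>H\<^esub>) \<in> G"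
          using T0(3) by blast
        then have tF: "t \<in> carrier F" using T0(1) by blast
        then have "z \<otimes>\<^bsub>F\<^esub> inv\<^bsub>F\<^esub> t \<in> N"
          using t(2) z in1[of "z \<otimes>\<^bsub>F\<^esub> inv\<^bsub>F\<^esub> t"] by simp
        then show ?thesis
          using t(1) z tF F.rcoset_eq_iff[OF N.subgroup_axioms] by blast
      qed
      then have "(\<lambda>z. N #>\<^bsub>F\<^esub> z) ` carrier F \<subseteq> (\<lambda>z. N #>\<^bsub>F\<^esub> z) ` T0" by blast
      then have "finite (rcosets\<^bsub>F\<^esub> N)"
        using T0(2) finite_subset unfolding F.finite_image_rcosets by blast
      with inf show False ..
    qed
    then show ?thesis
      unfolding H_def
      by (intro not_virtually_product[where x = "\<iota> x" and y = "\<iota> y" and x' = "\<iota> x" and y' = "\<iota> y"])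
        (use G(1) in1 in2 nc xy xyF in \<open>simp_all add: H_def\<close>)
  qed
  ultimately show ?thesis using G(1) by blast
qed

section \<open>From subgroups of a product of free groups to full subdirect products\<close>

text \<open>A group that embeds in one free factor is free, hence a product of a free group with the
  trivial one. This is what excludes trivial intersections with the factors.\<close>

lemma virtually_product_of_embedding:
  fixes H1 :: "'a monoid" and H2 :: "'b monoid"
  assumes "group H1" "group H2" and G: "subgroup G (H1 \<times>\<times> H2)"
    and h: "h \<in> hom (H1 \<times>\<times> H2) F" "inj_on h G" and F: "group F" "\<And>J. subgroup J F \<Longrightarrow> is_free_group (F\<lparr>carrier := J\<rparr>)"
  shows "virtually_product_of_two_free_groups ((H1 \<times>\<times> H2)\<lparr>carrier := G\<rparr>)"
proof -
  interpret H1: group H1 by fact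
  interpret H2: group H2 by fact
  interpret P: group "H1 \<times>\<times> H2" by (rule DirProd_group[OF H1.is_group H2.is_group])
  define A where "A = (H1 \<times>\<times> H2)\<lparr>carrier := G\<rparr>"
  interpret A: group A unfolding A_def by (rule subgroup.subgroup_is_group[OF G P.is_group])
  note hG = restrict_iso[OF P.is_group F(1) h G]
  obtain S :: "'c set" where "F\<lparr>carrier := h ` G\<rparr> \<cong> free_group S"
    using F(2)[OF hG(1)] by (auto simp: is_free_group_def)
  then have A_free: "is_free_group A"
    using is_free_groupI[OF A.is_group] iso_trans[OF is_isoI[OF hG(2)]] by (auto simp: A_def)
  \<comment> \<open>The trivial factor must have the same element type as \<open>A\<close>, so it is
    taken as a subgroup of it.\<close>
  define B where "B = A\<lparr>carrier := {\<one>\<^bsub>A\<^esub>}\<rparr>"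
  interpret B: group B unfolding B_def by (rule A.subgroup_imp_group[OF A.triv_subgroup])
  have "(\<lambda>_. []) \<in> iso B (free_group ({} :: nat set))"
    by (auto simp: iso_iff hom_def B_def free_group_def)
  then have B_free: "is_free_group B"
    using is_free_groupI[OF B.is_group] is_isoI by blast
  have "(\<lambda>a. (a, \<one>\<^bsub>A\<^esub>)) \<in> iso (A\<lparr>carrier := carrier A\<rparr>) (A \<times>\<times> B)"
    by (auto simp: iso_iff hom_def B_def inj_on_def)
  then have "A\<lparr>carrier := carrier A\<rparr> \<cong> A \<times>\<times> B" by (rule is_isoI)
  moreover have "finite_index A (carrier A)"
    using A.p_normal_carrier A.subgroup_self by (auto simp: finite_index_def p_normal_def)
  ultimately have "virtually_product_of_two_free_groups A"
    unfolding virtually_product_of_two_free_groups_def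
    using A.is_group A_free B_free by blast
  then show ?thesis by (simp add: A_def)
qed

text \<open>\<open>f\<close> classifies elements by their first coordinate modulo \<open>N1\<close>.
  If it agrees on two elements, their quotient lies in \<open>N1 \<times> N2\<close>: its first
  coordinate is in \<open>N1\<close>, and dividing by that leaves an element of \<open>N2\<close>.
  The product \<open>N1 \<times> N2\<close> thus has finite index, and both factors are
  free.\<close>

lemma virtually_product_of_finite_index:
  fixes S1 :: "'a set" and S2 :: "'b set"
  defines "H1 \<equiv> free_group S1" and "H2 \<equiv> free_group S2"
  assumes G: "subgroup G (H1 \<times>\<times> H2)"
    and f: "finite (f ` G)" "\<And>g g'. g \<in> G \<Longrightarrow> g' \<in> G \<Longrightarrow> f g = f g' \<Longrightarrow>
      (fst g \<otimes>\<^bsub>H1\<^esub> inv\<^bsub>H1\<^esub> fst g', \<one>\<^bsub>H2\<^esub>) \<in> G"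
  shows "virtually_product_of_two_free_groups ((H1 \<times>\<times> H2)\<lparr>carrier := G\<rparr>)"
proof -
  interpret H1: group H1 by (simp add: H1_def free.is_group)
  interpret H2: group H2 by (simp add: H2_def free.is_group)
  interpret P: group "H1 \<times>\<times> H2" by (rule DirProd_group[OF H1.is_group H2.is_group])
  interpret G: subgroup G "H1 \<times>\<times> H2" by (rule G)
  define PG where "PG = (H1 \<times>\<times> H2)\<lparr>carrier := G\<rparr>"
  interpret PG: group PG unfolding PG_def by (rule subgroup.subgroup_is_group[OF G P.is_group])
  have GH: "fst g \<in> carrier H1" "snd g \<in> carrier H2" if "g \<in> G" for g
    using G.mem_carrier[OF that] by auto
  define N1 N2 where "N1 = {x \<in> carrier H1. (x, \<one>\<^bsub>H2\<^esub>) \<in> G}" and "N2 = {y \<in> carrier H2. (\<one>\<^bsub>H1\<^esub>, y) \<in> G}"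
  have inv_P: "inv\<^bsub>H1 \<times>\<times> H2\<^esub> (a, b) = (inv\<^bsub>H1\<^esub> a, inv\<^bsub>H2\<^esub> b)" if "a \<in> carrier H1" "b \<in> carrier H2" for a b
    using that by (simp add: inv_DirProd[OF H1.is_group H2.is_group])
  have N1: "subgroup N1 H1"
  proof (rule H1.subgroupI)
    show "N1 \<noteq> {}" using G.one_closed by (auto simp: N1_def)
    fix a assume "a \<in> N1"
    then show "inv\<^bsub>H1\<^esub> a \<in> N1" using G.m_inv_closed[of "(a, \<one>\<^bsub>H2\<^esub>)"] by (simp add: N1_def inv_P)
    fix b assume "b \<in> N1"
    with \<open>a \<in> N1\<close> show "a \<otimes>\<^bsub>H1\<^esub> b \<in> N1" using G.m_closed[of "(a, \<one>\<^bsub>H2\<^esub>)" "(b, \<one>\<^bsub>H2\<^esub>)"] by (simp add: N1_def)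
  qed (auto simp: N1_def)
  have N2: "subgroup N2 H2"
  proof (rule H2.subgroupI)
    show "N2 \<noteq> {}" using G.one_closed by (auto simp: N2_def)
    fix a assume "a \<in> N2"
    then show "inv\<^bsub>H2\<^esub> a \<in> N2" using G.m_inv_closed[of "(\<one>\<^bsub>H1\<^esub>, a)"] by (simp add: N2_def inv_P)
    fix b assume "b \<in> N2"
    with \<open>a \<in> N2\<close> show "a \<otimes>\<^bsub>H2\<^esub> b \<in> N2" using G.m_closed[of "(\<one>\<^bsub>H1\<^esub>, a)" "(\<one>\<^bsub>H1\<^esub>, b)"] by (simp add: N2_def)
  qed (auto simp: N2_def)
  have prod: "(a, b) \<in> G" if "a \<in> N1" "b \<in> N2" for a b
    using that G.m_closed[of "(a, \<one>\<^bsub>H2\<^esub>)" "(\<one>\<^bsub>H1\<^esub>, b)"] by (simp add: N1_def N2_def)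
  have K: "subgroup (N1 \<times> N2) PG"
    unfolding PG_def using prod
    by (intro P.subgroup_incl[OF DirProd_subgroups[OF H1.is_group N1 H2.is_group N2] G]) auto
  define A where "A = (H1 \<times>\<times> H2)\<lparr>carrier := N1 \<times> {\<one>\<^bsub>H2\<^esub>}\<rparr>"
  define B where "B = (H1 \<times>\<times> H2)\<lparr>carrier := {\<one>\<^bsub>H1\<^esub>} \<times> N2\<rparr>"
  interpret A: group A unfolding A_def
    by (rule P.subgroup_imp_group[OF DirProd_subgroups[OF H1.is_group N1 H2.is_group H2.triv_subgroup]])
  interpret B: group B unfolding B_def
    by (rule P.subgroup_imp_group[OF DirProd_subgroups[OF H1.is_group H1.triv_subgroup H2.is_group N2]])
  have "fst \<in> iso A (H1\<lparr>carrier := N1\<rparr>)"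
    by (auto simp: iso_iff hom_def A_def inj_on_def mult_DirProd' image_iff)
  moreover obtain S :: "'a word set" where "H1\<lparr>carrier := N1\<rparr> \<cong> free_group S"
    using nielsen_schreier[of N1 S1] N1 by (auto simp: is_free_group_def H1_def)
  ultimately have A_free: "is_free_group A"
    using is_free_groupI[OF A.is_group] iso_trans is_isoI by blast
  have "snd \<in> iso B (H2\<lparr>carrier := N2\<rparr>)"
    by (auto simp: iso_iff hom_def B_def inj_on_def mult_DirProd' image_iff)
  moreover obtain S' :: "'b word set" where "H2\<lparr>carrier := N2\<rparr> \<cong> free_group S'"
    using nielsen_schreier[of N2 S2] N2 by (auto simp: is_free_group_def H2_def)
  ultimately have B_free: "is_free_group B"
    using is_free_groupI[OF B.is_group] iso_trans is_isoI by blast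
  have "(\<lambda>(a, b). ((a, \<one>\<^bsub>H2\<^esub>), (\<one>\<^bsub>H1\<^esub>, b))) \<in> iso (PG\<lparr>carrier := N1 \<times> N2\<rparr>) (A \<times>\<times> B)"
    using subgroup.subset[OF N1] subgroup.subset[OF N2]
    by (auto simp: iso_iff hom_def A_def B_def PG_def inj_on_def)
  then have "PG\<lparr>carrier := N1 \<times> N2\<rparr> \<cong> A \<times>\<times> B" by (rule is_isoI)
  moreover have "finite (rcosets\<^bsub>PG\<^esub> (N1 \<times> N2))"
  proof (rule PG.finite_rcosetsI[OF K])
    show "finite (f ` carrier PG)" using f(1) by (simp add: PG_def)
    fix g g' assume "g \<in> carrier PG" "g' \<in> carrier PG" and eq: "f g = f g'"
    then have g: "g \<in> G" "g' \<in> G" by (simp_all add: PG_def)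
    define a b where "a = fst g \<otimes>\<^bsub>H1\<^esub> inv\<^bsub>H1\<^esub> fst g'" and "b = snd g \<otimes>\<^bsub>H2\<^esub> inv\<^bsub>H2\<^esub> snd g'"
    have ab: "a \<in> carrier H1" "b \<in> carrier H2" using GH g by (simp_all add: a_def b_def)
    have aG: "(a, \<one>\<^bsub>H2\<^esub>) \<in> G" unfolding a_def by (rule f(2)[OF g eq])
    have gg': "g \<otimes>\<^bsub>PG\<^esub> inv\<^bsub>PG\<^esub> g' = (a, b)"
      using GH[OF g(1)] GH[OF g(2)] g inv_P[of "fst g'" "snd g'"]
      by (simp add: PG_def P.m_inv_consistent[OF G] mult_DirProd' a_def b_def)
    have "(a, b) \<in> G"
    proof -
      have "g \<otimes>\<^bsub>PG\<^esub> inv\<^bsub>PG\<^esub> g' \<in> carrier PG"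
        using \<open>g \<in> carrier PG\<close> \<open>g' \<in> carrier PG\<close> by simp
      then show ?thesis
        unfolding gg' by (simp add: PG_def)
    qed
    then have "inv\<^bsub>H1 \<times>\<times> H2\<^esub> (a, \<one>\<^bsub>H2\<^esub>) \<otimes>\<^bsub>H1 \<times>\<times> H2\<^esub> (a, b) \<in> G"
      using aG by blast
    then have "(\<one>\<^bsub>H1\<^esub>, b) \<in> G"
      using ab by (simp add: inv_P)
    then show "g \<otimes>\<^bsub>PG\<^esub> inv\<^bsub>PG\<^esub> g' \<in> N1 \<times> N2"
      using gg' aG ab by (simp add: N1_def N2_def)
  qed
  ultimately show ?thesis
    unfolding virtually_product_of_two_free_groups_def finite_index_def PG_def[symmetric]
    using PG.is_group K A_free B_free by blast
qed

text \<open>The factors are the two projections of \<open>G\<close>, recoded in \<open>nat\<close>.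
  Each way to fail makes \<open>G\<close> virtually a product: a trivial intersection makes a
  projection injective, and finite index makes the product of the intersections large in
  \<open>G\<close>.\<close>

lemma full_subdirect_of_subgroup:
  fixes p :: nat and H :: "nat word monoid"
  assumes p: "Factorial_Ring.prime p"
  defines "H \<equiv> free_group {..<2}"
  assumes G: "subgroup G (H \<times>\<times> H)" "finitely_generated_group ((H \<times>\<times> H)\<lparr>carrier := G\<rparr>)"
    "p_conjugacy_separable p ((H \<times>\<times> H)\<lparr>carrier := G\<rparr>)"
    "\<not> virtually_product_of_two_free_groups ((H \<times>\<times> H)\<lparr>carrier := G\<rparr>)"
  shows "\<exists>(F1 :: nat monoid) (F2 :: nat monoid) G. is_free_group F1 \<and> is_free_group F2 \<and>
          full_subdirect_product F1 F2 G \<and>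
          finitely_generated_group ((F1 \<times>\<times> F2)\<lparr>carrier := G\<rparr>) \<and>
          p_conjugacy_separable p ((F1 \<times>\<times> F2)\<lparr>carrier := G\<rparr>) \<and>
          infinite (rcosets\<^bsub>F1 \<times>\<times> F2\<^esub> G)"
proof -
  interpret H: group H by (simp add: H_def free.is_group)
  interpret P: group "H \<times>\<times> H" by (rule DirProd_group[OF H.is_group H.is_group])
  interpret G: subgroup G "H \<times>\<times> H" by (rule G(1))
  interpret PG: group "(H \<times>\<times> H)\<lparr>carrier := G\<rparr>" by (rule G.subgroup_is_group) (rule P.is_group)
  have fst_hom: "group_hom (H \<times>\<times> H) H fst" and snd_hom: "group_hom (H \<times>\<times> H) H snd"
    using P.is_group H.is_group by (auto simp: group_hom_def group_hom_axioms_def hom_def)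
  define J1 J2 where "J1 = fst ` G" and "J2 = snd ` G"
  have J: "subgroup J1 H" "subgroup J2 H"
    unfolding J1_def J2_def using group_hom.subgroup_img_is_subgroup[OF fst_hom G(1)]
      group_hom.subgroup_img_is_subgroup[OF snd_hom G(1)] by auto
  define H1 H2 where "H1 = H\<lparr>carrier := J1\<rparr>" and "H2 = H\<lparr>carrier := J2\<rparr>"
  interpret H1: group H1 unfolding H1_def by (rule subgroup.subgroup_is_group[OF J(1) H.is_group])
  interpret H2: group H2 unfolding H2_def by (rule subgroup.subgroup_is_group[OF J(2) H.is_group])
  have free_sub: "is_free_group (H\<lparr>carrier := K\<rparr>)" if "subgroup K H" for K
    using nielsen_schreier that unfolding H_def by blast
  define F1 F2 where "F1 = image_group (to_nat :: nat word \<Rightarrow> nat) H1"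
    and "F2 = image_group (to_nat :: nat word \<Rightarrow> nat) H2"
  have inj_K: "inj_on to_nat K" for K :: "nat word set"
    by (rule inj_on_subset[OF inj_to_nat]) simp
  note F1 = group_image_group[OF H1.is_group inj_K, folded F1_def]
  note F2 = group_image_group[OF H2.is_group inj_K, folded F2_def]
  interpret F1: group F1 by (rule F1(2))
  interpret F2: group F2 by (rule F2(2))
  interpret FF: group "F1 \<times>\<times> F2" by (rule DirProd_group[OF F1.is_group F2.is_group])
  interpret HH: group "H1 \<times>\<times> H2" by (rule DirProd_group[OF H1.is_group H2.is_group])
  have free: "is_free_group F1" "is_free_group F2"
  proof -
    obtain S1 S2 :: "nat word set" where "H1 \<cong> free_group S1" "H2 \<cong> free_group S2"
      using free_sub[OF J(1)] free_sub[OF J(2)] by (auto simp: is_free_group_def H1_def H2_def)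
    then show "is_free_group F1" "is_free_group F2"
      using is_free_groupI[OF F1.is_group] is_free_groupI[OF F2.is_group]
        H1.iso_sym[OF is_isoI[OF F1(1)]] H2.iso_sym[OF is_isoI[OF F2(1)]] iso_trans by blast+
  qed
  have HH_eq: "H1 \<times>\<times> H2 = (H \<times>\<times> H)\<lparr>carrier := J1 \<times> J2\<rparr>"
    by (simp add: H1_def H2_def DirProd_def)
  have PG_eq: "(H1 \<times>\<times> H2)\<lparr>carrier := G\<rparr> = (H \<times>\<times> H)\<lparr>carrier := G\<rparr>"
    by (simp add: HH_eq)
  have GJ: "G \<subseteq> J1 \<times> J2" by (force simp: J1_def J2_def)
  have G_HH: "subgroup G (H1 \<times>\<times> H2)"
    unfolding HH_eq by (rule P.subgroup_incl[OF G(1) DirProd_subgroups[OF H.is_group J(1) H.is_group J(2)] GJ])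
  define h :: "nat word \<times> nat word \<Rightarrow> nat \<times> nat" where "h = (\<lambda>(a, b). (to_nat a, to_nat b))"
  have h_inj: "h z = h z' \<longleftrightarrow> z = z'" for z z'
    by (cases z; cases z') (simp add: h_def)
  have h_hom: "h \<in> hom (H1 \<times>\<times> H2) (F1 \<times>\<times> F2)"
    using iso_imp_homomorphism[OF F1(1)] iso_imp_homomorphism[OF F2(1)] by (auto simp: h_def hom_def)
  define G' where "G' = h ` G"
  have h_inj_on: "inj_on h K" for K using h_inj by (auto simp: inj_on_def)
  note G' = restrict_iso[OF HH.is_group FF.is_group h_hom h_inj_on G_HH, folded G'_def, unfolded PG_eq]
  have G'_iff: "(to_nat a, to_nat b) \<in> G' \<longleftrightarrow> (a, b) \<in> G" for a b :: "nat word"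
    using h_inj[of "(a, b)"] by (auto simp: G'_def h_def image_iff)
  interpret PG': group "(F1 \<times>\<times> F2)\<lparr>carrier := G'\<rparr>"
    by (rule subgroup.subgroup_is_group[OF G'(1) FF.is_group])
  have one: "\<one>\<^bsub>F1\<^esub> = to_nat \<one>\<^bsub>H\<^esub>" "\<one>\<^bsub>F2\<^esub> = to_nat \<one>\<^bsub>H\<^esub>"
    by (simp_all add: F1_def F2_def image_group_one H1_def H2_def)
  have carr: "carrier F1 = to_nat ` J1" "carrier F2 = to_nat ` J2"
    by (simp_all add: F1_def F2_def image_group_carrier H1_def H2_def)
  have div_G: "(a \<otimes>\<^bsub>H\<^esub> inv\<^bsub>H\<^esub> a', b \<otimes>\<^bsub>H\<^esub> inv\<^bsub>H\<^esub> b') \<in> G" if "(a, b) \<in> G" "(a', b') \<in> G" for a a' b b'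
    using G.m_closed[OF that(1) G.m_inv_closed[OF that(2)]] G.mem_carrier[OF that(2)]
    by (simp add: inv_DirProd[OF H.is_group H.is_group])
  have N1: "\<exists>x. x \<noteq> \<one>\<^bsub>H\<^esub> \<and> (x, \<one>\<^bsub>H\<^esub>) \<in> G"
  proof (rule ccontr)
    assume *: "\<not> ?thesis"
    have "inj_on snd G"
    proof (rule inj_onI, clarsimp)
      fix a a' b assume ab: "(a, b) \<in> G" "(a', b) \<in> G"
      then have c: "a \<in> carrier H" "a' \<in> carrier H" "b \<in> carrier H" using G.subset by auto
      then have "a \<otimes>\<^bsub>H\<^esub> inv\<^bsub>H\<^esub> a' = \<one>\<^bsub>H\<^esub>"
        using * div_G[OF ab] by auto
      then show "a = a'" using c by (simp add: H.inv_solve_right')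
    qed
    then show False
      using virtually_product_of_embedding[OF H.is_group H.is_group G(1) _ _ H.is_group free_sub]
        G(4) snd_hom by (auto simp: group_hom_def group_hom_axioms_def)
  qed
  have N2: "\<exists>x. x \<noteq> \<one>\<^bsub>H\<^esub> \<and> (\<one>\<^bsub>H\<^esub>, x) \<in> G"
  proof (rule ccontr)
    assume *: "\<not> ?thesis"
    have "inj_on fst G"
    proof (rule inj_onI, clarsimp)
      fix a b b' assume ab: "(a, b) \<in> G" "(a, b') \<in> G"
      then have c: "a \<in> carrier H" "b \<in> carrier H" "b' \<in> carrier H" using G.subset by auto
      then have "b \<otimes>\<^bsub>H\<^esub> inv\<^bsub>H\<^esub> b' = \<one>\<^bsub>H\<^esub>"
        using * div_G[OF ab] by auto
      then show "b = b'" using c by (simp add: H.inv_solve_right')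
    qed
    then show False
      using virtually_product_of_embedding[OF H.is_group H.is_group G(1) _ _ H.is_group free_sub]
        G(4) fst_hom by (auto simp: group_hom_def group_hom_axioms_def)
  qed
  have "full_subdirect_product F1 F2 G'"
    unfolding full_subdirect_product_def subdirect_product_def
  proof (intro conjI)
    show "subgroup G' (F1 \<times>\<times> F2)" by (rule G'(1))
    show "fst ` G' = carrier F1" "snd ` G' = carrier F2"
      by (force simp: G'_def h_def carr J1_def J2_def image_iff split: prod.splits)+
    obtain x where x: "x \<noteq> \<one>\<^bsub>H\<^esub>" "(x, \<one>\<^bsub>H\<^esub>) \<in> G" using N1 by blast
    then have "(to_nat x, \<one>\<^bsub>F2\<^esub>) \<in> G' \<inter> (carrier F1 \<times> {\<one>\<^bsub>F2\<^esub>})" "(to_nat x, \<one>\<^bsub>F2\<^esub>) \<noteq> \<one>\<^bsub>F1 \<times>\<times> F2\<^esub>"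
      using G'_iff[of x "\<one>\<^bsub>H\<^esub>"] GJ by (auto simp: one carr)
    then show "G' \<inter> (carrier F1 \<times> {\<one>\<^bsub>F2\<^esub>}) \<noteq> {\<one>\<^bsub>F1 \<times>\<times> F2\<^esub>}" by blast
    obtain y where y: "y \<noteq> \<one>\<^bsub>H\<^esub>" "(\<one>\<^bsub>H\<^esub>, y) \<in> G" using N2 by blast
    then have "(\<one>\<^bsub>F1\<^esub>, to_nat y) \<in> G' \<inter> ({\<one>\<^bsub>F1\<^esub>} \<times> carrier F2)" "(\<one>\<^bsub>F1\<^esub>, to_nat y) \<noteq> \<one>\<^bsub>F1 \<times>\<times> F2\<^esub>"
      using G'_iff[of "\<one>\<^bsub>H\<^esub>" y] GJ by (auto simp: one carr)
    then show "G' \<inter> ({\<one>\<^bsub>F1\<^esub>} \<times> carrier F2) \<noteq> {\<one>\<^bsub>F1 \<times>\<times> F2\<^esub>}" by blast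
  qed
  moreover have "finitely_generated_group ((F1 \<times>\<times> F2)\<lparr>carrier := G'\<rparr>)"
    by (rule finitely_generated_hom_image[OF G(2) PG'.is_group, where h = h])
      (use G'(2) in \<open>auto simp: iso_iff\<close>)
  moreover have "p_conjugacy_separable p ((F1 \<times>\<times> F2)\<lparr>carrier := G'\<rparr>)"
    by (rule p_conjugacy_separable_iso[OF p PG'.is_group PG.is_group PG.iso_set_sym[OF G'(2)] G(3)])
  moreover have "infinite (rcosets\<^bsub>F1 \<times>\<times> F2\<^esub> G')"
  proof
    assume fin: "finite (rcosets\<^bsub>F1 \<times>\<times> F2\<^esub> G')"
    \<comment> \<open>Finite index of \<open>G'\<close> bounds the number of these cosets, and two
      elements with the same coset have first coordinates that differ by an element of the first
      intersection.\<close>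
    define f where "f g = G' #>\<^bsub>F1 \<times>\<times> F2\<^esub> (to_nat (fst g), \<one>\<^bsub>F2\<^esub>)" for g :: "nat word \<times> nat word"
    have closed: "(to_nat (fst g), \<one>\<^bsub>F2\<^esub>) \<in> carrier (F1 \<times>\<times> F2)" if "g \<in> G" for g
      using that GJ by (auto simp: carr J1_def) (metis F2.one_closed carr(2) J2_def)
    have "f ` G \<subseteq> (\<lambda>z. G' #>\<^bsub>F1 \<times>\<times> F2\<^esub> z) ` carrier (F1 \<times>\<times> F2)"
      using closed by (auto simp: f_def)
    then have "finite (f ` G)"
      using fin finite_subset unfolding FF.finite_image_rcosets by blast
    moreover have "(fst g \<otimes>\<^bsub>H\<^esub> inv\<^bsub>H\<^esub> fst g', \<one>\<^bsub>H\<^esub>) \<in> G" if g: "g \<in> G" "g' \<in> G" "f g = f g'" for g g'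
    proof -
      have J1g: "fst g \<in> J1" "fst g' \<in> J1" using g by (auto simp: J1_def)
      have c: "to_nat (fst g) \<in> carrier F1" "to_nat (fst g') \<in> carrier F1" using J1g by (auto simp: carr)
      have "(to_nat (fst g), \<one>\<^bsub>F2\<^esub>) \<otimes>\<^bsub>F1 \<times>\<times> F2\<^esub> inv\<^bsub>F1 \<times>\<times> F2\<^esub> (to_nat (fst g'), \<one>\<^bsub>F2\<^esub>) \<in> G'"
        using g(3) FF.rcoset_eq_iff[OF G'(1) closed[OF g(1)] closed[OF g(2)]] by (simp only: f_def)
      then have "(to_nat (fst g) \<otimes>\<^bsub>F1\<^esub> inv\<^bsub>F1\<^esub> to_nat (fst g'), \<one>\<^bsub>F2\<^esub>) \<in> G'"
        using c by (simp add: inv_DirProd[OF F1.is_group F2.is_group])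
      moreover interpret \<kappa>: group_hom H1 F1 to_nat
        using F1(1) by (simp add: group_hom_def group_hom_axioms_def H1.is_group F1.is_group iso_imp_homomorphism)
      have "to_nat (fst g) \<otimes>\<^bsub>F1\<^esub> inv\<^bsub>F1\<^esub> to_nat (fst g') = to_nat (fst g \<otimes>\<^bsub>H1\<^esub> inv\<^bsub>H1\<^esub> fst g')"
        using J1g \<kappa>.hom_mult[of "fst g" "inv\<^bsub>H1\<^esub> fst g'"] \<kappa>.hom_inv[of "fst g'"] H1.inv_closed[of "fst g'"]
        by (simp add: H1_def)
      ultimately show ?thesis
        using G'_iff J1g by (simp add: one H1_def H.m_inv_consistent[OF J(1)])
    qed
    ultimately show False
      using virtually_product_of_finite_index[of G "{..<2}" "{..<2}" f] G(1,4) by (simp add: H_def)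
  qed
  ultimately show ?thesis using free by blast
qed

section \<open>From full subdirect products to finitely presented groups\<close>

locale subdirect =
  fixes F1 :: "'a monoid" and F2 :: "'b monoid" and G :: "('a \<times> 'b) set"
  assumes F1: "group F1" and F2: "group F2" and subdirect: "subdirect_product F1 F2 G"
begin

sublocale F1: group F1 by (rule F1)
sublocale F2: group F2 by (rule F2)
sublocale P: group "F1 \<times>\<times> F2" by (rule DirProd_group[OF F1 F2])
sublocale G: subgroup G "F1 \<times>\<times> F2"
  using subdirect by (simp add: subdirect_product_def)

abbreviation "PG \<equiv> (F1 \<times>\<times> F2)\<lparr>carrier := G\<rparr>"

sublocale PG: group PG by (rule G.subgroup_is_group[OF P.is_group])

definition N1 :: "'a set" where "N1 = {x \<in> carrier F1. (x, \<one>\<^bsub>F2\<^esub>) \<in> G}"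
definition N2 :: "'b set" where "N2 = {y \<in> carrier F2. (\<one>\<^bsub>F1\<^esub>, y) \<in> G}"

lemma G_closed: "(a, b) \<in> G \<Longrightarrow> a \<in> carrier F1" "(a, b) \<in> G \<Longrightarrow> b \<in> carrier F2"
  using G.mem_carrier by auto

lemma inv_P: "a \<in> carrier F1 \<Longrightarrow> b \<in> carrier F2 \<Longrightarrow> inv\<^bsub>F1 \<times>\<times> F2\<^esub> (a, b) = (inv\<^bsub>F1\<^esub> a, inv\<^bsub>F2\<^esub> b)"
  by (rule inv_DirProd[OF F1 F2])

lemma inv_PG: "(a, b) \<in> G \<Longrightarrow> inv\<^bsub>PG\<^esub> (a, b) = (inv\<^bsub>F1\<^esub> a, inv\<^bsub>F2\<^esub> b)"
  using P.m_inv_consistent[OF G.subgroup_axioms, of "(a, b)"] inv_P[of a b] G_closed[of a b] by metis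

lemma G_mult: "(a, b) \<in> G \<Longrightarrow> (c, d) \<in> G \<Longrightarrow> (a \<otimes>\<^bsub>F1\<^esub> c, b \<otimes>\<^bsub>F2\<^esub> d) \<in> G"
  using G.m_closed[of "(a, b)" "(c, d)"] by simp

lemma G_inv: "(a, b) \<in> G \<Longrightarrow> (inv\<^bsub>F1\<^esub> a, inv\<^bsub>F2\<^esub> b) \<in> G"
  using G.m_inv_closed[of "(a, b)"] inv_P G_closed by simp

lemma ex_snd: "a \<in> carrier F1 \<Longrightarrow> \<exists>b. (a, b) \<in> G"
  and ex_fst: "b \<in> carrier F2 \<Longrightarrow> \<exists>a. (a, b) \<in> G"
proof -
  have "fst ` G = carrier F1" "snd ` G = carrier F2"
    using subdirect by (simp_all add: subdirect_product_def)
  then show "a \<in> carrier F1 \<Longrightarrow> \<exists>b. (a, b) \<in> G" "b \<in> carrier F2 \<Longrightarrow> \<exists>a. (a, b) \<in> G"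
    by force+
qed

lemma P_pow: "(a, b) [^]\<^bsub>F1 \<times>\<times> F2\<^esub> (n :: nat) = (a [^]\<^bsub>F1\<^esub> n, b [^]\<^bsub>F2\<^esub> n)"
  by (induction n) simp_all

lemma P_int_pow:
  "a \<in> carrier F1 \<Longrightarrow> b \<in> carrier F2 \<Longrightarrow>
    (a, b) [^]\<^bsub>F1 \<times>\<times> F2\<^esub> (i :: int) = (a [^]\<^bsub>F1\<^esub> i, b [^]\<^bsub>F2\<^esub> i)"
  by (cases i rule: int_cases2) (simp_all add: int_pow_int P.int_pow_neg F1.int_pow_neg F2.int_pow_neg P_pow inv_P)

lemma G_int_pow: "(a, b) \<in> G \<Longrightarrow> (a [^]\<^bsub>F1\<^esub> (i :: int), b [^]\<^bsub>F2\<^esub> i) \<in> G"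
  using P.subgroup_int_pow_closed[OF G.subgroup_axioms, of "(a, b)" i] P_int_pow G_closed by simp

lemma N1_normal: "N1 \<lhd> F1"
proof (rule F1.normal_invI[OF F1.subgroupI])
  show "N1 \<noteq> {}" using G.one_closed by (auto simp: N1_def)
  show "inv\<^bsub>F1\<^esub> a \<in> N1" if "a \<in> N1" for a
    using that G_inv[of a "\<one>\<^bsub>F2\<^esub>"] by (simp add: N1_def)
  show "a \<otimes>\<^bsub>F1\<^esub> b \<in> N1" if "a \<in> N1" "b \<in> N1" for a b
    using that G_mult[of a "\<one>\<^bsub>F2\<^esub>" b "\<one>\<^bsub>F2\<^esub>"] by (simp add: N1_def)
  fix x n assume x: "x \<in> carrier F1" and n: "n \<in> N1"
  obtain y where y: "(x, y) \<in> G" using ex_snd[OF x] by blast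
  then have "(x \<otimes>\<^bsub>F1\<^esub> n \<otimes>\<^bsub>F1\<^esub> inv\<^bsub>F1\<^esub> x, y \<otimes>\<^bsub>F2\<^esub> \<one>\<^bsub>F2\<^esub> \<otimes>\<^bsub>F2\<^esub> inv\<^bsub>F2\<^esub> y) \<in> G"
    using n by (intro G_mult G_inv) (auto simp: N1_def)
  then show "x \<otimes>\<^bsub>F1\<^esub> n \<otimes>\<^bsub>F1\<^esub> inv\<^bsub>F1\<^esub> x \<in> N1"
    using x n G_closed[OF y] by (simp add: N1_def)
qed (auto simp: N1_def)

lemma N2_normal: "N2 \<lhd> F2"
proof (rule F2.normal_invI[OF F2.subgroupI])
  show "N2 \<noteq> {}" using G.one_closed by (auto simp: N2_def)
  show "inv\<^bsub>F2\<^esub> a \<in> N2" if "a \<in> N2" for a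
    using that G_inv[of "\<one>\<^bsub>F1\<^esub>" a] by (simp add: N2_def)
  show "a \<otimes>\<^bsub>F2\<^esub> b \<in> N2" if "a \<in> N2" "b \<in> N2" for a b
    using that G_mult[of "\<one>\<^bsub>F1\<^esub>" a "\<one>\<^bsub>F1\<^esub>" b] by (simp add: N2_def)
  fix x n assume x: "x \<in> carrier F2" and n: "n \<in> N2"
  obtain y where y: "(y, x) \<in> G" using ex_fst[OF x] by blast
  then have "(y \<otimes>\<^bsub>F1\<^esub> \<one>\<^bsub>F1\<^esub> \<otimes>\<^bsub>F1\<^esub> inv\<^bsub>F1\<^esub> y, x \<otimes>\<^bsub>F2\<^esub> n \<otimes>\<^bsub>F2\<^esub> inv\<^bsub>F2\<^esub> x) \<in> G"
    using n by (intro G_mult G_inv) (auto simp: N2_def)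
  then show "x \<otimes>\<^bsub>F2\<^esub> n \<otimes>\<^bsub>F2\<^esub> inv\<^bsub>F2\<^esub> x \<in> N2"
    using x n G_closed[OF y] by (simp add: N2_def)
qed (auto simp: N2_def)

lemma N1_G: "n \<in> N1 \<Longrightarrow> (n, \<one>\<^bsub>F2\<^esub>) \<in> G" and N2_G: "n' \<in> N2 \<Longrightarrow> (\<one>\<^bsub>F1\<^esub>, n') \<in> G"
  by (simp_all add: N1_def N2_def)

text \<open>Goursat's correspondence: \<open>G\<close> is the graph of an isomorphism between the
  quotients by \<open>N1\<close> and \<open>N2\<close>, and this equivalence says that it is well
  defined and injective.\<close>

lemma N1_iff: "(a, b) \<in> G \<Longrightarrow> a \<in> N1 \<longleftrightarrow> b \<in> N2"
proof -
  assume ab: "(a, b) \<in> G"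
  note c = G_closed[OF ab]
  show ?thesis
  proof
    assume "a \<in> N1"
    then have "(inv\<^bsub>F1\<^esub> a \<otimes>\<^bsub>F1\<^esub> a, inv\<^bsub>F2\<^esub> \<one>\<^bsub>F2\<^esub> \<otimes>\<^bsub>F2\<^esub> b) \<in> G"
      by (rule G_mult[OF G_inv[OF N1_G] ab])
    then show "b \<in> N2" using c by (simp add: N2_def)
  next
    assume "b \<in> N2"
    then have "(inv\<^bsub>F1\<^esub> \<one>\<^bsub>F1\<^esub> \<otimes>\<^bsub>F1\<^esub> a, inv\<^bsub>F2\<^esub> b \<otimes>\<^bsub>F2\<^esub> b) \<in> G"
      by (rule G_mult[OF G_inv[OF N2_G] ab])
    then show "a \<in> N1" using c by (simp add: N1_def)
  qed
qed

sublocale N1: normal N1 F1 by (rule N1_normal)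
sublocale N2: normal N2 F2 by (rule N2_normal)

text \<open>A pair \<open>(a, b)\<close> differs from the element \<open>(s b, b)\<close> of
  \<open>G\<close> only in the first coordinate, by \<open>inv s b \<otimes> a\<close>. The coset of
  this factor modulo \<open>N1\<close> determines the coset of the pair modulo
  \<open>G\<close>.\<close>

lemma infinite_index_N1:
  assumes "infinite (rcosets\<^bsub>F1 \<times>\<times> F2\<^esub> G)"
  shows "infinite (rcosets\<^bsub>F1\<^esub> N1)"
proof
  assume fin: "finite (rcosets\<^bsub>F1\<^esub> N1)"
  obtain s where s: "\<And>b. b \<in> carrier F2 \<Longrightarrow> (s b, b) \<in> G"
    using ex_fst by metis
  define f where "f = (\<lambda>(a, b). N1 #>\<^bsub>F1\<^esub> (inv\<^bsub>F1\<^esub> s b \<otimes>\<^bsub>F1\<^esub> a))"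
  have sF: "s b \<in> carrier F1" if "b \<in> carrier F2" for b using G_closed(1)[OF s[OF that]] .
  have "finite (rcosets\<^bsub>F1 \<times>\<times> F2\<^esub> G)"
  proof (rule P.finite_rcosetsI[OF G.subgroup_axioms])
    have "f ` carrier (F1 \<times>\<times> F2) \<subseteq> (\<lambda>x. N1 #>\<^bsub>F1\<^esub> x) ` carrier F1"
      using sF by (auto simp: f_def)
    then show "finite (f ` carrier (F1 \<times>\<times> F2))"
      using fin finite_subset unfolding F1.finite_image_rcosets by blast
    fix z z' assume "z \<in> carrier (F1 \<times>\<times> F2)" "z' \<in> carrier (F1 \<times>\<times> F2)" and eq: "f z = f z'"
    then obtain a b a' b' where z: "z = (a, b)" "z' = (a', b')" "a \<in> carrier F1" "b \<in> carrier F2"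
      "a' \<in> carrier F1" "b' \<in> carrier F2" by (cases z; cases z') auto
    define c c' where "c = inv\<^bsub>F1\<^esub> s b \<otimes>\<^bsub>F1\<^esub> a" and "c' = inv\<^bsub>F1\<^esub> s b' \<otimes>\<^bsub>F1\<^esub> a'"
    have cF: "c \<in> carrier F1" "c' \<in> carrier F1" using z sF by (simp_all add: c_def c'_def)
    have "c \<otimes>\<^bsub>F1\<^esub> inv\<^bsub>F1\<^esub> c' \<in> N1"
      using eq z F1.rcoset_eq_iff[OF N1.subgroup_axioms cF] by (simp add: f_def c_def c'_def)
    then have "(s b \<otimes>\<^bsub>F1\<^esub> (c \<otimes>\<^bsub>F1\<^esub> inv\<^bsub>F1\<^esub> c') \<otimes>\<^bsub>F1\<^esub> inv\<^bsub>F1\<^esub> s b', b \<otimes>\<^bsub>F2\<^esub> \<one>\<^bsub>F2\<^esub> \<otimes>\<^bsub>F2\<^esub> inv\<^bsub>F2\<^esub> b') \<in> G"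
      using z by (intro G_mult G_inv N1_G s)
    then show "z \<otimes>\<^bsub>F1 \<times>\<times> F2\<^esub> inv\<^bsub>F1 \<times>\<times> F2\<^esub> z' \<in> G"
      using z sF by (simp add: inv_P c_def c'_def F1.group_simps)
  qed
  with assms show False ..
qed

lemma infinite_index_N2:
  assumes "infinite (rcosets\<^bsub>F1 \<times>\<times> F2\<^esub> G)"
  shows "infinite (rcosets\<^bsub>F2\<^esub> N2)"
proof
  assume fin: "finite (rcosets\<^bsub>F2\<^esub> N2)"
  obtain t where t: "\<And>a. a \<in> carrier F1 \<Longrightarrow> (a, t a) \<in> G"
    using ex_snd by metis
  have tF: "t a \<in> carrier F2" if "a \<in> carrier F1" for a using G_closed(2)[OF t[OF that]] .
  have "finite (rcosets\<^bsub>F1\<^esub> N1)"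
  proof (rule F1.finite_rcosetsI[OF N1.subgroup_axioms])
    have "(\<lambda>a. N2 #>\<^bsub>F2\<^esub> t a) ` carrier F1 \<subseteq> (\<lambda>x. N2 #>\<^bsub>F2\<^esub> x) ` carrier F2"
      using tF by auto
    then show "finite ((\<lambda>a. N2 #>\<^bsub>F2\<^esub> t a) ` carrier F1)"
      using fin finite_subset unfolding F2.finite_image_rcosets by blast
    fix a a' assume a: "a \<in> carrier F1" "a' \<in> carrier F1" "N2 #>\<^bsub>F2\<^esub> t a = N2 #>\<^bsub>F2\<^esub> t a'"
    then have "t a \<otimes>\<^bsub>F2\<^esub> inv\<^bsub>F2\<^esub> t a' \<in> N2"
      using F2.rcoset_eq_iff[OF N2.subgroup_axioms tF tF] by blast
    moreover have "(a \<otimes>\<^bsub>F1\<^esub> inv\<^bsub>F1\<^esub> a', t a \<otimes>\<^bsub>F2\<^esub> inv\<^bsub>F2\<^esub> t a') \<in> G"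
      by (intro G_mult G_inv t a)
    ultimately show "a \<otimes>\<^bsub>F1\<^esub> inv\<^bsub>F1\<^esub> a' \<in> N1"
      using N1_iff by blast
  qed
  with infinite_index_N1[OF assms] show False ..
qed

end

section \<open>Transfer to free groups with arbitrary elements\<close>

lemma (in group) subgroup_equalizer:
  assumes "group H" "h \<in> hom G H" "k \<in> hom G H"
  shows "subgroup {x \<in> carrier G. h x = k x} G"
proof -
  interpret h: group_hom G H h
    using assms by (simp add: group_hom_def group_hom_axioms_def)
  interpret k: group_hom G H k
    using assms by (simp add: group_hom_def group_hom_axioms_def)
  show ?thesis
    by (rule subgroupI) (auto intro!: exI[of _ \<one>])
qed

lemma is_free_primitive_in_coset:
  assumes F: "is_free_group F" and N: "N \<lhd> F" "N \<noteq> {\<one>\<^bsub>F\<^esub>}" "infinite (rcosets\<^bsub>F\<^esub> N)" and h: "h \<in> carrier F"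
  obtains n where "n \<in> N"
    "\<And>c. c \<in> carrier F \<Longrightarrow> (h \<otimes>\<^bsub>F\<^esub> n) \<otimes>\<^bsub>F\<^esub> c = c \<otimes>\<^bsub>F\<^esub> (h \<otimes>\<^bsub>F\<^esub> n) \<Longrightarrow>
      \<exists>i::int. c = (h \<otimes>\<^bsub>F\<^esub> n) [^]\<^bsub>F\<^esub> i"
proof -
  interpret F: group F using F by (simp add: is_free_group_def)
  interpret N: normal N F by (rule N)
  obtain S :: "'a set" and \<phi> where \<phi>: "\<phi> \<in> iso F (free_group S)"
    using F by (auto simp: is_free_group_def is_iso_def)
  interpret \<phi>: group_hom F "free_group S" \<phi>
    using \<phi> by (simp add: group_hom_def group_hom_axioms_def F.is_group iso_imp_homomorphism)
  have inj: "inj_on \<phi> (carrier F)" and surj: "\<phi> ` carrier F = carrier (free_group S)"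
    using \<phi> by (simp_all add: iso_iff)
  have mem: "\<phi> x \<in> \<phi> ` N \<longleftrightarrow> x \<in> N" if "x \<in> carrier F" for x
    using that by (intro inj_on_image_mem_iff[OF inj _ N.subset])
  have N': "\<phi> ` N \<lhd> free_group S"
    by (rule N.surj_hom_normal_subgroup[OF \<phi>.group_hom_axioms surj])
  obtain w where "w \<in> N" "w \<noteq> \<one>\<^bsub>F\<^esub>" using N.one_closed N(2) by blast
  then have "\<phi> w \<in> \<phi> ` N" "\<phi> w \<noteq> \<one>\<^bsub>free_group S\<^esub>"
    using inj_onD[OF inj, of w "\<one>\<^bsub>F\<^esub>"] N.mem_carrier by auto
  then have N'1: "\<phi> ` N \<noteq> {\<one>\<^bsub>free_group S\<^esub>}" by blast
  have inf: "infinite (rcosets\<^bsub>free_group S\<^esub> (\<phi> ` N))"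
  proof
    assume "finite (rcosets\<^bsub>free_group S\<^esub> (\<phi> ` N))"
    then have "finite (rcosets\<^bsub>F\<^esub> {x \<in> carrier F. \<phi> x \<in> \<phi> ` N})"
      by (rule F.finite_index_vimage(2)[OF free.is_group \<phi>.homh normal_imp_subgroup[OF N']])
    moreover have "{x \<in> carrier F. \<phi> x \<in> \<phi> ` N} = N"
      using mem N.subset by blast
    ultimately show False using N(3) by simp
  qed
  have "\<not> S \<subseteq> {s}" for s
    using cyclic_free_group_finite_index[of S s, OF _ N' N'1] inf by blast
  then obtain a b where ab: "a \<in> S" "b \<in> S" "a \<noteq> b" by blast
  obtain n' where n': "n' \<in> \<phi> ` N"
    "\<And>c. c \<in> carrier (free_group S) \<Longrightarrow>
      (\<phi> h \<otimes>\<^bsub>free_group S\<^esub> n') \<otimes>\<^bsub>free_group S\<^esub> c = c \<otimes>\<^bsub>free_group S\<^esub> (\<phi> h \<otimes>\<^bsub>free_group S\<^esub> n') \<Longrightarrow>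
      \<exists>i::int. c = (\<phi> h \<otimes>\<^bsub>free_group S\<^esub> n') [^]\<^bsub>free_group S\<^esub> i"
    using primitive_in_coset[OF ab N' N'1 \<phi>.hom_closed[OF h]] by metis
  then obtain n where n: "n \<in> N" "n' = \<phi> n" by blast
  have nF: "n \<in> carrier F" using n(1) by (rule N.mem_carrier)
  show ?thesis
  proof (rule that[OF n(1)])
    fix c assume c: "c \<in> carrier F" "(h \<otimes>\<^bsub>F\<^esub> n) \<otimes>\<^bsub>F\<^esub> c = c \<otimes>\<^bsub>F\<^esub> (h \<otimes>\<^bsub>F\<^esub> n)"
    have "(\<phi> h \<otimes>\<^bsub>free_group S\<^esub> \<phi> n) \<otimes>\<^bsub>free_group S\<^esub> \<phi> c = \<phi> c \<otimes>\<^bsub>free_group S\<^esub> (\<phi> h \<otimes>\<^bsub>free_group S\<^esub> \<phi> n)"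
      using arg_cong[OF c(2), of \<phi>] c(1) h nF by simp
    then obtain i :: int where "\<phi> c = (\<phi> h \<otimes>\<^bsub>free_group S\<^esub> \<phi> n) [^]\<^bsub>free_group S\<^esub> i"
      using n'(2)[of "\<phi> c"] c(1) n(2) by auto
    then have "\<phi> c = \<phi> ((h \<otimes>\<^bsub>F\<^esub> n) [^]\<^bsub>F\<^esub> i)"
      using h nF by (simp add: \<phi>.hom_int_pow)
    then have "c = (h \<otimes>\<^bsub>F\<^esub> n) [^]\<^bsub>F\<^esub> i"
      using c(1) h nF by (intro inj_onD[OF inj]) auto
    then show "\<exists>i::int. c = (h \<otimes>\<^bsub>F\<^esub> n) [^]\<^bsub>F\<^esub> i" by blast
  qed
qed

text \<open>Only finitely many letters occur in the generators, and their products involve no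
  others.\<close>

lemma finitely_generated_free_group_finite_basis:
  assumes "finitely_generated_group (free_group S)"
  shows "finite S"
proof -
  obtain A where A: "finite A" "A \<subseteq> carrier (free_group S)" "generate (free_group S) A = carrier (free_group S)"
    using assms by (auto simp: finitely_generated_group_def)
  define T where "T = (\<Union>w\<in>A. fst ` set w)"
  have "fst ` set w \<subseteq> S" if "w \<in> A" for w
    using subsetD[OF A(2) that] by (simp add: carrier_free_group)
  then have T: "finite T" "T \<subseteq> S"
    using A(1) by (simp_all add: T_def UN_least)
  interpret i: group_hom "free_group T" "free_group S" "\<lambda>w. w"
    using free_group_inclusion[OF T(2)] by (simp add: group_hom_def group_hom_axioms_def free.is_group)
  have "subgroup (carrier (free_group T)) (free_group S)"
    using i.img_is_subgroup by simp
  moreover have "A \<subseteq> carrier (free_group T)"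
    using subsetD[OF A(2)] by (force simp: T_def carrier_free_group)
  ultimately have "carrier (free_group S) \<subseteq> carrier (free_group T)"
    using free.generate_subgroup_incl[of A "carrier (free_group T)" S] unfolding A(3) by blast
  then have "[(s, True)] \<in> carrier (free_group T)" if "s \<in> S" for s
    using that free_letter[of "(s, True)" S] by auto
  then have "S \<subseteq> T"
    by (auto simp: carrier_free_group)
  then show ?thesis using T(1) finite_subset by blast
qed

lemma finitely_generated_is_free_group:
  assumes F: "is_free_group F" and fg: "finitely_generated_group F"
  obtains n :: nat and \<theta> where "\<theta> \<in> iso (free_group {..<n}) F"
proof -
  interpret F: group F using F by (simp add: is_free_group_def)
  obtain S :: "'a set" and \<phi> where \<phi>: "\<phi> \<in> iso F (free_group S)"
    using F by (auto simp: is_free_group_def is_iso_def)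
  then have "finitely_generated_group (free_group S)"
    using finitely_generated_hom_image[OF fg free.is_group, of \<phi>] by (auto simp: iso_iff)
  then have "finite S" by (rule finitely_generated_free_group_finite_basis)
  then obtain f where f: "bij_betw f {0..<card S} S"
    using ex_bij_betw_nat_finite by blast
  then have "map (apfst f) \<in> iso (free_group {..<card S}) (free_group S)"
    using free_group_relabel[of f "{..<card S}"] by (simp add: bij_betw_def lessThan_atLeast0)
  then show ?thesis
    using that iso_set_trans[OF _ F.iso_set_sym[OF \<phi>]] by blast
qed

context subdirect begin

text \<open>A finitely generated subdirect product is generated by a lift of the free group \<open>F2\<close> and
  finitely many elements of \<open>N1\<close>, and the latter generate \<open>N1\<close> as a normal subgroup.\<close>

lemma N1_normal_closure:
  assumes F2_free: "is_free_group F2" and fg: "finitely_generated_group PG"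
  obtains R where "finite R" "R \<subseteq> carrier F1" "N1 = normal_closure F1 R"
proof -
  obtain S :: "'b set" where "F2 \<cong> free_group S"
    using F2_free by (auto simp: is_free_group_def)
  then obtain \<phi> where \<phi>: "\<phi> \<in> iso F2 (free_group S)" by (auto simp: is_iso_def)
  interpret \<phi>: group_hom F2 "free_group S" \<phi>
    using \<phi> by (simp add: group_hom_def group_hom_axioms_def F2.is_group iso_imp_homomorphism)
  define \<eta> where "\<eta> = inv_into (carrier F2) \<phi>"
  have \<eta>: "\<eta> \<in> iso (free_group S) F2"
    unfolding \<eta>_def by (rule F2.iso_set_sym[OF \<phi>])
  then have \<eta>_hom: "\<eta> \<in> hom (free_group S) F2" by (rule iso_imp_homomorphism)
  have \<eta>_\<phi>: "\<eta> (\<phi> b) = b" if "b \<in> carrier F2" for b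
    using that \<phi> by (simp add: \<eta>_def iso_iff)
  have "\<forall>s\<in>S. \<exists>g. g \<in> G \<and> snd g = \<eta> [(s, True)]"
  proof
    fix s assume "s \<in> S"
    then have "\<eta> [(s, True)] \<in> carrier F2"
      using hom_in_carrier[OF \<eta>_hom] by (simp add: free_letter)
    then show "\<exists>g. g \<in> G \<and> snd g = \<eta> [(s, True)]" using ex_fst by force
  qed
  then obtain \<gamma> where \<gamma>: "\<And>s. s \<in> S \<Longrightarrow> \<gamma> s \<in> G" "\<And>s. s \<in> S \<Longrightarrow> snd (\<gamma> s) = \<eta> [(s, True)]"
    by metis
  define \<tau> where "\<tau> = free_lift PG \<gamma>"
  have \<gamma>_PG: "\<gamma> \<in> S \<rightarrow> carrier PG" using \<gamma> by auto
  have \<tau>: "\<tau> \<in> hom (free_group S) PG"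
    unfolding \<tau>_def by (rule PG.free_lift_hom[OF \<gamma>_PG])
  have snd_hom: "snd \<in> hom PG F2" and fst_hom: "fst \<in> hom PG F1"
    using G_closed by (auto simp: hom_def)
  have snd_\<tau>: "snd (\<tau> w) = \<eta> w" if "w \<in> carrier (free_group S)" for w
  proof (rule free_hom_eq[OF F2.is_group _ \<eta>_hom _ that, of "\<lambda>w. snd (\<tau> w)"])
    show "(\<lambda>w. snd (\<tau> w)) \<in> hom (free_group S) F2"
      using Group.hom_compose[OF \<tau> snd_hom] by (simp add: comp_def)
    fix s assume s: "s \<in> S"
    have "\<tau> [(s, True)] = \<gamma> s"
      using \<gamma>_PG s PG.r_one[of "\<gamma> s"] by (auto simp: \<tau>_def Pi_iff simp del: PG.r_one)
    then show "snd (\<tau> [(s, True)]) = \<eta> [(s, True)]" using \<gamma>(2)[OF s] by simp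
  qed
  \<comment> \<open>An endomorphism of \<open>G\<close> that factors through the free group
    \<open>F2\<close> and keeps the second coordinate. So \<open>g\<close> and
    \<open>\<rho> g\<close> differ by an element of \<open>N1\<close>, and \<open>R\<close> collects
    these differences for the generators.\<close>
  define \<rho> where "\<rho> g = \<tau> (\<phi> (snd g))" for g :: "'a \<times> 'b"
  have \<rho>_hom: "\<rho> \<in> hom PG PG"
    using Group.hom_compose[OF Group.hom_compose[OF snd_hom \<phi>.homh] \<tau>] by (simp add: comp_def \<rho>_def[abs_def])
  then interpret \<rho>: group_hom PG PG \<rho>
    by (simp add: group_hom_def group_hom_axioms_def PG.is_group)
  have \<rho>_G: "\<rho> g \<in> G" if "g \<in> G" for g
    using \<rho>.hom_closed[of g] that by simp
  have snd_\<rho>: "snd (\<rho> g) = snd g" if "g \<in> G" for g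
    using that G_closed snd_\<tau> \<eta>_\<phi> by (cases g) (auto simp: \<rho>_def)
  have \<rho>_N2: "\<rho> (x, \<one>\<^bsub>F2\<^esub>) = \<one>\<^bsub>PG\<^esub>" for x
    using hom_one[OF \<tau> free.is_group PG.is_group] by (simp add: \<rho>_def)
  obtain A where A: "finite A" "A \<subseteq> G" "generate PG A = G"
    using fg by (auto simp: finitely_generated_group_def)
  define R where "R = (\<lambda>g. fst g \<otimes>\<^bsub>F1\<^esub> inv\<^bsub>F1\<^esub> fst (\<rho> g)) ` A"
  have in_N1: "fst g \<otimes>\<^bsub>F1\<^esub> inv\<^bsub>F1\<^esub> fst (\<rho> g) \<in> N1" if g: "g \<in> G" for g
  proof -
    have "(fst g \<otimes>\<^bsub>F1\<^esub> inv\<^bsub>F1\<^esub> fst (\<rho> g), snd g \<otimes>\<^bsub>F2\<^esub> inv\<^bsub>F2\<^esub> snd (\<rho> g)) \<in> G"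
      using g \<rho>_G[OF g] by (intro G_mult G_inv) simp_all
    then show ?thesis
      using snd_\<rho>[OF g] g G_closed(2)[of "fst g" "snd g"] N1_iff N2.one_closed by auto
  qed
  have R: "finite R" "R \<subseteq> N1"
    using A in_N1 by (auto simp: R_def)
  have RF: "R \<subseteq> carrier F1" using R(2) N1.subset by blast
  have "N1 \<subseteq> M" if M: "M \<lhd> F1" "R \<subseteq> M" for M
  proof
    interpret M: normal M F1 by (rule M(1))
    interpret q: group_hom F1 "F1 Mod M" "\<lambda>x. M #>\<^bsub>F1\<^esub> x" by (rule F1.rcoset_hom[OF M(1)])
    define k where "k g = M #>\<^bsub>F1\<^esub> fst g" for g :: "'a \<times> 'b"
    have k_hom: "k \<in> hom PG (F1 Mod M)"
      using Group.hom_compose[OF fst_hom q.homh] by (simp add: comp_def k_def[abs_def])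
    interpret k: group_hom PG "F1 Mod M" k
      using k_hom by (simp add: group_hom_def group_hom_axioms_def PG.is_group q.H.is_group)
    have fstF: "fst g \<in> carrier F1" if "g \<in> G" for g using that G_closed by (cases g) auto
    \<comment> \<open>Modulo \<open>M\<close> the first coordinates of \<open>g\<close> and
      \<open>\<rho> g\<close> agree on generators, hence on \<open>G\<close>. For \<open>g\<close>
      from \<open>N1\<close> the element \<open>\<rho> g\<close> is trivial, so \<open>N1\<close>
      vanishes modulo \<open>M\<close>.\<close>
    have "subgroup {g \<in> carrier PG. k g = (k \<circ> \<rho>) g} PG"
      by (rule PG.subgroup_equalizer[OF q.H.is_group k_hom Group.hom_compose[OF \<rho>_hom k_hom]])
    then have "subgroup {g \<in> carrier PG. k g = k (\<rho> g)} PG" by simp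
    moreover have "A \<subseteq> {g \<in> carrier PG. k g = k (\<rho> g)}"
    proof
      fix g assume g: "g \<in> A"
      then have "fst g \<otimes>\<^bsub>F1\<^esub> inv\<^bsub>F1\<^esub> fst (\<rho> g) \<in> M" using M(2) by (auto simp: R_def)
      moreover have "g \<in> G" using g A(2) by blast
      ultimately show "g \<in> {g \<in> carrier PG. k g = k (\<rho> g)}"
        using F1.rcoset_eq_iff[OF M.subgroup_axioms fstF fstF[OF \<rho>_G]] by (simp add: k_def)
    qed
    ultimately have "generate PG A \<subseteq> {g \<in> carrier PG. k g = k (\<rho> g)}"
      by (intro PG.generate_subgroup_incl)
    then have "G \<subseteq> {g \<in> carrier PG. k g = k (\<rho> g)}"
      unfolding A(3) .
    moreover fix x assume x: "x \<in> N1"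
    ultimately have "M #>\<^bsub>F1\<^esub> x = M #>\<^bsub>F1\<^esub> \<one>\<^bsub>F1\<^esub>"
      using N1_G[OF x] \<rho>_N2 by (auto simp: k_def)
    then show "x \<in> M"
      using F1.rcoset_eq_iff[OF M.subgroup_axioms N1.mem_carrier[OF x] F1.one_closed] N1.mem_carrier[OF x] by simp
  qed
  then have "N1 = normal_closure F1 R"
    using N1_normal R(2) by (auto simp: normal_closure_def)
  with that R(1) RF show ?thesis by blast
qed

text \<open>A conjugator has coordinates \<open>a = x1^i\<close> and \<open>b = x2^j f\<close>.
  Dividing it by \<open>(x1, x2)^i\<close> leaves first coordinate 1, so \<open>x2^(j - i) f\<close>
  is in \<open>N2\<close>, and there \<open>x2\<close> may be replaced by
  \<open>f^m\<close>.\<close>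

lemma conjugate_imp_pow_mem:
  fixes m :: int
  assumes ef: "(e, f) \<in> G" and x: "(x1, x2) \<in> G" and n: "x2 = f [^]\<^bsub>F2\<^esub> m \<otimes>\<^bsub>F2\<^esub> n" "n \<in> N2"
    and prim1: "\<And>c. c \<in> carrier F1 \<Longrightarrow> x1 \<otimes>\<^bsub>F1\<^esub> c = c \<otimes>\<^bsub>F1\<^esub> x1 \<Longrightarrow> \<exists>i::int. c = x1 [^]\<^bsub>F1\<^esub> i"
    and prim2: "\<And>c. c \<in> carrier F2 \<Longrightarrow> x2 \<otimes>\<^bsub>F2\<^esub> c = c \<otimes>\<^bsub>F2\<^esub> x2 \<Longrightarrow> \<exists>i::int. c = x2 [^]\<^bsub>F2\<^esub> i"
    and conj: "conjugate_in PG (x1, x2) (x1, inv\<^bsub>F2\<^esub> f \<otimes>\<^bsub>F2\<^esub> x2 \<otimes>\<^bsub>F2\<^esub> f)"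
  obtains k :: int where "f [^]\<^bsub>F2\<^esub> (1 + m * k) \<in> N2"
proof -
  note c = G_closed[OF ef] G_closed[OF x]
  interpret q: group_hom F2 "F2 Mod N2" "\<lambda>x. N2 #>\<^bsub>F2\<^esub> x" by (rule F2.rcoset_hom[OF N2_normal])
  obtain a b where ab: "(a, b) \<in> G" "x1 = inv\<^bsub>F1\<^esub> a \<otimes>\<^bsub>F1\<^esub> x1 \<otimes>\<^bsub>F1\<^esub> a"
    "inv\<^bsub>F2\<^esub> f \<otimes>\<^bsub>F2\<^esub> x2 \<otimes>\<^bsub>F2\<^esub> f = inv\<^bsub>F2\<^esub> b \<otimes>\<^bsub>F2\<^esub> x2 \<otimes>\<^bsub>F2\<^esub> b"
    using conj by (auto simp: conjugate_in_def inv_PG)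
  note abc = G_closed[OF ab(1)]
  have "a \<otimes>\<^bsub>F1\<^esub> x1 = a \<otimes>\<^bsub>F1\<^esub> (inv\<^bsub>F1\<^esub> a \<otimes>\<^bsub>F1\<^esub> x1 \<otimes>\<^bsub>F1\<^esub> a)"
    using ab(2) by simp
  then have "x1 \<otimes>\<^bsub>F1\<^esub> a = a \<otimes>\<^bsub>F1\<^esub> x1"
    using abc c by (simp add: F1.group_simps)
  then obtain i :: int where i: "a = x1 [^]\<^bsub>F1\<^esub> i"
    using prim1 abc by blast
  have "b \<otimes>\<^bsub>F2\<^esub> (inv\<^bsub>F2\<^esub> f \<otimes>\<^bsub>F2\<^esub> x2 \<otimes>\<^bsub>F2\<^esub> f) \<otimes>\<^bsub>F2\<^esub> inv\<^bsub>F2\<^esub> f =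
      b \<otimes>\<^bsub>F2\<^esub> (inv\<^bsub>F2\<^esub> b \<otimes>\<^bsub>F2\<^esub> x2 \<otimes>\<^bsub>F2\<^esub> b) \<otimes>\<^bsub>F2\<^esub> inv\<^bsub>F2\<^esub> f"
    using ab(3) by simp
  then have "x2 \<otimes>\<^bsub>F2\<^esub> (b \<otimes>\<^bsub>F2\<^esub> inv\<^bsub>F2\<^esub> f) = (b \<otimes>\<^bsub>F2\<^esub> inv\<^bsub>F2\<^esub> f) \<otimes>\<^bsub>F2\<^esub> x2"
    using abc c by (simp add: F2.group_simps)
  then obtain j :: int where j: "b \<otimes>\<^bsub>F2\<^esub> inv\<^bsub>F2\<^esub> f = x2 [^]\<^bsub>F2\<^esub> j"
    using prim2[of "b \<otimes>\<^bsub>F2\<^esub> inv\<^bsub>F2\<^esub> f"] abc c by blast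
  have b: "b = x2 [^]\<^bsub>F2\<^esub> j \<otimes>\<^bsub>F2\<^esub> f"
    using abc c by (simp add: F2.group_simps flip: j)
  have "(inv\<^bsub>F1\<^esub> (x1 [^]\<^bsub>F1\<^esub> i) \<otimes>\<^bsub>F1\<^esub> a, inv\<^bsub>F2\<^esub> (x2 [^]\<^bsub>F2\<^esub> i) \<otimes>\<^bsub>F2\<^esub> b) \<in> G"
    by (rule G_mult[OF G_inv[OF G_int_pow[OF x]] ab(1)])
  then have "inv\<^bsub>F2\<^esub> (x2 [^]\<^bsub>F2\<^esub> i) \<otimes>\<^bsub>F2\<^esub> b \<in> N2"
    using N1_iff[of "inv\<^bsub>F1\<^esub> (x1 [^]\<^bsub>F1\<^esub> i) \<otimes>\<^bsub>F1\<^esub> a" "inv\<^bsub>F2\<^esub> (x2 [^]\<^bsub>F2\<^esub> i) \<otimes>\<^bsub>F2\<^esub> b"] c i N1.one_closed by simp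
  moreover have "inv\<^bsub>F2\<^esub> (x2 [^]\<^bsub>F2\<^esub> i) \<otimes>\<^bsub>F2\<^esub> b = x2 [^]\<^bsub>F2\<^esub> (j - i) \<otimes>\<^bsub>F2\<^esub> f"
    using c F2.int_pow_mult[of x2 "- i" j] by (simp add: b F2.int_pow_neg F2.m_assoc)
  ultimately have mem: "x2 [^]\<^bsub>F2\<^esub> (j - i) \<otimes>\<^bsub>F2\<^esub> f \<in> N2" by simp
  have x2_q: "N2 #>\<^bsub>F2\<^esub> x2 = N2 #>\<^bsub>F2\<^esub> (f [^]\<^bsub>F2\<^esub> m)"
    using n c N2.inv_op_closed2[of "f [^]\<^bsub>F2\<^esub> m" n] N2.mem_carrier[OF n(2)]
    by (subst F2.rcoset_eq_iff[OF N2.subgroup_axioms]) auto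
  have "N2 #>\<^bsub>F2\<^esub> (x2 [^]\<^bsub>F2\<^esub> (j - i) \<otimes>\<^bsub>F2\<^esub> f) =
      (N2 #>\<^bsub>F2\<^esub> x2) [^]\<^bsub>F2 Mod N2\<^esub> (j - i) \<otimes>\<^bsub>F2 Mod N2\<^esub> (N2 #>\<^bsub>F2\<^esub> f)"
    using c by (simp only: q.hom_mult q.hom_int_pow F2.int_pow_closed)
  also have "\<dots> = N2 #>\<^bsub>F2\<^esub> ((f [^]\<^bsub>F2\<^esub> m) [^]\<^bsub>F2\<^esub> (j - i) \<otimes>\<^bsub>F2\<^esub> f)"
    using c by (simp only: x2_q q.hom_mult q.hom_int_pow F2.int_pow_closed)
  also have "(f [^]\<^bsub>F2\<^esub> m) [^]\<^bsub>F2\<^esub> (j - i) \<otimes>\<^bsub>F2\<^esub> f = f [^]\<^bsub>F2\<^esub> (1 + m * (j - i))"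
    using c F2.int_pow_mult[of f "m * (j - i)" 1] by (simp add: F2.int_pow_pow add.commute)
  finally have eq: "N2 #>\<^bsub>F2\<^esub> (x2 [^]\<^bsub>F2\<^esub> (j - i) \<otimes>\<^bsub>F2\<^esub> f) = N2 #>\<^bsub>F2\<^esub> (f [^]\<^bsub>F2\<^esub> (1 + m * (j - i)))" .
  have "N2 #>\<^bsub>F2\<^esub> (x2 [^]\<^bsub>F2\<^esub> (j - i) \<otimes>\<^bsub>F2\<^esub> f) = N2"
    using F2.coset_join2[OF _ N2.subgroup_axioms mem] c by simp
  then have "f [^]\<^bsub>F2\<^esub> (1 + m * (j - i)) \<in> N2"
    using F2.coset_join1[OF _ _ N2.subgroup_axioms, of "f [^]\<^bsub>F2\<^esub> (1 + m * (j - i))"] eq c by simp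
  with that show ?thesis by blast
qed

text \<open>The commutator with \<open>(1, n)\<close> has first coordinate 1 whatever
  \<open>k1\<close> is. Modulo \<open>K\<close>, the second coordinates of elements of
  \<open>K\<close> therefore act trivially on \<open>N2\<close>.\<close>

lemma commutator_mem:
  assumes K: "K \<lhd> PG" and k: "(k1, k2) \<in> K" and n: "n \<in> N2"
  shows "(\<one>\<^bsub>F1\<^esub>, n \<otimes>\<^bsub>F2\<^esub> inv\<^bsub>F2\<^esub> (inv\<^bsub>F2\<^esub> k2 \<otimes>\<^bsub>F2\<^esub> n \<otimes>\<^bsub>F2\<^esub> k2)) \<in> K"
proof -
  interpret K: normal K PG by (rule K)
  have kG: "(k1, k2) \<in> G" using K.mem_carrier[OF k] by simp
  note c = G_closed[OF kG] N2.mem_carrier[OF n]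
  have nG: "(\<one>\<^bsub>F1\<^esub>, n) \<in> G" by (rule N2_G[OF n])
  have "((\<one>\<^bsub>F1\<^esub>, n) \<otimes>\<^bsub>PG\<^esub> inv\<^bsub>PG\<^esub> (k1, k2) \<otimes>\<^bsub>PG\<^esub> inv\<^bsub>PG\<^esub> (\<one>\<^bsub>F1\<^esub>, n)) \<otimes>\<^bsub>PG\<^esub> (k1, k2) \<in> K"
    using nG k by (intro K.m_closed K.inv_op_closed2) simp_all
  then show ?thesis
    using c by (simp add: inv_PG[OF kG] inv_PG[OF nG] F1.group_simps F2.group_simps)
qed

end

section \<open>Conjugacy of the test elements modulo a normal subgroup of \<open>G\<close>\<close>

context subdirect begin

text \<open>Here \<open>z = l f\<close> with \<open>l\<close> in \<open>N2\<close>, and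
  \<open>z\<close> acts trivially on \<open>N2\<close> modulo \<open>K\<close>. So \<open>f\<close>
  acts on \<open>x2\<close> like the inverse of \<open>l\<close>, and this is conjugation by the
  element \<open>(1, inv l)\<close> of \<open>G\<close>.\<close>

lemma conjugate_mod_residual:
  assumes K: "K \<lhd> PG" and ef: "(e, f) \<in> G" and x: "x1 \<in> N1" "x2 \<in> N2"
    and n: "n \<in> N1" and z: "(e \<otimes>\<^bsub>F1\<^esub> n, z) \<in> K"
  shows "\<exists>g\<in>G. inv\<^bsub>PG\<^esub> g \<otimes>\<^bsub>PG\<^esub> (x1, x2) \<otimes>\<^bsub>PG\<^esub> g \<otimes>\<^bsub>PG\<^esub>
    inv\<^bsub>PG\<^esub> (x1, inv\<^bsub>F2\<^esub> f \<otimes>\<^bsub>F2\<^esub> x2 \<otimes>\<^bsub>F2\<^esub> f) \<in> K"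
proof -
  interpret K: normal K PG by (rule K)
  have zG: "(e \<otimes>\<^bsub>F1\<^esub> n, z) \<in> G" using K.mem_carrier[OF z] by simp
  note c = G_closed[OF ef] G_closed(2)[OF zG] N1.mem_carrier[OF x(1)] N2.mem_carrier[OF x(2)] N1.mem_carrier[OF n]
  define l where "l = z \<otimes>\<^bsub>F2\<^esub> inv\<^bsub>F2\<^esub> f"
  have l: "l \<in> N2"
  proof -
    have "((e \<otimes>\<^bsub>F1\<^esub> n) \<otimes>\<^bsub>F1\<^esub> inv\<^bsub>F1\<^esub> e, l) \<in> G"
      unfolding l_def by (rule G_mult[OF zG G_inv[OF ef]])
    moreover have "(e \<otimes>\<^bsub>F1\<^esub> n) \<otimes>\<^bsub>F1\<^esub> inv\<^bsub>F1\<^esub> e \<in> N1"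
      using n c by (intro N1.inv_op_closed2)
    ultimately show ?thesis using N1_iff by blast
  qed
  have lF: "l \<in> carrier F2" using l by (rule N2.mem_carrier)
  define y where "y = l \<otimes>\<^bsub>F2\<^esub> x2 \<otimes>\<^bsub>F2\<^esub> inv\<^bsub>F2\<^esub> l"
  have y: "y \<in> N2" unfolding y_def using x(2) lF by (intro N2.inv_op_closed2)
  have "(\<one>\<^bsub>F1\<^esub>, y \<otimes>\<^bsub>F2\<^esub> inv\<^bsub>F2\<^esub> (inv\<^bsub>F2\<^esub> z \<otimes>\<^bsub>F2\<^esub> y \<otimes>\<^bsub>F2\<^esub> z)) \<in> K"
    by (rule commutator_mem[OF K z y])
  moreover have "inv\<^bsub>F2\<^esub> z \<otimes>\<^bsub>F2\<^esub> y \<otimes>\<^bsub>F2\<^esub> z = inv\<^bsub>F2\<^esub> f \<otimes>\<^bsub>F2\<^esub> x2 \<otimes>\<^bsub>F2\<^esub> f"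
    using c by (simp add: y_def l_def F2.group_simps)
  ultimately have mem: "(\<one>\<^bsub>F1\<^esub>, y \<otimes>\<^bsub>F2\<^esub> inv\<^bsub>F2\<^esub> (inv\<^bsub>F2\<^esub> f \<otimes>\<^bsub>F2\<^esub> x2 \<otimes>\<^bsub>F2\<^esub> f)) \<in> K" by simp
  have gG: "(\<one>\<^bsub>F1\<^esub>, inv\<^bsub>F2\<^esub> l) \<in> G" using N2_G l by simp
  have yG: "(x1, inv\<^bsub>F2\<^esub> f \<otimes>\<^bsub>F2\<^esub> x2 \<otimes>\<^bsub>F2\<^esub> f) \<in> G"
  proof -
    have "inv\<^bsub>F2\<^esub> f \<otimes>\<^bsub>F2\<^esub> x2 \<otimes>\<^bsub>F2\<^esub> f \<in> N2" using x(2) c by (intro N2.inv_op_closed1)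
    from G_mult[OF N1_G[OF x(1)] N2_G[OF this]] show ?thesis using c by simp
  qed
  show ?thesis
    using mem c lF by (intro bexI[OF _ gG]) (simp add: inv_PG[OF gG] inv_PG[OF yG] y_def)
qed

text \<open>With \<open>u m + v d = 1\<close>, \<open>f\<close> is the product of
  \<open>U = f^(u m)\<close> and \<open>k2 = f^(v d)\<close>, where \<open>k2\<close> is a second
  coordinate in \<open>K\<close>. The factor \<open>U\<close> acts on \<open>x2\<close> like an
  element of \<open>N2\<close>, and \<open>k2\<close> acts trivially on the result modulo
  \<open>K\<close>.\<close>

lemma conjugate_mod_coprime:
  fixes m :: int and d :: nat
  assumes K: "K \<lhd> PG" and ef: "(e, f) \<in> G" and x: "(x1, x2) \<in> G"
    and n: "x2 = f [^]\<^bsub>F2\<^esub> m \<otimes>\<^bsub>F2\<^esub> n" "n \<in> N2"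
    and d: "(e [^]\<^bsub>F1\<^esub> d, f [^]\<^bsub>F2\<^esub> d) \<in> K" "coprime m (int d)"
  shows "\<exists>g\<in>G. inv\<^bsub>PG\<^esub> g \<otimes>\<^bsub>PG\<^esub> (x1, x2) \<otimes>\<^bsub>PG\<^esub> g \<otimes>\<^bsub>PG\<^esub>
    inv\<^bsub>PG\<^esub> (x1, inv\<^bsub>F2\<^esub> f \<otimes>\<^bsub>F2\<^esub> x2 \<otimes>\<^bsub>F2\<^esub> f) \<in> K"
proof -
  interpret K: normal K PG by (rule K)
  interpret q: group_hom F2 "F2 Mod N2" "\<lambda>x. N2 #>\<^bsub>F2\<^esub> x" by (rule F2.rcoset_hom[OF N2_normal])
  note c = G_closed[OF ef] G_closed[OF x] N2.mem_carrier[OF n(2)]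
  obtain u v where uv: "u * m + v * int d = 1"
    using bezout_int[of m "int d"] d(2) by auto
  define k1 k2 where "k1 = e [^]\<^bsub>F1\<^esub> (v * int d)" and "k2 = f [^]\<^bsub>F2\<^esub> (v * int d)"
  have k: "(k1, k2) \<in> K"
  proof -
    have "(e [^]\<^bsub>F1\<^esub> d, f [^]\<^bsub>F2\<^esub> d) [^]\<^bsub>PG\<^esub> v \<in> K"
      by (rule PG.subgroup_int_pow_closed[OF K.subgroup_axioms d(1)])
    moreover have "(e [^]\<^bsub>F1\<^esub> d, f [^]\<^bsub>F2\<^esub> d) [^]\<^bsub>PG\<^esub> v = (e [^]\<^bsub>F1\<^esub> d, f [^]\<^bsub>F2\<^esub> d) [^]\<^bsub>F1 \<times>\<times> F2\<^esub> v"
      using P.int_pow_consistent[OF G.subgroup_axioms] K.mem_carrier[OF d(1)] by simp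
    moreover have "(e [^]\<^bsub>F1\<^esub> d, f [^]\<^bsub>F2\<^esub> d) [^]\<^bsub>F1 \<times>\<times> F2\<^esub> v = (k1, k2)"
      using c by (simp add: P_int_pow k1_def k2_def F1.int_pow_pow F2.int_pow_pow mult.commute flip: int_pow_int)
    ultimately show ?thesis by simp
  qed
  have kF: "k2 \<in> carrier F2" using c by (simp add: k2_def)
  define M where "M = f [^]\<^bsub>F2\<^esub> m"
  define U where "U = f [^]\<^bsub>F2\<^esub> (u * m)"
  have MU: "M \<in> carrier F2" "U \<in> carrier F2" using c by (simp_all add: M_def U_def)
  have f_eq: "f = U \<otimes>\<^bsub>F2\<^esub> k2"
    using c F2.int_pow_mult[of f "u * m" "v * int d"] uv by (simp add: U_def k2_def)
  have M_k2: "M \<otimes>\<^bsub>F2\<^esub> k2 = k2 \<otimes>\<^bsub>F2\<^esub> M"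
    using c F2.int_pow_mult[of f m "v * int d"] F2.int_pow_mult[of f "v * int d" m]
    by (simp add: M_def k2_def add.commute)
  text \<open>Conjugation by \<open>U\<close> acts on \<open>x2\<close> like conjugation by some \<open>l\<close> in \<open>N2\<close>,
    because \<open>x2 ^ u\<close> and \<open>U\<close> agree modulo \<open>N2\<close>.\<close>
  define W where "W = x2 [^]\<^bsub>F2\<^esub> u"
  have W: "W \<in> carrier F2" "W \<otimes>\<^bsub>F2\<^esub> x2 = x2 \<otimes>\<^bsub>F2\<^esub> W"
    using c F2.int_pow_mult[of x2 u 1] F2.int_pow_mult[of x2 1 u] by (simp_all add: W_def add.commute)
  define l where "l = inv\<^bsub>F2\<^esub> W \<otimes>\<^bsub>F2\<^esub> U"
  have x2_M: "x2 = M \<otimes>\<^bsub>F2\<^esub> n" by (simp add: n(1) M_def)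
  have x2_q: "N2 #>\<^bsub>F2\<^esub> x2 = N2 #>\<^bsub>F2\<^esub> M"
    using n(2) c MU N2.inv_op_closed2[of M n]
    by (subst F2.rcoset_eq_iff[OF N2.subgroup_axioms]) (auto simp: x2_M)
  have "N2 #>\<^bsub>F2\<^esub> W = N2 #>\<^bsub>F2\<^esub> U"
  proof -
    have "N2 #>\<^bsub>F2\<^esub> W = (N2 #>\<^bsub>F2\<^esub> M) [^]\<^bsub>F2 Mod N2\<^esub> u"
      unfolding W_def x2_q[symmetric] using c by (simp only: q.hom_int_pow)
    also have "\<dots> = N2 #>\<^bsub>F2\<^esub> (M [^]\<^bsub>F2\<^esub> u)"
      using MU by (simp only: q.hom_int_pow)
    also have "M [^]\<^bsub>F2\<^esub> u = U"
      using c by (simp add: M_def U_def F2.int_pow_pow mult.commute)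
    finally show ?thesis .
  qed
  then have "W \<otimes>\<^bsub>F2\<^esub> inv\<^bsub>F2\<^esub> U \<in> N2"
    using F2.rcoset_eq_iff[OF N2.subgroup_axioms W(1) MU(2)] by simp
  then have "U \<otimes>\<^bsub>F2\<^esub> inv\<^bsub>F2\<^esub> W \<in> N2"
    using N2.m_inv_closed[of "W \<otimes>\<^bsub>F2\<^esub> inv\<^bsub>F2\<^esub> U"] W MU by (simp add: F2.inv_mult_group)
  then have l: "l \<in> N2"
    unfolding l_def using F2.normal_mult_commute[OF N2_normal] W MU by simp
  have lF: "l \<in> carrier F2" using l by (rule N2.mem_carrier)
  have U_eq: "U = W \<otimes>\<^bsub>F2\<^esub> l" using W MU by (simp add: l_def F2.group_simps)
  define y where "y = inv\<^bsub>F2\<^esub> l \<otimes>\<^bsub>F2\<^esub> x2 \<otimes>\<^bsub>F2\<^esub> l"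
  have yF: "y \<in> carrier F2" using lF c by (simp add: y_def)
  have "inv\<^bsub>F2\<^esub> U \<otimes>\<^bsub>F2\<^esub> x2 \<otimes>\<^bsub>F2\<^esub> U = inv\<^bsub>F2\<^esub> l \<otimes>\<^bsub>F2\<^esub> (inv\<^bsub>F2\<^esub> W \<otimes>\<^bsub>F2\<^esub> (x2 \<otimes>\<^bsub>F2\<^esub> W)) \<otimes>\<^bsub>F2\<^esub> l"
    using W(1) lF c by (simp add: U_eq F2.group_simps)
  also have "\<dots> = y"
    using W(1) lF c by (simp add: y_def F2.inv_cancel flip: W(2))
  finally have U_conj: "inv\<^bsub>F2\<^esub> U \<otimes>\<^bsub>F2\<^esub> x2 \<otimes>\<^bsub>F2\<^esub> U = y" .
  have f_conj: "inv\<^bsub>F2\<^esub> f \<otimes>\<^bsub>F2\<^esub> x2 \<otimes>\<^bsub>F2\<^esub> f = inv\<^bsub>F2\<^esub> k2 \<otimes>\<^bsub>F2\<^esub> y \<otimes>\<^bsub>F2\<^esub> k2"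
  proof -
    have "inv\<^bsub>F2\<^esub> f \<otimes>\<^bsub>F2\<^esub> x2 \<otimes>\<^bsub>F2\<^esub> f = inv\<^bsub>F2\<^esub> k2 \<otimes>\<^bsub>F2\<^esub> (inv\<^bsub>F2\<^esub> U \<otimes>\<^bsub>F2\<^esub> x2 \<otimes>\<^bsub>F2\<^esub> U) \<otimes>\<^bsub>F2\<^esub> k2"
      unfolding f_eq using MU kF c(4) by (simp add: F2.group_simps)
    then show ?thesis by (simp only: U_conj)
  qed
  \<comment> \<open>\<open>y\<close> need not lie in \<open>N2\<close>, where commutators with
    \<open>k2\<close> are known to be in \<open>K\<close>. Splitting off \<open>M\<close>, which
    commutes with \<open>k2\<close> as both are powers of \<open>f\<close>, leaves the part
    \<open>r\<close> in \<open>N2\<close>.\<close>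
  define r where "r = inv\<^bsub>F2\<^esub> M \<otimes>\<^bsub>F2\<^esub> y"
  have r: "r \<in> N2"
  proof -
    have "inv\<^bsub>F2\<^esub> M \<otimes>\<^bsub>F2\<^esub> inv\<^bsub>F2\<^esub> l \<otimes>\<^bsub>F2\<^esub> M \<in> N2"
      using l MU by (intro N2.inv_op_closed1) simp_all
    then have "(inv\<^bsub>F2\<^esub> M \<otimes>\<^bsub>F2\<^esub> inv\<^bsub>F2\<^esub> l \<otimes>\<^bsub>F2\<^esub> M) \<otimes>\<^bsub>F2\<^esub> (n \<otimes>\<^bsub>F2\<^esub> l) \<in> N2"
      using n(2) l by blast
    then show ?thesis
      using MU lF c by (simp add: r_def y_def x2_M F2.group_simps)
  qed
  have rF: "r \<in> carrier F2" using r by (rule N2.mem_carrier)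
  have y_eq: "y = M \<otimes>\<^bsub>F2\<^esub> r" using MU yF by (simp add: r_def F2.group_simps)
  have eqF: "y \<otimes>\<^bsub>F2\<^esub> inv\<^bsub>F2\<^esub> (inv\<^bsub>F2\<^esub> k2 \<otimes>\<^bsub>F2\<^esub> y \<otimes>\<^bsub>F2\<^esub> k2) =
      M \<otimes>\<^bsub>F2\<^esub> (r \<otimes>\<^bsub>F2\<^esub> inv\<^bsub>F2\<^esub> (inv\<^bsub>F2\<^esub> k2 \<otimes>\<^bsub>F2\<^esub> r \<otimes>\<^bsub>F2\<^esub> k2)) \<otimes>\<^bsub>F2\<^esub> inv\<^bsub>F2\<^esub> M"
  proof -
    have "inv\<^bsub>F2\<^esub> k2 \<otimes>\<^bsub>F2\<^esub> (M \<otimes>\<^bsub>F2\<^esub> r) \<otimes>\<^bsub>F2\<^esub> k2 = inv\<^bsub>F2\<^esub> k2 \<otimes>\<^bsub>F2\<^esub> (M \<otimes>\<^bsub>F2\<^esub> k2) \<otimes>\<^bsub>F2\<^esub> (inv\<^bsub>F2\<^esub> k2 \<otimes>\<^bsub>F2\<^esub> r \<otimes>\<^bsub>F2\<^esub> k2)"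
      using MU kF rF by (simp add: F2.group_simps)
    also have "\<dots> = M \<otimes>\<^bsub>F2\<^esub> (inv\<^bsub>F2\<^esub> k2 \<otimes>\<^bsub>F2\<^esub> r \<otimes>\<^bsub>F2\<^esub> k2)"
      unfolding M_k2 using MU kF rF by (simp add: F2.group_simps)
    finally show ?thesis
      unfolding y_eq using MU kF rF by (simp add: F2.group_simps)
  qed
  have MG: "(e [^]\<^bsub>F1\<^esub> m, M) \<in> G" unfolding M_def by (rule G_int_pow[OF ef])
  have "(e [^]\<^bsub>F1\<^esub> m, M) \<otimes>\<^bsub>PG\<^esub> (\<one>\<^bsub>F1\<^esub>, r \<otimes>\<^bsub>F2\<^esub> inv\<^bsub>F2\<^esub> (inv\<^bsub>F2\<^esub> k2 \<otimes>\<^bsub>F2\<^esub> r \<otimes>\<^bsub>F2\<^esub> k2)) \<otimes>\<^bsub>PG\<^esub> inv\<^bsub>PG\<^esub> (e [^]\<^bsub>F1\<^esub> m, M) \<in> K"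
    using MG by (intro K.inv_op_closed2 commutator_mem[OF K k r]) simp
  then have mem: "(\<one>\<^bsub>F1\<^esub>, y \<otimes>\<^bsub>F2\<^esub> inv\<^bsub>F2\<^esub> (inv\<^bsub>F2\<^esub> f \<otimes>\<^bsub>F2\<^esub> x2 \<otimes>\<^bsub>F2\<^esub> f)) \<in> K"
    using c by (simp add: inv_PG[OF MG] f_conj eqF)
  have gG: "(\<one>\<^bsub>F1\<^esub>, l) \<in> G" by (rule N2_G[OF l])
  have conjG: "(x1, inv\<^bsub>F2\<^esub> f \<otimes>\<^bsub>F2\<^esub> x2 \<otimes>\<^bsub>F2\<^esub> f) \<in> G"
  proof -
    have "inv\<^bsub>PG\<^esub> (\<one>\<^bsub>F1\<^esub>, l) \<otimes>\<^bsub>PG\<^esub> (x1, x2) \<otimes>\<^bsub>PG\<^esub> (\<one>\<^bsub>F1\<^esub>, l) = (x1, y)"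
      using c by (simp add: inv_PG[OF gG] y_def)
    then have x1y: "(x1, y) \<in> G"
      using PG.m_closed[OF PG.m_closed[OF PG.inv_closed[of "(\<one>\<^bsub>F1\<^esub>, l)"], of "(x1, x2)"], of "(\<one>\<^bsub>F1\<^esub>, l)"] gG x
      by simp
    have memG: "(\<one>\<^bsub>F1\<^esub>, y \<otimes>\<^bsub>F2\<^esub> inv\<^bsub>F2\<^esub> (inv\<^bsub>F2\<^esub> f \<otimes>\<^bsub>F2\<^esub> x2 \<otimes>\<^bsub>F2\<^esub> f)) \<in> G"
      using K.mem_carrier[OF mem] by simp
    show ?thesis
      using G_mult[OF G_inv[OF memG] x1y] c yF by (simp add: F2.group_simps)
  qed
  show ?thesis
    using mem c lF by (intro bexI[OF _ gG]) (simp add: inv_PG[OF gG] inv_PG[OF conjG] y_def)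
qed

end

lemma (in group) residually_finiteI:
  assumes "\<And>x. x \<in> carrier G \<Longrightarrow> x \<noteq> \<one> \<Longrightarrow> \<exists>K. K \<lhd> G \<and> finite (rcosets K) \<and> x \<notin> K"
  shows "residually_finite G"
  unfolding residually_finite_def
proof (intro conjI ballI impI)
  fix x assume x: "x \<in> carrier G" "x \<noteq> \<one>"
  then obtain K where K: "K \<lhd> G" "finite (rcosets K)" "x \<notin> K"
    using assms by blast
  interpret K: normal K G by (rule K(1))
  interpret Q: group "G Mod K" by (rule K.factorgroup_is_group)
  have fin: "finite (carrier (G Mod K))"
    using K(2) by (simp add: FactGroup_def)
  obtain f :: "'a set \<Rightarrow> nat" where f: "inj_on f (carrier (G Mod K))"
    using finite_imp_inj_to_nat_seg[OF fin] by metis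
  define M where "M = image_group f (G Mod K)"
  note M = group_image_group[OF Q.is_group f, folded M_def]
  have hom: "f \<circ> (\<lambda>x. K #> x) \<in> hom G M"
    by (rule Group.hom_compose[OF K.r_coset_hom_Mod iso_imp_homomorphism[OF M(1)]])
  have "f (K #> x) \<noteq> f (K #> \<one>)"
  proof
    assume "f (K #> x) = f (K #> \<one>)"
    then have "K #> x = K #> \<one>"
      by (rule inj_onD[OF f]) (use x in \<open>auto simp: carrier_FactGroup simp del: coset_mult_one\<close>)
    then show False
      using rcoset_eq_iff[OF K.subgroup_axioms x(1) one_closed] x(1) K(3) by simp
  qed
  then have "(f \<circ> (\<lambda>x. K #> x)) x \<noteq> \<one>\<^bsub>M\<^esub>"
    using K.subset by (simp add: M_def image_group_one)
  moreover have "finite (carrier M)" using fin by (simp add: M_def image_group_carrier)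
  ultimately show "\<exists>(M :: nat monoid) \<phi>. group M \<and> finite (carrier M) \<and> \<phi> \<in> hom G M \<and> \<phi> x \<noteq> \<one>\<^bsub>M\<^esub>"
    using M(2) hom by blast
qed (rule is_group)

lemma finitely_presented_p_group_of_full_subdirect:
  fixes F1 F2 :: "nat monoid" and p :: nat
  assumes p: "Factorial_Ring.prime p" and free: "is_free_group F1" "is_free_group F2"
    and full: "full_subdirect_product F1 F2 G"
    and fg: "finitely_generated_group ((F1 \<times>\<times> F2)\<lparr>carrier := G\<rparr>)"
    and pcs: "p_conjugacy_separable p ((F1 \<times>\<times> F2)\<lparr>carrier := G\<rparr>)"
    and inf: "infinite (rcosets\<^bsub>F1 \<times>\<times> F2\<^esub> G)"
  shows "\<exists>Q :: nat monoid. group Q \<and> infinite (carrier Q) \<and> finitely_presented_group Q \<and>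
          residually_finite Q \<and> p_group p Q"
proof -
  interpret subdirect F1 F2 G
    by (rule subdirect.intro)
      (use free full in \<open>simp_all add: is_free_group_def full_subdirect_product_def\<close>)

  \<comment> \<open>Both intersections are nontrivial and of infinite index\<close>
  have N1_ne: "N1 \<noteq> {\<one>\<^bsub>F1\<^esub>}"
  proof
    assume 1: "N1 = {\<one>\<^bsub>F1\<^esub>}"
    have "a = \<one>\<^bsub>F1\<^esub>" if "(a, \<one>\<^bsub>F2\<^esub>) \<in> G" for a
      using iffD2[OF N1_iff[OF that] N2.one_closed] unfolding 1 by (rule singletonD)
    moreover have "(\<one>\<^bsub>F1\<^esub>, \<one>\<^bsub>F2\<^esub>) \<in> G"
      using G.one_closed unfolding one_DirProd .
    ultimately have "G \<inter> (carrier F1 \<times> {\<one>\<^bsub>F2\<^esub>}) = {\<one>\<^bsub>F1 \<times>\<times> F2\<^esub>}"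
      unfolding one_DirProd using F1.one_closed by blast
    then show False using full by (simp add: full_subdirect_product_def)
  qed
  have N2_ne: "N2 \<noteq> {\<one>\<^bsub>F2\<^esub>}"
  proof
    assume 2: "N2 = {\<one>\<^bsub>F2\<^esub>}"
    have "b = \<one>\<^bsub>F2\<^esub>" if "(\<one>\<^bsub>F1\<^esub>, b) \<in> G" for b
      using iffD1[OF N1_iff[OF that] N1.one_closed] unfolding 2 by (rule singletonD)
    moreover have "(\<one>\<^bsub>F1\<^esub>, \<one>\<^bsub>F2\<^esub>) \<in> G"
      using G.one_closed unfolding one_DirProd .
    ultimately have "G \<inter> ({\<one>\<^bsub>F1\<^esub>} \<times> carrier F2) = {\<one>\<^bsub>F1 \<times>\<times> F2\<^esub>}"
      unfolding one_DirProd using F2.one_closed by blast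
    then show False using full by (simp add: full_subdirect_product_def)
  qed
  note inf1 = infinite_index_N1[OF inf] and inf2 = infinite_index_N2[OF inf]

  \<comment> \<open>Non-conjugate test pairs and a finite quotient that separates them\<close>
  have separated: "\<exists>x1 x2 n1 n2 K. n1 \<in> N1 \<and> n2 \<in> N2 \<and> x1 = e [^]\<^bsub>F1\<^esub> m \<otimes>\<^bsub>F1\<^esub> n1 \<and>
      x2 = f [^]\<^bsub>F2\<^esub> m \<otimes>\<^bsub>F2\<^esub> n2 \<and> (x1, x2) \<in> G \<and> p_normal p PG K \<and>
      (\<forall>g\<in>G. inv\<^bsub>PG\<^esub> g \<otimes>\<^bsub>PG\<^esub> (x1, x2) \<otimes>\<^bsub>PG\<^esub> g \<otimes>\<^bsub>PG\<^esub>
        inv\<^bsub>PG\<^esub> (x1, inv\<^bsub>F2\<^esub> f \<otimes>\<^bsub>F2\<^esub> x2 \<otimes>\<^bsub>F2\<^esub> f) \<notin> K)"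
    if ef: "(e, f) \<in> G" and nk: "\<And>k::int. f [^]\<^bsub>F2\<^esub> (1 + m * k) \<notin> N2" for e f and m :: int
  proof -
    note c = G_closed[OF ef]
    obtain n1 where n1: "n1 \<in> N1" "\<And>c. c \<in> carrier F1 \<Longrightarrow>
        (e [^]\<^bsub>F1\<^esub> m \<otimes>\<^bsub>F1\<^esub> n1) \<otimes>\<^bsub>F1\<^esub> c = c \<otimes>\<^bsub>F1\<^esub> (e [^]\<^bsub>F1\<^esub> m \<otimes>\<^bsub>F1\<^esub> n1) \<Longrightarrow>
        \<exists>i::int. c = (e [^]\<^bsub>F1\<^esub> m \<otimes>\<^bsub>F1\<^esub> n1) [^]\<^bsub>F1\<^esub> i"
      using is_free_primitive_in_coset[OF free(1) N1_normal N1_ne inf1 F1.int_pow_closed[OF c(1)]] by metis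
    obtain n2 where n2: "n2 \<in> N2" "\<And>c. c \<in> carrier F2 \<Longrightarrow>
        (f [^]\<^bsub>F2\<^esub> m \<otimes>\<^bsub>F2\<^esub> n2) \<otimes>\<^bsub>F2\<^esub> c = c \<otimes>\<^bsub>F2\<^esub> (f [^]\<^bsub>F2\<^esub> m \<otimes>\<^bsub>F2\<^esub> n2) \<Longrightarrow>
        \<exists>i::int. c = (f [^]\<^bsub>F2\<^esub> m \<otimes>\<^bsub>F2\<^esub> n2) [^]\<^bsub>F2\<^esub> i"
      using is_free_primitive_in_coset[OF free(2) N2_normal N2_ne inf2 F2.int_pow_closed[OF c(2)]] by metis
    define x1 x2 where "x1 = e [^]\<^bsub>F1\<^esub> m \<otimes>\<^bsub>F1\<^esub> n1" and "x2 = f [^]\<^bsub>F2\<^esub> m \<otimes>\<^bsub>F2\<^esub> n2"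
    have nF: "n1 \<in> carrier F1" "n2 \<in> carrier F2"
      using N1.mem_carrier[OF n1(1)] N2.mem_carrier[OF n2(1)] by auto
    have nG: "(n1, n2) \<in> G"
      using G_mult[OF N1_G[OF n1(1)] N2_G[OF n2(1)]] nF by simp
    have x: "(x1, x2) \<in> G"
      unfolding x1_def x2_def by (rule G_mult[OF G_int_pow[OF ef] nG])
    note xc = G_closed[OF x]
    \<comment> \<open>The second coordinate changes only by an element of \<open>N2\<close>:
      \<open>f\<close> commutes with the factor \<open>f^m\<close> of \<open>x2\<close> and
      normalizes \<open>N2\<close>.\<close>
    have y: "(x1, inv\<^bsub>F2\<^esub> f \<otimes>\<^bsub>F2\<^esub> x2 \<otimes>\<^bsub>F2\<^esub> f) \<in> G"
    proof -
      have f_comm: "f [^]\<^bsub>F2\<^esub> m \<otimes>\<^bsub>F2\<^esub> f = f \<otimes>\<^bsub>F2\<^esub> f [^]\<^bsub>F2\<^esub> m"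
        using c F2.int_pow_mult[of f m 1] F2.int_pow_mult[of f 1 m] by (simp add: add.commute)
      define M where "M = f [^]\<^bsub>F2\<^esub> m"
      have M: "M \<in> carrier F2" "M \<otimes>\<^bsub>F2\<^esub> f = f \<otimes>\<^bsub>F2\<^esub> M" using c f_comm by (simp_all add: M_def)
      have "inv\<^bsub>F2\<^esub> f \<otimes>\<^bsub>F2\<^esub> x2 \<otimes>\<^bsub>F2\<^esub> f =
          (inv\<^bsub>F2\<^esub> f \<otimes>\<^bsub>F2\<^esub> (M \<otimes>\<^bsub>F2\<^esub> f)) \<otimes>\<^bsub>F2\<^esub> (inv\<^bsub>F2\<^esub> f \<otimes>\<^bsub>F2\<^esub> n2 \<otimes>\<^bsub>F2\<^esub> f)"
        using c nF M(1) by (simp add: x2_def F2.group_simps flip: M_def)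
      also have "\<dots> = M \<otimes>\<^bsub>F2\<^esub> (inv\<^bsub>F2\<^esub> f \<otimes>\<^bsub>F2\<^esub> n2 \<otimes>\<^bsub>F2\<^esub> f)"
        unfolding M(2) using c nF M(1) by (simp add: F2.group_simps)
      finally have eq: "inv\<^bsub>F2\<^esub> f \<otimes>\<^bsub>F2\<^esub> x2 \<otimes>\<^bsub>F2\<^esub> f = M \<otimes>\<^bsub>F2\<^esub> (inv\<^bsub>F2\<^esub> f \<otimes>\<^bsub>F2\<^esub> n2 \<otimes>\<^bsub>F2\<^esub> f)" .
      have l: "inv\<^bsub>F2\<^esub> f \<otimes>\<^bsub>F2\<^esub> n2 \<otimes>\<^bsub>F2\<^esub> f \<in> N2"
        using n2(1) c by (intro N2.inv_op_closed1)
      have "(e [^]\<^bsub>F1\<^esub> m \<otimes>\<^bsub>F1\<^esub> (n1 \<otimes>\<^bsub>F1\<^esub> \<one>\<^bsub>F1\<^esub>), M \<otimes>\<^bsub>F2\<^esub> (\<one>\<^bsub>F2\<^esub> \<otimes>\<^bsub>F2\<^esub> (inv\<^bsub>F2\<^esub> f \<otimes>\<^bsub>F2\<^esub> n2 \<otimes>\<^bsub>F2\<^esub> f))) \<in> G"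
        unfolding M_def by (rule G_mult[OF G_int_pow[OF ef] G_mult[OF N1_G[OF n1(1)] N2_G[OF l]]])
      then show ?thesis
        unfolding eq x1_def using nF c by simp
    qed
    have "\<not> conjugate_in PG (x1, x2) (x1, inv\<^bsub>F2\<^esub> f \<otimes>\<^bsub>F2\<^esub> x2 \<otimes>\<^bsub>F2\<^esub> f)"
    proof
      assume "conjugate_in PG (x1, x2) (x1, inv\<^bsub>F2\<^esub> f \<otimes>\<^bsub>F2\<^esub> x2 \<otimes>\<^bsub>F2\<^esub> f)"
      from conjugate_imp_pow_mem[OF ef x x2_def n2(1) n1(2)[folded x1_def] n2(2)[folded x2_def] this]
      show False using nk by blast
    qed
    then have "conj_separated p PG (x1, x2) (x1, inv\<^bsub>F2\<^esub> f \<otimes>\<^bsub>F2\<^esub> x2 \<otimes>\<^bsub>F2\<^esub> f)"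
      using pcs x y by (simp add: p_conjugacy_separable_iff[OF p])
    then obtain K where K: "p_normal p PG K" "\<forall>g\<in>G. inv\<^bsub>PG\<^esub> g \<otimes>\<^bsub>PG\<^esub> (x1, x2) \<otimes>\<^bsub>PG\<^esub> g \<otimes>\<^bsub>PG\<^esub>
        inv\<^bsub>PG\<^esub> (x1, inv\<^bsub>F2\<^esub> f \<otimes>\<^bsub>F2\<^esub> x2 \<otimes>\<^bsub>F2\<^esub> f) \<notin> K"
      unfolding conj_separated_def partial_object.select_convs by auto
    show ?thesis
      by (intro exI conjI) (fact n1(1) n2(1) x1_def x2_def x K)+
  qed
  have coprime_pow: "\<exists>k::int. f [^]\<^bsub>F2\<^esub> (1 + m * k) \<in> N2"
    if ef: "(e, f) \<in> G" and m: "coprime m (int p)" for e f and m :: int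
  proof (rule ccontr)
    assume "\<not> ?thesis"
    then obtain x1 x2 n1 n2 K where n: "n2 \<in> N2" "x2 = f [^]\<^bsub>F2\<^esub> m \<otimes>\<^bsub>F2\<^esub> n2" and x: "(x1, x2) \<in> G"
      and K: "p_normal p PG K" "\<forall>g\<in>G. inv\<^bsub>PG\<^esub> g \<otimes>\<^bsub>PG\<^esub> (x1, x2) \<otimes>\<^bsub>PG\<^esub> g \<otimes>\<^bsub>PG\<^esub>
        inv\<^bsub>PG\<^esub> (x1, inv\<^bsub>F2\<^esub> f \<otimes>\<^bsub>F2\<^esub> x2 \<otimes>\<^bsub>F2\<^esub> f) \<notin> K"
      using separated[OF ef, of m] by metis
    obtain a where "(e, f) [^]\<^bsub>PG\<^esub> (p ^ a :: nat) \<in> K"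
      using p_normal_pow_mem[OF K(1), of "(e, f)"] ef by auto
    then have "(e [^]\<^bsub>F1\<^esub> (p ^ a :: nat), f [^]\<^bsub>F2\<^esub> (p ^ a :: nat)) \<in> K"
      by (simp add: P_pow flip: P.nat_pow_consistent)
    moreover have "coprime m (int (p ^ a))" using m by simp
    ultimately show False
      using conjugate_mod_coprime[OF p_normal_imp_normal[OF K(1)] ef x n(2,1)] K(2) by blast
  qed

  \<comment> \<open>The quotient by \<open>N1\<close> is a \<open>p\<close>-group\<close>
  have p_torsion: "\<exists>k. e [^]\<^bsub>F1\<^esub> (p ^ k :: nat) \<in> N1" if e: "e \<in> carrier F1" for e
  proof -
    obtain f where ef: "(e, f) \<in> G" using ex_snd[OF e] by blast
    note c = G_closed[OF ef]
    have p2: "p \<ge> 2" using p prime_ge_2_nat by blast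
    \<comment> \<open>Any integer of absolute value above 1 that is prime to \<open>p\<close> would
      do: \<open>1 + (p + 1) k\<close> is never 0, so \<open>f\<close> has finite order modulo
      \<open>N2\<close>.\<close>
    have "coprime (int p + 1) (int p)"
      by (simp add: coprime_iff_gcd_eq_1 gcd.commute)
    then obtain k where k: "f [^]\<^bsub>F2\<^esub> (1 + (int p + 1) * k) \<in> N2"
      using coprime_pow[OF ef] by blast
    define j where "j = 1 + (int p + 1) * k"
    have "j \<noteq> 0"
    proof
      assume "j = 0"
      then have "(int p + 1) * (- k) = 1" by (simp add: j_def algebra_simps)
      then have "int p + 1 dvd 1" by (metis dvd_triv_left)
      then show False using p2 by auto
    qed
    define d where "d = nat \<bar>j\<bar>"
    have d: "d > 0" using \<open>j \<noteq> 0\<close> by (simp add: d_def)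
    have "f [^]\<^bsub>F2\<^esub> d \<in> N2"
    proof (cases "j \<ge> 0")
      case True
      then have "j = int d" by (simp add: d_def)
      then show ?thesis using k by (simp add: int_pow_int flip: j_def)
    next
      case False
      then have "j = - int d" by (simp add: d_def)
      then have "inv\<^bsub>F2\<^esub> (f [^]\<^bsub>F2\<^esub> d) \<in> N2" using k c by (simp add: F2.int_pow_neg_int flip: j_def)
      then have "inv\<^bsub>F2\<^esub> (inv\<^bsub>F2\<^esub> (f [^]\<^bsub>F2\<^esub> d)) \<in> N2" by (rule N2.m_inv_closed)
      then show ?thesis using c by simp
    qed
    \<comment> \<open>For \<open>f' = f^(p^a)\<close> the power \<open>f'^m\<close> is already in
      \<open>N2\<close>, and \<open>m\<close> is prime to \<open>p\<close>. The relation that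
      \<open>m\<close> yields for \<open>f'\<close> then puts \<open>f'\<close> itself in
      \<open>N2\<close>.\<close>
    moreover obtain a m where am: "d = p ^ a * m" "\<not> p dvd m"
      by (rule multiplicity_decompose'[of d p]) (use d p2 in auto)
    ultimately have fm: "(f [^]\<^bsub>F2\<^esub> (p ^ a)) [^]\<^bsub>F2\<^esub> m \<in> N2"
      using c by (simp add: F2.nat_pow_pow)
    define f' where "f' = f [^]\<^bsub>F2\<^esub> (p ^ a)"
    have f': "f' \<in> carrier F2" using c by (simp add: f'_def)
    have e'f': "(e [^]\<^bsub>F1\<^esub> (p ^ a), f') \<in> G"
      using G_int_pow[OF ef, of "int (p ^ a)"] unfolding f'_def int_pow_int .
    have "coprime (int m) (int p)"
      using am(2) p by (metis coprime_commute coprime_int_iff prime_imp_coprime_nat)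
    then obtain i where i: "f' [^]\<^bsub>F2\<^esub> (1 + int m * i) \<in> N2"
      using coprime_pow[OF e'f'] by blast
    have "(f' [^]\<^bsub>F2\<^esub> m) [^]\<^bsub>F2\<^esub> (- i) \<in> N2"
      using F2.subgroup_int_pow_closed[OF N2.subgroup_axioms] fm by (simp add: f'_def)
    then have "f' [^]\<^bsub>F2\<^esub> (int m * (- i)) \<in> N2"
      using f' by (simp add: F2.int_pow_pow flip: int_pow_int)
    with i have "f' [^]\<^bsub>F2\<^esub> (1 + int m * i) \<otimes>\<^bsub>F2\<^esub> f' [^]\<^bsub>F2\<^esub> (int m * (- i)) \<in> N2"
      by blast
    then have "f' \<in> N2"
      using f' by (simp flip: F2.int_pow_mult)
    then show ?thesis
      using N1_iff[OF e'f'] by blast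
  qed

  \<comment> \<open>The quotient by \<open>N1\<close> is residually finite\<close>
  have residual: "\<exists>L. L \<lhd> F1 \<and> finite (rcosets\<^bsub>F1\<^esub> L) \<and> N1 \<subseteq> L \<and> e \<notin> L"
    if e: "e \<in> carrier F1" "e \<notin> N1" for e
  proof -
    obtain f where ef: "(e, f) \<in> G" using ex_snd[OF e(1)] by blast
    note c = G_closed[OF ef]
    have "f \<notin> N2" using N1_iff[OF ef] e(2) by blast
    \<comment> \<open>With \<open>m = 0\<close> the exponent \<open>1 + m * k\<close> is 1, so the
      hypothesis is just that \<open>f\<close> is not in \<open>N2\<close>, and the test elements
      lie in \<open>N1\<close> and \<open>N2\<close>.\<close>
    then obtain x1 x2 n1 n2 K where n: "n1 \<in> N1" "n2 \<in> N2" "x1 = e [^]\<^bsub>F1\<^esub> (0::int) \<otimes>\<^bsub>F1\<^esub> n1"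
        "x2 = f [^]\<^bsub>F2\<^esub> (0::int) \<otimes>\<^bsub>F2\<^esub> n2"
      and K: "p_normal p PG K" "\<forall>g\<in>G. inv\<^bsub>PG\<^esub> g \<otimes>\<^bsub>PG\<^esub> (x1, x2) \<otimes>\<^bsub>PG\<^esub> g \<otimes>\<^bsub>PG\<^esub>
        inv\<^bsub>PG\<^esub> (x1, inv\<^bsub>F2\<^esub> f \<otimes>\<^bsub>F2\<^esub> x2 \<otimes>\<^bsub>F2\<^esub> f) \<notin> K"
      using separated[OF ef, of 0] c by auto
    have xN: "x1 \<in> N1" "x2 \<in> N2"
      using n N1.mem_carrier[OF n(1)] N2.mem_carrier[OF n(2)] by simp_all
    interpret K: normal K PG by (rule p_normal_imp_normal[OF K(1)])
    \<comment> \<open>The product of \<open>N1\<close> with the first projection of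
      \<open>K\<close>. It is normal because \<open>G\<close> projects onto \<open>F1\<close>, and
      its index is at most that of \<open>K\<close> in \<open>G\<close>.\<close>
    define L where "L = {w \<in> carrier F1. \<exists>n\<in>N1. \<exists>z. (w \<otimes>\<^bsub>F1\<^esub> n, z) \<in> K}"
    have L: "L \<lhd> F1"
    proof (rule F1.normal_invI[OF F1.subgroupI])
      have "\<one>\<^bsub>F1\<^esub> \<in> L"
        using K.one_closed N1.one_closed unfolding L_def
        by (intro CollectI conjI bexI[of _ "\<one>\<^bsub>F1\<^esub>"] exI[of _ "\<one>\<^bsub>F2\<^esub>"]) simp_all
      then show "L \<noteq> {}" by blast
    next
      fix w assume "w \<in> L"
      then obtain n z where w: "w \<in> carrier F1" "n \<in> N1" "(w \<otimes>\<^bsub>F1\<^esub> n, z) \<in> K" by (auto simp: L_def)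
      have nF: "n \<in> carrier F1" using w(2) by (rule N1.mem_carrier)
      have kG: "(w \<otimes>\<^bsub>F1\<^esub> n, z) \<in> G" using K.mem_carrier[OF w(3)] by simp
      have "inv\<^bsub>PG\<^esub> (w \<otimes>\<^bsub>F1\<^esub> n, z) \<in> K" using w(3) by (rule K.m_inv_closed)
      moreover have "w \<otimes>\<^bsub>F1\<^esub> inv\<^bsub>F1\<^esub> n \<otimes>\<^bsub>F1\<^esub> inv\<^bsub>F1\<^esub> w \<in> N1"
        using w(1,2) by (intro N1.inv_op_closed2) auto
      ultimately show "inv\<^bsub>F1\<^esub> w \<in> L"
        using w(1) nF unfolding L_def
        by (intro CollectI conjI bexI[of _ "w \<otimes>\<^bsub>F1\<^esub> inv\<^bsub>F1\<^esub> n \<otimes>\<^bsub>F1\<^esub> inv\<^bsub>F1\<^esub> w"] exI[of _ "inv\<^bsub>F2\<^esub> z"])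
          (simp_all add: inv_PG[OF kG] F1.group_simps)
      fix w' assume "w' \<in> L"
      then obtain n' z' where w': "w' \<in> carrier F1" "n' \<in> N1" "(w' \<otimes>\<^bsub>F1\<^esub> n', z') \<in> K" by (auto simp: L_def)
      have n'F: "n' \<in> carrier F1" using w'(2) by (rule N1.mem_carrier)
      have "(w \<otimes>\<^bsub>F1\<^esub> n, z) \<otimes>\<^bsub>PG\<^esub> (w' \<otimes>\<^bsub>F1\<^esub> n', z') \<in> K"
        using w(3) w'(3) by (rule K.m_closed)
      moreover have "inv\<^bsub>F1\<^esub> w' \<otimes>\<^bsub>F1\<^esub> n \<otimes>\<^bsub>F1\<^esub> w' \<in> N1"
        using w(2) w'(1) by (intro N1.inv_op_closed1)
      then have "inv\<^bsub>F1\<^esub> w' \<otimes>\<^bsub>F1\<^esub> n \<otimes>\<^bsub>F1\<^esub> w' \<otimes>\<^bsub>F1\<^esub> n' \<in> N1"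
        using w'(2) by blast
      ultimately show "w \<otimes>\<^bsub>F1\<^esub> w' \<in> L"
        using w(1) w'(1) nF n'F unfolding L_def
        by (intro CollectI conjI bexI[of _ "inv\<^bsub>F1\<^esub> w' \<otimes>\<^bsub>F1\<^esub> n \<otimes>\<^bsub>F1\<^esub> w' \<otimes>\<^bsub>F1\<^esub> n'"] exI[of _ "z \<otimes>\<^bsub>F2\<^esub> z'"])
          (simp_all add: F1.group_simps)
    next
      fix x w assume x: "x \<in> carrier F1" and "w \<in> L"
      then obtain n z where w: "w \<in> carrier F1" "n \<in> N1" "(w \<otimes>\<^bsub>F1\<^esub> n, z) \<in> K" by (auto simp: L_def)
      have nF: "n \<in> carrier F1" using w(2) by (rule N1.mem_carrier)
      obtain y where y: "(x, y) \<in> G" using ex_snd[OF x] by blast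
      have "(x, y) \<otimes>\<^bsub>PG\<^esub> (w \<otimes>\<^bsub>F1\<^esub> n, z) \<otimes>\<^bsub>PG\<^esub> inv\<^bsub>PG\<^esub> (x, y) \<in> K"
        using w(3) y by (intro K.inv_op_closed2) simp_all
      moreover have "x \<otimes>\<^bsub>F1\<^esub> n \<otimes>\<^bsub>F1\<^esub> inv\<^bsub>F1\<^esub> x \<in> N1"
        using w(2) x by (intro N1.inv_op_closed2)
      ultimately show "x \<otimes>\<^bsub>F1\<^esub> w \<otimes>\<^bsub>F1\<^esub> inv\<^bsub>F1\<^esub> x \<in> L"
        using w(1) x nF unfolding L_def
        by (intro CollectI conjI bexI[of _ "x \<otimes>\<^bsub>F1\<^esub> n \<otimes>\<^bsub>F1\<^esub> inv\<^bsub>F1\<^esub> x"] exI[of _ "y \<otimes>\<^bsub>F2\<^esub> z \<otimes>\<^bsub>F2\<^esub> inv\<^bsub>F2\<^esub> y"])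
          (simp_all add: inv_PG[OF y] F1.group_simps)
    qed (auto simp: L_def)
    have "finite (rcosets\<^bsub>F1\<^esub> L)"
    proof -
      obtain t where t: "\<And>a. a \<in> carrier F1 \<Longrightarrow> (a, t a) \<in> G" using ex_snd by metis
      show ?thesis
      proof (rule F1.finite_rcosetsI[OF normal_imp_subgroup[OF L]])
        have "(\<lambda>a. K #>\<^bsub>PG\<^esub> (a, t a)) ` carrier F1 \<subseteq> (\<lambda>g. K #>\<^bsub>PG\<^esub> g) ` carrier PG"
          using t by auto
        moreover have "finite ((\<lambda>g. K #>\<^bsub>PG\<^esub> g) ` carrier PG)"
          using K(1) by (simp add: p_normal_def PG.finite_image_rcosets del: partial_object.update_convs)
        ultimately show "finite ((\<lambda>a. K #>\<^bsub>PG\<^esub> (a, t a)) ` carrier F1)"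
          using finite_subset by blast
        fix a a' assume a: "a \<in> carrier F1" "a' \<in> carrier F1" "K #>\<^bsub>PG\<^esub> (a, t a) = K #>\<^bsub>PG\<^esub> (a', t a')"
        then have "(a, t a) \<otimes>\<^bsub>PG\<^esub> inv\<^bsub>PG\<^esub> (a', t a') \<in> K"
          using PG.rcoset_eq_iff[OF K.subgroup_axioms, of "(a, t a)" "(a', t a')"] t by simp
        then have "(a \<otimes>\<^bsub>F1\<^esub> inv\<^bsub>F1\<^esub> a', t a \<otimes>\<^bsub>F2\<^esub> inv\<^bsub>F2\<^esub> t a') \<in> K"
          by (simp add: inv_PG[OF t[OF a(2)]])
        then show "a \<otimes>\<^bsub>F1\<^esub> inv\<^bsub>F1\<^esub> a' \<in> L"
          using a N1.one_closed unfolding L_def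
          by (intro CollectI conjI bexI[of _ "\<one>\<^bsub>F1\<^esub>"] exI[of _ "t a \<otimes>\<^bsub>F2\<^esub> inv\<^bsub>F2\<^esub> t a'"]) simp_all
      qed
    qed
    moreover have "N1 \<subseteq> L"
    proof
      fix w assume w: "w \<in> N1"
      then have "w \<in> carrier F1" by (rule N1.mem_carrier)
      then show "w \<in> L"
        using w K.one_closed unfolding L_def
        by (intro CollectI conjI bexI[of _ "inv\<^bsub>F1\<^esub> w"] exI[of _ "\<one>\<^bsub>F2\<^esub>"]) simp_all
    qed
    moreover have "e \<notin> L"
    proof
      assume "e \<in> L"
      then obtain n z where "n \<in> N1" "(e \<otimes>\<^bsub>F1\<^esub> n, z) \<in> K" by (auto simp: L_def)
      then show False
        using conjugate_mod_residual[OF K.normal_axioms ef xN] K(2) by blast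
    qed
    ultimately show ?thesis using L by blast
  qed

  \<comment> \<open>A finite presentation of the quotient\<close>
  have fst_hom: "fst \<in> hom PG F1"
    using G_closed by (auto simp: hom_def)
  have fst_G: "fst ` G = carrier F1"
    using full by (simp add: full_subdirect_product_def subdirect_product_def)
  have "finitely_generated_group F1"
    by (rule finitely_generated_hom_image[OF fg F1.is_group fst_hom]) (simp add: fst_G)
  then obtain n :: nat and \<theta> where \<theta>: "\<theta> \<in> iso (free_group {..<n}) F1"
    using finitely_generated_is_free_group[OF free(1)] by blast
  interpret \<theta>: group_hom "free_group {..<n}" F1 \<theta>
    using \<theta> by (simp add: group_hom_def group_hom_axioms_def free.is_group F1.is_group iso_imp_homomorphism)
  have \<theta>_inj: "inj_on \<theta> (carrier (free_group {..<n}))" and \<theta>_surj: "\<theta> ` carrier (free_group {..<n}) = carrier F1"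
    using \<theta> by (simp_all add: iso_iff)
  define N where "N = {w \<in> carrier (free_group {..<n}). \<theta> w \<in> N1}"
  have N: "N \<lhd> free_group {..<n}"
    unfolding N_def by (rule free.normal_vimage[OF F1.is_group \<theta>.homh N1_normal])
  interpret N: normal N "free_group {..<n}" by (rule N)
  obtain R where R: "finite R" "R \<subseteq> carrier F1" "N1 = normal_closure F1 R"
    using N1_normal_closure[OF free(2) fg] .
  obtain R' where R': "finite R'" "R' \<subseteq> carrier (free_group {..<n})" "R = \<theta> ` R'"
    using finite_subset_image[OF R(1), of \<theta> "carrier (free_group {..<n})"] R(2) \<theta>_surj by auto
  have N_closure: "N = normal_closure (free_group {..<n}) R'"
  proof
    have "R \<subseteq> N1" unfolding R(3) normal_closure_def by (rule Inter_greatest) simp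
    then have "R' \<subseteq> N" using R'(2) unfolding R'(3) N_def by blast
    then show "normal_closure (free_group {..<n}) R' \<subseteq> N"
      unfolding normal_closure_def by (intro Inter_lower CollectI conjI N)
    show "N \<subseteq> normal_closure (free_group {..<n}) R'"
      unfolding normal_closure_def
    proof (rule Inter_greatest)
      fix M assume "M \<in> {M. M \<lhd> free_group {..<n} \<and> R' \<subseteq> M}"
      then have M: "M \<lhd> free_group {..<n}" "R' \<subseteq> M" by simp_all
      interpret M: normal M "free_group {..<n}" by (rule M(1))
      have "\<theta> ` M \<lhd> F1"
        by (rule M.surj_hom_normal_subgroup[OF \<theta>.group_hom_axioms \<theta>_surj])
      moreover have "R \<subseteq> \<theta> ` M" unfolding R'(3) by (rule image_mono[OF M(2)])
      ultimately have N1_le: "N1 \<subseteq> \<theta> ` M"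
        unfolding R(3) normal_closure_def by (intro Inter_lower CollectI conjI)
      show "N \<subseteq> M"
      proof
        fix w assume "w \<in> N"
        then have "w \<in> carrier (free_group {..<n}) \<and> \<theta> w \<in> N1" unfolding N_def mem_Collect_eq .
        note w = conjunct1[OF this] conjunct2[OF this]
        show "w \<in> M"
          by (rule iffD1[OF inj_on_image_mem_iff[OF \<theta>_inj w(1) M.subset] subsetD[OF N1_le w(2)]])
      qed
    qed
  qed

  \<comment> \<open>The quotient as a group of natural numbers\<close>
  define Q0 where "Q0 = free_group {..<n} Mod N"
  interpret Q0: group Q0 unfolding Q0_def by (rule N.factorgroup_is_group)
  interpret q: group_hom "free_group {..<n}" Q0 "\<lambda>x. N #>\<^bsub>free_group {..<n}\<^esub> x"
    unfolding Q0_def by (rule free.rcoset_hom[OF N])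
  \<comment> \<open>Cosets may be infinite sets, so they are coded through a chosen representative
    word, which is countable data and determines the coset.\<close>
  define c :: "nat word set \<Rightarrow> nat" where "c C = to_nat (SOME w. w \<in> C)" for C
  have c_inj: "inj_on c (carrier Q0)"
  proof (rule inj_onI)
    fix C D assume C: "C \<in> carrier Q0" and D: "D \<in> carrier Q0" and eq: "c C = c D"
    obtain u v where uv: "u \<in> carrier (free_group {..<n})" "C = N #>\<^bsub>free_group {..<n}\<^esub> u"
      "v \<in> carrier (free_group {..<n})" "D = N #>\<^bsub>free_group {..<n}\<^esub> v"
      using C D unfolding Q0_def carrier_FactGroup by (elim imageE)
    have "(SOME w. w \<in> C) \<in> C" "(SOME w. w \<in> D) \<in> D"
      unfolding uv(2,4)
      by (rule someI[of "\<lambda>w. w \<in> _", OF free.rcos_self[OF uv(1) N.subgroup_axioms]],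
          rule someI[of "\<lambda>w. w \<in> _", OF free.rcos_self[OF uv(3) N.subgroup_axioms]])
    moreover have "(SOME w. w \<in> C) = (SOME w. w \<in> D)" using eq by (simp add: c_def)
    ultimately show "C = D"
      unfolding uv(2,4) using free.repr_independence[OF _ uv(1) N.subgroup_axioms]
        free.repr_independence[OF _ uv(3) N.subgroup_axioms] by metis
  qed
  define Q where "Q = image_group c Q0"
  note Q = group_image_group[OF Q0.is_group c_inj, folded Q_def]
  interpret Q: group Q by (rule Q(2))
  define \<psi> where "\<psi> w = c (N #>\<^bsub>free_group {..<n}\<^esub> w)" for w
  have \<psi>_hom: "\<psi> \<in> hom (free_group {..<n}) Q"
    using Group.hom_compose[OF q.homh iso_imp_homomorphism[OF Q(1)]] by (simp add: comp_def \<psi>_def[abs_def])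
  interpret \<psi>: group_hom "free_group {..<n}" Q \<psi>
    using \<psi>_hom by (simp add: group_hom_def group_hom_axioms_def free.is_group Q.is_group)
  have \<psi>_surj: "\<psi> ` carrier (free_group {..<n}) = carrier Q"
    by (auto simp: \<psi>_def Q_def image_group_carrier Q0_def carrier_FactGroup)
  have \<psi>_one: "\<psi> w = \<one>\<^bsub>Q\<^esub> \<longleftrightarrow> w \<in> N" if w: "w \<in> carrier (free_group {..<n})" for w
  proof -
    have "\<psi> w = \<one>\<^bsub>Q\<^esub> \<longleftrightarrow> c (N #>\<^bsub>free_group {..<n}\<^esub> w) = c (N #>\<^bsub>free_group {..<n}\<^esub> \<one>\<^bsub>free_group {..<n}\<^esub>)"
      using \<psi>.hom_one by (simp add: \<psi>_def)
    also have "\<dots> \<longleftrightarrow> N #>\<^bsub>free_group {..<n}\<^esub> w = N #>\<^bsub>free_group {..<n}\<^esub> \<one>\<^bsub>free_group {..<n}\<^esub>"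
    proof (rule inj_on_eq_iff[OF c_inj])
      show "N #>\<^bsub>free_group {..<n}\<^esub> w \<in> carrier Q0"
        "N #>\<^bsub>free_group {..<n}\<^esub> \<one>\<^bsub>free_group {..<n}\<^esub> \<in> carrier Q0"
        unfolding Q0_def carrier_FactGroup by (intro imageI w free.one_closed)+
    qed
    also have "\<dots> \<longleftrightarrow> w \<in> N"
      using free.rcoset_eq_iff[OF N.subgroup_axioms w free.one_closed] w by simp
    finally show ?thesis .
  qed

  \<comment> \<open>The required properties of the quotient\<close>
  have "infinite (carrier Q)"
  proof
    assume "finite (carrier Q)"
    then have "finite (carrier Q0)" using Q(1) bij_betw_finite by (auto simp: iso_def)
    then have fin: "finite (rcosets\<^bsub>free_group {..<n}\<^esub> N)" by (simp add: Q0_def FactGroup_def)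
    define \<theta>' where "\<theta>' = inv_into (carrier (free_group {..<n})) \<theta>"
    have \<theta>': "\<theta>' \<in> hom F1 (free_group {..<n})"
      unfolding \<theta>'_def by (rule iso_imp_homomorphism[OF free.iso_set_sym[OF \<theta>]])
    have "\<theta> (\<theta>' g) = g" "\<theta>' g \<in> carrier (free_group {..<n})" if "g \<in> carrier F1" for g
      using that \<theta>_surj hom_in_carrier[OF \<theta>'] by (auto simp: \<theta>'_def f_inv_into_f)
    then have "{g \<in> carrier F1. \<theta>' g \<in> N} = {g \<in> carrier F1. g \<in> N1}"
      unfolding N_def by (intro Collect_cong conj_cong refl) simp
    also have "\<dots> = N1" using N1.subset by blast
    finally have "{g \<in> carrier F1. \<theta>' g \<in> N} = N1" .
    then show False
      using F1.finite_index_vimage(2)[OF free.is_group \<theta>' N.subgroup_axioms fin] inf1 by simp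
  qed
  moreover have "finitely_presented_group Q"
    unfolding finitely_presented_group_def
    using Q.is_group R'(1,2) Q0.iso_sym[OF is_isoI[OF Q(1)]] unfolding Q0_def N_closure by blast
  moreover have "residually_finite Q"
  proof (rule Q.residually_finiteI)
    fix x assume x: "x \<in> carrier Q" "x \<noteq> \<one>\<^bsub>Q\<^esub>"
    then obtain w where w: "w \<in> carrier (free_group {..<n})" "x = \<psi> w" using \<psi>_surj by blast
    then have "w \<notin> N" using x(2) \<psi>_one by blast
    then have "\<theta> w \<notin> N1" using w(1) unfolding N_def by blast
    from residual[OF \<theta>.hom_closed[OF w(1)] this]
    obtain L where L: "L \<lhd> F1" "finite (rcosets\<^bsub>F1\<^esub> L)" "N1 \<subseteq> L" "\<theta> w \<notin> L"
      by (elim exE conjE)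
    define L' where "L' = {w \<in> carrier (free_group {..<n}). \<theta> w \<in> L}"
    have L': "L' \<lhd> free_group {..<n}"
      unfolding L'_def by (rule free.normal_vimage[OF F1.is_group \<theta>.homh L(1)])
    interpret L': normal L' "free_group {..<n}" by (rule L')
    have fin: "finite (rcosets\<^bsub>free_group {..<n}\<^esub> L')"
      unfolding L'_def
      by (rule free.finite_index_vimage(2)[OF F1.is_group \<theta>.homh normal_imp_subgroup[OF L(1)] L(2)])
    have NL': "N \<subseteq> L'" using L(3) unfolding L'_def N_def by blast
    have K: "\<psi> ` L' \<lhd> Q"
      by (rule L'.surj_hom_normal_subgroup[OF \<psi>.group_hom_axioms \<psi>_surj])
    \<comment> \<open>The kernel \<open>N\<close> of \<open>\<psi>\<close> lies in
      \<open>L'\<close>, so \<open>L'\<close> is the full preimage of its image.\<close>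
    have mem: "\<psi> v \<in> \<psi> ` L' \<Longrightarrow> v \<in> L'" if v: "v \<in> carrier (free_group {..<n})" for v
    proof -
      assume "\<psi> v \<in> \<psi> ` L'"
      then obtain l where l: "l \<in> L'" "\<psi> v = \<psi> l" by blast
      have lF: "l \<in> carrier (free_group {..<n})" using l(1) by (rule L'.mem_carrier)
      have "\<psi> (v \<otimes>\<^bsub>free_group {..<n}\<^esub> inv\<^bsub>free_group {..<n}\<^esub> l) = \<one>\<^bsub>Q\<^esub>"
        using v lF l(2) by simp
      moreover have vl: "v \<otimes>\<^bsub>free_group {..<n}\<^esub> inv\<^bsub>free_group {..<n}\<^esub> l \<in> carrier (free_group {..<n})"
        using v lF by (intro free.m_closed free.inv_closed)
      ultimately have "v \<otimes>\<^bsub>free_group {..<n}\<^esub> inv\<^bsub>free_group {..<n}\<^esub> l \<in> L'"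
        using subsetD[OF NL' iffD1[OF \<psi>_one[OF vl]]] by simp
      then have "v \<otimes>\<^bsub>free_group {..<n}\<^esub> inv\<^bsub>free_group {..<n}\<^esub> l \<otimes>\<^bsub>free_group {..<n}\<^esub> l \<in> L'"
        using l(1) by (rule L'.m_closed)
      then show ?thesis using v lF by (simp add: free.m_assoc)
    qed
    have "finite (rcosets\<^bsub>Q\<^esub> (\<psi> ` L'))"
    proof -
      define s where "s = inv_into (carrier (free_group {..<n})) \<psi>"
      have s: "s y \<in> carrier (free_group {..<n})" "\<psi> (s y) = y" if "y \<in> carrier Q" for y
        using inv_into_into[of y \<psi> "carrier (free_group {..<n})"] f_inv_into_f[of y \<psi> "carrier (free_group {..<n})"] that
        unfolding \<psi>_surj s_def by simp_all
      show ?thesis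
      proof (rule Q.finite_rcosetsI[OF normal_imp_subgroup[OF K]])
        have "(\<lambda>y. L' #>\<^bsub>free_group {..<n}\<^esub> s y) ` carrier Q \<subseteq>
            (\<lambda>v. L' #>\<^bsub>free_group {..<n}\<^esub> v) ` carrier (free_group {..<n})"
          by (rule image_subsetI, rule imageI, rule s(1))
        then show "finite ((\<lambda>y. L' #>\<^bsub>free_group {..<n}\<^esub> s y) ` carrier Q)"
          using fin finite_subset unfolding free.finite_image_rcosets by blast
        fix y z assume yz: "y \<in> carrier Q" "z \<in> carrier Q"
          and eq: "L' #>\<^bsub>free_group {..<n}\<^esub> s y = L' #>\<^bsub>free_group {..<n}\<^esub> s z"
        have sc: "s y \<in> carrier (free_group {..<n})" "s z \<in> carrier (free_group {..<n})" "\<psi> (s y) = y" "\<psi> (s z) = z"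
          using s[OF yz(1)] s[OF yz(2)] by simp_all
        have "s y \<otimes>\<^bsub>free_group {..<n}\<^esub> inv\<^bsub>free_group {..<n}\<^esub> s z \<in> L'"
          using eq free.rcoset_eq_iff[OF L'.subgroup_axioms sc(1,2)] by simp
        then have "\<psi> (s y \<otimes>\<^bsub>free_group {..<n}\<^esub> inv\<^bsub>free_group {..<n}\<^esub> s z) \<in> \<psi> ` L'" by (rule imageI)
        then show "y \<otimes>\<^bsub>Q\<^esub> inv\<^bsub>Q\<^esub> z \<in> \<psi> ` L'" using sc by simp
      qed
    qed
    moreover have "x \<notin> \<psi> ` L'"
    proof
      assume "x \<in> \<psi> ` L'"
      then have "w \<in> L'" unfolding w(2) by (rule mem[OF w(1)])
      then show False using L(4) unfolding L'_def mem_Collect_eq by (elim conjE notE)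
    qed
    ultimately show "\<exists>K. K \<lhd> Q \<and> finite (rcosets\<^bsub>Q\<^esub> K) \<and> x \<notin> K"
      using K by blast
  qed
  moreover have "p_group p Q"
    unfolding p_group_def
  proof (intro conjI ballI)
    fix x assume x: "x \<in> carrier Q"
    then obtain w where w: "w \<in> carrier (free_group {..<n})" "x = \<psi> w" using \<psi>_surj by blast
    obtain k where k: "\<theta> w [^]\<^bsub>F1\<^esub> (p ^ k :: nat) \<in> N1"
      using p_torsion[OF \<theta>.hom_closed[OF w(1)]] by blast
    then have "w [^]\<^bsub>free_group {..<n}\<^esub> (p ^ k :: nat) \<in> N"
      unfolding N_def using w(1) by (simp add: \<theta>.hom_nat_pow)
    then have "\<psi> (w [^]\<^bsub>free_group {..<n}\<^esub> (p ^ k :: nat)) = \<one>\<^bsub>Q\<^esub>"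
      by (rule iffD2[OF \<psi>_one[OF free.nat_pow_closed[OF w(1)]]])
    then have "x [^]\<^bsub>Q\<^esub> (p ^ k :: nat) = \<one>\<^bsub>Q\<^esub>"
      using w by (simp add: \<psi>.hom_nat_pow)
    then have "Q.ord x dvd p ^ k" using x Q.pow_eq_id by blast
    then show "\<exists>k. Q.ord x = p ^ k" using p divides_primepow_nat by blast
  qed (rule Q.is_group)
  ultimately show ?thesis using Q.is_group by blast
qed

theorem corollary1p8:
  fixes p :: nat and H :: "nat word monoid"
  assumes "Factorial_Ring.prime p"
  defines "H \<equiv> free_group {..<2}"
  shows
    "((\<exists>Q :: nat monoid. group Q \<and> infinite (carrier Q) \<and> finitely_presented_group Q \<and>
          residually_finite Q \<and> p_group p Q)
      \<longleftrightarrow>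
      (\<exists>G. subgroup G (H \<times>\<times> H) \<and> finitely_generated_group ((H \<times>\<times> H)\<lparr>carrier := G\<rparr>) \<and>
          p_conjugacy_separable p ((H \<times>\<times> H)\<lparr>carrier := G\<rparr>) \<and>
          \<not> virtually_product_of_two_free_groups ((H \<times>\<times> H)\<lparr>carrier := G\<rparr>)))
     \<and>
     ((\<exists>G. subgroup G (H \<times>\<times> H) \<and> finitely_generated_group ((H \<times>\<times> H)\<lparr>carrier := G\<rparr>) \<and>
          p_conjugacy_separable p ((H \<times>\<times> H)\<lparr>carrier := G\<rparr>) \<and>
          \<not> virtually_product_of_two_free_groups ((H \<times>\<times> H)\<lparr>carrier := G\<rparr>))
      \<longleftrightarrow>
      (\<exists>(F1 :: nat monoid) (F2 :: nat monoid) G. is_free_group F1 \<and> is_free_group F2 \<and>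
          full_subdirect_product F1 F2 G \<and>
          finitely_generated_group ((F1 \<times>\<times> F2)\<lparr>carrier := G\<rparr>) \<and>
          p_conjugacy_separable p ((F1 \<times>\<times> F2)\<lparr>carrier := G\<rparr>) \<and>
          infinite (rcosets\<^bsub>F1 \<times>\<times> F2\<^esub> G)))"
    (is "(?A \<longleftrightarrow> ?B) \<and> (?B \<longleftrightarrow> ?C)")
proof -
  have "?A \<Longrightarrow> ?B"
    using subgroup_of_square[OF assms(1)] unfolding H_def by blast
  moreover have "?B \<Longrightarrow> ?C"
    using full_subdirect_of_subgroup[OF assms(1)] unfolding H_def by blast
  moreover have "?C \<Longrightarrow> ?A"
    using finitely_presented_p_group_of_full_subdirect[OF assms(1)] by blast
  ultimately show ?thesis by blast
qed

end
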